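(* The strict 2-category $\mathbf{CwA}$ of small categories with attributes admits the construction of coalgebras over $\mathbf{Cat}$ (with respect to the forgetful strict 2-functor $\mathbf{CwA}\to\mathbf{Cat}$ taking the underlying category).
   Context: **Display categories.** A display category $\mathbf{C}$ is a category (also denoted $\mathbf{C}$) with a class $\mathcal{D}_{\mathbf{C}}$ of morphisms, called displays, such that every display $p:E\to B$ has, along every $f:A\to B$, a pullback $f^*p:f^*E\to A$ that is a display, and $\mathcal{D}_{\mathbf{C}}$ is closed under composition with isomorphisms. A choice of such pullbacks is fixed. $\mathcal{D}_{\mathbf{C}}$ also denotes the $\mathbf{C}$-indexed category (pseudofunctor $\mathbf{C}^{\mathrm{op}}\to\mathbf{Cat}$) whose value at $A$ is the full subcategory of $\mathbf{C}/A$ on displays, with reindexing by the chosen pullbacks. A display functor is a functor taking displays to displays and pullbacks of displays to pullbacks of displays; it induces a $\mathbf{C}$-indexed functor (pseudonatural transformation) $\mathcal{D}_F:\mathcal{D}_{\mathbf{C}}\to F^*\mathcal{D}_{\mathbf{D}}$, $p\mapsto Fp$. A natural transformation $\alpha:F\Rightarrow G:\mathbf{C}\to\mathbf{D}$ between display functors induces $\mathcal{D}_\alpha:\mathcal{D}_F\Rightarrow\alpha^*\mathcal{D}_{\mathbf{D}}\circ\mathcal{D}_G$, whose component at $p:E\to B$ is the map $(\mathcal{D}_\alpha)_p:Fp\to(\alpha_B)^*(Gp)$ over $FB$ induced by $\alpha_E$ and $Fp$. **CwAs.** A small category with attributes (CwA) $\mathbf{C}$ consists of a small display category $\mathbf{C}$,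 a small strict $\mathbf{C}$-indexed category $\mathbf{Tp}_{\mathbf{C}}:\mathbf{C}^{\mathrm{op}}\to\mathbf{Cat}$ (a strict functor), and a $\mathbf{C}$-indexed functor $\mathrm{comp}_{\mathbf{C}}:\mathbf{Tp}_{\mathbf{C}}\to\mathcal{D}_{\mathbf{C}}$ (pseudonatural) that is a $\mathbf{C}$-indexed equivalence (each component is an equivalence of categories). Write $A[u]=\mathbf{Tp}_{\mathbf{C}}(u)(A)$, and $(\rho_u)_A:u^*\mathrm{comp}_{\mathbf{C}}(A)\cong\mathrm{comp}_{\mathbf{C}}(A[u])$ for the pseudonaturality isomorphisms. A morphism $F:\mathbf{C}\to\mathbf{D}$ consists of a display functor $F$, a strict $\mathbf{C}$-indexed functor (strictly natural) $\mathbf{Tp}_F:\mathbf{Tp}_{\mathbf{C}}\to F^*\mathbf{Tp}_{\mathbf{D}}$, and a $\mathbf{C}$-indexed natural isomorphism $\tau_F:\mathcal{D}_F\circ\mathrm{comp}_{\mathbf{C}}\Rightarrow F^*\mathrm{comp}_{\mathbf{D}}\circ\mathbf{Tp}_F$. A 2-morphism $\alpha:F\Rightarrow G$ consists of a natural transformation $\alpha:F\Rightarrow G$ and a $\mathbf{C}$-indexed natural transformation $\mathbf{Tp}_\alpha:\mathbf{Tp}_F\Rightarrow\alpha^*\mathbf{Tp}_{\mathbf{D}}\circ\mathbf{Tp}_G$ (components $\alpha_A:FA\to(GA)[\alpha_\Gamma]$) compatible with $\tau$: for each $A\in\mathbf{Tp}_{\mathbf{C}}(\Gamma)$, $\mathrm{comp}_{\mathbf{D}}(\alpha_A)\circ(\tau_F)_A=(\rho_{\alpha_\Gamma})_{GA}\circ(\alpha_\Gamma)^*(\tau_G)_A\circ(\mathcal{D}_\alpha)_{\mathrm{comp}_{\mathbf{C}}(A)}$.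 $\mathbf{CwA}$ is the resulting strict 2-category. **Construction of coalgebras.** For a strict 2-category $\mathbf{K}$, $\mathbf{Comon}(\mathbf{K})$ is the strict 2-category of comonads $\Box:C\to C$ in $\mathbf{K}$; a morphism $\Box_1\to\Box_2$ is a morphism $f:C_1\to C_2$ with a 2-morphism $\tau:f\Box_1\Rightarrow\Box_2f$ compatible with counits and comultiplications; a 2-morphism is a 2-morphism of $\mathbf{K}$ compatible with the $\tau$s. An object of coalgebras for $\Box:C\to C$ is an object $C^\Box$ with $\mathrm{Hom}_{\mathbf{K}}(D,C^\Box)\cong\mathrm{Hom}_{\mathbf{Comon}(\mathbf{K})}(\mathrm{id}_D,\Box)$ naturally in $D$; it yields a forgetful–cofree adjunction $U\dashv F:C\to C^\Box$. $\mathbf{K}$ admits the construction of coalgebras if every comonad in $\mathbf{K}$ has an object of coalgebras. A strict 2-functor $\Phi:\mathbf{K}\to\mathbf{L}$ between such 2-categories preserves the construction of coalgebras on the nose if for every comonad $\Box:C\to C$ in $\mathbf{K}$ the adjunction $\Phi U\dashv\Phi F:\Phi C\to\Phi(C^\Box)$ is comonadic on the nose, i.e. the comparison morphism $\Phi(C^\Box)\to(\Phi C)^{\Phi\Box}$ is an identity (objects of coalgebras in $\mathbf{K}$, $\mathbf{L}$ being understood as chosen; in $\mathbf{Cat}$ they are the usual categories of coalgebras). $\mathbf{K}$ admits the construction of coalgebras over $\mathbf{L}$ (via $\Phi$) if $\mathbf{K}$ and $\mathbf{L}$ admit the construction of coalgebras and $\Phi$ preserves it on the nose. $\mathbf{Cat}$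 is the strict 2-category of small categories. *)

theory Defs
  imports "HOL-Library.FuncSet"
begin

section \<open>Size\<close>

text \<open>
  The elements of a type \<open>'u\<close> serve as the objects and arrows of the small categories, and
  \<open>small A\<close> says that the subset \<open>A\<close> of \<open>'u\<close> counts as a (small) set. Only the closure
  properties that the theory of coalgebras uses are required, so that every model of ZFC (\<open>'u\<close> its
  universe of sets, the small subsets being the extensions of its elements, \<open>pair\<close> the ordered
  pair) and every Grothendieck universe is an instance; so is any infinite type with all of its
  subsets.
\<close>

locale universe =
  fixes small :: "'u set \<Rightarrow> bool" and pair :: "'u \<Rightarrow> 'u \<Rightarrow> 'u"
  assumes pair_inject: "pair a b = pair a' b' \<Longrightarrow> a = a' \<and> b = b'"
    and small_subset: "small A \<Longrightarrow> B \<subseteq> A \<Longrightarrow> small B"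
    and small_singleton: "small {x}"
    and small_image: "small A \<Longrightarrow> small (f ` A)"
    and small_UN: "small I \<Longrightarrow> (\<And>i. i \<in> I \<Longrightarrow> small (X i)) \<Longrightarrow> small (\<Union>i\<in>I. X i)"

definition pfst :: "('u \<Rightarrow> 'u \<Rightarrow> 'u) \<Rightarrow> 'u \<Rightarrow> 'u" where
  "pfst pair x = (THE a. \<exists>b. x = pair a b)"

definition psnd :: "('u \<Rightarrow> 'u \<Rightarrow> 'u) \<Rightarrow> 'u \<Rightarrow> 'u" where
  "psnd pair x = (THE b. \<exists>a. x = pair a b)"


section \<open>Categories, functors, natural transformations\<close>

text \<open>
  The operations of the structures below are required to be undefined outside their intended domains. This makes
  equality of the records coincide with equality of the structures they represent, as is needed
  to state strict equations between functors, 2-cells, and so on. \<open>Cmp C g f\<close> is \<open>g\<close> after \<open>f\<close>.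
\<close>

record ('o, 'a) cat =
  Ob :: "'o set"
  Ar :: "'a set"
  Dom :: "'a \<Rightarrow> 'o"
  Cod :: "'a \<Rightarrow> 'o"
  Idn :: "'o \<Rightarrow> 'a"
  Cmp :: "'a \<Rightarrow> 'a \<Rightarrow> 'a"

definition hom :: "('o, 'a) cat \<Rightarrow> 'o \<Rightarrow> 'o \<Rightarrow> 'a set" where
  "hom C a b = {f \<in> Ar C. Dom C f = a \<and> Cod C f = b}"

definition composable :: "('o, 'a) cat \<Rightarrow> 'a \<Rightarrow> 'a \<Rightarrow> bool" where
  "composable C g f \<longleftrightarrow> g \<in> Ar C \<and> f \<in> Ar C \<and> Dom C g = Cod C f"

locale category =
  fixes C :: "('o, 'a) cat"
  assumes Dom_funcset: "Dom C \<in> Ar C \<rightarrow>\<^sub>E Ob C"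
    and Cod_funcset: "Cod C \<in> Ar C \<rightarrow>\<^sub>E Ob C"
    and Idn_ext: "Idn C \<in> extensional (Ob C)"
    and Idn_hom: "x \<in> Ob C \<Longrightarrow> Idn C x \<in> hom C x x"
    and Cmp_ext: "\<not> composable C g f \<Longrightarrow> Cmp C g f = undefined"
    and Cmp_hom: "composable C g f \<Longrightarrow> Cmp C g f \<in> hom C (Dom C f) (Cod C g)"
    and Cmp_Idn_left: "f \<in> Ar C \<Longrightarrow> Cmp C (Idn C (Cod C f)) f = f"
    and Cmp_Idn_right: "f \<in> Ar C \<Longrightarrow> Cmp C f (Idn C (Dom C f)) = f"
    and Cmp_assoc: "composable C h g \<Longrightarrow> composable C g f \<Longrightarrow>
      Cmp C h (Cmp C g f) = Cmp C (Cmp C h g) f"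

definition inverse_arrows :: "('o, 'a) cat \<Rightarrow> 'a \<Rightarrow> 'a \<Rightarrow> bool" where
  "inverse_arrows C f g \<longleftrightarrow> composable C g f \<and> composable C f g \<and>
    Cmp C g f = Idn C (Dom C f) \<and> Cmp C f g = Idn C (Dom C g)"

definition iso_arrow :: "('o, 'a) cat \<Rightarrow> 'a \<Rightarrow> bool" where
  "iso_arrow C f \<longleftrightarrow> (\<exists>g. inverse_arrows C f g)"

definition inv_arrow :: "('o, 'a) cat \<Rightarrow> 'a \<Rightarrow> 'a" where
  "inv_arrow C f = (THE g. inverse_arrows C f g)"

record ('o, 'a, 'p, 'b) func =
  FDom :: "('o, 'a) cat"
  FCod :: "('p, 'b) cat"
  FOb :: "'o \<Rightarrow> 'p"
  FAr :: "'a \<Rightarrow> 'b"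

locale "functor" =
  fixes F :: "('o, 'a, 'p, 'b) func"
  assumes FDom_category: "category (FDom F)"
    and FCod_category: "category (FCod F)"
    and FOb_funcset: "FOb F \<in> Ob (FDom F) \<rightarrow>\<^sub>E Ob (FCod F)"
    and FAr_ext: "FAr F \<in> extensional (Ar (FDom F))"
    and FAr_hom: "f \<in> hom (FDom F) x y \<Longrightarrow> FAr F f \<in> hom (FCod F) (FOb F x) (FOb F y)"
    and FAr_Idn: "x \<in> Ob (FDom F) \<Longrightarrow> FAr F (Idn (FDom F) x) = Idn (FCod F) (FOb F x)"
    and FAr_Cmp: "composable (FDom F) g f \<Longrightarrow>
      FAr F (Cmp (FDom F) g f) = Cmp (FCod F) (FAr F g) (FAr F f)"

definition functors :: "('o, 'a) cat \<Rightarrow> ('p, 'b) cat \<Rightarrow> ('o, 'a, 'p, 'b) func set" where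
  "functors C D = {F. functor F \<and> FDom F = C \<and> FCod F = D}"

definition id_func :: "('o, 'a) cat \<Rightarrow> ('o, 'a, 'o, 'a) func" where
  "id_func C = \<lparr>FDom = C, FCod = C, FOb = restrict id (Ob C), FAr = restrict id (Ar C)\<rparr>"

definition comp_func ::
  "('p, 'b, 'q, 'c) func \<Rightarrow> ('o, 'a, 'p, 'b) func \<Rightarrow> ('o, 'a, 'q, 'c) func" where
  "comp_func G F = \<lparr>FDom = FDom F, FCod = FCod G,
    FOb = compose (Ob (FDom F)) (FOb G) (FOb F), FAr = compose (Ar (FDom F)) (FAr G) (FAr F)\<rparr>"

definition iso_functor :: "('o, 'a, 'p, 'b) func \<Rightarrow> bool" where
  "iso_functor F \<longleftrightarrow> functor F \<and> (\<exists>G \<in> functors (FCod F) (FDom F).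
    comp_func G F = id_func (FDom F) \<and> comp_func F G = id_func (FCod F))"

definition nat_trans ::
  "('o, 'a, 'p, 'b) func \<Rightarrow> ('o, 'a, 'p, 'b) func \<Rightarrow> ('o \<Rightarrow> 'b) \<Rightarrow> bool" where
  "nat_trans F G t \<longleftrightarrow> functor F \<and> functor G \<and> FDom F = FDom G \<and> FCod F = FCod G \<and>
    t \<in> extensional (Ob (FDom F)) \<and>
    (\<forall>x \<in> Ob (FDom F). t x \<in> hom (FCod F) (FOb F x) (FOb G x)) \<and>
    (\<forall>f x y. f \<in> hom (FDom F) x y \<longrightarrow>
      Cmp (FCod F) (t y) (FAr F f) = Cmp (FCod F) (FAr G f) (t x))"

definition nat_iso ::
  "('o, 'a, 'p, 'b) func \<Rightarrow> ('o, 'a, 'p, 'b) func \<Rightarrow> ('o \<Rightarrow> 'b) \<Rightarrow> bool" where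
  "nat_iso F G t \<longleftrightarrow> nat_trans F G t \<and> (\<forall>x \<in> Ob (FDom F). iso_arrow (FCod F) (t x))"

definition equivalence_functor :: "('o, 'a, 'p, 'b) func \<Rightarrow> bool" where
  "equivalence_functor F \<longleftrightarrow> functor F \<and> (\<exists>G \<in> functors (FCod F) (FDom F).
    (\<exists>s. nat_iso (id_func (FDom F)) (comp_func G F) s) \<and>
    (\<exists>t. nat_iso (comp_func F G) (id_func (FCod F)) t))"

record ('o, 'a, 'p, 'b) ntrans =
  NDom :: "('o, 'a, 'p, 'b) func"
  NCod :: "('o, 'a, 'p, 'b) func"
  NMap :: "'o \<Rightarrow> 'b"

definition ntrans :: "('o, 'a, 'p, 'b) ntrans \<Rightarrow> bool" where
  "ntrans t \<longleftrightarrow> nat_trans (NDom t) (NCod t) (NMap t)"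

definition id_ntrans :: "('o, 'a, 'p, 'b) func \<Rightarrow> ('o, 'a, 'p, 'b) ntrans" where
  "id_ntrans F = \<lparr>NDom = F, NCod = F, NMap = (\<lambda>x\<in>Ob (FDom F). Idn (FCod F) (FOb F x))\<rparr>"

definition vcomp_ntrans ::
  "('o, 'a, 'p, 'b) ntrans \<Rightarrow> ('o, 'a, 'p, 'b) ntrans \<Rightarrow> ('o, 'a, 'p, 'b) ntrans" where
  "vcomp_ntrans t s = \<lparr>NDom = NDom s, NCod = NCod t,
    NMap = (\<lambda>x\<in>Ob (FDom (NDom s)). Cmp (FCod (NDom s)) (NMap t x) (NMap s x))\<rparr>"

definition hcomp_ntrans ::
  "('p, 'b, 'q, 'c) ntrans \<Rightarrow> ('o, 'a, 'p, 'b) ntrans \<Rightarrow> ('o, 'a, 'q, 'c) ntrans" where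
  "hcomp_ntrans t s = \<lparr>NDom = comp_func (NDom t) (NDom s), NCod = comp_func (NCod t) (NCod s),
    NMap = (\<lambda>x\<in>Ob (FDom (NDom s)).
      Cmp (FCod (NDom t)) (FAr (NCod t) (NMap s x)) (NMap t (FOb (NDom s) x)))\<rparr>"


section \<open>Strict 2-categories and strict 2-functors\<close>

text \<open>\<open>Cmp1\<close> and \<open>HCmp\<close> compose along 0-cells, \<open>VCmp\<close> composes along 1-cells.\<close>

record ('o, 'f, 'c) two_cat =
  Zero :: "'o set"
  One :: "'f set"
  Two :: "'c set"
  Src1 :: "'f \<Rightarrow> 'o"
  Trg1 :: "'f \<Rightarrow> 'o"
  Src2 :: "'c \<Rightarrow> 'f"
  Trg2 :: "'c \<Rightarrow> 'f"
  Id1 :: "'o \<Rightarrow> 'f"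
  Id2 :: "'f \<Rightarrow> 'c"
  Cmp1 :: "'f \<Rightarrow> 'f \<Rightarrow> 'f"
  VCmp :: "'c \<Rightarrow> 'c \<Rightarrow> 'c"
  HCmp :: "'c \<Rightarrow> 'c \<Rightarrow> 'c"

definition cells1 :: "('o, 'f, 'c) two_cat \<Rightarrow> 'o \<Rightarrow> 'o \<Rightarrow> 'f set" where
  "cells1 K A B = {f \<in> One K. Src1 K f = A \<and> Trg1 K f = B}"

definition cells2 :: "('o, 'f, 'c) two_cat \<Rightarrow> 'f \<Rightarrow> 'f \<Rightarrow> 'c set" where
  "cells2 K f g = {a \<in> Two K. Src2 K a = f \<and> Trg2 K a = g}"

definition Hom :: "('o, 'f, 'c) two_cat \<Rightarrow> 'o \<Rightarrow> 'o \<Rightarrow> ('f, 'c) cat" where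
  "Hom K A B =
    (let obj = cells1 K A B; arr = {a \<in> Two K. Src2 K a \<in> cells1 K A B \<and> Trg2 K a \<in> cells1 K A B}
     in \<lparr>Ob = obj, Ar = arr, Dom = restrict (Src2 K) arr, Cod = restrict (Trg2 K) arr,
      Idn = restrict (Id2 K) obj,
      Cmp = (\<lambda>b a. if b \<in> arr \<and> a \<in> arr \<and> Src2 K b = Trg2 K a then VCmp K b a else undefined)\<rparr>)"

locale strict_two_category =
  fixes K :: "('o, 'f, 'c) two_cat"
  assumes Src1_Zero: "f \<in> One K \<Longrightarrow> Src1 K f \<in> Zero K"
    and Trg1_Zero: "f \<in> One K \<Longrightarrow> Trg1 K f \<in> Zero K"
    and Id1_cell: "A \<in> Zero K \<Longrightarrow> Id1 K A \<in> cells1 K A A"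
    and Cmp1_cell: "f \<in> cells1 K A B \<Longrightarrow> g \<in> cells1 K B C \<Longrightarrow> Cmp1 K g f \<in> cells1 K A C"
    and Cmp1_Id1_left: "f \<in> cells1 K A B \<Longrightarrow> Cmp1 K (Id1 K B) f = f"
    and Cmp1_Id1_right: "f \<in> cells1 K A B \<Longrightarrow> Cmp1 K f (Id1 K A) = f"
    and Cmp1_assoc: "f \<in> cells1 K A B \<Longrightarrow> g \<in> cells1 K B C \<Longrightarrow> h \<in> cells1 K C D \<Longrightarrow>
      Cmp1 K h (Cmp1 K g f) = Cmp1 K (Cmp1 K h g) f"
    and Two_parallel: "a \<in> Two K \<Longrightarrow>
      \<exists>A B. Src2 K a \<in> cells1 K A B \<and> Trg2 K a \<in> cells1 K A B"
    and Hom_category: "A \<in> Zero K \<Longrightarrow> B \<in> Zero K \<Longrightarrow> category (Hom K A B)"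
    and HCmp_cell: "a \<in> Ar (Hom K A B) \<Longrightarrow> b \<in> Ar (Hom K B C) \<Longrightarrow>
      HCmp K b a \<in> cells2 K (Cmp1 K (Src2 K b) (Src2 K a)) (Cmp1 K (Trg2 K b) (Trg2 K a))"
    and HCmp_Id2: "f \<in> cells1 K A B \<Longrightarrow> g \<in> cells1 K B C \<Longrightarrow>
      HCmp K (Id2 K g) (Id2 K f) = Id2 K (Cmp1 K g f)"
    and interchange: "composable (Hom K A B) a' a \<Longrightarrow> composable (Hom K B C) b' b \<Longrightarrow>
      HCmp K (VCmp K b' b) (VCmp K a' a) = VCmp K (HCmp K b' a') (HCmp K b a)"
    and HCmp_Id1_left: "a \<in> Ar (Hom K A B) \<Longrightarrow> HCmp K (Id2 K (Id1 K B)) a = a"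
    and HCmp_Id1_right: "a \<in> Ar (Hom K A B) \<Longrightarrow> HCmp K a (Id2 K (Id1 K A)) = a"
    and HCmp_assoc:
      "a \<in> Ar (Hom K A B) \<Longrightarrow> b \<in> Ar (Hom K B C) \<Longrightarrow> c \<in> Ar (Hom K C D) \<Longrightarrow>
      HCmp K c (HCmp K b a) = HCmp K (HCmp K c b) a"

record ('o, 'f, 'c, 'p, 'g, 'd) two_func =
  P0 :: "'o \<Rightarrow> 'p"
  P1 :: "'f \<Rightarrow> 'g"
  P2 :: "'c \<Rightarrow> 'd"

locale strict_two_functor =
  fixes K :: "('o, 'f, 'c) two_cat" and L :: "('p, 'g, 'd) two_cat"
    and \<Phi> :: "('o, 'f, 'c, 'p, 'g, 'd) two_func"
  assumes source: "strict_two_category K" and target: "strict_two_category L"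
    and P0_Zero: "A \<in> Zero K \<Longrightarrow> P0 \<Phi> A \<in> Zero L"
    and P1_cell: "f \<in> cells1 K A B \<Longrightarrow> P1 \<Phi> f \<in> cells1 L (P0 \<Phi> A) (P0 \<Phi> B)"
    and P2_cell: "a \<in> cells2 K f g \<Longrightarrow> P2 \<Phi> a \<in> cells2 L (P1 \<Phi> f) (P1 \<Phi> g)"
    and P1_Id1: "A \<in> Zero K \<Longrightarrow> P1 \<Phi> (Id1 K A) = Id1 L (P0 \<Phi> A)"
    and P1_Cmp1: "f \<in> cells1 K A B \<Longrightarrow> g \<in> cells1 K B C \<Longrightarrow>
      P1 \<Phi> (Cmp1 K g f) = Cmp1 L (P1 \<Phi> g) (P1 \<Phi> f)"
    and P2_Id2: "f \<in> One K \<Longrightarrow> P2 \<Phi> (Id2 K f) = Id2 L (P1 \<Phi> f)"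
    and P2_VCmp: "a \<in> cells2 K f g \<Longrightarrow> b \<in> cells2 K g h \<Longrightarrow>
      P2 \<Phi> (VCmp K b a) = VCmp L (P2 \<Phi> b) (P2 \<Phi> a)"
    and P2_HCmp: "a \<in> Ar (Hom K A B) \<Longrightarrow> b \<in> Ar (Hom K B C) \<Longrightarrow>
      P2 \<Phi> (HCmp K b a) = HCmp L (P2 \<Phi> b) (P2 \<Phi> a)"


section \<open>The 2-category of comonads\<close>

record ('o, 'f, 'c) comonad =
  MOb :: 'o
  MEnd :: 'f
  MEps :: 'c
  MDel :: 'c

definition comonad :: "('o, 'f, 'c) two_cat \<Rightarrow> ('o, 'f, 'c) comonad \<Rightarrow> bool" where
  "comonad K T \<longleftrightarrow> MOb T \<in> Zero K \<and> MEnd T \<in> cells1 K (MOb T) (MOb T) \<and>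
    MEps T \<in> cells2 K (MEnd T) (Id1 K (MOb T)) \<and>
    MDel T \<in> cells2 K (MEnd T) (Cmp1 K (MEnd T) (MEnd T)) \<and>
    VCmp K (HCmp K (MEps T) (Id2 K (MEnd T))) (MDel T) = Id2 K (MEnd T) \<and>
    VCmp K (HCmp K (Id2 K (MEnd T)) (MEps T)) (MDel T) = Id2 K (MEnd T) \<and>
    VCmp K (HCmp K (MDel T) (Id2 K (MEnd T))) (MDel T) =
      VCmp K (HCmp K (Id2 K (MEnd T)) (MDel T)) (MDel T)"

record ('o, 'f, 'c) comonad_mor =
  CSrc :: "('o, 'f, 'c) comonad"
  CTrg :: "('o, 'f, 'c) comonad"
  CMor :: 'f
  CTau :: 'c

definition comonad_mor :: "('o, 'f, 'c) two_cat \<Rightarrow> ('o, 'f, 'c) comonad_mor \<Rightarrow> bool" where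
  "comonad_mor K m \<longleftrightarrow>
    (let S = CSrc m; T = CTrg m; f = CMor m; t = CTau m in
      comonad K S \<and> comonad K T \<and> f \<in> cells1 K (MOb S) (MOb T) \<and>
      t \<in> cells2 K (Cmp1 K f (MEnd S)) (Cmp1 K (MEnd T) f) \<and>
      VCmp K (HCmp K (MEps T) (Id2 K f)) t = HCmp K (Id2 K f) (MEps S) \<and>
      VCmp K (HCmp K (MDel T) (Id2 K f)) t =
        VCmp K (HCmp K (Id2 K (MEnd T)) t)
          (VCmp K (HCmp K t (Id2 K (MEnd S))) (HCmp K (Id2 K f) (MDel S))))"

record ('o, 'f, 'c) comonad_cell =
  BSrc :: "('o, 'f, 'c) comonad_mor"
  BTrg :: "('o, 'f, 'c) comonad_mor"
  BCell :: 'c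

definition comonad_cell :: "('o, 'f, 'c) two_cat \<Rightarrow> ('o, 'f, 'c) comonad_cell \<Rightarrow> bool" where
  "comonad_cell K x \<longleftrightarrow>
    (let m = BSrc x; n = BTrg x; a = BCell x in
      comonad_mor K m \<and> comonad_mor K n \<and> CSrc m = CSrc n \<and> CTrg m = CTrg n \<and>
      a \<in> cells2 K (CMor m) (CMor n) \<and>
      VCmp K (HCmp K (Id2 K (MEnd (CTrg m))) a) (CTau m) =
        VCmp K (CTau n) (HCmp K a (Id2 K (MEnd (CSrc m)))))"

definition Comon :: "('o, 'f, 'c) two_cat \<Rightarrow>
  (('o, 'f, 'c) comonad, ('o, 'f, 'c) comonad_mor, ('o, 'f, 'c) comonad_cell) two_cat" where
  "Comon K = \<lparr>Zero = {T. comonad K T}, One = {m. comonad_mor K m}, Two = {x. comonad_cell K x},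
    Src1 = CSrc, Trg1 = CTrg, Src2 = BSrc, Trg2 = BTrg,
    Id1 = (\<lambda>T. \<lparr>CSrc = T, CTrg = T, CMor = Id1 K (MOb T), CTau = Id2 K (MEnd T)\<rparr>),
    Id2 = (\<lambda>m. \<lparr>BSrc = m, BTrg = m, BCell = Id2 K (CMor m)\<rparr>),
    Cmp1 = (\<lambda>n m. \<lparr>CSrc = CSrc m, CTrg = CTrg n, CMor = Cmp1 K (CMor n) (CMor m),
      CTau = VCmp K (HCmp K (CTau n) (Id2 K (CMor m))) (HCmp K (Id2 K (CMor n)) (CTau m))\<rparr>),
    VCmp = (\<lambda>y x. \<lparr>BSrc = BSrc x, BTrg = BTrg y, BCell = VCmp K (BCell y) (BCell x)\<rparr>),
    HCmp = (\<lambda>y x.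
      \<lparr>BSrc =
        \<lparr>CSrc = CSrc (BSrc x), CTrg = CTrg (BSrc y), CMor = Cmp1 K (CMor (BSrc y)) (CMor (BSrc x)),
         CTau = VCmp K (HCmp K (CTau (BSrc y)) (Id2 K (CMor (BSrc x))))
           (HCmp K (Id2 K (CMor (BSrc y))) (CTau (BSrc x)))\<rparr>,
       BTrg =
        \<lparr>CSrc = CSrc (BTrg x), CTrg = CTrg (BTrg y), CMor = Cmp1 K (CMor (BTrg y)) (CMor (BTrg x)),
         CTau = VCmp K (HCmp K (CTau (BTrg y)) (Id2 K (CMor (BTrg x))))
           (HCmp K (Id2 K (CMor (BTrg y))) (CTau (BTrg x)))\<rparr>,
       BCell = HCmp K (BCell y) (BCell x)\<rparr>)\<rparr>"

text \<open>The 2-functor from \<open>K\<close> to \<open>Comon K\<close> sending \<open>D\<close> to the identity comonad on \<open>D\<close>.\<close>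

definition triv :: "('o, 'f, 'c) two_cat \<Rightarrow> ('o, 'f, 'c, ('o, 'f, 'c) comonad,
    ('o, 'f, 'c) comonad_mor, ('o, 'f, 'c) comonad_cell) two_func" where
  "triv K =
    (let t0 = (\<lambda>D. \<lparr>MOb = D, MEnd = Id1 K D, MEps = Id2 K (Id1 K D), MDel = Id2 K (Id1 K D)\<rparr>);
         t1 = (\<lambda>h. \<lparr>CSrc = t0 (Src1 K h), CTrg = t0 (Trg1 K h), CMor = h, CTau = Id2 K h\<rparr>)
     in \<lparr>P0 = t0, P1 = t1,
       P2 = (\<lambda>a. \<lparr>BSrc = t1 (Src2 K a), BTrg = t1 (Trg2 K a), BCell = a\<rparr>)\<rparr>)"


section \<open>Objects of coalgebras\<close>

text \<open>
  An object of coalgebras for \<open>T\<close> is an object \<open>AOb\<close> together with isomorphisms of categories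
  \<open>AIso D\<close> from \<open>Hom(D, AOb)\<close> to \<open>Hom(id\<^sub>D, T)\<close>, 2-natural in \<open>D\<close>.
\<close>

record ('o, 'f, 'c) coalg_obj =
  AOb :: 'o
  AIso :: "'o \<Rightarrow> ('f, 'c, ('o, 'f, 'c) comonad_mor, ('o, 'f, 'c) comonad_cell) func"

definition coalgebra_object ::
  "('o, 'f, 'c) two_cat \<Rightarrow> ('o, 'f, 'c) comonad \<Rightarrow> ('o, 'f, 'c) coalg_obj \<Rightarrow> bool" where
  "coalgebra_object K T A \<longleftrightarrow> AOb A \<in> Zero K \<and>
    (\<forall>D \<in> Zero K. AIso A D \<in> functors (Hom K D (AOb A)) (Hom (Comon K) (P0 (triv K) D) T) \<and>
      iso_functor (AIso A D)) \<and>
    (\<forall>D \<in> Zero K. \<forall>D' \<in> Zero K. \<forall>h \<in> Ob (Hom K D' D). \<forall>f \<in> Ob (Hom K D (AOb A)).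
      FOb (AIso A D') (Cmp1 K f h) = Cmp1 (Comon K) (FOb (AIso A D) f) (P1 (triv K) h)) \<and>
    (\<forall>D \<in> Zero K. \<forall>D' \<in> Zero K. \<forall>b \<in> Ar (Hom K D' D). \<forall>a \<in> Ar (Hom K D (AOb A)).
      FAr (AIso A D') (HCmp K a b) = HCmp (Comon K) (FAr (AIso A D) a) (P2 (triv K) b))"

definition admits_coalgebras :: "('o, 'f, 'c) two_cat \<Rightarrow> bool" where
  "admits_coalgebras K \<longleftrightarrow> (\<forall>T. comonad K T \<longrightarrow> (\<exists>A. coalgebra_object K T A))"

definition coalgebra_choice ::
  "('o, 'f, 'c) two_cat \<Rightarrow> (('o, 'f, 'c) comonad \<Rightarrow> ('o, 'f, 'c) coalg_obj) \<Rightarrow> bool" where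
  "coalgebra_choice K ch \<longleftrightarrow> (\<forall>T. comonad K T \<longrightarrow> coalgebra_object K T (ch T))"

text \<open>
  The forgetful-cofree adjunction of an object of coalgebras: \<open>(U, u)\<close> is the universal coalgebra,
  the cofree 1-cell corresponds to the coalgebra \<open>(T, \<delta>)\<close>, and the unit corresponds to the
  structure 2-cell \<open>u\<close>, regarded as a coalgebra map from \<open>(U, u)\<close> to \<open>(T U, \<delta> U)\<close>. The counit is
  that of \<open>T\<close>.
\<close>

definition univ_coalg ::
  "('o, 'f, 'c) two_cat \<Rightarrow> ('o, 'f, 'c) coalg_obj \<Rightarrow> ('o, 'f, 'c) comonad_mor" where
  "univ_coalg K A = FOb (AIso A (AOb A)) (Id1 K (AOb A))"

definition forgetful :: "('o, 'f, 'c) two_cat \<Rightarrow> ('o, 'f, 'c) coalg_obj \<Rightarrow> 'f" where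
  "forgetful K A = CMor (univ_coalg K A)"

definition cofree ::
  "('o, 'f, 'c) two_cat \<Rightarrow> ('o, 'f, 'c) comonad \<Rightarrow> ('o, 'f, 'c) coalg_obj \<Rightarrow> 'f" where
  "cofree K T A = inv_into (Ob (Hom K (MOb T) (AOb A))) (FOb (AIso A (MOb T)))
    \<lparr>CSrc = P0 (triv K) (MOb T), CTrg = T, CMor = MEnd T, CTau = MDel T\<rparr>"

definition coalg_unit ::
  "('o, 'f, 'c) two_cat \<Rightarrow> ('o, 'f, 'c) comonad \<Rightarrow> ('o, 'f, 'c) coalg_obj \<Rightarrow> 'c" where
  "coalg_unit K T A = inv_into (Ar (Hom K (AOb A) (AOb A))) (FAr (AIso A (AOb A)))
    \<lparr>BSrc = univ_coalg K A,
     BTrg = FOb (AIso A (AOb A)) (Cmp1 K (cofree K T A) (forgetful K A)),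
     BCell = CTau (univ_coalg K A)\<rparr>"

record ('o, 'f, 'c) adj =
  AdjLow :: 'o
  AdjUp :: 'o
  AdjL :: 'f
  AdjR :: 'f
  AdjUnit :: 'c
  AdjCounit :: 'c

text \<open>The left adjoint \<open>AdjL\<close> goes from \<open>AdjUp\<close> to \<open>AdjLow\<close>; the comonad lives on \<open>AdjLow\<close>.\<close>

definition adjunction :: "('o, 'f, 'c) two_cat \<Rightarrow> ('o, 'f, 'c) adj \<Rightarrow> bool" where
  "adjunction K J \<longleftrightarrow>
    (let U = AdjL J; F = AdjR J; i = AdjUnit J; e = AdjCounit J in
      AdjLow J \<in> Zero K \<and> AdjUp J \<in> Zero K \<and>
      U \<in> cells1 K (AdjUp J) (AdjLow J) \<and> F \<in> cells1 K (AdjLow J) (AdjUp J) \<and>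
      i \<in> cells2 K (Id1 K (AdjUp J)) (Cmp1 K F U) \<and>
      e \<in> cells2 K (Cmp1 K U F) (Id1 K (AdjLow J)) \<and>
      VCmp K (HCmp K e (Id2 K U)) (HCmp K (Id2 K U) i) = Id2 K U \<and>
      VCmp K (HCmp K (Id2 K F) e) (HCmp K i (Id2 K F)) = Id2 K F)"

definition coalg_adjunction :: "('o, 'f, 'c) two_cat \<Rightarrow> ('o, 'f, 'c) comonad \<Rightarrow>
    ('o, 'f, 'c) coalg_obj \<Rightarrow> ('o, 'f, 'c) adj" where
  "coalg_adjunction K T A = \<lparr>AdjLow = MOb T, AdjUp = AOb A, AdjL = forgetful K A,
    AdjR = cofree K T A, AdjUnit = coalg_unit K T A, AdjCounit = MEps T\<rparr>"

definition map_adj :: "('o, 'f, 'c, 'p, 'g, 'd) two_func \<Rightarrow> ('o, 'f, 'c) adj \<Rightarrow> ('p, 'g, 'd) adj"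
  where
  "map_adj \<Phi> J = \<lparr>AdjLow = P0 \<Phi> (AdjLow J), AdjUp = P0 \<Phi> (AdjUp J), AdjL = P1 \<Phi> (AdjL J),
    AdjR = P1 \<Phi> (AdjR J), AdjUnit = P2 \<Phi> (AdjUnit J), AdjCounit = P2 \<Phi> (AdjCounit J)\<rparr>"

definition adj_comonad :: "('o, 'f, 'c) two_cat \<Rightarrow> ('o, 'f, 'c) adj \<Rightarrow> ('o, 'f, 'c) comonad" where
  "adj_comonad K J = \<lparr>MOb = AdjLow J, MEnd = Cmp1 K (AdjL J) (AdjR J), MEps = AdjCounit J,
    MDel = HCmp K (Id2 K (AdjL J)) (HCmp K (AdjUnit J) (Id2 K (AdjR J)))\<rparr>"

text \<open>
  The comparison 1-cell from the upper object of an adjunction to the chosen object of coalgebras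
  of its comonad corresponds to the left adjoint \<open>U\<close> with the coalgebra structure \<open>U \<eta>\<close>.
\<close>

definition comparison :: "('o, 'f, 'c) two_cat \<Rightarrow>
    (('o, 'f, 'c) comonad \<Rightarrow> ('o, 'f, 'c) coalg_obj) \<Rightarrow> ('o, 'f, 'c) adj \<Rightarrow> 'f" where
  "comparison K ch J =
    (let T = adj_comonad K J in
      inv_into (Ob (Hom K (AdjUp J) (AOb (ch T)))) (FOb (AIso (ch T) (AdjUp J)))
        \<lparr>CSrc = P0 (triv K) (AdjUp J), CTrg = T, CMor = AdjL J,
         CTau = HCmp K (Id2 K (AdjL J)) (AdjUnit J)\<rparr>)"

definition comonadic_on_the_nose :: "('o, 'f, 'c) two_cat \<Rightarrow>
    (('o, 'f, 'c) comonad \<Rightarrow> ('o, 'f, 'c) coalg_obj) \<Rightarrow> ('o, 'f, 'c) adj \<Rightarrow> bool" where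
  "comonadic_on_the_nose K ch J \<longleftrightarrow> adjunction K J \<and>
    AOb (ch (adj_comonad K J)) = AdjUp J \<and> comparison K ch J = Id1 K (AdjUp J)"

definition preserves_coalgebras_on_the_nose ::
  "('o, 'f, 'c) two_cat \<Rightarrow> (('o, 'f, 'c) comonad \<Rightarrow> ('o, 'f, 'c) coalg_obj) \<Rightarrow>
   ('p, 'g, 'd) two_cat \<Rightarrow> (('p, 'g, 'd) comonad \<Rightarrow> ('p, 'g, 'd) coalg_obj) \<Rightarrow>
   ('o, 'f, 'c, 'p, 'g, 'd) two_func \<Rightarrow> bool" where
  "preserves_coalgebras_on_the_nose K chK L chL \<Phi> \<longleftrightarrow>
    (\<forall>T. comonad K T \<longrightarrow>
      comonadic_on_the_nose L chL (map_adj \<Phi> (coalg_adjunction K T (chK T))))"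

text \<open>
  \<open>K\<close> admits the construction of coalgebras over \<open>L\<close>, where the objects of coalgebras in \<open>L\<close> are
  the given ones \<open>chL\<close>, and those in \<open>K\<close> can be chosen suitably.
\<close>

definition admits_coalgebras_over ::
  "('o, 'f, 'c) two_cat \<Rightarrow> ('p, 'g, 'd) two_cat \<Rightarrow>
   (('p, 'g, 'd) comonad \<Rightarrow> ('p, 'g, 'd) coalg_obj) \<Rightarrow>
   ('o, 'f, 'c, 'p, 'g, 'd) two_func \<Rightarrow> bool" where
  "admits_coalgebras_over K L chL \<Phi> \<longleftrightarrow>
    strict_two_functor K L \<Phi> \<and> admits_coalgebras K \<and> admits_coalgebras L \<and>
    coalgebra_choice L chL \<and>
    (\<exists>chK. coalgebra_choice K chK \<and> preserves_coalgebras_on_the_nose K chK L chL \<Phi>)"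


section \<open>The 2-category of small categories and its usual objects of coalgebras\<close>

definition small_category :: "('u set \<Rightarrow> bool) \<Rightarrow> ('u, 'u) cat \<Rightarrow> bool" where
  "small_category small C \<longleftrightarrow> category C \<and> small (Ob C) \<and> small (Ar C)"

definition Cat :: "('u set \<Rightarrow> bool) \<Rightarrow>
  (('u, 'u) cat, ('u, 'u, 'u, 'u) func, ('u, 'u, 'u, 'u) ntrans) two_cat" where
  "Cat small = \<lparr>Zero = {C. small_category small C},
    One = {F. functor F \<and> small_category small (FDom F) \<and> small_category small (FCod F)},
    Two = {t. ntrans t \<and> small_category small (FDom (NDom t)) \<and>
      small_category small (FCod (NDom t))},
    Src1 = FDom, Trg1 = FCod, Src2 = NDom, Trg2 = NCod, Id1 = id_func, Id2 = id_ntrans,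
    Cmp1 = comp_func, VCmp = vcomp_ntrans, HCmp = hcomp_ntrans\<rparr>"

type_synonym 'u cat_comonad =
  "(('u, 'u) cat, ('u, 'u, 'u, 'u) func, ('u, 'u, 'u, 'u) ntrans) comonad"

text \<open>
  A coalgebra \<open>a : A \<rightarrow> T A\<close> is coded as the pair \<open>(A, a)\<close>, and a coalgebra map \<open>f\<close> from \<open>(A, a)\<close>
  to \<open>(B, b)\<close> as the nested pair \<open>((A, a), (f, (B, b)))\<close>.
\<close>

definition coalg_cat :: "('u \<Rightarrow> 'u \<Rightarrow> 'u) \<Rightarrow> 'u cat_comonad \<Rightarrow> ('u, 'u) cat" where
  "coalg_cat pair T =
    (let C = MOb T; E = MEnd T; \<epsilon> = NMap (MEps T); \<delta> = NMap (MDel T);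
         coalg = (\<lambda>A a. A \<in> Ob C \<and> a \<in> hom C A (FOb E A) \<and>
           Cmp C (\<epsilon> A) a = Idn C A \<and> Cmp C (\<delta> A) a = Cmp C (FAr E a) a);
         obj = {pair A a |A a. coalg A a};
         arr = {pair (pair A a) (pair f (pair B b)) |A a f B b.
           coalg A a \<and> coalg B b \<and> f \<in> hom C A B \<and> Cmp C b f = Cmp C (FAr E f) a};
         src = pfst pair; map = (\<lambda>x. pfst pair (psnd pair x)); trg = (\<lambda>x. psnd pair (psnd pair x))
     in \<lparr>Ob = obj, Ar = arr, Dom = restrict src arr, Cod = restrict trg arr,
       Idn = (\<lambda>x\<in>obj. pair x (pair (Idn C (pfst pair x)) x)),
       Cmp = (\<lambda>y x. if y \<in> arr \<and> x \<in> arr \<and> src y = trg x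
         then pair (src x) (pair (Cmp C (map y) (map x)) (trg y)) else undefined)\<rparr>)"

definition coalg_forget ::
  "('u \<Rightarrow> 'u \<Rightarrow> 'u) \<Rightarrow> 'u cat_comonad \<Rightarrow> ('u, 'u, 'u, 'u) func" where
  "coalg_forget pair T = \<lparr>FDom = coalg_cat pair T, FCod = MOb T,
    FOb = (\<lambda>x\<in>Ob (coalg_cat pair T). pfst pair x),
    FAr = (\<lambda>x\<in>Ar (coalg_cat pair T). pfst pair (psnd pair x))\<rparr>"

definition coalg_universal :: "('u set \<Rightarrow> bool) \<Rightarrow> ('u \<Rightarrow> 'u \<Rightarrow> 'u) \<Rightarrow> 'u cat_comonad \<Rightarrow>
    (('u, 'u) cat, ('u, 'u, 'u, 'u) func, ('u, 'u, 'u, 'u) ntrans) comonad_mor" where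
  "coalg_universal small pair T = \<lparr>CSrc = P0 (triv (Cat small)) (coalg_cat pair T), CTrg = T,
    CMor = coalg_forget pair T,
    CTau = \<lparr>NDom = coalg_forget pair T, NCod = comp_func (MEnd T) (coalg_forget pair T),
      NMap = (\<lambda>x\<in>Ob (coalg_cat pair T). psnd pair x)\<rparr>\<rparr>"

text \<open>
  The isomorphism from \<open>Hom(D, X)\<close> to \<open>Hom(id\<^sub>D, T)\<close> sends a 1-cell \<open>h\<close> to the composite of the
  universal coalgebra on \<open>X\<close> with \<open>h\<close>, and similarly for 2-cells.
\<close>

definition Cat_coalg :: "('u set \<Rightarrow> bool) \<Rightarrow> ('u \<Rightarrow> 'u \<Rightarrow> 'u) \<Rightarrow> 'u cat_comonad \<Rightarrow>
    (('u, 'u) cat, ('u, 'u, 'u, 'u) func, ('u, 'u, 'u, 'u) ntrans) coalg_obj" where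
  "Cat_coalg small pair T =
    (let K = Cat small; X = coalg_cat pair T; m = coalg_universal small pair T in
      \<lparr>AOb = X,
       AIso = (\<lambda>D. \<lparr>FDom = Hom K D X, FCod = Hom (Comon K) (P0 (triv K) D) T,
         FOb = (\<lambda>h\<in>Ob (Hom K D X). Cmp1 (Comon K) m (P1 (triv K) h)),
         FAr = (\<lambda>a\<in>Ar (Hom K D X). HCmp (Comon K) (Id2 (Comon K) m) (P2 (triv K) a))\<rparr>)\<rparr>)"


section \<open>Indexed categories\<close>

text \<open>
  A pseudofunctor on the opposite of \<open>IBase\<close>: for \<open>u : a \<rightarrow> b\<close> the reindexing functor \<open>IRe u\<close> goes
  from the fibre over \<open>b\<close> to the fibre over \<open>a\<close>; \<open>IUnit a\<close> and \<open>IMult u v\<close> are the structural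
  isomorphisms from \<open>x\<close> to \<open>id\<^sub>a* x\<close> and from \<open>v* (u* x)\<close> to \<open>(u v)* x\<close>.
\<close>

record ('o, 'a, 'p, 'q) icat =
  IBase :: "('o, 'a) cat"
  IFib :: "'o \<Rightarrow> ('p, 'q) cat"
  IRe :: "'a \<Rightarrow> ('p, 'q, 'p, 'q) func"
  IUnit :: "'o \<Rightarrow> 'p \<Rightarrow> 'q"
  IMult :: "'a \<Rightarrow> 'a \<Rightarrow> 'p \<Rightarrow> 'q"

locale indexed_category =
  fixes P :: "('o, 'a, 'p, 'q) icat"
  assumes IBase_category: "category (IBase P)"
    and IFib_ext: "IFib P \<in> extensional (Ob (IBase P))"
    and IFib_category: "a \<in> Ob (IBase P) \<Longrightarrow> category (IFib P a)"
    and IRe_ext: "IRe P \<in> extensional (Ar (IBase P))"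
    and IRe_functor: "u \<in> hom (IBase P) a b \<Longrightarrow> IRe P u \<in> functors (IFib P b) (IFib P a)"
    and IUnit_ext: "IUnit P \<in> extensional (Ob (IBase P))"
    and IUnit_iso: "a \<in> Ob (IBase P) \<Longrightarrow>
      nat_iso (id_func (IFib P a)) (IRe P (Idn (IBase P) a)) (IUnit P a)"
    and IMult_ext: "\<not> composable (IBase P) u v \<Longrightarrow> IMult P u v = undefined"
    and IMult_iso: "composable (IBase P) u v \<Longrightarrow>
      nat_iso (comp_func (IRe P v) (IRe P u)) (IRe P (Cmp (IBase P) u v)) (IMult P u v)"
    and IUnit_right: "u \<in> hom (IBase P) a b \<Longrightarrow> x \<in> Ob (IFib P b) \<Longrightarrow>
      Cmp (IFib P a) (IMult P u (Idn (IBase P) a) x) (IUnit P a (FOb (IRe P u) x)) =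
        Idn (IFib P a) (FOb (IRe P u) x)"
    and IUnit_left: "u \<in> hom (IBase P) a b \<Longrightarrow> x \<in> Ob (IFib P b) \<Longrightarrow>
      Cmp (IFib P a) (IMult P (Idn (IBase P) b) u x) (FAr (IRe P u) (IUnit P b x)) =
        Idn (IFib P a) (FOb (IRe P u) x)"
    and IMult_assoc: "w \<in> hom (IBase P) a b \<Longrightarrow> v \<in> hom (IBase P) b c \<Longrightarrow>
      u \<in> hom (IBase P) c d \<Longrightarrow> x \<in> Ob (IFib P d) \<Longrightarrow>
      Cmp (IFib P a) (IMult P u (Cmp (IBase P) v w) x) (IMult P v w (FOb (IRe P u) x)) =
        Cmp (IFib P a) (IMult P (Cmp (IBase P) u v) w x) (FAr (IRe P w) (IMult P u v x))"

locale strict_indexed_category = indexed_category +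
  assumes IRe_Idn: "a \<in> Ob (IBase P) \<Longrightarrow> IRe P (Idn (IBase P) a) = id_func (IFib P a)"
    and IUnit_Idn: "a \<in> Ob (IBase P) \<Longrightarrow> x \<in> Ob (IFib P a) \<Longrightarrow> IUnit P a x = Idn (IFib P a) x"
    and IRe_Cmp: "composable (IBase P) u v \<Longrightarrow>
      IRe P (Cmp (IBase P) u v) = comp_func (IRe P v) (IRe P u)"
    and IMult_Idn: "v \<in> hom (IBase P) a b \<Longrightarrow> u \<in> hom (IBase P) b c \<Longrightarrow> x \<in> Ob (IFib P c) \<Longrightarrow>
      IMult P u v x = Idn (IFib P a) (FOb (IRe P (Cmp (IBase P) u v)) x)"

text \<open>
  Indexed functors are pseudonatural transformations; for \<open>u : a \<rightarrow> b\<close>, \<open>XRho u x\<close> is the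
  isomorphism from \<open>u* (\<theta>\<^sub>b x)\<close> to \<open>\<theta>\<^sub>a (u* x)\<close>.
\<close>

record ('o, 'a, 'p, 'q, 'r, 's) ifun =
  XDom :: "('o, 'a, 'p, 'q) icat"
  XCod :: "('o, 'a, 'r, 's) icat"
  XFun :: "'o \<Rightarrow> ('p, 'q, 'r, 's) func"
  XRho :: "'a \<Rightarrow> 'p \<Rightarrow> 's"

definition XBase :: "('o, 'a, 'p, 'q, 'r, 's) ifun \<Rightarrow> ('o, 'a) cat" where
  "XBase \<theta> = IBase (XDom \<theta>)"

locale indexed_functor =
  fixes \<theta> :: "('o, 'a, 'p, 'q, 'r, 's) ifun"
  assumes XDom_indexed: "indexed_category (XDom \<theta>)"
    and XCod_indexed: "indexed_category (XCod \<theta>)"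
    and same_base: "IBase (XCod \<theta>) = XBase \<theta>"
    and XFun_ext: "XFun \<theta> \<in> extensional (Ob (XBase \<theta>))"
    and XFun_functor: "a \<in> Ob (XBase \<theta>) \<Longrightarrow>
      XFun \<theta> a \<in> functors (IFib (XDom \<theta>) a) (IFib (XCod \<theta>) a)"
    and XRho_ext: "XRho \<theta> \<in> extensional (Ar (XBase \<theta>))"
    and XRho_iso: "u \<in> hom (XBase \<theta>) a b \<Longrightarrow>
      nat_iso (comp_func (IRe (XCod \<theta>) u) (XFun \<theta> b)) (comp_func (XFun \<theta> a) (IRe (XDom \<theta>) u))
        (XRho \<theta> u)"
    and XRho_unit: "a \<in> Ob (XBase \<theta>) \<Longrightarrow> x \<in> Ob (IFib (XDom \<theta>) a) \<Longrightarrow>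
      Cmp (IFib (XCod \<theta>) a) (XRho \<theta> (Idn (XBase \<theta>) a) x) (IUnit (XCod \<theta>) a (FOb (XFun \<theta> a) x)) =
        FAr (XFun \<theta> a) (IUnit (XDom \<theta>) a x)"
    and XRho_mult: "v \<in> hom (XBase \<theta>) a b \<Longrightarrow> u \<in> hom (XBase \<theta>) b c \<Longrightarrow>
      x \<in> Ob (IFib (XDom \<theta>) c) \<Longrightarrow>
      Cmp (IFib (XCod \<theta>) a) (XRho \<theta> (Cmp (XBase \<theta>) u v) x)
          (IMult (XCod \<theta>) u v (FOb (XFun \<theta> c) x)) =
        Cmp (IFib (XCod \<theta>) a) (FAr (XFun \<theta> a) (IMult (XDom \<theta>) u v x))
          (Cmp (IFib (XCod \<theta>) a) (XRho \<theta> v (FOb (IRe (XDom \<theta>) u) x))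
            (FAr (IRe (XCod \<theta>) v) (XRho \<theta> u x)))"

locale strict_indexed_functor = indexed_functor +
  assumes XFun_IRe: "u \<in> hom (XBase \<theta>) a b \<Longrightarrow>
      comp_func (IRe (XCod \<theta>) u) (XFun \<theta> b) = comp_func (XFun \<theta> a) (IRe (XDom \<theta>) u)"
    and XRho_Idn: "u \<in> hom (XBase \<theta>) a b \<Longrightarrow> x \<in> Ob (IFib (XDom \<theta>) b) \<Longrightarrow>
      XRho \<theta> u x = Idn (IFib (XCod \<theta>) a) (FOb (XFun \<theta> a) (FOb (IRe (XDom \<theta>) u) x))"

definition indexed_equivalence :: "('o, 'a, 'p, 'q, 'r, 's) ifun \<Rightarrow> bool" where
  "indexed_equivalence \<theta> \<longleftrightarrow> indexed_functor \<theta> \<and>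
    (\<forall>a \<in> Ob (XBase \<theta>). equivalence_functor (XFun \<theta> a))"

text \<open>Indexed natural transformations are modifications.\<close>

definition indexed_nat :: "('o, 'a, 'p, 'q, 'r, 's) ifun \<Rightarrow> ('o, 'a, 'p, 'q, 'r, 's) ifun \<Rightarrow>
    ('o \<Rightarrow> 'p \<Rightarrow> 's) \<Rightarrow> bool" where
  "indexed_nat \<theta> \<chi> m \<longleftrightarrow> indexed_functor \<theta> \<and> indexed_functor \<chi> \<and>
    XDom \<theta> = XDom \<chi> \<and> XCod \<theta> = XCod \<chi> \<and> m \<in> extensional (Ob (XBase \<theta>)) \<and>
    (\<forall>a \<in> Ob (XBase \<theta>). nat_trans (XFun \<theta> a) (XFun \<chi> a) (m a)) \<and>
    (\<forall>u a b x. u \<in> hom (XBase \<theta>) a b \<and> x \<in> Ob (IFib (XDom \<theta>) b) \<longrightarrow>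
      Cmp (IFib (XCod \<theta>) a) (m a (FOb (IRe (XDom \<theta>) u) x)) (XRho \<theta> u x) =
        Cmp (IFib (XCod \<theta>) a) (XRho \<chi> u x) (FAr (IRe (XCod \<theta>) u) (m b x)))"

definition indexed_nat_iso :: "('o, 'a, 'p, 'q, 'r, 's) ifun \<Rightarrow> ('o, 'a, 'p, 'q, 'r, 's) ifun \<Rightarrow>
    ('o \<Rightarrow> 'p \<Rightarrow> 's) \<Rightarrow> bool" where
  "indexed_nat_iso \<theta> \<chi> m \<longleftrightarrow> indexed_nat \<theta> \<chi> m \<and>
    (\<forall>a \<in> Ob (XBase \<theta>). nat_iso (XFun \<theta> a) (XFun \<chi> a) (m a))"

definition id_ifun :: "('o, 'a, 'p, 'q) icat \<Rightarrow> ('o, 'a, 'p, 'q, 'p, 'q) ifun" where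
  "id_ifun P = \<lparr>XDom = P, XCod = P, XFun = (\<lambda>a\<in>Ob (IBase P). id_func (IFib P a)),
    XRho = (\<lambda>u\<in>Ar (IBase P). \<lambda>x\<in>Ob (IFib P (Cod (IBase P) u)).
      Idn (IFib P (Dom (IBase P) u)) (FOb (IRe P u) x))\<rparr>"

definition comp_ifun :: "('o, 'a, 'r, 's, 'm, 'n) ifun \<Rightarrow> ('o, 'a, 'p, 'q, 'r, 's) ifun \<Rightarrow>
    ('o, 'a, 'p, 'q, 'm, 'n) ifun" where
  "comp_ifun \<chi> \<theta> =
    (let B = XBase \<theta> in
      \<lparr>XDom = XDom \<theta>, XCod = XCod \<chi>,
       XFun = (\<lambda>a\<in>Ob B. comp_func (XFun \<chi> a) (XFun \<theta> a)),
       XRho = (\<lambda>u\<in>Ar B. \<lambda>x\<in>Ob (IFib (XDom \<theta>) (Cod B u)).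
         Cmp (IFib (XCod \<chi>) (Dom B u)) (FAr (XFun \<chi> (Dom B u)) (XRho \<theta> u x))
           (XRho \<chi> u (FOb (XFun \<theta> (Cod B u)) x)))\<rparr>)"

text \<open>Base change of indexed categories and indexed functors along a functor \<open>F\<close>.\<close>

definition pull_icat :: "('o, 'a, 'i, 'j) func \<Rightarrow> ('i, 'j, 'p, 'q) icat \<Rightarrow> ('o, 'a, 'p, 'q) icat"
  where
  "pull_icat F Q = \<lparr>IBase = FDom F,
    IFib = compose (Ob (FDom F)) (IFib Q) (FOb F),
    IRe = compose (Ar (FDom F)) (IRe Q) (FAr F),
    IUnit = compose (Ob (FDom F)) (IUnit Q) (FOb F),
    IMult = (\<lambda>u v. if composable (FDom F) u v then IMult Q (FAr F u) (FAr F v) else undefined)\<rparr>"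

definition pull_ifun :: "('o, 'a, 'i, 'j) func \<Rightarrow> ('i, 'j, 'p, 'q, 'r, 's) ifun \<Rightarrow>
    ('o, 'a, 'p, 'q, 'r, 's) ifun" where
  "pull_ifun F \<theta> = \<lparr>XDom = pull_icat F (XDom \<theta>), XCod = pull_icat F (XCod \<theta>),
    XFun = compose (Ob (FDom F)) (XFun \<theta>) (FOb F),
    XRho = compose (Ar (FDom F)) (XRho \<theta>) (FAr F)\<rparr>"

text \<open>
  For \<open>\<alpha> : F \<Rightarrow> G\<close>, the indexed functor from \<open>G* Q\<close> to \<open>F* Q\<close> whose component at \<open>a\<close> is reindexing
  along \<open>\<alpha>\<^sub>a\<close>. For \<open>u : a \<rightarrow> b\<close> its structural isomorphism is the composite of
  \<open>(F u)* (\<alpha>\<^sub>b)* \<cong> (\<alpha>\<^sub>b \<circ> F u)* = (G u \<circ> \<alpha>\<^sub>a)* \<cong> (\<alpha>\<^sub>a)* (G u)*\<close>.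
\<close>

definition re_ntrans :: "('o, 'a, 'i, 'j) ntrans \<Rightarrow> ('i, 'j, 'p, 'q) icat \<Rightarrow>
    ('o, 'a, 'p, 'q, 'p, 'q) ifun" where
  "re_ntrans \<alpha> Q =
    (let F = NDom \<alpha>; G = NCod \<alpha>; t = NMap \<alpha>; B = FDom F in
      \<lparr>XDom = pull_icat G Q, XCod = pull_icat F Q,
       XFun = (\<lambda>a\<in>Ob B. IRe Q (t a)),
       XRho = (\<lambda>u\<in>Ar B. \<lambda>x\<in>Ob (IFib Q (FOb G (Cod B u))).
         (let S = IFib Q (FOb F (Dom B u)) in
           Cmp S (inv_arrow S (IMult Q (FAr G u) (t (Dom B u)) x))
             (IMult Q (t (Cod B u)) (FAr F u) x)))\<rparr>)"


section \<open>Display categories\<close>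

definition is_pullback :: "('o, 'a) cat \<Rightarrow> 'a \<Rightarrow> 'a \<Rightarrow> 'a \<Rightarrow> 'a \<Rightarrow> bool" where
  "is_pullback C f p p' f' \<longleftrightarrow>
    composable C f p' \<and> composable C p f' \<and> Cmp C f p' = Cmp C p f' \<and>
    (\<forall>x y. composable C f x \<and> composable C p y \<and> Cmp C f x = Cmp C p y \<longrightarrow>
      (\<exists>!h. h \<in> hom C (Dom C x) (Dom C p') \<and> Cmp C p' h = x \<and> Cmp C f' h = y))"

text \<open>
  \<open>Pb1 f p\<close> is the chosen pullback \<open>f* p\<close> of the display \<open>p\<close> along \<open>f\<close>, and \<open>Pb2 f p\<close> the other
  projection.
\<close>

record ('o, 'a) dcat =
  DCat :: "('o, 'a) cat"
  Disp :: "'a set"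
  Pb1 :: "'a \<Rightarrow> 'a \<Rightarrow> 'a"
  Pb2 :: "'a \<Rightarrow> 'a \<Rightarrow> 'a"

definition disp_cospan :: "('o, 'a) dcat \<Rightarrow> 'a \<Rightarrow> 'a \<Rightarrow> bool" where
  "disp_cospan D f p \<longleftrightarrow> f \<in> Ar (DCat D) \<and> p \<in> Disp D \<and> Cod (DCat D) f = Cod (DCat D) p"

locale display_category =
  fixes D :: "('o, 'a) dcat"
  assumes DCat_category: "category (DCat D)"
    and Disp_subset: "Disp D \<subseteq> Ar (DCat D)"
    and Pb1_Disp: "disp_cospan D f p \<Longrightarrow> Pb1 D f p \<in> Disp D"
    and Pb_pullback: "disp_cospan D f p \<Longrightarrow> is_pullback (DCat D) f p (Pb1 D f p) (Pb2 D f p)"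
    and Pb1_ext: "\<not> disp_cospan D f p \<Longrightarrow> Pb1 D f p = undefined"
    and Pb2_ext: "\<not> disp_cospan D f p \<Longrightarrow> Pb2 D f p = undefined"
    and Disp_iso_left: "p \<in> Disp D \<Longrightarrow> iso_arrow (DCat D) i \<Longrightarrow> composable (DCat D) i p \<Longrightarrow>
      Cmp (DCat D) i p \<in> Disp D"
    and Disp_iso_right: "p \<in> Disp D \<Longrightarrow> iso_arrow (DCat D) i \<Longrightarrow> composable (DCat D) p i \<Longrightarrow>
      Cmp (DCat D) p i \<in> Disp D"

definition gap :: "('o, 'a) dcat \<Rightarrow> 'a \<Rightarrow> 'a \<Rightarrow> 'a \<Rightarrow> 'a \<Rightarrow> 'a" where
  "gap D f p x y = (THE h. h \<in> hom (DCat D) (Dom (DCat D) x) (Dom (DCat D) (Pb1 D f p)) \<and>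
    Cmp (DCat D) (Pb1 D f p) h = x \<and> Cmp (DCat D) (Pb2 D f p) h = y)"

text \<open>The category of displays over \<open>A\<close>; \<open>(p, h, q)\<close> is the arrow from \<open>p\<close> to \<open>q\<close> given by \<open>h\<close>.\<close>

definition disp_slice :: "('o, 'a) dcat \<Rightarrow> 'o \<Rightarrow> ('a, 'a \<times> 'a \<times> 'a) cat" where
  "disp_slice D A =
    (let C = DCat D; obj = {p \<in> Disp D. Cod C p = A};
         arr = {(p, h, q). p \<in> obj \<and> q \<in> obj \<and> h \<in> hom C (Dom C p) (Dom C q) \<and> Cmp C q h = p}
     in \<lparr>Ob = obj, Ar = arr,
       Dom = (\<lambda>(p, h, q)\<in>arr. p), Cod = (\<lambda>(p, h, q)\<in>arr. q),
       Idn = (\<lambda>p\<in>obj. (p, Idn C (Dom C p), p)),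
       Cmp = (\<lambda>(p', k, r) (p, h, q). if (p', k, r) \<in> arr \<and> (p, h, q) \<in> arr \<and> p' = q
         then (p, Cmp C k h, r) else undefined)\<rparr>)"

definition disp_icat :: "('o, 'a) dcat \<Rightarrow> ('o, 'a, 'a, 'a \<times> 'a \<times> 'a) icat" where
  "disp_icat D =
    (let C = DCat D in
      \<lparr>IBase = C, IFib = restrict (disp_slice D) (Ob C),
       IRe = (\<lambda>u\<in>Ar C. \<lparr>FDom = disp_slice D (Cod C u), FCod = disp_slice D (Dom C u),
         FOb = (\<lambda>p\<in>Ob (disp_slice D (Cod C u)). Pb1 D u p),
         FAr = (\<lambda>(p, h, q)\<in>Ar (disp_slice D (Cod C u)).
           (Pb1 D u p, gap D u q (Pb1 D u p) (Cmp C h (Pb2 D u p)), Pb1 D u q))\<rparr>),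
       IUnit = (\<lambda>A\<in>Ob C. \<lambda>p\<in>Ob (disp_slice D A).
         (p, gap D (Idn C A) p p (Idn C (Dom C p)), Pb1 D (Idn C A) p)),
       IMult = (\<lambda>u v. if composable C u v
         then (\<lambda>p\<in>Ob (disp_slice D (Cod C u)).
           (Pb1 D v (Pb1 D u p),
            gap D (Cmp C u v) p (Pb1 D v (Pb1 D u p)) (Cmp C (Pb2 D u p) (Pb2 D v (Pb1 D u p))),
            Pb1 D (Cmp C u v) p))
         else undefined)\<rparr>)"

locale display_functor =
  fixes C :: "('o, 'a) dcat" and D :: "('p, 'b) dcat" and F :: "('o, 'a, 'p, 'b) func"
  assumes display_source: "display_category C" and display_target: "display_category D"
    and F_functor: "F \<in> functors (DCat C) (DCat D)"
    and F_Disp: "p \<in> Disp C \<Longrightarrow> FAr F p \<in> Disp D"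
    and F_pullback: "p \<in> Disp C \<Longrightarrow> is_pullback (DCat C) f p p' f' \<Longrightarrow>
      is_pullback (DCat D) (FAr F f) (FAr F p) (FAr F p') (FAr F f')"

text \<open>
  The indexed functor on displays induced by a display functor \<open>F\<close>. Its structural isomorphism
  from \<open>(F u)* (F p)\<close> to \<open>F (u* p)\<close> is the comparison map of pullbacks.
\<close>

definition disp_ifun :: "('o, 'a) dcat \<Rightarrow> ('p, 'b) dcat \<Rightarrow> ('o, 'a, 'p, 'b) func \<Rightarrow>
    ('o, 'a, 'a, 'a \<times> 'a \<times> 'a, 'b, 'b \<times> 'b \<times> 'b) ifun" where
  "disp_ifun C D F =
    \<lparr>XDom = disp_icat C, XCod = pull_icat F (disp_icat D),
     XFun = (\<lambda>A\<in>Ob (DCat C). \<lparr>FDom = disp_slice C A, FCod = disp_slice D (FOb F A),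
       FOb = (\<lambda>p\<in>Ob (disp_slice C A). FAr F p),
       FAr = (\<lambda>(p, h, q)\<in>Ar (disp_slice C A). (FAr F p, FAr F h, FAr F q))\<rparr>),
     XRho = (\<lambda>u\<in>Ar (DCat C). \<lambda>p\<in>Ob (disp_slice C (Cod (DCat C) u)).
       (let p' = Pb1 D (FAr F u) (FAr F p); f' = Pb2 D (FAr F u) (FAr F p) in
         (p',
          (THE h. h \<in> hom (DCat D) (Dom (DCat D) p') (FOb F (Dom (DCat C) (Pb1 C u p))) \<and>
            Cmp (DCat D) (FAr F (Pb1 C u p)) h = p' \<and> Cmp (DCat D) (FAr F (Pb2 C u p)) h = f'),
          FAr F (Pb1 C u p))))\<rparr>"

text \<open>
  The component at a display \<open>p : E \<rightarrow> B\<close> of the transformation on displays induced by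
  \<open>\<alpha> : F \<Rightarrow> G\<close>: the map \<open>F p \<rightarrow> (\<alpha>\<^sub>B)* (G p)\<close> over \<open>F B\<close> induced by \<open>\<alpha>\<^sub>E\<close> and \<open>F p\<close>.
\<close>

definition disp_nat :: "('o, 'a) dcat \<Rightarrow> ('p, 'b) dcat \<Rightarrow> ('o, 'a, 'p, 'b) ntrans \<Rightarrow> 'a \<Rightarrow>
    'b \<times> 'b \<times> 'b" where
  "disp_nat C D \<alpha> p =
    (let E = Dom (DCat C) p; B = Cod (DCat C) p; Fp = FAr (NDom \<alpha>) p; Gp = FAr (NCod \<alpha>) p in
      (Fp, gap D (NMap \<alpha> B) Gp Fp (NMap \<alpha> E), Pb1 D (NMap \<alpha> B) Gp))"


section \<open>The 2-category of small categories with attributes\<close>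

record 'u cwa =
  WDisp :: "('u, 'u) dcat"
  WTp :: "('u, 'u, 'u, 'u) icat"
  WComp :: "('u, 'u, 'u, 'u, 'u, 'u \<times> 'u \<times> 'u) ifun"

abbreviation WCat :: "'u cwa \<Rightarrow> ('u, 'u) cat" where
  "WCat C \<equiv> DCat (WDisp C)"

definition cwa :: "('u set \<Rightarrow> bool) \<Rightarrow> 'u cwa \<Rightarrow> bool" where
  "cwa small C \<longleftrightarrow> display_category (WDisp C) \<and> small_category small (WCat C) \<and>
    strict_indexed_category (WTp C) \<and> IBase (WTp C) = WCat C \<and>
    (\<forall>\<Gamma> \<in> Ob (WCat C). small_category small (IFib (WTp C) \<Gamma>)) \<and>
    indexed_equivalence (WComp C) \<and> XDom (WComp C) = WTp C \<and> XCod (WComp C) = disp_icat (WDisp C)"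

text \<open>
  \<open>HTau \<Gamma> A\<close> is the component at \<open>A \<in> Tp(\<Gamma>)\<close> of the indexed natural isomorphism from \<open>F (comp A)\<close>
  to \<open>comp (F A)\<close>.
\<close>

record 'u cwa_mor =
  HSrc :: "'u cwa"
  HTrg :: "'u cwa"
  HFun :: "('u, 'u, 'u, 'u) func"
  HTp :: "('u, 'u, 'u, 'u, 'u, 'u) ifun"
  HTau :: "'u \<Rightarrow> 'u \<Rightarrow> 'u \<times> 'u \<times> 'u"

definition cwa_mor :: "('u set \<Rightarrow> bool) \<Rightarrow> 'u cwa_mor \<Rightarrow> bool" where
  "cwa_mor small H \<longleftrightarrow>
    (let C = HSrc H; D = HTrg H; F = HFun H in
      cwa small C \<and> cwa small D \<and> display_functor (WDisp C) (WDisp D) F \<and>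
      strict_indexed_functor (HTp H) \<and> XDom (HTp H) = WTp C \<and>
      XCod (HTp H) = pull_icat F (WTp D) \<and>
      indexed_nat_iso (comp_ifun (disp_ifun (WDisp C) (WDisp D) F) (WComp C))
        (comp_ifun (pull_ifun F (WComp D)) (HTp H)) (HTau H))"

definition id_cwa :: "'u cwa \<Rightarrow> 'u cwa_mor" where
  "id_cwa C = \<lparr>HSrc = C, HTrg = C, HFun = id_func (WCat C), HTp = id_ifun (WTp C),
    HTau = (\<lambda>\<Gamma>\<in>Ob (WCat C). \<lambda>A\<in>Ob (IFib (WTp C) \<Gamma>).
      Idn (disp_slice (WDisp C) \<Gamma>) (FOb (XFun (WComp C) \<Gamma>) A))\<rparr>"

text \<open>The isomorphism of a composite is \<open>G (F (comp A)) \<rightarrow> G (comp (F A)) \<rightarrow> comp (G (F A))\<close>.\<close>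

definition comp_cwa :: "'u cwa_mor \<Rightarrow> 'u cwa_mor \<Rightarrow> 'u cwa_mor" where
  "comp_cwa G F = \<lparr>HSrc = HSrc F, HTrg = HTrg G, HFun = comp_func (HFun G) (HFun F),
    HTp = comp_ifun (pull_ifun (HFun F) (HTp G)) (HTp F),
    HTau = (\<lambda>\<Gamma>\<in>Ob (WCat (HSrc F)). \<lambda>A\<in>Ob (IFib (WTp (HSrc F)) \<Gamma>).
      (let \<Delta> = FOb (HFun F) \<Gamma> in
        Cmp (disp_slice (WDisp (HTrg G)) (FOb (HFun G) \<Delta>))
          (HTau G \<Delta> (FOb (XFun (HTp F) \<Gamma>) A))
          (FAr (XFun (disp_ifun (WDisp (HSrc G)) (WDisp (HTrg G)) (HFun G)) \<Delta>) (HTau F \<Gamma> A))))\<rparr>"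

record 'u cwa_cell =
  LSrc :: "'u cwa_mor"
  LTrg :: "'u cwa_mor"
  LNat :: "('u, 'u, 'u, 'u) ntrans"
  LTp :: "'u \<Rightarrow> 'u \<Rightarrow> 'u"

definition cwa_cell :: "('u set \<Rightarrow> bool) \<Rightarrow> 'u cwa_cell \<Rightarrow> bool" where
  "cwa_cell small L \<longleftrightarrow>
    (let F = LSrc L; G = LTrg L; C = HSrc F; D = HTrg F; \<alpha> = LNat L in
      cwa_mor small F \<and> cwa_mor small G \<and> HSrc G = C \<and> HTrg G = D \<and>
      ntrans \<alpha> \<and> NDom \<alpha> = HFun F \<and> NCod \<alpha> = HFun G \<and>
      indexed_nat (HTp F) (comp_ifun (re_ntrans \<alpha> (WTp D)) (HTp G)) (LTp L) \<and>
      (\<forall>\<Gamma> \<in> Ob (WCat C). \<forall>A \<in> Ob (IFib (WTp C) \<Gamma>).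
        (let S = disp_slice (WDisp D) (FOb (HFun F) \<Gamma>); u = NMap \<alpha> \<Gamma> in
          Cmp S (FAr (XFun (WComp D) (FOb (HFun F) \<Gamma>)) (LTp L \<Gamma> A)) (HTau F \<Gamma> A) =
          Cmp S (XRho (WComp D) u (FOb (XFun (HTp G) \<Gamma>) A))
            (Cmp S (FAr (IRe (disp_icat (WDisp D)) u) (HTau G \<Gamma> A))
              (disp_nat (WDisp C) (WDisp D) \<alpha> (FOb (XFun (WComp C) \<Gamma>) A))))))"

definition id_cwa_cell :: "'u cwa_mor \<Rightarrow> 'u cwa_cell" where
  "id_cwa_cell F = \<lparr>LSrc = F, LTrg = F, LNat = id_ntrans (HFun F),
    LTp = (\<lambda>\<Gamma>\<in>Ob (WCat (HSrc F)). \<lambda>A\<in>Ob (IFib (WTp (HSrc F)) \<Gamma>).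
      Idn (IFib (WTp (HTrg F)) (FOb (HFun F) \<Gamma>)) (FOb (XFun (HTp F) \<Gamma>) A))\<rparr>"

text \<open>Vertical composition on types is \<open>F A \<rightarrow> (G A)[\<alpha>] \<rightarrow> (H A)[\<beta>][\<alpha>] = (H A)[\<beta> \<alpha>]\<close>.\<close>

definition vcomp_cwa :: "'u cwa_cell \<Rightarrow> 'u cwa_cell \<Rightarrow> 'u cwa_cell" where
  "vcomp_cwa M L =
    (let F = LSrc L; Tp = WTp (HTrg F) in
      \<lparr>LSrc = F, LTrg = LTrg M, LNat = vcomp_ntrans (LNat M) (LNat L),
       LTp = (\<lambda>\<Gamma>\<in>Ob (WCat (HSrc F)). \<lambda>A\<in>Ob (IFib (WTp (HSrc F)) \<Gamma>).
         Cmp (IFib Tp (FOb (HFun F) \<Gamma>))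
           (FAr (IRe Tp (NMap (LNat L) \<Gamma>)) (LTp M \<Gamma> A)) (LTp L \<Gamma> A))\<rparr>)"

text \<open>
  For \<open>\<alpha> : F \<Rightarrow> G\<close> and \<open>\<beta> : H \<Rightarrow> K\<close>, horizontal composition on types is
  \<open>H (F A) \<rightarrow> (K (F A))[\<beta>] \<rightarrow> (K ((G A)[\<alpha>]))[\<beta>] = (K (G A))[K \<alpha> \<circ> \<beta>]\<close>.
\<close>

definition hcomp_cwa :: "'u cwa_cell \<Rightarrow> 'u cwa_cell \<Rightarrow> 'u cwa_cell" where
  "hcomp_cwa M L =
    (let F = LSrc L; H = LSrc M; K = LTrg M; Tp = WTp (HTrg H) in
      \<lparr>LSrc = comp_cwa H F, LTrg = comp_cwa K (LTrg L), LNat = hcomp_ntrans (LNat M) (LNat L),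
       LTp = (\<lambda>\<Gamma>\<in>Ob (WCat (HSrc F)). \<lambda>A\<in>Ob (IFib (WTp (HSrc F)) \<Gamma>).
         (let \<Delta> = FOb (HFun F) \<Gamma> in
           Cmp (IFib Tp (FOb (HFun H) \<Delta>))
             (FAr (IRe Tp (NMap (LNat M) \<Delta>)) (FAr (XFun (HTp K) \<Delta>) (LTp L \<Gamma> A)))
             (LTp M \<Delta> (FOb (XFun (HTp F) \<Gamma>) A))))\<rparr>)"

definition CwA :: "('u set \<Rightarrow> bool) \<Rightarrow> ('u cwa, 'u cwa_mor, 'u cwa_cell) two_cat" where
  "CwA small = \<lparr>Zero = {C. cwa small C}, One = {F. cwa_mor small F}, Two = {L. cwa_cell small L},
    Src1 = HSrc, Trg1 = HTrg, Src2 = LSrc, Trg2 = LTrg, Id1 = id_cwa, Id2 = id_cwa_cell,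
    Cmp1 = comp_cwa, VCmp = vcomp_cwa, HCmp = hcomp_cwa\<rparr>"

definition CwA_forget :: "('u cwa, 'u cwa_mor, 'u cwa_cell, ('u, 'u) cat,
    ('u, 'u, 'u, 'u) func, ('u, 'u, 'u, 'u) ntrans) two_func" where
  "CwA_forget = \<lparr>P0 = WCat, P1 = HFun, P2 = LNat\<rparr>"

end

theory Submission
 imports Defs
begin

text \<open>
 Types are equivalent to displays, so the action of a 2-cell on types is determined by its underlying natural
 transformation, and any natural transformation between morphisms of CwAs extends to a 2-cell: the
 2-functor to categories is bijective on 2-cells between given 1-cells. Hence a universal coalgebra in the
 category-level sense lifts to CwAs as soon as the category of coalgebras carries a CwA structure whose
 forgetful functor \<open>U\<close> is a morphism and through which 1-cells factor uniquely.

 A display of coalgebras is a coalgebra map whose underlying arrow is a display. Since the functor of the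
 comonad preserves pullbacks of displays, \<open>U\<close> creates them. A type over a coalgebra is a type \<open>A\<close> over
 the underlying object with a coalgebra structure on its extension making the projection a coalgebra map;
 these are reindexed strictly, because the reindexing of \<open>A\<close> is strict and the coalgebra structure on
 the pullback is unique.
\<close>

section \<open>Categories and functors\<close>

text \<open>Two rigid demands shape the construction. The objects of coalgebras of
  \<open>Cat\<close> are prescribed, so the new structure has to sit on exactly
  \<open>coalg_cat\<close>, with \<open>coalg_forget\<close> itself as underlying functor; and types
  must be reindexed strictly, while displays, with their chosen pullbacks, are reindexed only up to
  isomorphism. Displays of coalgebras therefore cannot serve as types: a type keeps a strictly
  reindexed type of the base and adds structure only where it is unique. Morphisms of CwAs preserve
  pullbacks in the weak sense, so the choice of pullbacks of coalgebras is free.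

  The bookkeeping obstacle is coherence: comprehension and \<open>HTau\<close> involve structural
  isomorphisms in slices. These are traded for the upper sides of the pullback squares that they
  induce. The laws of an indexed functor into displays say exactly that these sides are natural and
  compose strictly, so each coherence condition becomes a commuting square in the base category. In
  this form a map of types over \<open>u\<close> is an arrow between extensions over
  \<open>u\<close>, and compatibility with \<open>HTau\<close> becomes conjugation.\<close>

lemma hom_iff: "f \<in> hom C a b \<longleftrightarrow> f \<in> Ar C \<and> Dom C f = a \<and> Cod C f = b"
 by (simp add: hom_def)

lemma composableI [simp]:
 "g \<in> Ar C ==> f \<in> Ar C ==> Dom C g = Cod C f ==> composable C g f"
 by (simp add: composable_def)

lemma Dom_Ob [simp]: "category C ==> f \<in> Ar C ==> Dom C f \<in> Ob C"
 using category.Dom_funcset by fastforce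

lemma Cod_Ob [simp]: "category C ==> f \<in> Ar C ==> Cod C f \<in> Ob C"
 using category.Cod_funcset by fastforce

lemma Idn_Ar [simp]: "category C ==> x \<in> Ob C ==> Idn C x \<in> Ar C"
 and Dom_Idn [simp]: "category C ==> x \<in> Ob C ==> Dom C (Idn C x) = x"
 and Cod_Idn [simp]: "category C ==> x \<in> Ob C ==> Cod C (Idn C x) = x"
 using category.Idn_hom by (fastforce simp: hom_iff)+

lemma Cmp_Ar [simp]:
 "category C ==> g \<in> Ar C ==> f \<in> Ar C ==> Dom C g = Cod C f ==> Cmp C g f \<in> Ar C"
 and Dom_Cmp [simp]:
 "category C ==> g \<in> Ar C ==> f \<in> Ar C ==> Dom C g = Cod C f ==> Dom C (Cmp C g f) = Dom C f"
 and Cod_Cmp [simp]: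
 "category C ==> g \<in> Ar C ==> f \<in> Ar C ==> Dom C g = Cod C f ==> Cod C (Cmp C g f) = Cod C g"
 using category.Cmp_hom[of C g f] by (auto simp: hom_iff)

lemma Cmp_Idn_l [simp]: "category C ==> f \<in> Ar C ==> Cod C f = x ==> Cmp C (Idn C x) f = f"
 using category.Cmp_Idn_left by fastforce

lemma Cmp_Idn_r [simp]: "category C ==> f \<in> Ar C ==> Dom C f = x ==> Cmp C f (Idn C x) = f"
 using category.Cmp_Idn_right by fastforce

lemma Cmp_assoc [simp]:
 "category C ==> h \<in> Ar C ==> g \<in> Ar C ==> f \<in> Ar C ==> Dom C h = Cod C g ==>
  Dom C g = Cod C f ==> Cmp C (Cmp C h g) f = Cmp C h (Cmp C g f)"
 by (rule category.Cmp_assoc[symmetric]) simp_all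

text \<open>Simplification nests composites to the right, which hides the pair \<open>a\<close>,
  \<open>b\<close> once it is composed with a further arrow \<open>x\<close>; this form applies an
  equation between two-fold composites inside such a longer one. \<open>Cmp_reassoc1\<close> does
  the same when one side is a single arrow.\<close>

lemma Cmp_reassoc:
 "Cmp C a b = Cmp C c d ==> category C ==> x \<in> Ar C ==> Cod C x = Dom C b ==>
  a \<in> Ar C ==> b \<in> Ar C ==> c \<in> Ar C ==> d \<in> Ar C ==> Dom C a = Cod C b ==>
  Dom C c = Cod C d ==> Cmp C a (Cmp C b x) = Cmp C c (Cmp C d x)"
 by (metis Cmp_assoc Dom_Cmp)

lemma Cmp_reassoc1:
 "Cmp C a b = e ==> category C ==> x \<in> Ar C ==> Cod C x = Dom C b ==>
  a \<in> Ar C ==> b \<in> Ar C ==> Dom C a = Cod C b ==> Cmp C a (Cmp C b x) = Cmp C e x"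
 by (metis Cmp_assoc)

lemma inverse_arrows_iff:
 "category C ==> inverse_arrows C f g \<longleftrightarrow> f \<in> Ar C \<and> g \<in> Ar C \<and> Dom C g = Cod C f \<and>
  Cod C g = Dom C f \<and> Cmp C g f = Idn C (Dom C f) \<and> Cmp C f g = Idn C (Cod C f)"
 by (auto simp: inverse_arrows_def composable_def)

lemma inverse_arrows_unique:
 assumes "category C" "inverse_arrows C f g" "inverse_arrows C f h"
 shows "g = h"
proof -
 have "g = Cmp C g (Cmp C f h)"
  using assms by (simp add: inverse_arrows_iff)
 also have "\<dots> = Cmp C (Cmp C g f) h"
  using assms by (subst Cmp_assoc) (simp_all add: inverse_arrows_iff)
 also have "\<dots> = h"
  using assms by (simp add: inverse_arrows_iff)
 finally show ?thesis .
qed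

lemma inv_arrow_eq: "category C ==> inverse_arrows C f g ==> inv_arrow C f = g"
 unfolding inv_arrow_def by (blast intro: inverse_arrows_unique the_equality)

lemma iso_arrowI:
 "category C ==> f \<in> Ar C ==> g \<in> Ar C ==> Dom C g = Cod C f ==> Cod C g = Dom C f ==>
  Cmp C g f = Idn C (Dom C f) ==> Cmp C f g = Idn C (Cod C f) ==> iso_arrow C f"
 unfolding iso_arrow_def by (auto simp: inverse_arrows_iff intro!: exI[of _ g])

lemma inv_arrow:
 assumes "category C" "iso_arrow C f"
 shows "inverse_arrows C f (inv_arrow C f)"
 using assms inv_arrow_eq by (metis iso_arrow_def)

lemma
 assumes "category C" "iso_arrow C f"
 shows iso_Ar [simp]: "f \<in> Ar C"
  and inv_Ar [simp]: "inv_arrow C f \<in> Ar C"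
  and Dom_inv [simp]: "Dom C (inv_arrow C f) = Cod C f"
  and Cod_inv [simp]: "Cod C (inv_arrow C f) = Dom C f"
  and inv_left [simp]: "Cmp C (inv_arrow C f) f = Idn C (Dom C f)"
  and inv_right [simp]: "Cmp C f (inv_arrow C f) = Idn C (Cod C f)"
 using inv_arrow[OF assms] assms by (simp_all add: inverse_arrows_iff)

lemma inv_left_assoc [simp]:
 "category C ==> iso_arrow C f ==> x \<in> Ar C ==> Cod C x = Dom C f ==>
  Cmp C (inv_arrow C f) (Cmp C f x) = x"
 by (simp add: Cmp_reassoc1[OF inv_left])

lemma inv_right_assoc [simp]:
 "category C ==> iso_arrow C f ==> x \<in> Ar C ==> Cod C x = Cod C f ==>
  Cmp C f (Cmp C (inv_arrow C f) x) = x"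
 by (simp add: Cmp_reassoc1[OF inv_right])

lemma iso_inv [simp]: "category C ==> iso_arrow C f ==> iso_arrow C (inv_arrow C f)"
 by (rule iso_arrowI[of _ _ f]) simp_all

lemma iso_Idn [simp]: "category C ==> x \<in> Ob C ==> iso_arrow C (Idn C x)"
 by (rule iso_arrowI[of _ _ "Idn C x"]) simp_all

lemma inv_Idn [simp]: "category C ==> x \<in> Ob C ==> inv_arrow C (Idn C x) = Idn C x"
 by (rule inv_arrow_eq) (simp_all add: inverse_arrows_iff)

lemma iso_Cmp [simp]:
 "category C ==> iso_arrow C g ==> iso_arrow C f ==> Dom C g = Cod C f ==> iso_arrow C (Cmp C g f)"
 by (rule iso_arrowI[of _ _ "Cmp C (inv_arrow C f) (inv_arrow C g)"]) simp_all

lemma iso_cancel_left: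
 assumes "category C" "iso_arrow C i" "f \<in> Ar C" "g \<in> Ar C" "Cod C f = Dom C i"
  "Cod C g = Dom C i" "Cmp C i f = Cmp C i g"
 shows "f = g"
 using assms inv_left_assoc by metis

lemma iso_cancel_right:
 assumes "category C" "iso_arrow C i" "f \<in> Ar C" "g \<in> Ar C" "Dom C f = Cod C i"
  "Dom C g = Cod C i" "Cmp C f i = Cmp C g i"
 shows "f = g"
proof -
 have "Cmp C (Cmp C f i) (inv_arrow C i) = f" "Cmp C (Cmp C g i) (inv_arrow C i) = g"
  using assms(1-6) by simp_all
 then show ?thesis using assms(7) by metis
qed

lemma FOb_Ob [simp]: "functor F ==> FCod F = D ==> x \<in> Ob (FDom F) ==> FOb F x \<in> Ob D"
 using functor.FOb_funcset by fastforce

lemma functor_hom: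
 assumes "functor F" "f \<in> Ar (FDom F)"
 shows "FAr F f \<in> hom (FCod F) (FOb F (Dom (FDom F) f)) (FOb F (Cod (FDom F) f))"
 using functor.FAr_hom[OF assms(1), of f] assms(2) by (simp add: hom_iff)

lemma FAr_Ar [simp]: "functor F ==> FCod F = D ==> f \<in> Ar (FDom F) ==> FAr F f \<in> Ar D"
 and Dom_FAr [simp]: "functor F ==> FCod F = D ==> f \<in> Ar (FDom F) ==>
  Dom D (FAr F f) = FOb F (Dom (FDom F) f)"
 and Cod_FAr [simp]: "functor F ==> FCod F = D ==> f \<in> Ar (FDom F) ==>
  Cod D (FAr F f) = FOb F (Cod (FDom F) f)"
 using functor_hom[of F f] unfolding hom_iff by blast+

lemma FAr_Idn' [simp]: "functor F ==> FDom F = C ==> x \<in> Ob C ==>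
  FAr F (Idn C x) = Idn (FCod F) (FOb F x)"
 by (metis functor.FAr_Idn)

lemma FAr_Cmp' [simp]: "functor F ==> FDom F = C ==> g \<in> Ar C ==> f \<in> Ar C ==>
  Dom C g = Cod C f ==> FAr F (Cmp C g f) = Cmp (FCod F) (FAr F g) (FAr F f)"
 using functor.FAr_Cmp by (metis composableI)

lemma FDom_category': "functor F ==> FDom F = C ==> category C"
 and FCod_category': "functor F ==> FCod F = C ==> category C"
 using functor.FDom_category functor.FCod_category by blast+

lemma FDom_cat [simp]: "functor F ==> category (FDom F)"
 and FCod_cat [simp]: "functor F ==> category (FCod F)"
 by (rule functor.FDom_category functor.FCod_category, assumption)+

lemma FOb_ext: "functor F ==> FOb F \<in> extensional (Ob (FDom F))"
 using functor.FOb_funcset by (auto simp: PiE_def)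

lemma functorI:
 assumes "category (FDom F)" "category (FCod F)" "FOb F \<in> extensional (Ob (FDom F))"
  "FAr F \<in> extensional (Ar (FDom F))"
  "\<And>x. x \<in> Ob (FDom F) ==> FOb F x \<in> Ob (FCod F)"
  "\<And>f. f \<in> Ar (FDom F) ==> FAr F f \<in> Ar (FCod F) \<and>
   Dom (FCod F) (FAr F f) = FOb F (Dom (FDom F) f) \<and>
   Cod (FCod F) (FAr F f) = FOb F (Cod (FDom F) f)"
  "\<And>x. x \<in> Ob (FDom F) ==> FAr F (Idn (FDom F) x) = Idn (FCod F) (FOb F x)"
  "\<And>g f. g \<in> Ar (FDom F) ==> f \<in> Ar (FDom F) ==> Dom (FDom F) g = Cod (FDom F) f ==>
   FAr F (Cmp (FDom F) g f) = Cmp (FCod F) (FAr F g) (FAr F f)"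
 shows "functor F"
proof (rule functor.intro)
 show "FOb F \<in> Ob (FDom F) \<rightarrow>\<^sub>E Ob (FCod F)"
  using assms(3,5) by (auto simp: PiE_def)
qed (use assms in \<open>auto simp: hom_iff composable_def\<close>)

lemma functor_eqI:
 assumes "functor F" "functor G" "FDom F = FDom G" "FCod F = FCod G"
  "\<And>x. x \<in> Ob (FDom G) ==> FOb F x = FOb G x" "\<And>f. f \<in> Ar (FDom G) ==> FAr F f = FAr G f"
 shows "F = G"
proof -
 have "FOb F = FOb G"
  using assms FOb_ext by (metis extensionalityI)
 moreover have "FAr F = FAr G"
  using assms functor.FAr_ext by (metis extensionalityI)
 ultimately show ?thesis using assms by simp
qed

lemma functors_iff: "F \<in> functors C D \<longleftrightarrow> functor F \<and> FDom F = C \<and> FCod F = D"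
 by (simp add: functors_def)

lemma functor_iso [simp]:
 "functor F ==> FCod F = D ==> iso_arrow (FDom F) f ==> iso_arrow D (FAr F f)"
 by (rule iso_arrowI[of _ _ "FAr F (inv_arrow (FDom F) f)"])
  (auto simp flip: FAr_Cmp'[OF _ refl])

lemma id_func_simps [simp]:
 "FDom (id_func C) = C" "FCod (id_func C) = C"
 "x \<in> Ob C ==> FOb (id_func C) x = x" "f \<in> Ar C ==> FAr (id_func C) f = f"
 by (simp_all add: id_func_def)

lemma comp_func_simps [simp]:
 "FDom (comp_func G F) = FDom F" "FCod (comp_func G F) = FCod G"
 "x \<in> Ob (FDom F) ==> FOb (comp_func G F) x = FOb G (FOb F x)"
 "f \<in> Ar (FDom F) ==> FAr (comp_func G F) f = FAr G (FAr F f)"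
 by (simp_all add: comp_func_def compose_def)

lemma functor_id [simp]: "category C ==> functor (id_func C)"
 by (rule functorI) (auto simp: id_func_def)

lemma functor_comp [simp]:
 assumes "functor F" "functor G" "FCod F = FDom G"
 shows "functor (comp_func G F)"
proof (rule functorI)
 show "FOb (comp_func G F) \<in> extensional (Ob (FDom (comp_func G F)))"
  "FAr (comp_func G F) \<in> extensional (Ar (FDom (comp_func G F)))"
  by (simp_all add: comp_func_def)
qed (use assms in simp_all)

lemma comp_id_left [simp]: "functor F ==> FCod F = C ==> comp_func (id_func C) F = F"
 by (rule functor_eqI) auto

lemma comp_id_right [simp]: "functor F ==> FDom F = C ==> comp_func F (id_func C) = F"
 by (rule functor_eqI) auto

lemma comp_func_assoc: "functor F ==> functor G ==> functor H ==> FCod F = FDom G ==>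
  FCod G = FDom H ==> comp_func H (comp_func G F) = comp_func (comp_func H G) F"
 by (rule functor_eqI) simp_all

lemma nat_transI:
 assumes "functor F" "functor G" "FDom F = FDom G" "FCod F = FCod G"
  "t \<in> extensional (Ob (FDom F))"
  "\<And>x. x \<in> Ob (FDom F) ==> t x \<in> Ar (FCod F) \<and> Dom (FCod F) (t x) = FOb F x \<and>
   Cod (FCod F) (t x) = FOb G x"
  "\<And>f. f \<in> Ar (FDom F) ==>
   Cmp (FCod F) (t (Cod (FDom F) f)) (FAr F f) = Cmp (FCod F) (FAr G f) (t (Dom (FDom F) f))"
 shows "nat_trans F G t"
 using assms by (auto simp: nat_trans_def hom_iff)

lemma
 assumes "nat_trans F G t"
 shows nat_trans_dom: "functor F" and nat_trans_cod: "functor G"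
  and nat_trans_FDom: "FDom G = FDom F" and nat_trans_FCod: "FCod G = FCod F"
  and nat_trans_ext: "t \<in> extensional (Ob (FDom F))"
  and nat_trans_Ar: "x \<in> Ob (FDom F) ==> t x \<in> Ar (FCod F)"
  and nat_trans_Dom: "x \<in> Ob (FDom F) ==> Dom (FCod F) (t x) = FOb F x"
  and nat_trans_Cod: "x \<in> Ob (FDom F) ==> Cod (FCod F) (t x) = FOb G x"
  and nat_trans_nat: "f \<in> Ar (FDom F) ==> 
   Cmp (FCod F) (t (Cod (FDom F) f)) (FAr F f) = Cmp (FCod F) (FAr G f) (t (Dom (FDom F) f))"
 using assms by (auto simp: nat_trans_def hom_iff)

lemma
 assumes "ntrans t"
 shows ntrans_dom [simp]: "functor (NDom t)" and ntrans_cod [simp]: "functor (NCod t)"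
  and ntrans_FDom [simp]: "FDom (NCod t) = FDom (NDom t)"
  and ntrans_FCod [simp]: "FCod (NCod t) = FCod (NDom t)"
  and ntrans_ext: "NMap t \<in> extensional (Ob (FDom (NDom t)))"
  and ntrans_Ar [simp]: "FCod (NDom t) = D ==> x \<in> Ob (FDom (NDom t)) ==> NMap t x \<in> Ar D"
  and ntrans_Dom [simp]:
   "FCod (NDom t) = D ==> x \<in> Ob (FDom (NDom t)) ==> Dom D (NMap t x) = FOb (NDom t) x"
  and ntrans_Cod [simp]:
   "FCod (NDom t) = D ==> x \<in> Ob (FDom (NDom t)) ==> Cod D (NMap t x) = FOb (NCod t) x"
  and ntrans_nat: "f \<in> Ar (FDom (NDom t)) ==> FDom (NDom t) = C ==> FCod (NDom t) = D ==>
   Cmp D (NMap t (Cod C f)) (FAr (NDom t) f) = Cmp D (FAr (NCod t) f) (NMap t (Dom C f))"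
 using assms by (auto simp: ntrans_def nat_trans_def hom_iff)

lemma ntransI:
 assumes "functor (NDom t)" "functor (NCod t)" "FDom (NDom t) = FDom (NCod t)"
  "FCod (NDom t) = FCod (NCod t)" "NMap t \<in> extensional (Ob (FDom (NDom t)))"
  "\<And>x. x \<in> Ob (FDom (NDom t)) ==> NMap t x \<in> Ar (FCod (NDom t)) \<and>
   Dom (FCod (NDom t)) (NMap t x) = FOb (NDom t) x \<and>
   Cod (FCod (NDom t)) (NMap t x) = FOb (NCod t) x"
  "\<And>f. f \<in> Ar (FDom (NDom t)) ==>
   Cmp (FCod (NDom t)) (NMap t (Cod (FDom (NDom t)) f)) (FAr (NDom t) f) =
   Cmp (FCod (NDom t)) (FAr (NCod t) f) (NMap t (Dom (FDom (NDom t)) f))"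
 shows "ntrans t"
 unfolding ntrans_def using assms by (intro nat_transI) auto

lemma ntrans_eqI:
 assumes "ntrans s" "ntrans t" "NDom s = NDom t" "NCod s = NCod t"
  "\<And>x. x \<in> Ob (FDom (NDom t)) ==> NMap s x = NMap t x"
 shows "s = t"
proof -
 have "NMap s = NMap t"
  using assms ntrans_ext by (metis extensionalityI)
 then show ?thesis using assms by simp
qed

lemma id_ntrans_simps [simp]:
 "NDom (id_ntrans F) = F" "NCod (id_ntrans F) = F"
 "x \<in> Ob (FDom F) ==> NMap (id_ntrans F) x = Idn (FCod F) (FOb F x)"
 by (simp_all add: id_ntrans_def)

lemma vcomp_ntrans_simps [simp]:
 "NDom (vcomp_ntrans t s) = NDom s" "NCod (vcomp_ntrans t s) = NCod t"
 "x \<in> Ob (FDom (NDom s)) ==>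
  NMap (vcomp_ntrans t s) x = Cmp (FCod (NDom s)) (NMap t x) (NMap s x)"
 by (simp_all add: vcomp_ntrans_def)

lemma hcomp_ntrans_simps [simp]:
 "NDom (hcomp_ntrans t s) = comp_func (NDom t) (NDom s)"
 "NCod (hcomp_ntrans t s) = comp_func (NCod t) (NCod s)"
 "x \<in> Ob (FDom (NDom s)) ==> NMap (hcomp_ntrans t s) x =
  Cmp (FCod (NDom t)) (FAr (NCod t) (NMap s x)) (NMap t (FOb (NDom s) x))"
 by (simp_all add: hcomp_ntrans_def)

lemma ntrans_id [simp]: "functor F ==> ntrans (id_ntrans F)"
 by (rule ntransI) (simp_all add: id_ntrans_def)

lemma ntrans_vcomp [simp]:
 assumes "ntrans s" "ntrans t" "NCod s = NDom t"
 shows "ntrans (vcomp_ntrans t s)"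
proof (rule ntransI)
 fix f assume "f \<in> Ar (FDom (NDom (vcomp_ntrans t s)))"
 moreover have "FDom (NDom t) = FDom (NDom s)" "FCod (NDom t) = FCod (NDom s)"
  using assms ntrans_FDom ntrans_FCod by metis+
 ultimately show "Cmp (FCod (NDom (vcomp_ntrans t s)))
   (NMap (vcomp_ntrans t s) (Cod (FDom (NDom (vcomp_ntrans t s))) f))
   (FAr (NDom (vcomp_ntrans t s)) f) =
  Cmp (FCod (NDom (vcomp_ntrans t s))) (FAr (NCod (vcomp_ntrans t s)) f)
   (NMap (vcomp_ntrans t s) (Dom (FDom (NDom (vcomp_ntrans t s))) f))"
  using assms ntrans_nat[OF assms(1), of f]
   Cmp_reassoc[OF ntrans_nat[OF assms(2), of f "FDom (NDom s)" "FCod (NDom s)"],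
    where x = "NMap s (Dom (FDom (NDom s)) f)"]
  by simp
next
 fix x assume x: "x \<in> Ob (FDom (NDom (vcomp_ntrans t s)))"
 have "FDom (NDom t) = FDom (NDom s)" "FCod (NDom t) = FCod (NDom s)"
  using assms ntrans_FDom ntrans_FCod by metis+
 then show "NMap (vcomp_ntrans t s) x \<in> Ar (FCod (NDom (vcomp_ntrans t s))) \<and>
   Dom (FCod (NDom (vcomp_ntrans t s))) (NMap (vcomp_ntrans t s) x) = FOb (NDom (vcomp_ntrans t s)) x \<and>
   Cod (FCod (NDom (vcomp_ntrans t s))) (NMap (vcomp_ntrans t s) x) = FOb (NCod (vcomp_ntrans t s)) x"
  using x assms by simp
next
 show "FDom (NDom (vcomp_ntrans t s)) = FDom (NCod (vcomp_ntrans t s))"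
  "FCod (NDom (vcomp_ntrans t s)) = FCod (NCod (vcomp_ntrans t s))"
  using assms ntrans_FDom[OF assms(1)] ntrans_FCod[OF assms(1)] by simp_all
qed (use assms in \<open>auto simp: vcomp_ntrans_def\<close>)

lemma ntrans_hcomp [simp]:
 assumes "ntrans s" "ntrans t" "FCod (NDom s) = FDom (NDom t)"
 shows "ntrans (hcomp_ntrans t s)"
proof (rule ntransI)
 fix f assume f: "f \<in> Ar (FDom (NDom (hcomp_ntrans t s)))"
 let ?D = "FDom (NDom t)" and ?E = "FCod (NDom t)" and ?C = "FDom (NDom s)"
 have f: "f \<in> Ar ?C" using f by simp
 define x y where xy: "x = Dom ?C f" "y = Cod ?C f"
 have c: "category ?C" "category ?D" "category ?E" using assms by simp_all
 have "Cmp ?E (Cmp ?E (FAr (NCod t) (NMap s y)) (NMap t (FOb (NDom s) y))) (FAr (NDom t) (FAr (NDom s) f))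
  = Cmp ?E (FAr (NCod t) (NMap s y)) (Cmp ?E (FAr (NCod t) (FAr (NDom s) f)) (NMap t (FOb (NDom s) x)))"
  using assms f ntrans_nat[OF assms(2), of "FAr (NDom s) f"] c by (simp add: xy)
 also have "\<dots> = Cmp ?E (FAr (NCod t) (Cmp ?D (NMap s y) (FAr (NDom s) f))) (NMap t (FOb (NDom s) x))"
  using assms f c by (simp add: xy)
 also have "\<dots> = Cmp ?E (FAr (NCod t) (Cmp ?D (FAr (NCod s) f) (NMap s x))) (NMap t (FOb (NDom s) x))"
  using ntrans_nat[OF assms(1), of f] f assms by (simp add: xy)
 also have "\<dots> = Cmp ?E (FAr (NCod t) (FAr (NCod s) f)) (Cmp ?E (FAr (NCod t) (NMap s x)) (NMap t (FOb (NDom s) x)))"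
  using assms f c by (simp add: xy)
 finally show "Cmp (FCod (NDom (hcomp_ntrans t s)))
   (NMap (hcomp_ntrans t s) (Cod (FDom (NDom (hcomp_ntrans t s))) f))
   (FAr (NDom (hcomp_ntrans t s)) f) =
  Cmp (FCod (NDom (hcomp_ntrans t s))) (FAr (NCod (hcomp_ntrans t s)) f)
   (NMap (hcomp_ntrans t s) (Dom (FDom (NDom (hcomp_ntrans t s))) f))"
  using f c by (simp add: xy assms)
qed (use assms in \<open>auto simp: hcomp_ntrans_def\<close>)

section \<open>Strict 2-categories\<close>

lemma Hom_simps:
 "Ob (Hom K A B) = cells1 K A B"
 "Ar (Hom K A B) = {a \<in> Two K. Src2 K a \<in> cells1 K A B \<and> Trg2 K a \<in> cells1 K A B}"
 "a \<in> Ar (Hom K A B) ==> Dom (Hom K A B) a = Src2 K a"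
 "a \<in> Ar (Hom K A B) ==> Cod (Hom K A B) a = Trg2 K a"
 "f \<in> cells1 K A B ==> Idn (Hom K A B) f = Id2 K f"
 "b \<in> Ar (Hom K A B) ==> a \<in> Ar (Hom K A B) ==> Src2 K b = Trg2 K a ==>
  Cmp (Hom K A B) b a = VCmp K b a"
 by (auto simp: Hom_def Let_def)

lemma Hom_composableD: "composable (Hom K A B) b a ==>
  a \<in> Ar (Hom K A B) \<and> b \<in> Ar (Hom K A B) \<and> Src2 K b = Trg2 K a"
 by (auto simp: composable_def Hom_simps(3,4))

lemma cells1_iff: "f \<in> cells1 K A B \<longleftrightarrow> f \<in> One K \<and> Src1 K f = A \<and> Trg1 K f = B"
 by (simp add: cells1_def)

lemma cells2_iff: "a \<in> cells2 K f g \<longleftrightarrow> a \<in> Two K \<and> Src2 K a = f \<and> Trg2 K a = g"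
 by (simp add: cells2_def)

text \<open>\<open>Hom\<close> restricts the operations of \<open>K\<close> to parallel cells; here
  its category axioms are reduced to equations about the unrestricted operations. Serves
  \<open>Cat\<close>, \<open>Comon\<close> and \<open>CwA\<close> alike.\<close>

lemma Hom_categoryI:
 assumes id: "\<And>f. f \<in> cells1 K A B ==> Id2 K f \<in> cells2 K f f"
  and v: "\<And>a b f g h. f \<in> cells1 K A B ==> g \<in> cells1 K A B ==> h \<in> cells1 K A B ==>
   a \<in> cells2 K f g ==> b \<in> cells2 K g h ==> VCmp K b a \<in> cells2 K f h"
  and l: "\<And>a f g. f \<in> cells1 K A B ==> g \<in> cells1 K A B ==> a \<in> cells2 K f g ==> VCmp K (Id2 K g) a = a"
  and r: "\<And>a f g. f \<in> cells1 K A B ==> g \<in> cells1 K A B ==> a \<in> cells2 K f g ==> VCmp K a (Id2 K f) = a"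
  and assoc: "\<And>a b c f g h k. f \<in> cells1 K A B ==> g \<in> cells1 K A B ==> h \<in> cells1 K A B ==>
   k \<in> cells1 K A B ==> a \<in> cells2 K f g ==> b \<in> cells2 K g h ==> c \<in> cells2 K h k ==>
   VCmp K c (VCmp K b a) = VCmp K (VCmp K c b) a"
 shows "category (Hom K A B)"
proof
 note [simp] = cells2_iff
 note d = Hom_def Let_def
 show "Dom (Hom K A B) \<in> Ar (Hom K A B) \<rightarrow>\<^sub>E Ob (Hom K A B)"
  "Cod (Hom K A B) \<in> Ar (Hom K A B) \<rightarrow>\<^sub>E Ob (Hom K A B)"
  "Idn (Hom K A B) \<in> extensional (Ob (Hom K A B))"
  by (auto simp: d)
 show "Idn (Hom K A B) x \<in> hom (Hom K A B) x x" if "x \<in> Ob (Hom K A B)" for x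
  using id[of x] that by (auto simp: d hom_iff)
 show "Cmp (Hom K A B) g f = undefined" if "\<not> composable (Hom K A B) g f" for g f
  using that by (auto simp: d composable_def)
 show "Cmp (Hom K A B) g f \<in> hom (Hom K A B) (Dom (Hom K A B) f) (Cod (Hom K A B) g)"
  if "composable (Hom K A B) g f" for g f
  using that v[of "Src2 K f" "Trg2 K f" "Trg2 K g" f g]
  by (auto simp: d composable_def hom_iff)
 show "Cmp (Hom K A B) (Idn (Hom K A B) (Cod (Hom K A B) f)) f = f" if "f \<in> Ar (Hom K A B)" for f
  using that l[of "Src2 K f" "Trg2 K f" f] id[of "Trg2 K f"] by (auto simp: d)
 show "Cmp (Hom K A B) f (Idn (Hom K A B) (Dom (Hom K A B) f)) = f" if "f \<in> Ar (Hom K A B)" for f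
  using that r[of "Src2 K f" "Trg2 K f" f] id[of "Src2 K f"] by (auto simp: d)
 show "Cmp (Hom K A B) h (Cmp (Hom K A B) g f) = Cmp (Hom K A B) (Cmp (Hom K A B) h g) f"
  if "composable (Hom K A B) h g" "composable (Hom K A B) g f" for h g f
  using that v[of "Src2 K f" "Trg2 K f" "Trg2 K g" f g] v[of "Src2 K g" "Trg2 K g" "Trg2 K h" g h]
   assoc[of "Src2 K f" "Trg2 K f" "Trg2 K g" "Trg2 K h" f g h]
  by (auto simp: d composable_def)
qed

lemma Cat_simps [simp]:
 "Zero (Cat small) = {C. small_category small C}"
 "One (Cat small) =
  {F. functor F \<and> small_category small (FDom F) \<and> small_category small (FCod F)}"
 "Two (Cat small) = {t. ntrans t \<and> small_category small (FDom (NDom t)) \<and>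
   small_category small (FCod (NDom t))}"
 "Src1 (Cat small) = FDom" "Trg1 (Cat small) = FCod" "Src2 (Cat small) = NDom"
 "Trg2 (Cat small) = NCod" "Id1 (Cat small) = id_func" "Id2 (Cat small) = id_ntrans"
 "Cmp1 (Cat small) = comp_func" "VCmp (Cat small) = vcomp_ntrans" "HCmp (Cat small) = hcomp_ntrans"
 by (simp_all add: Cat_def)

text \<open>Componentwise the two sides differ only in the order of \<open>b'\<close> and the image
  of \<open>NMap a x\<close>; naturality of \<open>b'\<close> at the arrow \<open>NMap a x\<close>
  exchanges them.\<close>

lemma interchange_ntrans:
 assumes "ntrans a" "ntrans a'" "ntrans b" "ntrans b'" "NDom a' = NCod a" "NDom b' = NCod b"
  "FCod (NDom a) = FDom (NDom b)"
 shows "hcomp_ntrans (vcomp_ntrans b' b) (vcomp_ntrans a' a) =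
  vcomp_ntrans (hcomp_ntrans b' a') (hcomp_ntrans b a)"
proof (rule ntrans_eqI)
 fix x assume "x \<in> Ob (FDom (NDom (vcomp_ntrans (hcomp_ntrans b' a') (hcomp_ntrans b a))))"
 then have x: "x \<in> Ob (FDom (NDom a))" by simp
 have e: "FCod (NCod a') = FDom (NDom b)" "FCod (NCod b') = FCod (NDom b)"
  "FDom (NCod b') = FDom (NDom b)" "FDom (NCod a') = FDom (NDom a)"
  using assms by simp_all
 have c: "category (FDom (NDom b))" "category (FCod (NDom b))" using assms by simp_all
 have "Cmp (FCod (NDom b)) (NMap b' (FOb (NCod a) x)) (FAr (NCod b) (NMap a x)) =
  Cmp (FCod (NDom b)) (FAr (NCod b') (NMap a x)) (NMap b' (FOb (NDom a) x))"
  using ntrans_nat[OF assms(4), of "NMap a x"] assms x by simp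
 note n = Cmp_reassoc[OF this, where x = "NMap b (FOb (NDom a) x)"]
 show "NMap (hcomp_ntrans (vcomp_ntrans b' b) (vcomp_ntrans a' a)) x =
  NMap (vcomp_ntrans (hcomp_ntrans b' a') (hcomp_ntrans b a)) x"
  using x assms e c n by simp
qed (use assms in simp_all)

lemma hcomp_ntrans_assoc:
 assumes "ntrans a" "ntrans b" "ntrans c" "FCod (NDom a) = FDom (NDom b)"
  "FCod (NDom b) = FDom (NDom c)"
 shows "hcomp_ntrans c (hcomp_ntrans b a) = hcomp_ntrans (hcomp_ntrans c b) a"
proof (rule ntrans_eqI)
 have c: "category (FDom (NDom c))" "category (FCod (NDom c))" using assms by simp_all
 then show "NMap (hcomp_ntrans c (hcomp_ntrans b a)) x = NMap (hcomp_ntrans (hcomp_ntrans c b) a) x"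
  if "x \<in> Ob (FDom (NDom (hcomp_ntrans (hcomp_ntrans c b) a)))" for x
  using assms that by simp
qed (use assms in \<open>simp_all add: comp_func_assoc\<close>)

lemma Cat_Hom_category: "category (Hom (Cat small) A B)"
proof (rule Hom_categoryI)
 show "VCmp (Cat small) c (VCmp (Cat small) b a) = VCmp (Cat small) (VCmp (Cat small) c b) a"
  if "a \<in> cells2 (Cat small) f g" "b \<in> cells2 (Cat small) g h" "c \<in> cells2 (Cat small) h k"
  for a b c f g h k
  using that by (auto simp: cells2_iff intro!: ntrans_eqI)
qed (auto simp: cells1_iff cells2_iff intro!: ntrans_eqI)

lemma Cat_2cat: "strict_two_category (Cat small)"
proof (rule strict_two_category.intro)
 show "HCmp (Cat small) (VCmp (Cat small) b' b) (VCmp (Cat small) a' a) =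
  VCmp (Cat small) (HCmp (Cat small) b' a') (HCmp (Cat small) b a)"
  if "composable (Hom (Cat small) A B) a' a" "composable (Hom (Cat small) B C) b' b" for A B C a a' b b'
  using that[THEN Hom_composableD] unfolding Cat_simps
  by (intro interchange_ntrans) (simp_all add: Hom_simps(2) cells1_iff)
 show "HCmp (Cat small) c (HCmp (Cat small) b a) = HCmp (Cat small) (HCmp (Cat small) c b) a"
  if "a \<in> Ar (Hom (Cat small) A B)" "b \<in> Ar (Hom (Cat small) B C)" "c \<in> Ar (Hom (Cat small) C D)"
  for A B C D a b c
  using that unfolding Cat_simps by (intro hcomp_ntrans_assoc) (simp_all add: Hom_simps(2) cells1_iff)
 show "HCmp (Cat small) b a \<in> cells2 (Cat small) (Cmp1 (Cat small) (Src2 (Cat small) b) (Src2 (Cat small) a))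
   (Cmp1 (Cat small) (Trg2 (Cat small) b) (Trg2 (Cat small) a))"
  if "a \<in> Ar (Hom (Cat small) A B)" "b \<in> Ar (Hom (Cat small) B C)" for A B C a b
  using that by (auto simp: Hom_simps(2) cells1_iff cells2_iff)
 show "HCmp (Cat small) (Id2 (Cat small) g) (Id2 (Cat small) f) =
   Id2 (Cat small) (Cmp1 (Cat small) g f)"
  if "f \<in> cells1 (Cat small) A B" "g \<in> cells1 (Cat small) B C" for A B C f g
  unfolding Cat_simps by (rule ntrans_eqI) (use that in \<open>auto simp: cells1_iff\<close>)
 show "HCmp (Cat small) (Id2 (Cat small) (Id1 (Cat small) B)) a = a"
  if "a \<in> Ar (Hom (Cat small) A B)" for A B a
  unfolding Cat_simps
  by (rule ntrans_eqI) (use that in \<open>auto simp: Hom_simps(2) cells1_iff small_category_def\<close>)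
 show "HCmp (Cat small) a (Id2 (Cat small) (Id1 (Cat small) A)) = a"
  if "a \<in> Ar (Hom (Cat small) A B)" for A B a
  unfolding Cat_simps
  by (rule ntrans_eqI) (use that in \<open>auto simp: Hom_simps(2) cells1_iff small_category_def\<close>)
 show "Cmp1 (Cat small) h (Cmp1 (Cat small) g f) = Cmp1 (Cat small) (Cmp1 (Cat small) h g) f"
  if "f \<in> cells1 (Cat small) A B" "g \<in> cells1 (Cat small) B C" "h \<in> cells1 (Cat small) C D"
  for A B C D f g h
  using that by (simp add: cells1_iff comp_func_assoc)
 show "\<exists>A B. Src2 (Cat small) a \<in> cells1 (Cat small) A B \<and> Trg2 (Cat small) a \<in> cells1 (Cat small) A B"
  if "a \<in> Two (Cat small)" for a
  using that by (auto simp: cells1_iff)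
qed (simp_all add: Cat_Hom_category cells1_iff small_category_def)

section \<open>Coalgebras in a strict 2-category\<close>

context strict_two_category
begin

lemma
 assumes "a \<in> Two K"
 shows Src2_One [simp]: "Src2 K a \<in> One K" and Trg2_One [simp]: "Trg2 K a \<in> One K"
  and Src1_Trg2 [simp]: "Src1 K (Trg2 K a) = Src1 K (Src2 K a)"
  and Trg1_Trg2 [simp]: "Trg1 K (Trg2 K a) = Trg1 K (Src2 K a)"
 using Two_parallel[OF assms] by (auto simp: cells1_iff)

lemmas [simp] = Src1_Zero Trg1_Zero

lemma
 assumes "A \<in> Zero K"
 shows Id1_One [simp]: "Id1 K A \<in> One K" and Src1_Id1 [simp]: "Src1 K (Id1 K A) = A"
  and Trg1_Id1 [simp]: "Trg1 K (Id1 K A) = A"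
 using Id1_cell[OF assms] by (auto simp: cells1_iff)

lemma
 assumes "f \<in> One K" "g \<in> One K" "Src1 K g = Trg1 K f"
 shows Cmp1_One [simp]: "Cmp1 K g f \<in> One K"
  and Src1_Cmp1 [simp]: "Src1 K (Cmp1 K g f) = Src1 K f"
  and Trg1_Cmp1 [simp]: "Trg1 K (Cmp1 K g f) = Trg1 K g"
 using Cmp1_cell[of f "Src1 K f" "Trg1 K f" g "Trg1 K g"] assms by (auto simp: cells1_iff)

lemma Cmp1_Id_l [simp]: "f \<in> One K ==> Trg1 K f = A ==> Cmp1 K (Id1 K A) f = f"
 using Cmp1_Id1_left[of f "Src1 K f" A] by (simp add: cells1_iff)

lemma Cmp1_Id_r [simp]: "f \<in> One K ==> Src1 K f = A ==> Cmp1 K f (Id1 K A) = f"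
 using Cmp1_Id1_right[of f A "Trg1 K f"] by (simp add: cells1_iff)

lemma Cmp1_assoc' [simp]: "f \<in> One K ==> g \<in> One K ==> h \<in> One K ==> Src1 K g = Trg1 K f ==>
  Src1 K h = Trg1 K g ==> Cmp1 K (Cmp1 K h g) f = Cmp1 K h (Cmp1 K g f)"
 using Cmp1_assoc[of f _ _ g _ h] by (simp add: cells1_iff)

lemma Ar_HomI [intro]: "a \<in> Two K ==> Src1 K (Src2 K a) = A ==> Trg1 K (Src2 K a) = B ==>
  a \<in> Ar (Hom K A B)"
 by (simp add: Hom_simps(2) cells1_iff)

lemma Hom_cat: "a \<in> Two K ==> category (Hom K (Src1 K (Src2 K a)) (Trg1 K (Src2 K a)))"
 by (simp add: Hom_category)

lemma
 assumes "f \<in> One K"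
 shows Id2_Two [simp]: "Id2 K f \<in> Two K" and Src2_Id2 [simp]: "Src2 K (Id2 K f) = f"
  and Trg2_Id2 [simp]: "Trg2 K (Id2 K f) = f"
proof -
 let ?H = "Hom K (Src1 K f) (Trg1 K f)"
 have c: "category ?H" and f: "f \<in> Ob ?H" "Idn ?H f = Id2 K f"
  using assms by (simp_all add: Hom_category Hom_simps cells1_iff)
 show "Id2 K f \<in> Two K" "Src2 K (Id2 K f) = f" "Trg2 K (Id2 K f) = f"
  using Idn_Ar[OF c f(1)] Dom_Idn[OF c f(1)] Cod_Idn[OF c f(1)] f(2)
  by (simp_all add: Hom_simps)
qed

lemma
 assumes "a \<in> Two K" "b \<in> Two K" "Src2 K b = Trg2 K a"
 shows VCmp_Two [simp]: "VCmp K b a \<in> Two K" and Src2_VCmp [simp]: "Src2 K (VCmp K b a) = Src2 K a"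
  and Trg2_VCmp [simp]: "Trg2 K (VCmp K b a) = Trg2 K b"
proof -
 let ?H = "Hom K (Src1 K (Src2 K a)) (Trg1 K (Src2 K a))"
 have c: "category ?H" by (rule Hom_cat[OF assms(1)])
 have ab: "a \<in> Ar ?H" "b \<in> Ar ?H" using assms by auto
 then have d: "Dom ?H b = Cod ?H a" and e: "Cmp ?H b a = VCmp K b a"
  using assms by (simp_all add: Hom_simps(3,4,6))
 have m: "VCmp K b a \<in> Ar ?H" using Cmp_Ar[OF c ab(2,1) d] e by simp
 then show "VCmp K b a \<in> Two K" by (simp add: Hom_simps(2))
 show "Src2 K (VCmp K b a) = Src2 K a" "Trg2 K (VCmp K b a) = Trg2 K b"
  using Dom_Cmp[OF c ab(2,1) d] Cod_Cmp[OF c ab(2,1) d] e m ab by (simp_all add: Hom_simps(3,4))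
qed

lemma VCmp_Id_l [simp]: "a \<in> Two K ==> Trg2 K a = f ==> VCmp K (Id2 K f) a = a"
proof -
 assume a: "a \<in> Two K" "Trg2 K a = f"
 let ?H = "Hom K (Src1 K (Src2 K a)) (Trg1 K (Src2 K a))"
 have aH: "a \<in> Ar ?H" "Id2 K f \<in> Ar ?H" using a by auto
 show ?thesis
  using Cmp_Idn_l[OF Hom_cat[OF a(1)] aH(1), of f] a aH
  by (auto simp: Hom_simps(4,5,6) cells1_iff)
qed

lemma VCmp_Id_r [simp]: "a \<in> Two K ==> Src2 K a = f ==> VCmp K a (Id2 K f) = a"
proof -
 assume a: "a \<in> Two K" "Src2 K a = f"
 let ?H = "Hom K (Src1 K (Src2 K a)) (Trg1 K (Src2 K a))"
 have aH: "a \<in> Ar ?H" "Id2 K f \<in> Ar ?H" using a by auto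
 show ?thesis
  using Cmp_Idn_r[OF Hom_cat[OF a(1)] aH(1), of f] a aH
  by (auto simp: Hom_simps(3,5,6) cells1_iff)
qed

lemma VCmp_assoc [simp]:
 assumes "a \<in> Two K" "b \<in> Two K" "c \<in> Two K" "Src2 K b = Trg2 K a" "Src2 K c = Trg2 K b"
 shows "VCmp K (VCmp K c b) a = VCmp K c (VCmp K b a)"
proof -
 let ?H = "Hom K (Src1 K (Src2 K a)) (Trg1 K (Src2 K a))"
 have aH: "a \<in> Ar ?H" "b \<in> Ar ?H" "c \<in> Ar ?H" "VCmp K b a \<in> Ar ?H" "VCmp K c b \<in> Ar ?H"
  using assms by auto
 show ?thesis
  using Cmp_assoc[OF Hom_cat[OF assms(1)] aH(3,2,1)] assms aH by (simp add: Hom_simps(3,4,6))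
qed

lemma
 assumes "a \<in> Two K" "b \<in> Two K" "Src1 K (Src2 K b) = Trg1 K (Src2 K a)"
 shows HCmp_Two [simp]: "HCmp K b a \<in> Two K"
  and Src2_HCmp [simp]: "Src2 K (HCmp K b a) = Cmp1 K (Src2 K b) (Src2 K a)"
  and Trg2_HCmp [simp]: "Trg2 K (HCmp K b a) = Cmp1 K (Trg2 K b) (Trg2 K a)"
proof -
 have "a \<in> Ar (Hom K (Src1 K (Src2 K a)) (Trg1 K (Src2 K a)))"
  "b \<in> Ar (Hom K (Trg1 K (Src2 K a)) (Trg1 K (Src2 K b)))"
  using assms by auto
 from HCmp_cell[OF this] show "HCmp K b a \<in> Two K"
  "Src2 K (HCmp K b a) = Cmp1 K (Src2 K b) (Src2 K a)"
  "Trg2 K (HCmp K b a) = Cmp1 K (Trg2 K b) (Trg2 K a)"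
  by (simp_all add: cells2_iff)
qed

lemma HCmp_Id2' [simp]: "f \<in> One K ==> g \<in> One K ==> Src1 K g = Trg1 K f ==>
  HCmp K (Id2 K g) (Id2 K f) = Id2 K (Cmp1 K g f)"
 by (rule HCmp_Id2[of f "Src1 K f" "Trg1 K f" g "Trg1 K g"]) (simp_all add: cells1_iff)

lemma HCmp_Id_l [simp]: "a \<in> Two K ==> Trg1 K (Src2 K a) = A ==> HCmp K (Id2 K (Id1 K A)) a = a"
 by (rule HCmp_Id1_left) auto

lemma HCmp_Id_r [simp]: "a \<in> Two K ==> Src1 K (Src2 K a) = A ==> HCmp K a (Id2 K (Id1 K A)) = a"
 by (rule HCmp_Id1_right) auto

lemma HCmp_assoc' [simp]:
 assumes "a \<in> Two K" "b \<in> Two K" "c \<in> Two K" "Src1 K (Src2 K b) = Trg1 K (Src2 K a)"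
  "Src1 K (Src2 K c) = Trg1 K (Src2 K b)"
 shows "HCmp K (HCmp K c b) a = HCmp K c (HCmp K b a)"
 by (rule HCmp_assoc[symmetric]) (use assms in auto)

lemma interchange':
 assumes "a \<in> Two K" "b \<in> Two K" "a' \<in> Two K" "b' \<in> Two K" "Src1 K (Src2 K b) = Trg1 K (Src2 K a)"
  "Src2 K a' = Trg2 K a" "Src2 K b' = Trg2 K b"
 shows "HCmp K (VCmp K b' b) (VCmp K a' a) = VCmp K (HCmp K b' a') (HCmp K b a)"
proof -
 have h: "a \<in> Ar (Hom K (Src1 K (Src2 K a)) (Trg1 K (Src2 K a)))"
  "a' \<in> Ar (Hom K (Src1 K (Src2 K a)) (Trg1 K (Src2 K a)))"
  "b \<in> Ar (Hom K (Trg1 K (Src2 K a)) (Trg1 K (Src2 K b)))"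
  "b' \<in> Ar (Hom K (Trg1 K (Src2 K a)) (Trg1 K (Src2 K b)))"
  using assms by auto
 show ?thesis
  by (rule interchange[of "Src1 K (Src2 K a)" "Trg1 K (Src2 K a)" a' a "Trg1 K (Src2 K b)" b' b])
   (use h assms in \<open>simp_all add: composable_def Hom_simps(3,4)\<close>)
qed

lemma HCmp_whisker_l [simp]:
 assumes "a \<in> Two K" "b \<in> Two K" "f \<in> One K" "Src2 K b = Trg2 K a" "Src1 K f = Trg1 K (Src2 K a)"
 shows "HCmp K (Id2 K f) (VCmp K b a) = VCmp K (HCmp K (Id2 K f) b) (HCmp K (Id2 K f) a)"
 using interchange'[of a "Id2 K f" b "Id2 K f"] assms by simp

lemma HCmp_whisker_r [simp]:
 assumes "a \<in> Two K" "b \<in> Two K" "f \<in> One K" "Src2 K b = Trg2 K a" "Trg1 K f = Src1 K (Src2 K a)"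
 shows "HCmp K (VCmp K b a) (Id2 K f) = VCmp K (HCmp K b (Id2 K f)) (HCmp K a (Id2 K f))"
 using interchange'[of "Id2 K f" a "Id2 K f" b] assms by simp

lemma HCmp_merge [simp]:
 assumes "a \<in> Two K" "f \<in> One K" "g \<in> One K" "Src1 K g = Trg1 K f" "Src1 K f = Trg1 K (Src2 K a)"
 shows "HCmp K (Id2 K g) (HCmp K (Id2 K f) a) = HCmp K (Id2 K (Cmp1 K g f)) a"
 using HCmp_assoc'[of a "Id2 K f" "Id2 K g"] assms by simp

text \<open>Both sides are the horizontal composite of \<open>b\<close> and \<open>a\<close>,
  whiskered in the two possible orders.\<close>

lemma HCmp_exchange:
 assumes "a \<in> Two K" "b \<in> Two K" "Src1 K (Src2 K b) = Trg1 K (Src2 K a)"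
 shows "VCmp K (HCmp K (Id2 K (Trg2 K b)) a) (HCmp K b (Id2 K (Src2 K a))) =
  VCmp K (HCmp K b (Id2 K (Trg2 K a))) (HCmp K (Id2 K (Src2 K b)) a)"
 using interchange'[of "Id2 K (Src2 K a)" b a "Id2 K (Trg2 K b)"]
  interchange'[of a "Id2 K (Src2 K b)" "Id2 K (Trg2 K a)" b] assms by simp

end

text \<open>Objects of coalgebras are defined by isomorphisms of hom-categories, while the universal
  property delivers bijections on objects and on arrows. The inverse maps respect identities and
  composites because \<open>F\<close> does and is injective on arrows.\<close>

lemma bij_iso_functor:
 assumes F: "functor F" and o: "bij_betw (FOb F) (Ob (FDom F)) (Ob (FCod F))"
  and a: "bij_betw (FAr F) (Ar (FDom F)) (Ar (FCod F))"
 shows "iso_functor F"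
proof -
 let ?C = "FDom F" and ?D = "FCod F"
 define io where "io = inv_into (Ob ?C) (FOb F)"
 define ia where "ia = inv_into (Ar ?C) (FAr F)"
 have o1: "io x \<in> Ob ?C" "FOb F (io x) = x" if "x \<in> Ob ?D" for x
  using o that unfolding io_def by (auto simp: bij_betw_def f_inv_into_f inv_into_into)
 have o2: "io (FOb F x) = x" if "x \<in> Ob ?C" for x
  using o that unfolding io_def by (auto simp: bij_betw_def)
 have a1: "ia x \<in> Ar ?C" "FAr F (ia x) = x" if "x \<in> Ar ?D" for x
  using a that unfolding ia_def by (auto simp: bij_betw_def f_inv_into_f inv_into_into)
 have a2: "ia (FAr F x) = x" if "x \<in> Ar ?C" for x
  using a that unfolding ia_def by (auto simp: bij_betw_def)
 have c: "category ?C" "category ?D" using F by simp_all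
 have d: "Dom ?C (ia f) = io (Dom ?D f)" "Cod ?C (ia f) = io (Cod ?D f)" if "f \<in> Ar ?D" for f
 proof -
  have "Dom ?D (FAr F (ia f)) = FOb F (Dom ?C (ia f))" "Cod ?D (FAr F (ia f)) = FOb F (Cod ?C (ia f))"
   by (rule Dom_FAr[OF F refl a1(1)[OF that]], rule Cod_FAr[OF F refl a1(1)[OF that]])
  then show "Dom ?C (ia f) = io (Dom ?D f)" "Cod ?C (ia f) = io (Cod ?D f)"
   using a1[OF that] c o2[of "Dom ?C (ia f)"] o2[of "Cod ?C (ia f)"] by simp_all
 qed
 define G where "G = \<lparr>FDom = ?D, FCod = ?C, FOb = restrict io (Ob ?D), FAr = restrict ia (Ar ?D)\<rparr>"
 have G: "functor G"
 proof (rule functorI)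
  fix x assume x: "x \<in> Ob (FDom G)"
  have "FAr F (Idn ?C (io x)) = Idn ?D x" using x o1 F by (simp add: G_def)
  then have "ia (Idn ?D x) = Idn ?C (io x)" using a2[of "Idn ?C (io x)"] x o1 c by (simp add: G_def)
  then show "FAr G (Idn (FDom G) x) = Idn (FCod G) (FOb G x)" using x c by (simp add: G_def)
 next
  fix g f assume gf: "g \<in> Ar (FDom G)" "f \<in> Ar (FDom G)" "Dom (FDom G) g = Cod (FDom G) f"
  then have "FAr F (Cmp ?C (ia g) (ia f)) = Cmp ?D g f" using a1 d F by (simp add: G_def)
  then have "ia (Cmp ?D g f) = Cmp ?C (ia g) (ia f)"
   using a2[of "Cmp ?C (ia g) (ia f)"] gf a1 d c by (simp add: G_def)
  then show "FAr G (Cmp (FDom G) g f) = Cmp (FCod G) (FAr G g) (FAr G f)"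
   using gf c by (simp add: G_def)
 qed (use c o1 a1 d in \<open>auto simp: G_def\<close>)
 have "comp_func G F = id_func ?C" "comp_func F G = id_func ?D"
  using F G o1 o2 a1 a2 c by (auto intro!: functor_eqI simp: G_def)
 moreover have "G \<in> functors ?D ?C" using G by (simp add: functors_iff G_def)
 ultimately show ?thesis unfolding iso_functor_def using F by auto
qed

section \<open>Coalgebras as morphisms out of identity comonads\<close>

lemma triv_simps [simp]:
 "MOb (P0 (triv K) D) = D" "MEnd (P0 (triv K) D) = Id1 K D"
 "MEps (P0 (triv K) D) = Id2 K (Id1 K D)" "MDel (P0 (triv K) D) = Id2 K (Id1 K D)"
 "P1 (triv K) h = \<lparr>CSrc = P0 (triv K) (Src1 K h), CTrg = P0 (triv K) (Trg1 K h), CMor = h, CTau = Id2 K h\<rparr>"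
 "P2 (triv K) a = \<lparr>BSrc = P1 (triv K) (Src2 K a), BTrg = P1 (triv K) (Trg2 K a), BCell = a\<rparr>"
 by (simp_all add: triv_def Let_def)

lemma Comon_simps [simp]:
 "Zero (Comon K) = {T. comonad K T}" "One (Comon K) = {m. comonad_mor K m}"
 "Two (Comon K) = {x. comonad_cell K x}" "Src1 (Comon K) = CSrc" "Trg1 (Comon K) = CTrg"
 "Src2 (Comon K) = BSrc" "Trg2 (Comon K) = BTrg"
 "Id2 (Comon K) m = \<lparr>BSrc = m, BTrg = m, BCell = Id2 K (CMor m)\<rparr>"
 "Cmp1 (Comon K) n m = \<lparr>CSrc = CSrc m, CTrg = CTrg n, CMor = Cmp1 K (CMor n) (CMor m),
   CTau = VCmp K (HCmp K (CTau n) (Id2 K (CMor m))) (HCmp K (Id2 K (CMor n)) (CTau m))\<rparr>"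
 "VCmp (Comon K) y x = \<lparr>BSrc = BSrc x, BTrg = BTrg y, BCell = VCmp K (BCell y) (BCell x)\<rparr>"
 "HCmp (Comon K) y x = \<lparr>BSrc = Cmp1 (Comon K) (BSrc y) (BSrc x), BTrg = Cmp1 (Comon K) (BTrg y) (BTrg x),
    BCell = HCmp K (BCell y) (BCell x)\<rparr>"
 by (simp_all add: Comon_def)

text \<open>A morphism of comonads from the identity comonad on \<open>D\<close> to
  \<open>T\<close>, with the identities contributed by the former already cancelled; see
  \<open>comonad_mor_triv\<close>.\<close>

definition coalgebra_on ::
 "('o, 'f, 'c) two_cat => ('o, 'f, 'c) comonad => 'o => 'f => 'c => bool" where
 "coalgebra_on K T D f t \<longleftrightarrow> f \<in> cells1 K D (MOb T) \<and> t \<in> cells2 K f (Cmp1 K (MEnd T) f) \<and>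
  VCmp K (HCmp K (MEps T) (Id2 K f)) t = Id2 K f \<and>
  VCmp K (HCmp K (MDel T) (Id2 K f)) t = VCmp K (HCmp K (Id2 K (MEnd T)) t) t"

text \<open>By the Yoneda argument, an isomorphism natural in \<open>D\<close> between 1-cells into
  \<open>X\<close> and coalgebras on \<open>D\<close> is composition with one coalgebra
  \<open>(U, u)\<close>. The two quantified clauses say that this composition is bijective on
  1-cells and fully faithful on 2-cells.\<close>

definition universal_coalgebra ::
 "('o, 'f, 'c) two_cat => ('o, 'f, 'c) comonad => 'o => 'f => 'c => bool" where
 "universal_coalgebra K T X U u \<longleftrightarrow> X \<in> Zero K \<and> coalgebra_on K T X U u \<and>
  (\<forall>D f t. D \<in> Zero K --> coalgebra_on K T D f t -->
   (\<exists>!h. h \<in> cells1 K D X \<and> Cmp1 K U h = f \<and> HCmp K u (Id2 K h) = t)) \<and>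
  (\<forall>D h h' a. D \<in> Zero K --> h \<in> cells1 K D X --> h' \<in> cells1 K D X -->
   a \<in> cells2 K (Cmp1 K U h) (Cmp1 K U h') -->
   VCmp K (HCmp K (Id2 K (MEnd T)) a) (HCmp K u (Id2 K h)) = VCmp K (HCmp K u (Id2 K h')) a -->
   (\<exists>!b. b \<in> cells2 K h h' \<and> HCmp K (Id2 K U) b = a))"

text \<open>Has the same shape as \<open>Cat_coalg\<close>, so that the latter becomes an instance.\<close>

definition postcomp_coalg :: "('o, 'f, 'c) two_cat => ('o, 'f, 'c) comonad => 'o =>
  ('o, 'f, 'c) comonad_mor => ('o, 'f, 'c) coalg_obj" where
 "postcomp_coalg K T X m = \<lparr>AOb = X,
   AIso = (\<lambda>D. \<lparr>FDom = Hom K D X, FCod = Hom (Comon K) (P0 (triv K) D) T,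
    FOb = (\<lambda>h\<in>Ob (Hom K D X). Cmp1 (Comon K) m (P1 (triv K) h)),
    FAr = (\<lambda>a\<in>Ar (Hom K D X). HCmp (Comon K) (Id2 (Comon K) m) (P2 (triv K) a))\<rparr>)\<rparr>"

context strict_two_category
begin

lemma comonad_triv: "D \<in> Zero K ==> comonad K (P0 (triv K) D)"
 by (simp add: comonad_def cells1_iff cells2_iff)

lemma comonad_mor_triv:
 assumes "comonad K T" "D \<in> Zero K"
 shows "comonad_mor K \<lparr>CSrc = P0 (triv K) D, CTrg = T, CMor = f, CTau = t\<rparr> \<longleftrightarrow> coalgebra_on K T D f t"
proof -
 have T: "MEnd T \<in> One K" "Src1 K (MEnd T) = MOb T" "Trg1 K (MEnd T) = MOb T"
  "MEps T \<in> Two K" "Src2 K (MEps T) = MEnd T" "MDel T \<in> Two K" "Src2 K (MDel T) = MEnd T"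
  using assms(1) by (auto simp: comonad_def cells1_iff cells2_iff)
 show ?thesis
  unfolding comonad_mor_def coalgebra_on_def Let_def
  using assms T comonad_triv by (auto simp: cells1_iff cells2_iff)
qed

lemma comonad_cell_triv:
 assumes "comonad K T" "D \<in> Zero K" "coalgebra_on K T D f t" "coalgebra_on K T D f' t'"
 shows "comonad_cell K \<lparr>BSrc = \<lparr>CSrc = P0 (triv K) D, CTrg = T, CMor = f, CTau = t\<rparr>,
   BTrg = \<lparr>CSrc = P0 (triv K) D, CTrg = T, CMor = f', CTau = t'\<rparr>, BCell = a\<rparr> \<longleftrightarrow>
  a \<in> cells2 K f f' \<and> VCmp K (HCmp K (Id2 K (MEnd T)) a) t = VCmp K t' a"
proof (cases "a \<in> cells2 K f f'")
 case True
 then show ?thesis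
  using assms comonad_mor_triv[OF assms(1,2)] 
  by (auto simp: comonad_cell_def Let_def coalgebra_on_def cells1_iff cells2_iff)
qed (simp add: comonad_cell_def Let_def)

lemma comonad_mor_typing:
 assumes "comonad_mor K m"
 shows "CMor m \<in> One K" "Src1 K (CMor m) = MOb (CSrc m)" "Trg1 K (CMor m) = MOb (CTrg m)"
  "CTau m \<in> Two K" "Src2 K (CTau m) = Cmp1 K (CMor m) (MEnd (CSrc m))"
  "Trg2 K (CTau m) = Cmp1 K (MEnd (CTrg m)) (CMor m)"
  "MEnd (CSrc m) \<in> One K" "Src1 K (MEnd (CSrc m)) = MOb (CSrc m)"
  "Trg1 K (MEnd (CSrc m)) = MOb (CSrc m)"
  "MEnd (CTrg m) \<in> One K" "Src1 K (MEnd (CTrg m)) = MOb (CTrg m)"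
  "Trg1 K (MEnd (CTrg m)) = MOb (CTrg m)"
 using assms by (auto simp: comonad_mor_def comonad_def Let_def cells1_iff cells2_iff)

text \<open>These are the codomains of the isomorphisms \<open>AIso\<close>, so they have to be
  categories; the main point is closure under vertical composition.\<close>

lemma Comon_Hom_category: "category (Hom (Comon K) S T)"
proof (rule Hom_categoryI)
 \<comment> \<open>Pasting: the square of \<open>a\<close>, from \<open>m\<close> to
   \<open>n\<close>, and the square of \<open>b\<close>, from \<open>n\<close> to \<open>p\<close>,
   share the 2-cell \<open>n\<close>.\<close>
 have eq: "VCmp K (HCmp K (Id2 K E) (VCmp K b a)) m = VCmp K p (HCmp K (VCmp K b a) (Id2 K D))"
  if "E \<in> One K" "D \<in> One K" "a \<in> Two K" "b \<in> Two K" "m \<in> Two K" "n \<in> Two K" "p \<in> Two K" "Src2 K b = Trg2 K a"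
   "Src1 K E = Trg1 K (Src2 K a)" "Trg1 K D = Src1 K (Src2 K a)"
   "VCmp K (HCmp K (Id2 K E) a) m = VCmp K n (HCmp K a (Id2 K D))"
   "VCmp K (HCmp K (Id2 K E) b) n = VCmp K p (HCmp K b (Id2 K D))"
   "Trg2 K m = Cmp1 K E (Src2 K a)" "Trg2 K n = Cmp1 K E (Src2 K b)"
   "Src2 K n = Cmp1 K (Src2 K b) D" "Src2 K p = Cmp1 K (Trg2 K b) D" 
  for E D a b m n p
 proof -
  have "VCmp K (HCmp K (Id2 K E) (VCmp K b a)) m = VCmp K (HCmp K (Id2 K E) b) (VCmp K n (HCmp K a (Id2 K D)))"
   using that by simp
  also have "\<dots> = VCmp K (VCmp K (HCmp K (Id2 K E) b) n) (HCmp K a (Id2 K D))"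
   using that(1-11,13-) by simp
  also have "\<dots> = VCmp K p (HCmp K (VCmp K b a) (Id2 K D))"
   using that(1-10,13-) unfolding that(12) by simp
  finally show ?thesis .
 qed
 show "Id2 (Comon K) f \<in> cells2 (Comon K) f f" if "f \<in> cells1 (Comon K) S T" for f
  using comonad_mor_typing[of f] that by (auto simp: comonad_cell_def Let_def cells1_iff cells2_iff)
 show "VCmp (Comon K) b a \<in> cells2 (Comon K) f h"
  if "a \<in> cells2 (Comon K) f g" "b \<in> cells2 (Comon K) g h" for a b f g h
 proof -
  have m: "comonad_mor K f" "comonad_mor K g" "comonad_mor K h"
   and c: "BCell a \<in> cells2 K (CMor f) (CMor g)" "BCell b \<in> cells2 K (CMor g) (CMor h)"
    "CSrc g = CSrc f" "CTrg g = CTrg f" "CSrc h = CSrc f" "CTrg h = CTrg f"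
    "VCmp K (HCmp K (Id2 K (MEnd (CTrg f))) (BCell a)) (CTau f) =
     VCmp K (CTau g) (HCmp K (BCell a) (Id2 K (MEnd (CSrc f))))"
    "VCmp K (HCmp K (Id2 K (MEnd (CTrg f))) (BCell b)) (CTau g) =
     VCmp K (CTau h) (HCmp K (BCell b) (Id2 K (MEnd (CSrc f))))"
   using that by (auto simp: comonad_cell_def Let_def cells2_iff[of _ "Comon K"])
  note t = comonad_mor_typing[OF m(1)] comonad_mor_typing[OF m(2)] comonad_mor_typing[OF m(3)]
  have "VCmp K (HCmp K (Id2 K (MEnd (CTrg f))) (VCmp K (BCell b) (BCell a))) (CTau f) =
   VCmp K (CTau h) (HCmp K (VCmp K (BCell b) (BCell a)) (Id2 K (MEnd (CSrc f))))"
   by (rule eq[of _ _ _ _ _ "CTau g"]) (use t c in \<open>simp_all add: cells2_iff\<close>)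
  note e = this
  have s: "BSrc a = f" "BTrg b = h" using that by (simp_all add: cells2_iff)
  have "VCmp K (BCell b) (BCell a) \<in> cells2 K (CMor f) (CMor h)"
   using c(1,2) by (simp add: cells2_iff)
  then show ?thesis
   using m c(3-6) e by (simp add: comonad_cell_def Let_def cells2_iff[of _ "Comon K"] s)
 qed
qed (auto simp: comonad_cell_def Let_def cells1_iff cells2_iff)

end

lemma Comon_Hom_triv_iff:
 "m \<in> Ob (Hom (Comon K) S T) \<longleftrightarrow> comonad_mor K m \<and> CSrc m = S \<and> CTrg m = T"
 by (auto simp: Hom_simps cells1_iff)

section \<open>The object of coalgebras given by a universal coalgebra\<close>

locale universal_coalg = strict_two_category K
 for K :: "('o, 'f, 'c) two_cat" +
 fixes T :: "('o, 'f, 'c) comonad" and X U u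
 assumes comonad: "comonad K T" and univ: "universal_coalgebra K T X U u"
begin

definition m where "m = \<lparr>CSrc = P0 (triv K) X, CTrg = T, CMor = U, CTau = u\<rparr>"

abbreviation A where "A \<equiv> postcomp_coalg K T X m"

lemma T [simp]: "MOb T \<in> Zero K" "MEnd T \<in> One K" "Src1 K (MEnd T) = MOb T" "Trg1 K (MEnd T) = MOb T"
  "MEps T \<in> Two K" "Src2 K (MEps T) = MEnd T" "Trg2 K (MEps T) = Id1 K (MOb T)"
  "MDel T \<in> Two K" "Src2 K (MDel T) = MEnd T" "Trg2 K (MDel T) = Cmp1 K (MEnd T) (MEnd T)"
 using comonad by (auto simp: comonad_def cells1_iff cells2_iff)

lemma X [simp]: "X \<in> Zero K" and Uu: "coalgebra_on K T X U u"
 using univ by (auto simp: universal_coalgebra_def)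

lemma U [simp]: "U \<in> One K" "Src1 K U = X" "Trg1 K U = MOb T" "u \<in> Two K" "Src2 K u = U"
  "Trg2 K u = Cmp1 K (MEnd T) U"
 and counit: "VCmp K (HCmp K (MEps T) (Id2 K U)) u = Id2 K U"
 and coassoc: "VCmp K (HCmp K (MDel T) (Id2 K U)) u = VCmp K (HCmp K (Id2 K (MEnd T)) u) u"
 using Uu by (auto simp: coalgebra_on_def cells1_iff cells2_iff)

text \<open>Whiskering the two laws of \<open>u\<close> with \<open>h\<close> gives the laws of the
  composite.\<close>

lemma coalgebra_comp:
 assumes "D \<in> Zero K" "h \<in> cells1 K D X"
 shows "coalgebra_on K T D (Cmp1 K U h) (HCmp K u (Id2 K h))"
proof -
 have h: "h \<in> One K" "Src1 K h = D" "Trg1 K h = X" using assms by (auto simp: cells1_iff)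
 have "HCmp K (VCmp K (HCmp K (MEps T) (Id2 K U)) u) (Id2 K h) = Id2 K (Cmp1 K U h)"
  unfolding counit using h by simp
 moreover have "HCmp K (VCmp K (HCmp K (MDel T) (Id2 K U)) u) (Id2 K h) =
  HCmp K (VCmp K (HCmp K (Id2 K (MEnd T)) u) u) (Id2 K h)"
  unfolding coassoc ..
 ultimately show ?thesis
  using h assms by (simp add: coalgebra_on_def cells1_iff cells2_iff)
qed

lemma lift1: "D \<in> Zero K ==> coalgebra_on K T D f t ==>
  \<exists>!h. h \<in> cells1 K D X \<and> Cmp1 K U h = f \<and> HCmp K u (Id2 K h) = t"
 and lift2: "D \<in> Zero K ==> h \<in> cells1 K D X ==> h' \<in> cells1 K D X ==>
  a \<in> cells2 K (Cmp1 K U h) (Cmp1 K U h') ==>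
  VCmp K (HCmp K (Id2 K (MEnd T)) a) (HCmp K u (Id2 K h)) = VCmp K (HCmp K u (Id2 K h')) a ==>
  \<exists>!b. b \<in> cells2 K h h' \<and> HCmp K (Id2 K U) b = a"
 using univ by (auto simp: universal_coalgebra_def)

lemma A_ob [simp]: "h \<in> cells1 K D X ==> FOb (AIso A D) h =
  \<lparr>CSrc = P0 (triv K) D, CTrg = T, CMor = Cmp1 K U h, CTau = HCmp K u (Id2 K h)\<rparr>"
 by (simp add: postcomp_coalg_def m_def Hom_simps(1)) (simp add: cells1_iff)

lemma A_ar [simp]: "a \<in> Ar (Hom K D X) ==> FAr (AIso A D) a =
  \<lparr>BSrc = FOb (AIso A D) (Src2 K a), BTrg = FOb (AIso A D) (Trg2 K a),
   BCell = HCmp K (Id2 K U) a\<rparr>"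
proof -
 assume a: "a \<in> Ar (Hom K D X)"
 then have "Src2 K a \<in> cells1 K D X" "Trg2 K a \<in> cells1 K D X" by (simp_all add: Hom_simps(2))
 then show ?thesis using a
  by (simp add: A_ob) (simp add: postcomp_coalg_def m_def Hom_simps(2) cells1_iff)
qed

text \<open>Compatibility of \<open>U a\<close> with the two whiskerings of \<open>u\<close> is the
  exchange law for \<open>u\<close> and \<open>a\<close>.\<close>

lemma whisker_cell:
 assumes "D \<in> Zero K" "a \<in> Ar (Hom K D X)"
 shows "comonad_cell K (FAr (AIso A D) a)"
proof -
 have a: "Src2 K a \<in> cells1 K D X" "Trg2 K a \<in> cells1 K D X" "a \<in> Two K"
  using assms by (simp_all add: Hom_simps(2))
 have "VCmp K (HCmp K (Id2 K (MEnd T)) (HCmp K (Id2 K U) a)) (HCmp K u (Id2 K (Src2 K a))) =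
  VCmp K (HCmp K u (Id2 K (Trg2 K a))) (HCmp K (Id2 K U) a)"
  using HCmp_exchange[of a u] a by (simp add: cells1_iff)
 then show ?thesis using assms a
  by (simp add: comonad_cell_triv comonad coalgebra_comp) (simp add: cells1_iff cells2_iff)
qed

lemma A_functor:
 assumes "D \<in> Zero K"
 shows "AIso A D \<in> functors (Hom K D X) (Hom (Comon K) (P0 (triv K) D) T)" (is "?F \<in> functors ?C ?D")
proof -
 have F: "FDom ?F = ?C" "FCod ?F = ?D" by (simp_all add: postcomp_coalg_def)
 have c: "category ?C" "category ?D" using assms by (simp_all add: Hom_category Comon_Hom_category)
 have o: "FOb ?F h \<in> Ob ?D" if "h \<in> cells1 K D X" for h
  using that assms comonad by (simp add: Comon_Hom_triv_iff comonad_mor_triv coalgebra_comp)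
 have ar: "FAr ?F a \<in> Ar ?D" if "a \<in> Ar ?C" for a
 proof -
  have "Src2 K a \<in> cells1 K D X" "Trg2 K a \<in> cells1 K D X" using that by (simp_all add: Hom_simps(2))
  then have "FOb ?F (Src2 K a) \<in> Ob ?D" "FOb ?F (Trg2 K a) \<in> Ob ?D"
   by (simp_all add: o del: A_ob)
  then show ?thesis using whisker_cell[OF assms that] that by (simp add: Hom_simps(2) Hom_simps(1) cells1_iff)
 qed
 have "functor ?F"
 proof (rule functorI, unfold F)
  show "category ?C" "category ?D" by (fact c)+
  show "FOb ?F \<in> extensional (Ob ?C)" "FAr ?F \<in> extensional (Ar ?C)"
   by (simp_all add: postcomp_coalg_def)
  show "FOb ?F x \<in> Ob ?D" if "x \<in> Ob ?C" for x using that o by (simp add: Hom_simps)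
  show "FAr ?F a \<in> Ar ?D \<and> Dom ?D (FAr ?F a) = FOb ?F (Dom ?C a) \<and> Cod ?D (FAr ?F a) = FOb ?F (Cod ?C a)"
   if "a \<in> Ar ?C" for a
   using ar[OF that] that by (simp add: Hom_simps(3,4))
  show "FAr ?F (Idn ?C x) = Idn ?D (FOb ?F x)" if "x \<in> Ob ?C" for x
  proof -
   have x: "x \<in> cells1 K D X" using that by (simp add: Hom_simps)
   then have i: "Id2 K x \<in> Ar ?C" by (auto simp: Hom_simps(2) cells1_iff)
   show ?thesis using o[OF x] i x by (simp add: Hom_simps(1,5)) (simp add: cells1_iff)
  qed
  show "FAr ?F (Cmp ?C b a) = Cmp ?D (FAr ?F b) (FAr ?F a)"
   if ba: "b \<in> Ar ?C" "a \<in> Ar ?C" "Dom ?C b = Cod ?C a" for b a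
  proof -
   have s: "Src2 K b = Trg2 K a" using ba by (simp add: Hom_simps(3,4))
   have m: "VCmp K b a \<in> Ar ?C" using Cmp_Ar[OF c(1) ba] ba(1,2) s by (simp add: Hom_simps(6))
   have "Src2 (Comon K) (FAr ?F b) = Trg2 (Comon K) (FAr ?F a)"
    using ba s by simp
   then have "Cmp ?D (FAr ?F b) (FAr ?F a) = VCmp (Comon K) (FAr ?F b) (FAr ?F a)"
    using ar[OF ba(1)] ar[OF ba(2)] by (simp add: Hom_simps(6))
   then show ?thesis using ba s m by (simp add: Hom_simps(6)) (simp add: Hom_simps(2) cells1_iff)
  qed
 qed
 then show ?thesis using F by (simp add: functors_iff)
qed

text \<open>This is the 1-cell clause of \<open>universal_coalgebra\<close>, read through the coding
  of a coalgebra on \<open>D\<close> as a comonad morphism.\<close>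

lemma A_ob_bij:
 assumes "D \<in> Zero K"
 shows "bij_betw (FOb (AIso A D)) (cells1 K D X) (Ob (Hom (Comon K) (P0 (triv K) D) T))"
proof (rule bij_betwI')
 fix h h' assume h: "h \<in> cells1 K D X" "h' \<in> cells1 K D X"
 show "(FOb (AIso A D) h = FOb (AIso A D) h') = (h = h')"
 proof
  assume "FOb (AIso A D) h = FOb (AIso A D) h'"
  then have "Cmp1 K U h' = Cmp1 K U h" "HCmp K u (Id2 K h') = HCmp K u (Id2 K h)"
   using h by simp_all
  then show "h = h'" using lift1[OF assms coalgebra_comp[OF assms h(1)]] h by blast
 qed simp
next
 fix h assume h: "h \<in> cells1 K D X"
 then show "FOb (AIso A D) h \<in> Ob (Hom (Comon K) (P0 (triv K) D) T)"
  using A_functor[OF assms] by (intro FOb_Ob) (simp_all add: functors_iff Hom_simps(1) del: A_ob)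
next
 fix n assume n: "n \<in> Ob (Hom (Comon K) (P0 (triv K) D) T)"
 then have e: "n = \<lparr>CSrc = P0 (triv K) D, CTrg = T, CMor = CMor n, CTau = CTau n\<rparr>"
  and c: "comonad_mor K n"
  by (simp_all add: Comon_Hom_triv_iff)
 have "comonad_mor K \<lparr>CSrc = P0 (triv K) D, CTrg = T, CMor = CMor n, CTau = CTau n\<rparr>"
  using c e by simp
 then have "coalgebra_on K T D (CMor n) (CTau n)"
  using assms comonad by (simp add: comonad_mor_triv)
 from ex1_implies_ex[OF lift1[OF assms this]] obtain h
  where "h \<in> cells1 K D X" "Cmp1 K U h = CMor n" "HCmp K u (Id2 K h) = CTau n" by blast
 then show "\<exists>h\<in>cells1 K D X. n = FOb (AIso A D) h" using e by (intro bexI[of _ h]) auto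
qed

text \<open>This is the 2-cell clause. Equality of images is equality of records, so it yields equal
  sources and targets by injectivity on 1-cells, and then the uniqueness in \<open>lift2\<close>
  applies.\<close>

lemma A_ar_bij:
 assumes D: "D \<in> Zero K"
 shows "bij_betw (FAr (AIso A D)) (Ar (Hom K D X)) (Ar (Hom (Comon K) (P0 (triv K) D) T))"
proof (rule bij_betwI')
 fix a a' assume a: "a \<in> Ar (Hom K D X)" "a' \<in> Ar (Hom K D X)"
 then have c: "Src2 K a \<in> cells1 K D X" "Trg2 K a \<in> cells1 K D X" "a \<in> Two K"
   "Src2 K a' \<in> cells1 K D X" "Trg2 K a' \<in> cells1 K D X" "a' \<in> Two K"
  by (simp_all add: Hom_simps(2))
 show "(FAr (AIso A D) a = FAr (AIso A D) a') = (a = a')"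
 proof
  assume eq: "FAr (AIso A D) a = FAr (AIso A D) a'"
  then have "FOb (AIso A D) (Src2 K a) = FOb (AIso A D) (Src2 K a')"
   "FOb (AIso A D) (Trg2 K a) = FOb (AIso A D) (Trg2 K a')"
   "HCmp K (Id2 K U) a = HCmp K (Id2 K U) a'"
   using a by (simp_all del: A_ob)
  then have s: "Src2 K a' = Src2 K a" "Trg2 K a' = Trg2 K a"
   and h: "HCmp K (Id2 K U) a' = HCmp K (Id2 K U) a"
   using A_ob_bij[OF D] c by (auto simp: bij_betw_def inj_on_eq_iff simp del: A_ob)
  have "VCmp K (HCmp K (Id2 K (MEnd T)) (HCmp K (Id2 K U) a)) (HCmp K u (Id2 K (Src2 K a))) =
   VCmp K (HCmp K u (Id2 K (Trg2 K a))) (HCmp K (Id2 K U) a)"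
   using HCmp_exchange[of a u] c by (simp add: cells1_iff)
  from lift2[OF D c(1,2) _ this] show "a = a'"
   using c s h by (auto simp: cells2_iff cells1_iff)
 qed simp
next
 fix a assume a: "a \<in> Ar (Hom K D X)"
 then show "FAr (AIso A D) a \<in> Ar (Hom (Comon K) (P0 (triv K) D) T)"
  using A_functor[OF assms] by (simp add: functors_iff del: A_ob A_ar)
next
 fix x assume x: "x \<in> Ar (Hom (Comon K) (P0 (triv K) D) T)"
 then have "BSrc x \<in> Ob (Hom (Comon K) (P0 (triv K) D) T)" "BTrg x \<in> Ob (Hom (Comon K) (P0 (triv K) D) T)"
  by (simp_all add: Hom_simps(1,2))
 then obtain h h' where h: "h \<in> cells1 K D X" "BSrc x = FOb (AIso A D) h"
  and h': "h' \<in> cells1 K D X" "BTrg x = FOb (AIso A D) h'"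
  using bij_betw_imp_surj_on[OF A_ob_bij[OF D], symmetric] by blast
 have e: "x = \<lparr>BSrc = FOb (AIso A D) h, BTrg = FOb (AIso A D) h', BCell = BCell x\<rparr>"
  by (simp add: h(2)[symmetric] h'(2)[symmetric])
 have "comonad_cell K \<lparr>BSrc = FOb (AIso A D) h, BTrg = FOb (AIso A D) h', BCell = BCell x\<rparr>"
  using x e by (simp add: Hom_simps(2))
 then have "BCell x \<in> cells2 K (Cmp1 K U h) (Cmp1 K U h')"
  "VCmp K (HCmp K (Id2 K (MEnd T)) (BCell x)) (HCmp K u (Id2 K h)) =
   VCmp K (HCmp K u (Id2 K h')) (BCell x)"
  using h(1) h'(1) D by (simp_all add: comonad_cell_triv comonad coalgebra_comp)
 from ex1_implies_ex[OF lift2[OF D h(1) h'(1) this]] obtain b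
  where b: "b \<in> cells2 K h h'" "HCmp K (Id2 K U) b = BCell x" by blast
 have bA: "b \<in> Ar (Hom K D X)" using b h(1) h'(1) by (auto simp: cells2_iff cells1_iff)
 have "FAr (AIso A D) b = x"
  using b bA e by (subst e) (simp add: cells2_iff del: A_ob)
 then show "\<exists>b\<in>Ar (Hom K D X). x = FAr (AIso A D) b" using bA by blast
qed

text \<open>Naturality in \<open>D\<close> is associativity of composition, since every
  \<open>AIso A D\<close> composes with the same comonad morphism \<open>m\<close>.\<close>

lemma coalgebra_object: "coalgebra_object K T A"
proof -
 have "AOb A = X" by (simp add: postcomp_coalg_def)
 moreover have "iso_functor (AIso A D)" if "D \<in> Zero K" for D
  using A_functor[OF that] A_ob_bij[OF that] A_ar_bij[OF that]
  by (intro bij_iso_functor) (simp_all add: functors_iff Hom_simps(1))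
 moreover have "FOb (AIso A D') (Cmp1 K f h) = Cmp1 (Comon K) (FOb (AIso A D) f) (P1 (triv K) h)"
  if "h \<in> cells1 K D' D" "f \<in> cells1 K D X" for D D' f h
 proof -
  have "Cmp1 K f h \<in> cells1 K D' X" by (rule Cmp1_cell[OF that])
  then show ?thesis using that by simp (simp add: cells1_iff)
 qed
 note ob = this
 moreover have "FAr (AIso A D') (HCmp K a b) = HCmp (Comon K) (FAr (AIso A D) a) (P2 (triv K) b)"
  if b: "b \<in> Ar (Hom K D' D)" and a: "a \<in> Ar (Hom K D X)" for D D' a b
 proof -
  have c: "Src2 K a \<in> cells1 K D X" "Trg2 K a \<in> cells1 K D X" "a \<in> Two K"
   "Src2 K b \<in> cells1 K D' D" "Trg2 K b \<in> cells1 K D' D" "b \<in> Two K"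
   using a b by (simp_all add: Hom_simps(2))
  then have r: "HCmp K a b \<in> Ar (Hom K D' X)" by (auto simp: cells1_iff)
  have "Src2 K (HCmp K a b) = Cmp1 K (Src2 K a) (Src2 K b)"
   "Trg2 K (HCmp K a b) = Cmp1 K (Trg2 K a) (Trg2 K b)"
   using c by (simp_all add: cells1_iff)
  moreover have "HCmp K (Id2 K U) (HCmp K a b) = HCmp K (HCmp K (Id2 K U) a) b"
   using c by (simp add: cells1_iff)
  ultimately show ?thesis
   using ob[OF c(4,1)] ob[OF c(5,2)] r a by (simp del: A_ob Comon_simps(9) HCmp_assoc')
 qed
 ultimately show ?thesis
  unfolding coalgebra_object_def using A_functor by (simp add: Hom_simps(1) del: A_ob A_ar Comon_simps triv_simps)
qed

lemma univ_coalg_A: "univ_coalg K A = m"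
 by (simp add: univ_coalg_def m_def postcomp_coalg_def) (simp add: Hom_simps(1) cells1_iff)

lemma AOb_A [simp]: "AOb A = X"
 by (simp add: postcomp_coalg_def)

lemma forgetful_A: "forgetful K A = U"
 unfolding forgetful_def univ_coalg_A by (simp add: m_def)

lemma cofree_coalgebra: "coalgebra_on K T (MOb T) (MEnd T) (MDel T)"
 using comonad by (auto simp: coalgebra_on_def comonad_def)

text \<open>The preimage that defines \<open>cofree\<close> exists because
  \<open>(T, \<delta>)\<close> is itself a coalgebra, by the laws of the comonad; the equations are
  what its being a preimage means.\<close>

lemma cofree_A: "cofree K T A \<in> cells1 K (MOb T) X \<and> Cmp1 K U (cofree K T A) = MEnd T \<and>
  HCmp K u (Id2 K (cofree K T A)) = MDel T"
proof -
 let ?n = "\<lparr>CSrc = P0 (triv K) (MOb T), CTrg = T, CMor = MEnd T, CTau = MDel T\<rparr>"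
 have n: "?n \<in> Ob (Hom (Comon K) (P0 (triv K) (MOb T)) T)"
  using cofree_coalgebra by (simp add: Comon_Hom_triv_iff comonad_mor_triv comonad)
 then have n': "?n \<in> FOb (AIso A (MOb T)) ` cells1 K (MOb T) X"
  using A_ob_bij[of "MOb T"] by (simp add: bij_betw_def)
 then have "FOb (AIso A (MOb T)) (cofree K T A) = ?n" "cofree K T A \<in> cells1 K (MOb T) X"
  unfolding cofree_def Hom_simps(1) AOb_A by (rule f_inv_into_f, rule inv_into_into)
 then show ?thesis by simp
qed

text \<open>Coassociativity of \<open>u\<close> says that \<open>u\<close> is a coalgebra map from
  \<open>(U, u)\<close> to the coalgebra of \<open>F U\<close>; hence it has a preimage 2-cell,
  whose ends are found by injectivity on 1-cells.\<close>

lemma unit_A: "coalg_unit K T A \<in> cells2 K (Id1 K X) (Cmp1 K (cofree K T A) U) \<and>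
  HCmp K (Id2 K U) (coalg_unit K T A) = u"
proof -
 let ?F = "cofree K T A"
 let ?n = "\<lparr>BSrc = univ_coalg K A, BTrg = FOb (AIso A X) (Cmp1 K ?F U), BCell = u\<rparr>"
 have F: "?F \<in> One K" "Src1 K ?F = MOb T" "Trg1 K ?F = X" "Cmp1 K U ?F = MEnd T"
  "HCmp K u (Id2 K ?F) = MDel T"
  using cofree_A by (auto simp: cells1_iff)
 have FU: "Cmp1 K ?F U \<in> cells1 K X X" using F by (simp add: cells1_iff)
 have e: "Cmp1 K U (Cmp1 K ?F U) = Cmp1 K (MEnd T) U"
  "HCmp K u (Id2 K (Cmp1 K ?F U)) = HCmp K (MDel T) (Id2 K U)"
  using Cmp1_assoc'[of U ?F U] HCmp_assoc'[of "Id2 K U" "Id2 K ?F" u] F by simp_all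
 have c: "coalgebra_on K T X (Cmp1 K (MEnd T) U) (HCmp K (MDel T) (Id2 K U))"
  using coalgebra_comp[OF X FU] e by simp
 have n: "?n = \<lparr>BSrc = \<lparr>CSrc = P0 (triv K) X, CTrg = T, CMor = U, CTau = u\<rparr>,
   BTrg = \<lparr>CSrc = P0 (triv K) X, CTrg = T, CMor = Cmp1 K (MEnd T) U,
    CTau = HCmp K (MDel T) (Id2 K U)\<rparr>, BCell = u\<rparr>"
  using FU e by (simp add: univ_coalg_A) (simp add: m_def)
 have "comonad_cell K ?n"
  unfolding n using comonad_cell_triv[OF comonad X Uu c] coassoc by (simp add: cells2_iff)
 moreover have "BSrc ?n \<in> Ob (Hom (Comon K) (P0 (triv K) X) T)"
  "BTrg ?n \<in> Ob (Hom (Comon K) (P0 (triv K) X) T)"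
  unfolding n using c Uu by (simp_all add: Comon_Hom_triv_iff comonad_mor_triv comonad)
 ultimately have "?n \<in> Ar (Hom (Comon K) (P0 (triv K) X) T)"
  by (simp add: Hom_simps(1,2))
 then have n: "?n \<in> FAr (AIso A X) ` Ar (Hom K X X)"
  using A_ar_bij[of X] by (simp add: bij_betw_def)
 have ctau: "CTau (univ_coalg K A) = u" unfolding univ_coalg_A by (simp add: m_def)
 have i: "FAr (AIso A X) (coalg_unit K T A) = ?n" "coalg_unit K T A \<in> Ar (Hom K X X)"
  unfolding coalg_unit_def AOb_A forgetful_A ctau by (rule f_inv_into_f[OF n], rule inv_into_into[OF n])
 let ?i = "coalg_unit K T A"
 have j: "Src2 K ?i \<in> cells1 K X X" "Trg2 K ?i \<in> cells1 K X X" "?i \<in> Two K"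
  using i(2) by (simp_all add: Hom_simps(2))
 have "FOb (AIso A X) (Src2 K ?i) = m" "FOb (AIso A X) (Trg2 K ?i) = FOb (AIso A X) (Cmp1 K ?F U)"
  "HCmp K (Id2 K U) ?i = u"
  using i by (simp_all add: univ_coalg_A del: A_ob)
 moreover have "FOb (AIso A X) (Id1 K X) = m" using univ_coalg_A by (simp add: univ_coalg_def)
 moreover have "Id1 K X \<in> cells1 K X X" by (simp add: cells1_iff)
 moreover have "inj_on (FOb (AIso A X)) (cells1 K X X)"
  using A_ob_bij[OF X] by (simp add: bij_betw_def)
 ultimately have "Src2 K ?i = Id1 K X" "Trg2 K ?i = Cmp1 K ?F U" "HCmp K (Id2 K U) ?i = u"
  using j FU unfolding inj_on_def by metis+
 then show ?thesis using j by (simp add: cells2_iff)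
qed

text \<open>The first triangle is the counit law of \<open>u\<close>. Whiskering with
  \<open>U\<close> turns the second into a counit law of the comonad, and the uniqueness in
  \<open>lift2\<close> removes the whiskering.\<close>

lemma adjunction: "adjunction K (coalg_adjunction K T A)"
proof -
 let ?F = "cofree K T A" and ?i = "coalg_unit K T A"
 have F [simp]: "?F \<in> One K" "Src1 K ?F = MOb T" "Trg1 K ?F = X" "Cmp1 K U ?F = MEnd T"
  "HCmp K u (Id2 K ?F) = MDel T"
  using cofree_A by (auto simp: cells1_iff)
 have i [simp]: "?i \<in> Two K" "Src2 K ?i = Id1 K X" "Trg2 K ?i = Cmp1 K ?F U" "HCmp K (Id2 K U) ?i = u"
  using unit_A by (auto simp: cells2_iff)
 define z where "z = VCmp K (HCmp K (Id2 K ?F) (MEps T)) (HCmp K ?i (Id2 K ?F))"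
 have UFU [simp]: "Cmp1 K U (Cmp1 K ?F x) = Cmp1 K (MEnd T) x"
  if "x \<in> One K" "Trg1 K x = MOb T" for x
  using Cmp1_assoc'[of x ?F U] that by simp
 have zc: "z \<in> cells2 K ?F ?F" by (simp add: z_def cells2_iff)
 have Ui: "HCmp K (Id2 K U) (HCmp K ?i (Id2 K ?F)) = MDel T"
  using HCmp_assoc'[of "Id2 K ?F" ?i "Id2 K U"] by simp
 have "HCmp K (Id2 K U) z = VCmp K (HCmp K (Id2 K (MEnd T)) (MEps T)) (MDel T)"
  by (simp add: z_def Ui)
 also have "\<dots> = HCmp K (Id2 K U) (Id2 K ?F)" using comonad by (simp add: comonad_def)
 finally have "HCmp K (Id2 K U) z = HCmp K (Id2 K U) (Id2 K ?F)" .
 moreover have "\<exists>!b. b \<in> cells2 K ?F ?F \<and> HCmp K (Id2 K U) b = Id2 K (MEnd T)"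
  by (rule lift2[of "MOb T"]) (simp_all add: cells1_iff cells2_iff)
 moreover have "Id2 K ?F \<in> cells2 K ?F ?F" "HCmp K (Id2 K U) (Id2 K ?F) = Id2 K (MEnd T)"
  by (simp_all add: cells2_iff)
 ultimately have z: "z = Id2 K ?F" using zc by metis
 have "VCmp K (HCmp K (MEps T) (Id2 K U)) (HCmp K (Id2 K U) ?i) = Id2 K U"
  using counit by simp
 with z show ?thesis
  unfolding adjunction_def Let_def coalg_adjunction_def forgetful_A z_def
  by (simp add: cells1_iff cells2_iff)
qed

text \<open>The forgetful-cofree adjunction induces the given comonad on the nose, which lets the
  comparison be formed at the object of coalgebras chosen for \<open>T\<close>.\<close>

lemma adj_comonad_A: "adj_comonad K (coalg_adjunction K T A) = T"
proof -
 let ?F = "cofree K T A" and ?i = "coalg_unit K T A"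
 have F [simp]: "?F \<in> One K" "Src1 K ?F = MOb T" "Trg1 K ?F = X" "Cmp1 K U ?F = MEnd T"
  "HCmp K u (Id2 K ?F) = MDel T"
  using cofree_A by (auto simp: cells1_iff)
 have i [simp]: "?i \<in> Two K" "Src2 K ?i = Id1 K X" "Trg2 K ?i = Cmp1 K ?F U" "HCmp K (Id2 K U) ?i = u"
  using unit_A by (auto simp: cells2_iff)
 have "HCmp K (Id2 K U) (HCmp K ?i (Id2 K ?F)) = MDel T"
  using HCmp_assoc'[of "Id2 K ?F" ?i "Id2 K U"] by simp
 then show ?thesis by (simp add: adj_comonad_def coalg_adjunction_def forgetful_A)
qed

text \<open>The universal coalgebra \<open>m\<close> is by definition the image of the identity
  1-cell, and the correspondence is injective.\<close>

lemma comparison_A: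
 assumes "ch T = A"
 shows "inv_into (cells1 K X (AOb (ch T))) (FOb (AIso (ch T) X)) m = Id1 K X"
proof -
 have e: "FOb (AIso A X) (Id1 K X) = m" using univ_coalg_A by (simp add: univ_coalg_def)
 have "Id1 K X \<in> cells1 K X X" by (simp add: cells1_iff)
 then have "inv_into (cells1 K X X) (FOb (AIso A X)) (FOb (AIso A X) (Id1 K X)) = Id1 K X"
  using A_ob_bij[OF X] by (intro inv_into_f_f) (simp_all add: bij_betw_def)
 then show ?thesis unfolding assms AOb_A e .
qed

end

section \<open>Comonads and adjunctions under a strict 2-functor\<close>

definition map_comonad ::
 "('o, 'f, 'c, 'p, 'g, 'd) two_func => ('o, 'f, 'c) comonad => ('p, 'g, 'd) comonad" where
 "map_comonad \<Phi> T = \<lparr>MOb = P0 \<Phi> (MOb T), MEnd = P1 \<Phi> (MEnd T), MEps = P2 \<Phi> (MEps T),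
  MDel = P2 \<Phi> (MDel T)\<rparr>"

context strict_two_functor
begin

sublocale K: strict_two_category K by (rule source)
sublocale L: strict_two_category L by (rule target)

lemma P1_simps [simp]:
 assumes "f \<in> One K"
 shows "P1 \<Phi> f \<in> One L" "Src1 L (P1 \<Phi> f) = P0 \<Phi> (Src1 K f)" "Trg1 L (P1 \<Phi> f) = P0 \<Phi> (Trg1 K f)"
  "P2 \<Phi> (Id2 K f) = Id2 L (P1 \<Phi> f)"
 using P1_cell[of f "Src1 K f" "Trg1 K f"] assms P2_Id2 by (auto simp: cells1_iff)

lemma P2_simps [simp]:
 assumes "a \<in> Two K"
 shows "P2 \<Phi> a \<in> Two L" "Src2 L (P2 \<Phi> a) = P1 \<Phi> (Src2 K a)" "Trg2 L (P2 \<Phi> a) = P1 \<Phi> (Trg2 K a)"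
 using P2_cell[of a "Src2 K a" "Trg2 K a"] assms by (auto simp: cells2_iff)

lemmas [simp] = P0_Zero P1_Id1

lemma P1_Cmp1' [simp]: "f \<in> One K ==> g \<in> One K ==> Src1 K g = Trg1 K f ==>
  P1 \<Phi> (Cmp1 K g f) = Cmp1 L (P1 \<Phi> g) (P1 \<Phi> f)"
 by (rule P1_Cmp1) (auto simp: cells1_iff)

lemma P2_VCmp' [simp]: "a \<in> Two K ==> b \<in> Two K ==> Src2 K b = Trg2 K a ==>
  P2 \<Phi> (VCmp K b a) = VCmp L (P2 \<Phi> b) (P2 \<Phi> a)"
 by (rule P2_VCmp) (auto simp: cells2_iff)

lemma P2_HCmp' [simp]: "a \<in> Two K ==> b \<in> Two K ==> Src1 K (Src2 K b) = Trg1 K (Src2 K a) ==>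
  P2 \<Phi> (HCmp K b a) = HCmp L (P2 \<Phi> b) (P2 \<Phi> a)"
 by (rule P2_HCmp[OF K.Ar_HomI K.Ar_HomI]) auto

lemma map_comonad:
 assumes "comonad K T"
 shows "comonad L (map_comonad \<Phi> T)"
proof -
 have T: "MOb T \<in> Zero K" "MEnd T \<in> One K" "Src1 K (MEnd T) = MOb T" "Trg1 K (MEnd T) = MOb T"
  "MEps T \<in> Two K" "Src2 K (MEps T) = MEnd T" "Trg2 K (MEps T) = Id1 K (MOb T)"
  "MDel T \<in> Two K" "Src2 K (MDel T) = MEnd T" "Trg2 K (MDel T) = Cmp1 K (MEnd T) (MEnd T)"
  using assms by (auto simp: comonad_def cells1_iff cells2_iff)
 have e: "VCmp K (HCmp K (MEps T) (Id2 K (MEnd T))) (MDel T) = Id2 K (MEnd T)"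
  "VCmp K (HCmp K (Id2 K (MEnd T)) (MEps T)) (MDel T) = Id2 K (MEnd T)"
  "VCmp K (HCmp K (MDel T) (Id2 K (MEnd T))) (MDel T) =
   VCmp K (HCmp K (Id2 K (MEnd T)) (MDel T)) (MDel T)"
  using assms by (auto simp: comonad_def)
 show ?thesis
  using T e[THEN arg_cong, of "P2 \<Phi>"] by (simp add: comonad_def map_comonad_def cells1_iff cells2_iff)
qed

lemma map_coalgebra:
 assumes "comonad K T" "coalgebra_on K T D f t" "D \<in> Zero K"
 shows "coalgebra_on L (map_comonad \<Phi> T) (P0 \<Phi> D) (P1 \<Phi> f) (P2 \<Phi> t)"
proof -
 have T: "MOb T \<in> Zero K" "MEnd T \<in> One K" "Src1 K (MEnd T) = MOb T" "Trg1 K (MEnd T) = MOb T"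
  "MEps T \<in> Two K" "Src2 K (MEps T) = MEnd T" "Trg2 K (MEps T) = Id1 K (MOb T)"
  "MDel T \<in> Two K" "Src2 K (MDel T) = MEnd T" "Trg2 K (MDel T) = Cmp1 K (MEnd T) (MEnd T)"
  using assms by (auto simp: comonad_def cells1_iff cells2_iff)
 have c: "f \<in> One K" "Src1 K f = D" "Trg1 K f = MOb T" "t \<in> Two K" "Src2 K t = f"
  "Trg2 K t = Cmp1 K (MEnd T) f"
  and e: "VCmp K (HCmp K (MEps T) (Id2 K f)) t = Id2 K f"
  "VCmp K (HCmp K (MDel T) (Id2 K f)) t = VCmp K (HCmp K (Id2 K (MEnd T)) t) t"
  using assms(2) by (auto simp: coalgebra_on_def cells1_iff cells2_iff)
 show ?thesis
  using T c e[THEN arg_cong, of "P2 \<Phi>"]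
  by (simp add: coalgebra_on_def map_comonad_def cells1_iff cells2_iff)
qed

text \<open>A 2-functor carries the adjunction to an adjunction, and the comonad of the image is the
  image of \<open>T\<close>. The coalgebra that defines the comparison is \<open>P1 \<Phi> U\<close>
  with structure \<open>U\<close> whiskered with the unit, that is \<open>P2 \<Phi> u\<close>: the
  universal coalgebra chosen in \<open>L\<close>, which corresponds to the identity.\<close>

lemma comonadic_on_the_nose:
 assumes T: "comonad K T" and u: "universal_coalgebra K T X U u"
  and v: "universal_coalgebra L (map_comonad \<Phi> T) (P0 \<Phi> X) (P1 \<Phi> U) (P2 \<Phi> u)"
  and ch: "ch (map_comonad \<Phi> T) = postcomp_coalg L (map_comonad \<Phi> T) (P0 \<Phi> X)
   \<lparr>CSrc = P0 (triv L) (P0 \<Phi> X), CTrg = map_comonad \<Phi> T, CMor = P1 \<Phi> U, CTau = P2 \<Phi> u\<rparr>"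
 shows "comonadic_on_the_nose L ch (map_adj \<Phi> (coalg_adjunction K T (postcomp_coalg K T X
  \<lparr>CSrc = P0 (triv K) X, CTrg = T, CMor = U, CTau = u\<rparr>)))"
proof -
 interpret u: universal_coalg K T X U u by unfold_locales (fact T u)+
 interpret v: universal_coalg L "map_comonad \<Phi> T" "P0 \<Phi> X" "P1 \<Phi> U" "P2 \<Phi> u"
  by unfold_locales (fact map_comonad[OF T] v)+
 let ?J = "coalg_adjunction K T u.A"
 let ?F = "cofree K T u.A" and ?i = "coalg_unit K T u.A"
 have F: "?F \<in> One K" "Src1 K ?F = MOb T" "Trg1 K ?F = X" "Cmp1 K U ?F = MEnd T"
  using u.cofree_A by (auto simp: cells1_iff)
 have i: "?i \<in> Two K" "Src2 K ?i = Id1 K X" "Trg2 K ?i = Cmp1 K ?F U" "HCmp K (Id2 K U) ?i = u"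
  using u.unit_A by (auto simp: cells2_iff)
 have UF: "Cmp1 L (P1 \<Phi> U) (P1 \<Phi> ?F) = P1 \<Phi> (MEnd T)"
  using F by (simp flip: F(4))
 have Ui: "HCmp L (Id2 L (P1 \<Phi> U)) (P2 \<Phi> ?i) = P2 \<Phi> u"
 proof -
  have "P2 \<Phi> (HCmp K (Id2 K U) ?i) = HCmp L (Id2 L (P1 \<Phi> U)) (P2 \<Phi> ?i)"
   using i(1-3) by simp
  then show ?thesis using i(4) by simp
 qed
 have d: "map_adj \<Phi> ?J = \<lparr>AdjLow = P0 \<Phi> (MOb T), AdjUp = P0 \<Phi> X, AdjL = P1 \<Phi> U, AdjR = P1 \<Phi> ?F,
   AdjUnit = P2 \<Phi> ?i, AdjCounit = P2 \<Phi> (MEps T)\<rparr>"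
  by (simp add: map_adj_def coalg_adjunction_def u.forgetful_A)
 have a: "adj_comonad L (map_adj \<Phi> ?J) = map_comonad \<Phi> T"
 proof -
  have "HCmp K (Id2 K U) (HCmp K ?i (Id2 K ?F)) = MDel T"
   using arg_cong[OF u.adj_comonad_A, of MDel]
   by (simp add: adj_comonad_def coalg_adjunction_def u.forgetful_A)
  from arg_cong[OF this, of "P2 \<Phi>"]
  have "HCmp L (Id2 L (P1 \<Phi> U)) (HCmp L (P2 \<Phi> ?i) (Id2 L (P1 \<Phi> ?F))) = P2 \<Phi> (MDel T)"
   using F i by simp
  then show ?thesis by (simp add: d adj_comonad_def map_comonad_def UF)
 qed
 have j: "adjunction L (map_adj \<Phi> ?J)"
 proof -
  have "VCmp K (HCmp K (MEps T) (Id2 K U)) (HCmp K (Id2 K U) ?i) = Id2 K U"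
   "VCmp K (HCmp K (Id2 K ?F) (MEps T)) (HCmp K ?i (Id2 K ?F)) = Id2 K ?F"
   using u.adjunction by (simp_all add: adjunction_def Let_def coalg_adjunction_def u.forgetful_A)
  from this(1)[THEN arg_cong, of "P2 \<Phi>"] this(2)[THEN arg_cong, of "P2 \<Phi>"]
  have "VCmp L (HCmp L (P2 \<Phi> (MEps T)) (Id2 L (P1 \<Phi> U))) (HCmp L (Id2 L (P1 \<Phi> U)) (P2 \<Phi> ?i)) = Id2 L (P1 \<Phi> U)"
   "VCmp L (HCmp L (Id2 L (P1 \<Phi> ?F)) (P2 \<Phi> (MEps T))) (HCmp L (P2 \<Phi> ?i) (Id2 L (P1 \<Phi> ?F))) = Id2 L (P1 \<Phi> ?F)"
   using F(1-3) i(1-3) K.Cmp1_assoc'[of U ?F U] K.Cmp1_assoc'[of ?F U ?F] F(4) by simp_all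
  then show ?thesis using F i UF by (simp add: adjunction_def Let_def d map_comonad_def cells1_iff cells2_iff)
 qed
 have "comparison L ch (map_adj \<Phi> ?J) = Id1 L (P0 \<Phi> X)"
  using v.comparison_A[of ch] ch unfolding comparison_def Let_def a
  by (simp add: d Hom_simps(1) Ui v.m_def)
 moreover have "AdjUp (map_adj \<Phi> ?J) = P0 \<Phi> X"
  by (simp add: d)
 moreover have "AOb (ch (adj_comonad L (map_adj \<Phi> ?J))) = P0 \<Phi> X"
  unfolding a ch by (simp add: postcomp_coalg_def)
 ultimately have "comonadic_on_the_nose L ch (map_adj \<Phi> ?J)"
  using j by (simp add: comonadic_on_the_nose_def)
 then show ?thesis unfolding u.m_def .
qed

end

section \<open>Coalgebras in the 2-category of small categories\<close>

context universe
begin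

lemma pfst_pair [simp]: "pfst pair (pair a b) = a"
 unfolding pfst_def using pair_inject by blast

lemma psnd_pair [simp]: "psnd pair (pair a b) = b"
 unfolding psnd_def using pair_inject by blast

lemma pair_eq_iff [simp]: "pair a b = pair a' b' \<longleftrightarrow> a = a' \<and> b = b'"
 using pair_inject by blast

lemma small_pairs: "small A ==> small B ==> small {pair a b |a b. a \<in> A \<and> b \<in> B}"
proof -
 assume "small A" "small B"
 then have "small (\<Union>a\<in>A. pair a ` B)" by (intro small_UN small_image)
 then show ?thesis by (rule small_subset) blast
qed

end

lemma ntrans_eq_iff:
 "ntrans s ==> ntrans t ==> NDom s = NDom t ==> NCod s = NCod t ==>
  s = t \<longleftrightarrow> (\<forall>x \<in> Ob (FDom (NDom t)). NMap s x = NMap t x)"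
 using ntrans_eqI by blast

section \<open>The category of coalgebras of a comonad on a small category\<close>

locale cat_comonad = universe small pair
 for small :: "'u set => bool" and pair :: "'u => 'u => 'u" +
 fixes T :: "'u cat_comonad"
 assumes comonad: "comonad (Cat small) T"
begin

abbreviation C where "C \<equiv> MOb T"
abbreviation E where "E \<equiv> MEnd T"
abbreviation eps where "eps \<equiv> NMap (MEps T)"
abbreviation del where "del \<equiv> NMap (MDel T)"
abbreviation X where "X \<equiv> coalg_cat pair T"

lemma T_simps [simp]: "category C" "functor E" "FDom E = C" "FCod E = C"
  "ntrans (MEps T)" "NDom (MEps T) = E" "NCod (MEps T) = id_func C"
  "ntrans (MDel T)" "NDom (MDel T) = E" "NCod (MDel T) = comp_func E E"
 and C_small: "small (Ob C)" "small (Ar C)"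
 using comonad by (auto simp: comonad_def cells1_iff cells2_iff small_category_def)

text \<open>Names the predicate that \<open>coalg_cat\<close> binds locally, with membership in
  \<open>hom\<close> unfolded.\<close>

definition coalg :: "'u => 'u => bool" where
 "coalg A a \<longleftrightarrow> A \<in> Ob C \<and> a \<in> Ar C \<and> Dom C a = A \<and> Cod C a = FOb E A \<and>
  Cmp C (eps A) a = Idn C A \<and> Cmp C (del A) a = Cmp C (FAr E a) a"

abbreviation und where "und \<equiv> pfst pair"
abbreviation str where "str \<equiv> psnd pair"
abbreviation ar where "ar y \<equiv> pfst pair (psnd pair y)"
abbreviation mk where "mk x f y \<equiv> pair x (pair f y)"

lemma X_Ob: "Ob X = {pair A a |A a. coalg A a}"
 unfolding coalg_cat_def Let_def coalg_def hom_iff by (simp only: cat.select_convs conj_assoc)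

lemma X_ObE: "x \<in> Ob X ==> (\<And>A a. x = pair A a ==> coalg A a ==> P) ==> P"
 by (auto simp: X_Ob)

lemma X_pair_Ob [simp]: "pair A a \<in> Ob X \<longleftrightarrow> coalg A a"
 by (auto simp: X_Ob)

lemma X_Ob_simps [simp]:
 assumes "x \<in> Ob X"
 shows "und x \<in> Ob C" "str x \<in> Ar C" "Dom C (str x) = und x" "Cod C (str x) = FOb E (und x)"
  "Cmp C (eps (und x)) (str x) = Idn C (und x)"
  "Cmp C (del (und x)) (str x) = Cmp C (FAr E (str x)) (str x)" "pair (und x) (str x) = x"
  "coalg (und x) (str x)"
proof -
 from assms obtain A a where "x = pair A a" "coalg A a" by (rule X_ObE)
 then show "und x \<in> Ob C" "str x \<in> Ar C" "Dom C (str x) = und x" "Cod C (str x) = FOb E (und x)"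
  "Cmp C (eps (und x)) (str x) = Idn C (und x)"
  "Cmp C (del (und x)) (str x) = Cmp C (FAr E (str x)) (str x)" "pair (und x) (str x) = x"
  "coalg (und x) (str x)"
  by (simp_all add: coalg_def)
qed

lemma X_Ar: "Ar X = {mk x f y |x f y. x \<in> Ob X \<and> y \<in> Ob X \<and> f \<in> Ar C \<and> Dom C f = und x \<and>
  Cod C f = und y \<and> Cmp C (str y) f = Cmp C (FAr E f) (str x)}"
 (is "_ = ?R")
proof -
 have *: "Ar X = {mk (pair A a) f (pair B b) |A a f B b. coalg A a \<and> coalg B b \<and> f \<in> hom C A B \<and>
   Cmp C b f = Cmp C (FAr E f) a}"
  unfolding coalg_cat_def Let_def coalg_def hom_iff by (simp only: cat.select_convs conj_assoc)
 show ?thesis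
 proof (intro set_eqI iffI)
  fix x assume "x \<in> Ar X"
  then obtain A a f B b where "x = mk (pair A a) f (pair B b)" "coalg A a" "coalg B b"
   "f \<in> hom C A B" "Cmp C b f = Cmp C (FAr E f) a"
   unfolding * by blast
  then have "x = mk (pair A a) f (pair B b) \<and> pair A a \<in> Ob X \<and> pair B b \<in> Ob X \<and> f \<in> Ar C \<and>
   Dom C f = und (pair A a) \<and> Cod C f = und (pair B b) \<and>
   Cmp C (str (pair B b)) f = Cmp C (FAr E f) (str (pair A a))" by (simp add: hom_iff)
  then show "x \<in> ?R" by blast
 next
  fix x assume "x \<in> ?R"
  then obtain y f z where h: "x = mk y f z" "y \<in> Ob X" "z \<in> Ob X" "f \<in> Ar C" "Dom C f = und y"
   "Cod C f = und z" "Cmp C (str z) f = Cmp C (FAr E f) (str y)"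
   by blast
  have "\<exists>A a B b. y = pair A a \<and> z = pair B b" using h(2,3) by (auto elim!: X_ObE)
  then obtain A a B b where yz: "y = pair A a" "z = pair B b" by blast
  then have "x = mk (pair A a) f (pair B b)" "coalg A a" "coalg B b" "f \<in> hom C A B"
   "Cmp C b f = Cmp C (FAr E f) a"
   using h by (simp_all add: hom_iff)
  then show "x \<in> Ar X" unfolding * by blast
 qed
qed

lemma X_ArE: "y \<in> Ar X ==> (\<And>x f z. y = mk x f z ==> x \<in> Ob X ==> z \<in> Ob X ==> f \<in> Ar C ==>
  Dom C f = und x ==> Cod C f = und z ==> Cmp C (str z) f = Cmp C (FAr E f) (str x) ==> P) ==> P"
 unfolding X_Ar by blast

lemma X_mk_Ar [simp]: "mk x f y \<in> Ar X \<longleftrightarrow> x \<in> Ob X \<and> y \<in> Ob X \<and> f \<in> Ar C \<and> Dom C f = und x \<and>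
  Cod C f = und y \<and> Cmp C (str y) f = Cmp C (FAr E f) (str x)"
 by (auto simp: X_Ar)

lemma X_Dom_eq: "Dom X = restrict und (Ar X)" and X_Cod_eq: "Cod X = restrict (\<lambda>x. str (str x)) (Ar X)"
 and X_Cmp_eq: "Cmp X g f = (if g \<in> Ar X \<and> f \<in> Ar X \<and> und g = str (str f)
  then mk (und f) (Cmp C (ar g) (ar f)) (str (str g)) else undefined)"
 and X_Idn_eq: "Idn X = (\<lambda>x\<in>Ob X. mk x (Idn C (und x)) x)"
 unfolding coalg_cat_def Let_def by (simp_all only: cat.select_convs)

lemma X_Dom: "y \<in> Ar X ==> Dom X y = und y" and X_Cod: "y \<in> Ar X ==> Cod X y = str (str y)"
 by (simp_all add: X_Dom_eq X_Cod_eq)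

lemma X_Ar_simps [simp]:
 assumes "y \<in> Ar X"
 shows "ar y \<in> Ar C" "Dom C (ar y) = und (Dom X y)" "Cod C (ar y) = und (Cod X y)"
  "Cmp C (str (Cod X y)) (ar y) = Cmp C (FAr E (ar y)) (str (Dom X y))"
  "Dom X y \<in> Ob X" "Cod X y \<in> Ob X" and X_mk_eq: "mk (Dom X y) (ar y) (Cod X y) = y"
 using assms by (auto elim!: X_ArE simp: X_Dom X_Cod)

lemma X_mk_Dom [simp]: "mk x f y \<in> Ar X ==> Dom X (mk x f y) = x"
 and X_mk_Cod [simp]: "mk x f y \<in> Ar X ==> Cod X (mk x f y) = y"
 by (simp_all only: X_Dom X_Cod pfst_pair psnd_pair)

lemma X_Ar_eqI: "f \<in> Ar X ==> g \<in> Ar X ==> Dom X f = Dom X g ==> Cod X f = Cod X g ==>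
  ar f = ar g ==> f = g"
 by (metis X_mk_eq)

lemma X_Idn: "x \<in> Ob X ==> Idn X x = mk x (Idn C (und x)) x"
 by (simp add: X_Idn_eq)

lemma X_Cmp: "g \<in> Ar X ==> f \<in> Ar X ==> Dom X g = Cod X f ==>
  Cmp X g f = mk (Dom X f) (Cmp C (ar g) (ar f)) (Cod X g)"
 by (simp add: X_Dom X_Cod X_Cmp_eq)

lemma X_Cmp_undefined: "\<not> composable X g f ==> Cmp X g f = undefined"
 by (auto simp: composable_def X_Dom X_Cod X_Cmp_eq)

lemma X_Cmp_Ar:
 assumes "g \<in> Ar X" "f \<in> Ar X" "Dom X g = Cod X f"
 shows "Cmp X g f \<in> Ar X"
proof -
 have "Cmp C (str (Cod X g)) (Cmp C (ar g) (ar f)) = Cmp C (FAr E (Cmp C (ar g) (ar f))) (str (Dom X f))"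
  using assms Cmp_reassoc[OF X_Ar_simps(4)[OF assms(1)], of "ar f"]
  by simp
 then show ?thesis using assms by (simp add: X_Cmp)
qed

lemma X_category [simp]: "category X"
proof
 show "Dom X \<in> Ar X \<rightarrow>\<^sub>E Ob X" "Cod X \<in> Ar X \<rightarrow>\<^sub>E Ob X"
  by (auto simp: PiE_def extensional_def) (simp_all add: X_Dom_eq X_Cod_eq)
 show "Idn X \<in> extensional (Ob X)"
  by (simp add: X_Idn_eq)
 have i: "Idn X x \<in> Ar X" if "x \<in> Ob X" for x using that by (simp add: X_Idn)
 show "Idn X x \<in> hom X x x" if "x \<in> Ob X" for x
  using that i[OF that] by (simp add: hom_iff) (simp add: X_Idn)
 show "Cmp X g f = undefined" if "\<not> composable X g f" for g f using that by (rule X_Cmp_undefined)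
 show "Cmp X g f \<in> hom X (Dom X f) (Cod X g)" if "composable X g f" for g f
  using that X_Cmp_Ar[of g f] by (simp add: composable_def hom_iff) (simp add: X_Cmp)
 show "Cmp X (Idn X (Cod X f)) f = f" if "f \<in> Ar X" for f
  using that i[of "Cod X f"] by (simp add: X_Cmp X_Idn X_mk_eq)
 show "Cmp X f (Idn X (Dom X f)) = f" if "f \<in> Ar X" for f
  using that i[of "Dom X f"] by (simp add: X_Cmp X_Idn X_mk_eq)
 show "Cmp X h (Cmp X g f) = Cmp X (Cmp X h g) f" if "composable X h g" "composable X g f" for h g f
  using that X_Cmp_Ar[of g f] X_Cmp_Ar[of h g] by (simp add: composable_def X_Cmp)
qed

lemma ar_Idn [simp]: "x \<in> Ob X ==> ar (Idn X x) = Idn C (und x)"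
 by (simp add: X_Idn)

lemma ar_Cmp [simp]: "g \<in> Ar X ==> f \<in> Ar X ==> Dom X g = Cod X f ==>
  ar (Cmp X g f) = Cmp C (ar g) (ar f)"
 by (simp add: X_Cmp)

text \<open>The codes of objects lie among the pairs from \<open>Ob C\<close> and
  \<open>Ar C\<close>, those of arrows among nested pairs of objects and arrows;
  \<open>small_pairs\<close> bounds both.\<close>

lemma X_small: "small (Ob X)" "small (Ar X)"
proof -
 have "small {pair A a |A a. A \<in> Ob C \<and> a \<in> Ar C}" by (intro small_pairs C_small)
 then show o: "small (Ob X)" by (rule small_subset) (auto elim!: X_ObE simp: coalg_def)
 have "small {pair x y |x y. x \<in> Ob X \<and> y \<in> {pair f z |f z. f \<in> Ar C \<and> z \<in> Ob X}}"
  by (intro small_pairs C_small o)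
 then show "small (Ar X)" by (rule small_subset) (auto elim!: X_ArE)
qed

abbreviation U where "U \<equiv> coalg_forget pair T"

lemma U_simps [simp]: "FDom U = X" "FCod U = C" "x \<in> Ob X ==> FOb U x = und x"
 "f \<in> Ar X ==> FAr U f = ar f"
 by (simp_all add: coalg_forget_def)

lemma U_functor [simp]: "functor U"
 by (rule functorI) (simp_all, simp_all add: coalg_forget_def)

definition u where "u = CTau (coalg_universal small pair T)"

lemma u_simps [simp]: "NDom u = U" "NCod u = comp_func E U" "x \<in> Ob X ==> NMap u x = str x"
 by (simp_all add: u_def coalg_universal_def)

lemma coalg_universal_eq: "coalg_universal small pair T =
  \<lparr>CSrc = P0 (triv (Cat small)) X, CTrg = T, CMor = U, CTau = u\<rparr>"
 by (simp add: coalg_universal_def u_def)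

lemma u_ntrans [simp]: "ntrans u"
 by (rule ntransI) (simp_all, simp add: u_def coalg_universal_def)

lemma X_small_category [simp]: "small_category small X" and C_small_category [simp]: "small_category small C"
 by (simp_all add: small_category_def X_small C_small)

text \<open>The two coalgebra laws are equations between natural transformations, so they can be
  tested at each object, where they are the laws of an ordinary coalgebra.\<close>

lemma coalgebra_on_iff:
 assumes "small_category small D"
 shows "coalgebra_on (Cat small) T D f t \<longleftrightarrow> functor f \<and> FDom f = D \<and> FCod f = C \<and>
  ntrans t \<and> NDom t = f \<and> NCod t = comp_func E f \<and> (\<forall>d \<in> Ob D. coalg (FOb f d) (NMap t d))"
proof (cases "functor f \<and> FDom f = D \<and> FCod f = C \<and> ntrans t \<and> NDom t = f \<and> NCod t = comp_func E f")
 case True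
 then have f [simp]: "functor f" "FDom f = D" "FCod f = C" "ntrans t" "NDom t = f"
  "NCod t = comp_func E f" by auto
 have D [simp]: "category D" using assms by (simp add: small_category_def)
 have c: "f \<in> cells1 (Cat small) D C" "t \<in> cells2 (Cat small) f (comp_func E f)"
  using assms by (simp_all add: cells1_iff cells2_iff)
 have "vcomp_ntrans (hcomp_ntrans (MEps T) (id_ntrans f)) t = id_ntrans f \<longleftrightarrow>
  (\<forall>d \<in> Ob D. Cmp C (eps (FOb f d)) (NMap t d) = Idn C (FOb f d))"
  by (subst ntrans_eq_iff) simp_all
 moreover have "vcomp_ntrans (hcomp_ntrans (MDel T) (id_ntrans f)) t =
  vcomp_ntrans (hcomp_ntrans (id_ntrans E) t) t \<longleftrightarrow>
  (\<forall>d \<in> Ob D. Cmp C (del (FOb f d)) (NMap t d) = Cmp C (FAr E (NMap t d)) (NMap t d))"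
  by (subst ntrans_eq_iff) (simp_all add: comp_func_assoc)
 ultimately show ?thesis
  using c by (auto simp: coalgebra_on_def coalg_def)
qed (auto simp: coalgebra_on_def cells1_iff cells2_iff)

text \<open>The only possible functor sends \<open>d\<close> to the coalgebra
  \<open>(f d, t d)\<close>; naturality of \<open>t\<close> is what makes each
  \<open>FAr f k\<close> a coalgebra map. Objects of \<open>X\<close> are determined by their two
  parts and arrows by their ends and underlying arrow, which gives uniqueness.\<close>

lemma lift_functor:
 assumes D: "small_category small D" and c: "coalgebra_on (Cat small) T D f t"
 shows "\<exists>!h. h \<in> cells1 (Cat small) D X \<and> comp_func U h = f \<and> hcomp_ntrans u (id_ntrans h) = t"
proof (rule ex_ex1I)
 have f [simp]: "functor f" "FDom f = D" "FCod f = C" "ntrans t" "NDom t = f"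
  "NCod t = comp_func E f" and co: "\<And>d. d \<in> Ob D ==> coalg (FOb f d) (NMap t d)"
  using c by (auto simp: coalgebra_on_iff[OF D])
 have [simp]: "category D" using D by (simp add: small_category_def)
 define ho where "ho = (\<lambda>d\<in>Ob D. pair (FOb f d) (NMap t d))"
 define h where "h = \<lparr>FDom = D, FCod = X, FOb = ho,
  FAr = (\<lambda>k\<in>Ar D. mk (ho (Dom D k)) (FAr f k) (ho (Cod D k)))\<rparr>"
 have ho: "ho d \<in> Ob X" "und (ho d) = FOb f d" "str (ho d) = NMap t d" if "d \<in> Ob D" for d
  using that co by (simp_all add: ho_def)
 have h1: "mk (ho (Dom D k)) (FAr f k) (ho (Cod D k)) \<in> Ar X" if "k \<in> Ar D" for k
  using that ho ntrans_nat[of t k D C] by simp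
 have h [simp]: "functor h"
 proof (rule functorI)
  fix g k assume gk: "g \<in> Ar (FDom h)" "k \<in> Ar (FDom h)" "Dom (FDom h) g = Cod (FDom h) k"
  then show "FAr h (Cmp (FDom h) g k) = Cmp (FCod h) (FAr h g) (FAr h k)"
   using h1[of g] h1[of k] X_Cmp[of "mk (ho (Dom D g)) (FAr f g) (ho (Cod D g))"
     "mk (ho (Dom D k)) (FAr f k) (ho (Cod D k))"]
   by (simp add: h_def)
 next
  fix k assume "k \<in> Ar (FDom h)"
  then show "FAr h k \<in> Ar (FCod h) \<and> Dom (FCod h) (FAr h k) = FOb h (Dom (FDom h) k) \<and>
    Cod (FCod h) (FAr h k) = FOb h (Cod (FDom h) k)"
   using h1[of k] X_mk_Dom[of "ho (Dom D k)" "FAr f k" "ho (Cod D k)"]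
    X_mk_Cod[of "ho (Dom D k)" "FAr f k" "ho (Cod D k)"] by (simp add: h_def del: X_mk_Ar X_mk_Dom X_mk_Cod)
 qed (use ho in \<open>simp_all add: h_def X_Idn ho_def\<close>)
 have s: "FDom h = D" "FCod h = X" by (simp_all add: h_def)
 have "comp_func U h = f"
  by (rule functor_eqI) (use h1 ho in \<open>simp_all add: s, simp_all add: h_def\<close>)
 moreover have "hcomp_ntrans u (id_ntrans h) = t"
  by (rule ntrans_eqI) (use calculation ho in \<open>simp_all add: s comp_func_assoc[symmetric], simp_all add: h_def\<close>)
 ultimately show "\<exists>h. h \<in> cells1 (Cat small) D X \<and> comp_func U h = f \<and> hcomp_ntrans u (id_ntrans h) = t"
  using s D by (intro exI[of _ h]) (simp add: cells1_iff)
next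
 fix h k
 assume hk: "h \<in> cells1 (Cat small) D X \<and> comp_func U h = f \<and> hcomp_ntrans u (id_ntrans h) = t"
  "k \<in> cells1 (Cat small) D X \<and> comp_func U k = f \<and> hcomp_ntrans u (id_ntrans k) = t"
 then have F: "functor h" "functor k" "FDom h = D" "FDom k = D" "FCod h = X" "FCod k = X"
  by (auto simp: cells1_iff)
 have c: "category D" using D by (simp add: small_category_def)
 have o: "FOb h d = FOb k d" if "d \<in> Ob D" for d
 proof -
  have "FOb (comp_func U h) d = FOb (comp_func U k) d"
   "NMap (hcomp_ntrans u (id_ntrans h)) d = NMap (hcomp_ntrans u (id_ntrans k)) d"
   using hk by auto
  then have "und (FOb h d) = und (FOb k d)" "str (FOb h d) = str (FOb k d)"
   using F that by simp_all
  moreover have "FOb h d \<in> Ob X" "FOb k d \<in> Ob X" using F that by simp_all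
  ultimately show ?thesis using X_Ob_simps(7) by metis
 qed
 show "h = k"
 proof (rule functor_eqI)
  fix g assume g: "g \<in> Ar (FDom k)"
  have "FAr (comp_func U h) g = FAr (comp_func U k) g" using hk by auto
  then have "ar (FAr h g) = ar (FAr k g)" using F g by simp
  then show "FAr h g = FAr k g" using F g o c by - (rule X_Ar_eqI, simp_all)
 qed (use F o in simp_all)
qed

text \<open>At each \<open>d\<close> the equation \<open>eq\<close> says that
  \<open>NMap a d\<close> is a coalgebra map. The components therefore lift, and they lift uniquely
  and naturally because an arrow of \<open>X\<close> is determined by its ends and underlying
  arrow.\<close>

lemma lift_ntrans:
 assumes D: "small_category small D" and h: "h \<in> cells1 (Cat small) D X" "h' \<in> cells1 (Cat small) D X"
  and a: "a \<in> cells2 (Cat small) (comp_func U h) (comp_func U h')"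
  and eq: "vcomp_ntrans (hcomp_ntrans (id_ntrans E) a) (hcomp_ntrans u (id_ntrans h)) =
   vcomp_ntrans (hcomp_ntrans u (id_ntrans h')) a"
 shows "\<exists>!b. b \<in> cells2 (Cat small) h h' \<and> hcomp_ntrans (id_ntrans U) b = a"
proof (rule ex_ex1I)
 have F [simp]: "functor h" "functor h'" "FDom h = D" "FDom h' = D" "FCod h = X" "FCod h' = X"
  using h by (auto simp: cells1_iff)
 have D' [simp]: "category D" using D by (simp add: small_category_def)
 have a' [simp]: "ntrans a" "NDom a = comp_func U h" "NCod a = comp_func U h'"
  using a by (auto simp: cells2_iff)
 define bm where "bm = (\<lambda>d\<in>Ob D. mk (FOb h d) (NMap a d) (FOb h' d))"
 have b1: "bm d \<in> Ar X" "ar (bm d) = NMap a d" "Dom X (bm d) = FOb h d" "Cod X (bm d) = FOb h' d"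
  if d: "d \<in> Ob D" for d
 proof -
  have "NMap (vcomp_ntrans (hcomp_ntrans (id_ntrans E) a) (hcomp_ntrans u (id_ntrans h))) d =
   NMap (vcomp_ntrans (hcomp_ntrans u (id_ntrans h')) a) d"
   using eq by simp
  then have e: "Cmp C (str (FOb h' d)) (NMap a d) = Cmp C (FAr E (NMap a d)) (str (FOb h d))"
   using d by simp
  have m: "mk (FOb h d) (NMap a d) (FOb h' d) \<in> Ar X"
   using d e by simp
  show "bm d \<in> Ar X" "ar (bm d) = NMap a d" "Dom X (bm d) = FOb h d" "Cod X (bm d) = FOb h' d"
   using d m X_mk_Dom[OF m] X_mk_Cod[OF m] by (simp_all add: bm_def)
 qed
 have ext: "bm \<in> extensional (Ob D)" by (simp add: bm_def)
 define b where "b = \<lparr>NDom = h, NCod = h', NMap = bm\<rparr>"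
 have b [simp]: "NDom b = h" "NCod b = h'" "NMap b = bm" by (simp_all add: b_def)
 have bn: "ntrans b"
 proof (rule ntransI)
  fix f assume "f \<in> Ar (FDom (NDom b))"
  then have f: "f \<in> Ar D" by simp
  then have "Cmp C (NMap a (Cod D f)) (ar (FAr h f)) = Cmp C (ar (FAr h' f)) (NMap a (Dom D f))"
   using ntrans_nat[OF a'(1), of f D C] by simp
  then have "Cmp X (bm (Cod D f)) (FAr h f) = Cmp X (FAr h' f) (bm (Dom D f))"
   using f b1 by - (rule X_Ar_eqI, simp_all)
  then show "Cmp (FCod (NDom b)) (NMap b (Cod (FDom (NDom b)) f)) (FAr (NDom b) f) =
     Cmp (FCod (NDom b)) (FAr (NCod b) f) (NMap b (Dom (FDom (NDom b)) f))" by simp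
 qed (use b1 ext in simp_all)
 have "hcomp_ntrans (id_ntrans U) b = a"
  by (rule ntrans_eqI) (use bn b1 in simp_all)
 then show "\<exists>b. b \<in> cells2 (Cat small) h h' \<and> hcomp_ntrans (id_ntrans U) b = a"
  using bn D by (intro exI[of _ b]) (simp add: cells2_iff)
 fix b b' assume bb: "b \<in> cells2 (Cat small) h h' \<and> hcomp_ntrans (id_ntrans U) b = a"
  "b' \<in> cells2 (Cat small) h h' \<and> hcomp_ntrans (id_ntrans U) b' = a"
 show "b = b'"
 proof (rule ntrans_eqI)
  fix d assume "d \<in> Ob (FDom (NDom b'))"
  then have d: "d \<in> Ob D" using bb by (simp add: cells2_iff)
  have "NMap (hcomp_ntrans (id_ntrans U) b) d = NMap (hcomp_ntrans (id_ntrans U) b') d" using bb by simp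
  moreover have "ntrans b" "ntrans b'" "NDom b = h" "NDom b' = h" "NCod b = h'" "NCod b' = h'"
   using bb by (simp_all add: cells2_iff)
  ultimately have "ar (NMap b d) = ar (NMap b' d)" using d by simp
  then show "NMap b d = NMap b' d" using d bb by - (rule X_Ar_eqI, simp_all add: cells2_iff)
 qed (use bb in \<open>simp_all add: cells2_iff\<close>)
qed

lemma universal: "universal_coalgebra (Cat small) T X U u"
proof -
 have "coalgebra_on (Cat small) T X U u"
  by (simp add: coalgebra_on_iff)
 then show ?thesis
  unfolding universal_coalgebra_def
  using lift_functor lift_ntrans by simp
qed

text \<open>Puts the prescribed objects of coalgebras of \<open>Cat\<close> into the form to which
  the general theory of universal coalgebras applies.\<close>

lemma Cat_coalg_eq: "Cat_coalg small pair T = postcomp_coalg (Cat small) T X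
  \<lparr>CSrc = P0 (triv (Cat small)) X, CTrg = T, CMor = U, CTau = u\<rparr>"
 unfolding Cat_coalg_def postcomp_coalg_def Let_def coalg_universal_eq ..

lemma coalgebra_object_Cat: "coalgebra_object (Cat small) T (Cat_coalg small pair T)"
proof -
 interpret u: universal_coalg "Cat small" T X U u
  by (rule universal_coalg.intro[OF Cat_2cat]) (unfold_locales, fact comonad, fact universal)
 show ?thesis using u.coalgebra_object unfolding Cat_coalg_eq u.m_def .
qed

end

section \<open>Pullbacks and displays\<close>

lemma
 assumes "category C" "is_pullback C f p p' f'"
 shows pb_Ar: "f \<in> Ar C" "p \<in> Ar C" "p' \<in> Ar C" "f' \<in> Ar C"
  and pb_ends: "Cod C p' = Dom C f" "Cod C f' = Dom C p" "Dom C f' = Dom C p'" "Cod C p = Cod C f"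
  and pb_comm: "Cmp C f p' = Cmp C p f'"
proof -
 have h: "f \<in> Ar C" "p \<in> Ar C" "p' \<in> Ar C" "f' \<in> Ar C" "Dom C f = Cod C p'" "Dom C p = Cod C f'"
  and e: "Cmp C f p' = Cmp C p f'"
  using assms(2) by (auto simp: is_pullback_def composable_def)
 have "Dom C (Cmp C f p') = Dom C p'" "Cod C (Cmp C f p') = Cod C f" using h assms(1) by simp_all
 moreover have "Dom C (Cmp C p f') = Dom C f'" "Cod C (Cmp C p f') = Cod C p" using h assms(1) by simp_all
 ultimately show "f \<in> Ar C" "p \<in> Ar C" "p' \<in> Ar C" "f' \<in> Ar C" "Cod C p' = Dom C f" "Cod C f' = Dom C p"
  "Dom C f' = Dom C p'" "Cod C p = Cod C f" "Cmp C f p' = Cmp C p f'"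
  using h e by simp_all
qed

lemma pb_ex1:
 assumes "is_pullback C f p p' f'" "x \<in> Ar C" "y \<in> Ar C" "Cod C x = Dom C f" "Cod C y = Dom C p"
  "f \<in> Ar C" "p \<in> Ar C" "Cmp C f x = Cmp C p y"
 shows "\<exists>!h. h \<in> hom C (Dom C x) (Dom C p') \<and> Cmp C p' h = x \<and> Cmp C f' h = y"
 using assms unfolding is_pullback_def by (simp add: composable_def)

lemma pb_ex:
 assumes "category C" "is_pullback C f p p' f'" "x \<in> Ar C" "y \<in> Ar C" "Cod C x = Dom C f"
  "Cod C y = Dom C p" "Cmp C f x = Cmp C p y"
 obtains h where "h \<in> Ar C" "Dom C h = Dom C x" "Cod C h = Dom C p'" "Cmp C p' h = x" "Cmp C f' h = y"
 using pb_ex1[OF assms(2-6) pb_Ar(1,2)[OF assms(1,2)] assms(7)] by (auto simp: hom_iff)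

lemma pb_unique:
 assumes "category C" "is_pullback C f p p' f'" "h \<in> Ar C" "k \<in> Ar C" "Cod C h = Dom C p'"
  "Cod C k = Dom C p'" "Dom C h = Dom C k" "Cmp C p' h = Cmp C p' k" "Cmp C f' h = Cmp C f' k"
 shows "h = k"
proof -
 note pb = pb_Ar[OF assms(1,2)] pb_ends[OF assms(1,2)] pb_comm[OF assms(1,2)]
 have "Cmp C f (Cmp C p' k) = Cmp C p (Cmp C f' k)"
  using pb assms by - (rule Cmp_reassoc, auto)
 then have "\<exists>!h. h \<in> hom C (Dom C (Cmp C p' k)) (Dom C p') \<and> Cmp C p' h = Cmp C p' k \<and>
   Cmp C f' h = Cmp C f' k"
  using pb assms by (intro pb_ex1[OF assms(2)]) simp_all
 moreover have "h \<in> hom C (Dom C (Cmp C p' k)) (Dom C p')" "k \<in> hom C (Dom C (Cmp C p' k)) (Dom C p')"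
  using pb assms by (simp_all add: hom_iff)
 ultimately show ?thesis using assms(8,9) by blast
qed

text \<open>Equality of the two composites forces the legs \<open>x\<close> and \<open>y\<close> to
  have the same domain, so this may be assumed when a mediating arrow is constructed.\<close>

lemma pbI:
 assumes "category C" "f \<in> Ar C" "p \<in> Ar C" "p' \<in> Ar C" "f' \<in> Ar C" "Cod C p' = Dom C f"
  "Cod C f' = Dom C p" "Cmp C f p' = Cmp C p f'"
  "\<And>x y. x \<in> Ar C ==> y \<in> Ar C ==> Cod C x = Dom C f ==> Cod C y = Dom C p ==> Dom C x = Dom C y ==>
   Cmp C f x = Cmp C p y ==>
   \<exists>h. h \<in> Ar C \<and> Dom C h = Dom C x \<and> Cod C h = Dom C p' \<and> Cmp C p' h = x \<and> Cmp C f' h = y"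
  "\<And>h k. h \<in> Ar C ==> k \<in> Ar C ==> Cod C h = Dom C p' ==> Cod C k = Dom C p' ==>
   Dom C h = Dom C k ==> Cmp C p' h = Cmp C p' k ==> Cmp C f' h = Cmp C f' k ==> h = k"
 shows "is_pullback C f p p' f'"
 unfolding is_pullback_def
proof (intro conjI allI impI)
 show "composable C f p'" "composable C p f'" "Cmp C f p' = Cmp C p f'" using assms by simp_all
 fix x y assume a: "composable C f x \<and> composable C p y \<and> Cmp C f x = Cmp C p y"
 then have h: "x \<in> Ar C" "y \<in> Ar C" "Cod C x = Dom C f" "Cod C y = Dom C p"
  by (auto simp: composable_def)
 then have "Dom C (Cmp C f x) = Dom C x" "Dom C (Cmp C p y) = Dom C y" using assms by simp_all
 then have d: "Dom C x = Dom C y" using a by simp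
 show "\<exists>!h. h \<in> hom C (Dom C x) (Dom C p') \<and> Cmp C p' h = x \<and> Cmp C f' h = y"
 proof (rule ex_ex1I)
  show "\<exists>h. h \<in> hom C (Dom C x) (Dom C p') \<and> Cmp C p' h = x \<and> Cmp C f' h = y"
   using assms(9)[OF h d] a by (simp add: hom_iff conj_assoc)
  show "h = k" if "h \<in> hom C (Dom C x) (Dom C p') \<and> Cmp C p' h = x \<and> Cmp C f' h = y"
   "k \<in> hom C (Dom C x) (Dom C p') \<and> Cmp C p' k = x \<and> Cmp C f' k = y" for h k
   using that by - (rule assms(10), auto simp: hom_iff)
 qed
qed

lemma pb_iso:
 assumes c: "category C" and a: "is_pullback C f p p1 f1" and b: "is_pullback C f p p2 f2"
 obtains i where "iso_arrow C i" "Dom C i = Dom C p1" "Cod C i = Dom C p2" "Cmp C p2 i = p1"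
  "Cmp C f2 i = f1"
proof -
 note A = pb_Ar[OF c a] pb_ends[OF c a] pb_comm[OF c a]
 note B = pb_Ar[OF c b] pb_ends[OF c b] pb_comm[OF c b]
 obtain i where i: "i \<in> Ar C" "Dom C i = Dom C p1" "Cod C i = Dom C p2" "Cmp C p2 i = p1" "Cmp C f2 i = f1"
  using A B by (elim pb_ex[OF c b, of p1 f1, rotated -1]) auto
 obtain j where j: "j \<in> Ar C" "Dom C j = Dom C p2" "Cod C j = Dom C p1" "Cmp C p1 j = p2" "Cmp C f1 j = f2"
  using A B by (elim pb_ex[OF c a, of p2 f2, rotated -1]) auto
 have "Cmp C j i = Idn C (Dom C p1)"
  by (rule pb_unique[OF c a]) (use A B c i j in \<open>simp_all add: Cmp_reassoc1[OF j(4)] Cmp_reassoc1[OF j(5)]\<close>)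
 moreover have "Cmp C i j = Idn C (Dom C p2)"
  by (rule pb_unique[OF c b]) (use A B c i j in \<open>simp_all add: Cmp_reassoc1[OF i(4)] Cmp_reassoc1[OF i(5)]\<close>)
 ultimately have "iso_arrow C i" using c i j by (intro iso_arrowI[of _ _ j]) simp_all
 then show thesis using that i by blast
qed

lemma pb_transport:
 assumes c: "category C" and b: "is_pullback C f p p' f'" and i: "iso_arrow C i" "Cod C i = Dom C p'"
 shows "is_pullback C f p (Cmp C p' i) (Cmp C f' i)"
proof (rule pbI)
 note B = pb_Ar[OF c b] pb_ends[OF c b] pb_comm[OF c b]
 show "Cmp C f (Cmp C p' i) = Cmp C p (Cmp C f' i)"
  using B c i by - (rule Cmp_reassoc, auto)
 fix x y assume x: "x \<in> Ar C" "y \<in> Ar C" "Cod C x = Dom C f" "Cod C y = Dom C p" "Cmp C f x = Cmp C p y"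
 from pb_ex[OF c b this] obtain h where h: "h \<in> Ar C" "Dom C h = Dom C x" "Cod C h = Dom C p'"
  "Cmp C p' h = x" "Cmp C f' h = y" .
 show "\<exists>h. h \<in> Ar C \<and> Dom C h = Dom C x \<and> Cod C h = Dom C (Cmp C p' i) \<and>
   Cmp C (Cmp C p' i) h = x \<and> Cmp C (Cmp C f' i) h = y"
  using B c i h by (intro exI[of _ "Cmp C (inv_arrow C i) h"]) simp
next
 note B = pb_Ar[OF c b] pb_ends[OF c b] pb_comm[OF c b]
 fix h k assume h: "h \<in> Ar C" "k \<in> Ar C" "Cod C h = Dom C (Cmp C p' i)" "Cod C k = Dom C (Cmp C p' i)"
  "Dom C h = Dom C k" "Cmp C (Cmp C p' i) h = Cmp C (Cmp C p' i) k" "Cmp C (Cmp C f' i) h = Cmp C (Cmp C f' i) k"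
 have "Cmp C i h = Cmp C i k"
  by (rule pb_unique[OF c b]) (use B c i h in simp_all)
 then show "h = k" using B c i h by - (rule iso_cancel_left[of C i], simp_all)
qed (use pb_Ar[OF c b] pb_ends[OF c b] c i in simp_all)

text \<open>Two pullbacks of one cospan differ by an isomorphism, so preservation has to be tested
  on a single pullback of each cospan; for coalgebras this will be the chosen one.\<close>

lemma pb_functor_transport:
 assumes F: "functor F" "FDom F = C" "FCod F = D" and a: "is_pullback C f p p1 f1"
  and b: "is_pullback C f p p2 f2" and d: "is_pullback D (FAr F f) (FAr F p) (FAr F p1) (FAr F f1)"
 shows "is_pullback D (FAr F f) (FAr F p) (FAr F p2) (FAr F f2)"
proof -
 have c: "category C" "category D" using F by auto
 obtain i where i: "iso_arrow C i" "Dom C i = Dom C p2" "Cod C i = Dom C p1" "Cmp C p1 i = p2" "Cmp C f1 i = f2"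
  by (rule pb_iso[OF c(1) b a])
 note A = pb_Ar[OF c(1) a] pb_ends[OF c(1) a]
 have "is_pullback D (FAr F f) (FAr F p) (Cmp D (FAr F p1) (FAr F i)) (Cmp D (FAr F f1) (FAr F i))"
  by (rule pb_transport[OF c(2) d]) (use F A c i in simp_all)
 moreover have "Cmp D (FAr F p1) (FAr F i) = FAr F p2" "Cmp D (FAr F f1) (FAr F i) = FAr F f2"
  using FAr_Cmp'[OF F(1,2), of p1 i] FAr_Cmp'[OF F(1,2), of f1 i] F A c i by simp_all
 ultimately show ?thesis by simp
qed

lemma nat_isoI: "nat_trans F G t ==> (\<And>x. x \<in> Ob (FDom F) ==> iso_arrow (FCod F) (t x)) ==> nat_iso F G t"
 by (simp add: nat_iso_def)

section \<open>Chosen pullbacks of displays and their reindexing\<close>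

context display_category
begin

abbreviation C where "C \<equiv> DCat D"
abbreviation DI where "DI \<equiv> disp_icat D"
abbreviation Sl where "Sl \<equiv> disp_slice D"

lemmas cat [simp] = DCat_category

lemma Disp_Ar [simp]: "p \<in> Disp D ==> p \<in> Ar C"
 using Disp_subset by blast

lemma
 assumes "f \<in> Ar C" "p \<in> Disp D" "Cod C f = Cod C p"
 shows Pb1_Disp' [simp]: "Pb1 D f p \<in> Disp D"
  and Pb1_Ar [simp]: "Pb1 D f p \<in> Ar C" and Pb2_Ar [simp]: "Pb2 D f p \<in> Ar C"
  and Cod_Pb1 [simp]: "Cod C (Pb1 D f p) = Dom C f" and Cod_Pb2 [simp]: "Cod C (Pb2 D f p) = Dom C p"
  and Dom_Pb2 [simp]: "Dom C (Pb2 D f p) = Dom C (Pb1 D f p)"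
  and Pb_comm [simp]: "Cmp C f (Pb1 D f p) = Cmp C p (Pb2 D f p)"
  and Pb: "is_pullback C f p (Pb1 D f p) (Pb2 D f p)"
proof -
 have d: "disp_cospan D f p" using assms by (simp add: disp_cospan_def)
 note pb = Pb_pullback[OF d]
 show "Pb1 D f p \<in> Disp D" using Pb1_Disp[OF d] .
 show "is_pullback C f p (Pb1 D f p) (Pb2 D f p)" by (rule pb)
 show "Pb1 D f p \<in> Ar C" "Pb2 D f p \<in> Ar C" "Cod C (Pb1 D f p) = Dom C f"
  "Cod C (Pb2 D f p) = Dom C p" "Dom C (Pb2 D f p) = Dom C (Pb1 D f p)"
  "Cmp C f (Pb1 D f p) = Cmp C p (Pb2 D f p)"
  using pb_Ar[OF cat pb] pb_ends[OF cat pb] pb_comm[OF cat pb] by simp_all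
qed

lemma Pb_comm_assoc [simp]:
 "f \<in> Ar C ==> p \<in> Disp D ==> Cod C f = Cod C p ==> x \<in> Ar C ==> Cod C x = Dom C (Pb1 D f p) ==>
  Cmp C f (Cmp C (Pb1 D f p) x) = Cmp C p (Cmp C (Pb2 D f p) x)"
 by (rule Cmp_reassoc) simp_all

lemma Pb_eqI:
 assumes "f \<in> Ar C" "p \<in> Disp D" "Cod C f = Cod C p" "h \<in> Ar C" "k \<in> Ar C"
  "Cod C h = Dom C (Pb1 D f p)" "Cod C k = Dom C (Pb1 D f p)" "Dom C h = Dom C k"
  "Cmp C (Pb1 D f p) h = Cmp C (Pb1 D f p) k" "Cmp C (Pb2 D f p) h = Cmp C (Pb2 D f p) k"
 shows "h = k"
 by (rule pb_unique[OF cat Pb[OF assms(1-3)]]) (use assms in simp_all)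

lemma
 assumes "f \<in> Ar C" "p \<in> Disp D" "Cod C f = Cod C p" "x \<in> Ar C" "y \<in> Ar C" "Cod C x = Dom C f"
  "Cod C y = Dom C p" "Cmp C f x = Cmp C p y"
 shows gap_Ar [simp]: "gap D f p x y \<in> Ar C" and Dom_gap [simp]: "Dom C (gap D f p x y) = Dom C x"
  and Cod_gap [simp]: "Cod C (gap D f p x y) = Dom C (Pb1 D f p)"
  and Pb1_gap [simp]: "Cmp C (Pb1 D f p) (gap D f p x y) = x"
  and Pb2_gap [simp]: "Cmp C (Pb2 D f p) (gap D f p x y) = y"
proof -
 have "\<exists>!h. h \<in> hom C (Dom C x) (Dom C (Pb1 D f p)) \<and> Cmp C (Pb1 D f p) h = x \<and> Cmp C (Pb2 D f p) h = y"
  by (rule pb_ex1[OF Pb[OF assms(1-3)]]) (use assms in simp_all)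
 from theI'[OF this] show "gap D f p x y \<in> Ar C" "Dom C (gap D f p x y) = Dom C x"
  "Cod C (gap D f p x y) = Dom C (Pb1 D f p)" "Cmp C (Pb1 D f p) (gap D f p x y) = x"
  "Cmp C (Pb2 D f p) (gap D f p x y) = y"
  by (simp_all add: gap_def hom_iff)
qed

lemma
 assumes "f \<in> Ar C" "p \<in> Disp D" "Cod C f = Cod C p" "x \<in> Ar C" "y \<in> Ar C" "Cod C x = Dom C f"
  "Cod C y = Dom C p" "Cmp C f x = Cmp C p y" "z \<in> Ar C" "Cod C z = Dom C x"
 shows Pb1_gap_assoc [simp]: "Cmp C (Pb1 D f p) (Cmp C (gap D f p x y) z) = Cmp C x z"
  and Pb2_gap_assoc [simp]: "Cmp C (Pb2 D f p) (Cmp C (gap D f p x y) z) = Cmp C y z"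
 using Cmp_reassoc1[OF Pb1_gap[OF assms(1-8)], of z] Cmp_reassoc1[OF Pb2_gap[OF assms(1-8)], of z] assms
 by simp_all

subsection \<open>Slices\<close>

abbreviation mid :: "'b \<times> 'b \<times> 'b => 'b" where "mid t \<equiv> fst (snd t)"

lemma slice_Ob [simp]: "p \<in> Ob (Sl A) \<longleftrightarrow> p \<in> Disp D \<and> Cod C p = A"
 by (simp add: disp_slice_def Let_def)

lemma slice_Ar: "t \<in> Ar (Sl A) \<longleftrightarrow> fst t \<in> Disp D \<and> Cod C (fst t) = A \<and> snd (snd t) \<in> Disp D \<and>
  Cod C (snd (snd t)) = A \<and> mid t \<in> Ar C \<and> Dom C (mid t) = Dom C (fst t) \<and>
  Cod C (mid t) = Dom C (snd (snd t)) \<and> Cmp C (snd (snd t)) (mid t) = fst t"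
 by (cases t) (auto simp: disp_slice_def Let_def hom_iff)

lemma slice_Dom [simp]: "t \<in> Ar (Sl A) ==> Dom (Sl A) t = fst t"
 and slice_Cod [simp]: "t \<in> Ar (Sl A) ==> Cod (Sl A) t = snd (snd t)"
 by (cases t, simp add: disp_slice_def Let_def)+

lemma slice_Ar_simps [simp]:
 assumes "t \<in> Ar (Sl A)"
 shows "fst t \<in> Disp D" "Cod C (fst t) = A" "snd (snd t) \<in> Disp D" "Cod C (snd (snd t)) = A"
  "mid t \<in> Ar C" "Dom C (mid t) = Dom C (fst t)" "Cod C (mid t) = Dom C (snd (snd t))"
  "Cmp C (snd (snd t)) (mid t) = fst t"
 using assms by (simp_all add: slice_Ar)

lemma slice_Ar_assoc [simp]:
 assumes "t \<in> Ar (Sl A)" "x \<in> Ar C" "Cod C x = Dom C (fst t)"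
 shows "Cmp C (snd (snd t)) (Cmp C (mid t) x) = Cmp C (fst t) x"
 using Cmp_reassoc1[OF slice_Ar_simps(8)[OF assms(1)], of x] assms by simp

lemma slice_Idn [simp]: "p \<in> Disp D ==> Cod C p = A ==> Idn (Sl A) p = (p, Idn C (Dom C p), p)"
 by (simp add: disp_slice_def Let_def)

lemma slice_Cmp [simp]: "s \<in> Ar (Sl A) ==> t \<in> Ar (Sl A) ==> fst s = snd (snd t) ==>
  Cmp (Sl A) s t = (fst t, Cmp C (mid s) (mid t), snd (snd s))"
 by (cases s, cases t) (simp add: disp_slice_def Let_def)

lemma slice_eqI: "fst s = fst t ==> snd (snd s) = snd (snd t) ==>
  mid s = mid t ==> s = t"
 by (simp add: prod_eq_iff)

lemma slice_category [simp]: "category (Sl A)"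
proof
 show "Dom (Sl A) \<in> Ar (Sl A) \<rightarrow>\<^sub>E Ob (Sl A)"
  "Cod (Sl A) \<in> Ar (Sl A) \<rightarrow>\<^sub>E Ob (Sl A)"
  by (auto simp: disp_slice_def Let_def)
 show "Idn (Sl A) \<in> extensional (Ob (Sl A))"
  by (auto simp: disp_slice_def Let_def)
 show "Cmp (Sl A) g f = undefined" if "\<not> composable (Sl A) g f" for g f
  using that slice_Dom slice_Cod unfolding composable_def
  by (cases g, cases f) (auto simp: disp_slice_def Let_def)
 show "Idn (Sl A) x \<in> hom (Sl A) x x" if "x \<in> Ob (Sl A)" for x
 proof -
  have "Idn (Sl A) x \<in> Ar (Sl A)" using that by (simp add: slice_Ar)
  then show ?thesis using that by (simp add: hom_iff) 
 qed
 fix f assume f: "f \<in> Ar (Sl A)"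
 have i: "Idn (Sl A) x \<in> Ar (Sl A)" if "x \<in> Disp D" "Cod C x = A" for x
  using that by (simp add: slice_Ar)
 show "Cmp (Sl A) (Idn (Sl A) (Cod (Sl A) f)) f = f"
  using f i[of "snd (snd f)"] by (simp add: prod_eq_iff)
 show "Cmp (Sl A) f (Idn (Sl A) (Dom (Sl A) f)) = f"
  using f i[of "fst f"] by (simp add: prod_eq_iff)
next
 have m: "(fst f, Cmp C (mid g) (mid f), snd (snd g)) \<in> Ar (Sl A)"
  if "g \<in> Ar (Sl A)" "f \<in> Ar (Sl A)" "fst g = snd (snd f)" for g f
 proof -
  have "Cmp C (snd (snd g)) (Cmp C (mid g) (mid f)) = fst f"
   using that slice_Ar_assoc[OF that(1), of "mid f"] by simp
  then show ?thesis using that by (subst slice_Ar) simp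
 qed
 show "Cmp (Sl A) g f \<in> hom (Sl A) (Dom (Sl A) f) (Cod (Sl A) g)"
  if "composable (Sl A) g f" for g f
 proof -
  from that have g: "g \<in> Ar (Sl A)" "f \<in> Ar (Sl A)" "fst g = snd (snd f)"
   by (auto simp: composable_def)
  from m[OF this] show ?thesis using g by (simp add: hom_iff)
 qed
 show "Cmp (Sl A) h (Cmp (Sl A) g f) = Cmp (Sl A) (Cmp (Sl A) h g) f"
  if "composable (Sl A) h g" "composable (Sl A) g f" for h g f
 proof -
  from that have g: "h \<in> Ar (Sl A)" "g \<in> Ar (Sl A)" "f \<in> Ar (Sl A)"
   "fst h = snd (snd g)" "fst g = snd (snd f)"
   by (auto simp: composable_def)
  from m[OF g(2,3,5)] m[OF g(1,2,4)] show ?thesis using g by simp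
 qed
qed

lemma slice_iso:
 assumes "t \<in> Ar (Sl A)" "iso_arrow C (mid t)"
 shows "iso_arrow (Sl A) t"
proof -
 let ?s = "(snd (snd t), inv_arrow C (mid t), fst t)"
 have "Cmp C (fst t) (inv_arrow C (mid t)) = snd (snd t)"
  using Cmp_assoc[of C "snd (snd t)" "mid t" "inv_arrow C (mid t)"] assms by simp
 then have s: "?s \<in> Ar (Sl A)" using assms by (subst slice_Ar) simp
 show ?thesis by (rule iso_arrowI[of _ _ ?s]) (use assms s in simp_all)
qed

lemma slice_iso_mid:
 assumes "iso_arrow (Sl A) t"
 shows "iso_arrow C (mid t)"
proof -
 let ?s = "inv_arrow (Sl A) t"
 have t: "t \<in> Ar (Sl A)" "?s \<in> Ar (Sl A)" using assms by simp_all
 have e: "fst ?s = snd (snd t)" "snd (snd ?s) = fst t"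
  using Dom_inv[OF slice_category assms] Cod_inv[OF slice_category assms] t by simp_all
 have "Cmp (Sl A) ?s t = Idn (Sl A) (fst t)"
  "Cmp (Sl A) t ?s = Idn (Sl A) (snd (snd t))"
  using inv_left[OF slice_category assms] inv_right[OF slice_category assms] t by simp_all
 then have "Cmp C (mid ?s) (mid t) = Idn C (Dom C (fst t))" "Cmp C (mid t) (mid ?s) = Idn C (Dom C (snd (snd t)))"
  using t e by simp_all
 then show ?thesis
  using slice_Ar_simps[OF t(1)] slice_Ar_simps[OF t(2)] e
  by (intro iso_arrowI[of _ _ "mid ?s"]) (simp_all del: slice_Ar_simps)
qed

subsection \<open>The indexed category of displays\<close>

lemma disp_icat_simps [simp]:
 "IBase DI = C" "A \<in> Ob C ==> IFib DI A = Sl A"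
 by (simp_all add: disp_icat_def Let_def)

lemma disp_re_simps [simp]:
 assumes "u \<in> Ar C"
 shows "FDom (IRe DI u) = Sl (Cod C u)" "FCod (IRe DI u) = Sl (Dom C u)"
  "p \<in> Disp D ==> Cod C p = Cod C u ==> FOb (IRe DI u) p = Pb1 D u p"
  "t \<in> Ar (Sl (Cod C u)) ==> FAr (IRe DI u) t =
   (Pb1 D u (fst t), gap D u (snd (snd t)) (Pb1 D u (fst t)) (Cmp C (mid t) (Pb2 D u (fst t))),
    Pb1 D u (snd (snd t)))"
 using assms by (simp_all add: disp_icat_def Let_def split: prod.split)

lemma disp_unit_simp [simp]: "A \<in> Ob C ==> p \<in> Disp D ==> Cod C p = A ==> IUnit DI A p =
  (p, gap D (Idn C A) p p (Idn C (Dom C p)), Pb1 D (Idn C A) p)"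
 by (simp add: disp_icat_def Let_def)

lemma disp_mult_simp [simp]: "u \<in> Ar C ==> v \<in> Ar C ==> Dom C u = Cod C v ==> p \<in> Disp D ==>
  Cod C p = Cod C u ==> IMult DI u v p = (Pb1 D v (Pb1 D u p),
   gap D (Cmp C u v) p (Pb1 D v (Pb1 D u p)) (Cmp C (Pb2 D u p) (Pb2 D v (Pb1 D u p))), Pb1 D (Cmp C u v) p)"
 by (simp add: disp_icat_def Let_def)

lemma disp_re_Ar:
 assumes "u \<in> Ar C" "t \<in> Ar (Sl (Cod C u))"
 shows "FAr (IRe DI u) t \<in> Ar (Sl (Dom C u))"
 by (subst slice_Ar) (use assms in simp)

lemma disp_re_functor: 
 assumes u: "u \<in> Ar C"
 shows "functor (IRe DI u)"
proof (rule functorI)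
 fix x assume "x \<in> Ob (FDom (IRe DI u))"
 then have x: "x \<in> Disp D" "Cod C x = Cod C u" using u by simp_all
 have i: "Idn (Sl (Cod C u)) x \<in> Ar (Sl (Cod C u))" using x u by (intro Idn_Ar) simp_all
 have "gap D u x (Pb1 D u x) (Cmp C (Idn C (Dom C x)) (Pb2 D u x)) = Idn C (Dom C (Pb1 D u x))"
  by (rule Pb_eqI[of u x]) (use x u in simp_all)
 then show "FAr (IRe DI u) (Idn (FDom (IRe DI u)) x) =
  Idn (FCod (IRe DI u)) (FOb (IRe DI u) x)"
  using x u i by simp
next
 fix g f assume a: "g \<in> Ar (FDom (IRe DI u))" "f \<in> Ar (FDom (IRe DI u))"
  "Dom (FDom (IRe DI u)) g = Cod (FDom (IRe DI u)) f"
 then have gf: "g \<in> Ar (Sl (Cod C u))" "f \<in> Ar (Sl (Cod C u))" "fst g = snd (snd f)"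
  using u by simp_all
 then have m: "(fst f, Cmp C (mid g) (mid f), snd (snd g)) \<in> Ar (Sl (Cod C u))"
  using Cmp_Ar[OF slice_category, of g _ f] by simp
 have e: "Cmp C (snd (snd g)) (Cmp C (mid g) (mid f)) = fst f" using slice_Ar_simps(8)[OF m] by simp
 have e': "Cmp C (snd (snd g)) (Cmp C (mid g) (Cmp C (mid f) x)) = Cmp C (fst f) x"
  if "x \<in> Ar C" "Cod C x = Dom C (fst f)" for x
  using Cmp_reassoc1[OF e, of x] gf that by simp
 have "gap D u (snd (snd g)) (Pb1 D u (fst f)) (Cmp C (Cmp C (mid g) (mid f)) (Pb2 D u (fst f))) =
  Cmp C (gap D u (snd (snd g)) (Pb1 D u (fst g)) (Cmp C (mid g) (Pb2 D u (fst g))))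
   (gap D u (snd (snd f)) (Pb1 D u (fst f)) (Cmp C (mid f) (Pb2 D u (fst f))))"
  by (rule Pb_eqI[of u "snd (snd g)"]) (use gf u e e' in simp_all)
 then show "FAr (IRe DI u) (Cmp (FDom (IRe DI u)) g f) =
  Cmp (FCod (IRe DI u)) (FAr (IRe DI u) g) (FAr (IRe DI u) f)"
  using gf u m disp_re_Ar[OF u gf(1)] disp_re_Ar[OF u gf(2)] by simp
next
 fix f assume f: "f \<in> Ar (FDom (IRe DI u))"
 then show "FAr (IRe DI u) f \<in> Ar (FCod (IRe DI u)) \<and>
  Dom (FCod (IRe DI u)) (FAr (IRe DI u) f) =
   FOb (IRe DI u) (Dom (FDom (IRe DI u)) f) \<and>
  Cod (FCod (IRe DI u)) (FAr (IRe DI u) f) =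
   FOb (IRe DI u) (Cod (FDom (IRe DI u)) f)"
  using u disp_re_Ar[OF u, of f] by simp
next
 show "FOb (IRe DI u) \<in> extensional (Ob (FDom (IRe DI u)))"
  "FAr (IRe DI u) \<in> extensional (Ar (FDom (IRe DI u)))"
  using u by (simp_all add: disp_icat_def Let_def)
qed (use u in simp_all)

lemma disp_unit_Ar: 
 assumes "A \<in> Ob C" "p \<in> Disp D" "Cod C p = A"
 shows "IUnit DI A p \<in> Ar (Sl A)" "iso_arrow C (mid (IUnit DI A p))"
proof -
 show "IUnit DI A p \<in> Ar (Sl A)" by (subst slice_Ar) (use assms in simp)
 \<comment> \<open>The inverse is the second projection of the chosen pullback along the identity.
   This order of composition needs an argument; the other is \<open>Pb2_gap\<close>.\<close>
 have "Cmp C (gap D (Idn C A) p p (Idn C (Dom C p))) (Pb2 D (Idn C A) p) = Idn C (Dom C (Pb1 D (Idn C A) p))"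
 proof (rule Pb_eqI[of "Idn C A" p])
  have e: "Cmp C p (Pb2 D (Idn C A) p) = Pb1 D (Idn C A) p"
   using Pb_comm[of "Idn C A" p, symmetric] assms by (simp del: Pb_comm)
  show "Cmp C (Pb1 D (Idn C A) p) (Cmp C (gap D (Idn C A) p p (Idn C (Dom C p))) (Pb2 D (Idn C A) p)) =
   Cmp C (Pb1 D (Idn C A) p) (Idn C (Dom C (Pb1 D (Idn C A) p)))"
   using assms e by simp
 qed (use assms in simp_all)
 then show "iso_arrow C (mid (IUnit DI A p))"
  using assms by (simp, intro iso_arrowI[of C _ "Pb2 D (Idn C A) p"]) simp_all
qed

lemma disp_mult_Ar:
 assumes uv: "u \<in> Ar C" "v \<in> Ar C" "Dom C u = Cod C v" "p \<in> Disp D" "Cod C p = Cod C u"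
 shows "IMult DI u v p \<in> Ar (Sl (Dom C v))" "iso_arrow C (mid (IMult DI u v p))"
proof -
 have e: "Cmp C u (Cmp C v (Pb1 D v (Pb1 D u p))) = Cmp C p (Cmp C (Pb2 D u p) (Pb2 D v (Pb1 D u p)))"
  using uv by simp
 show "IMult DI u v p \<in> Ar (Sl (Dom C v))" by (subst slice_Ar) (use assms e in simp)
 have e2: "Cmp C u (Cmp C v (Pb1 D (Cmp C u v) p)) = Cmp C p (Pb2 D (Cmp C u v) p)"
  using Pb_comm[of "Cmp C u v" p] uv by (simp del: Pb_comm)
 have e3: "Cmp C u (Cmp C v (Cmp C (Pb1 D (Cmp C u v) p) z)) = Cmp C p (Cmp C (Pb2 D (Cmp C u v) p) z)"
  if "z \<in> Ar C" "Cod C z = Dom C (Pb1 D (Cmp C u v) p)" for z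
  using Pb_comm_assoc[of "Cmp C u v" p z] uv that by (simp del: Pb_comm_assoc)
 \<comment> \<open>The inverse of \<open>g\<close> is built in two stages: \<open>k\<close> goes
   from the pullback along the composite into the pullback along \<open>u\<close>, and
   \<open>j\<close> from there into the iterated pullback.\<close>
 define g where "g = gap D (Cmp C u v) p (Pb1 D v (Pb1 D u p)) (Cmp C (Pb2 D u p) (Pb2 D v (Pb1 D u p)))"
 define k where "k = gap D u p (Cmp C v (Pb1 D (Cmp C u v) p)) (Pb2 D (Cmp C u v) p)"
 have k [simp]: "k \<in> Ar C" "Dom C k = Dom C (Pb1 D (Cmp C u v) p)" "Cod C k = Dom C (Pb1 D u p)"
  "Cmp C (Pb1 D u p) k = Cmp C v (Pb1 D (Cmp C u v) p)" "Cmp C (Pb2 D u p) k = Pb2 D (Cmp C u v) p"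
  unfolding k_def using uv e2 by simp_all
 have g [simp]: "g \<in> Ar C" "Dom C g = Dom C (Pb1 D v (Pb1 D u p))" "Cod C g = Dom C (Pb1 D (Cmp C u v) p)"
  "Cmp C (Pb1 D (Cmp C u v) p) g = Pb1 D v (Pb1 D u p)"
  "Cmp C (Pb2 D (Cmp C u v) p) g = Cmp C (Pb2 D u p) (Pb2 D v (Pb1 D u p))"
  unfolding g_def using uv e by simp_all
 define j where "j = gap D v (Pb1 D u p) (Pb1 D (Cmp C u v) p) k"
 have j [simp]: "j \<in> Ar C" "Dom C j = Dom C (Pb1 D (Cmp C u v) p)" "Cod C j = Dom C (Pb1 D v (Pb1 D u p))"
  "Cmp C (Pb1 D v (Pb1 D u p)) j = Pb1 D (Cmp C u v) p" "Cmp C (Pb2 D v (Pb1 D u p)) j = k"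
  unfolding j_def using uv by simp_all
 have kg: "Cmp C k g = Pb2 D v (Pb1 D u p)"
  by (rule Pb_eqI[of u p]) (use uv in \<open>simp_all add: Cmp_reassoc1[OF k(5)] Cmp_reassoc[OF k(4)]\<close>)
 have jg: "Cmp C j g = Idn C (Dom C (Pb1 D v (Pb1 D u p)))"
  by (rule Pb_eqI[of v "Pb1 D u p"]) (use uv in \<open>simp_all add: Cmp_reassoc1[OF j(5)] Cmp_reassoc1[OF j(4)] kg\<close>)
 have gj: "Cmp C g j = Idn C (Dom C (Pb1 D (Cmp C u v) p))"
  by (rule Pb_eqI[of "Cmp C u v" p]) (use uv in \<open>simp_all add: Cmp_reassoc1[OF g(4)] Cmp_reassoc[OF g(5)]\<close>)
 have "iso_arrow C g" by (rule iso_arrowI[of _ _ j]) (use uv jg gj in simp_all)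
 then show "iso_arrow C (mid (IMult DI u v p))" using uv by (simp add: g_def)
qed

text \<open>Here and below the structural maps are described by their composites with the two
  pullback projections. With these rules available the explicit formulas are removed from
  simplification, and coherence is checked projection by projection.\<close>

lemma
 assumes "A \<in> Ob C" "p \<in> Disp D" "Cod C p = A"
 shows unit_fst [simp]: "fst (IUnit DI A p) = p"
  and unit_snd [simp]: "snd (snd (IUnit DI A p)) = Pb1 D (Idn C A) p"
  and unit_mid [simp]: "mid (IUnit DI A p) \<in> Ar C"
   "Dom C (mid (IUnit DI A p)) = Dom C p"
   "Cod C (mid (IUnit DI A p)) = Dom C (Pb1 D (Idn C A) p)"
   "Cmp C (Pb1 D (Idn C A) p) (mid (IUnit DI A p)) = p"
   "Cmp C (Pb2 D (Idn C A) p) (mid (IUnit DI A p)) = Idn C (Dom C p)"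
 using assms by simp_all

lemma
 assumes "A \<in> Ob C" "p \<in> Disp D" "Cod C p = A" "z \<in> Ar C" "Cod C z = Dom C p"
 shows unit_mid_assoc [simp]:
   "Cmp C (Pb1 D (Idn C A) p) (Cmp C (mid (IUnit DI A p)) z) = Cmp C p z"
   "Cmp C (Pb2 D (Idn C A) p) (Cmp C (mid (IUnit DI A p)) z) = z"
 using assms by simp_all

lemma mult_comm:
 assumes "u \<in> Ar C" "v \<in> Ar C" "Dom C u = Cod C v" "p \<in> Disp D" "Cod C p = Cod C u"
 shows "Cmp C (Cmp C u v) (Pb1 D v (Pb1 D u p)) = Cmp C p (Cmp C (Pb2 D u p) (Pb2 D v (Pb1 D u p)))"
 using assms by simp

lemma
 assumes "u \<in> Ar C" "v \<in> Ar C" "Dom C u = Cod C v" "p \<in> Disp D" "Cod C p = Cod C u"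
 shows mult_fst [simp]: "fst (IMult DI u v p) = Pb1 D v (Pb1 D u p)"
  and mult_snd [simp]: "snd (snd (IMult DI u v p)) = Pb1 D (Cmp C u v) p"
  and mult_mid [simp]: "mid (IMult DI u v p) \<in> Ar C"
   "Dom C (mid (IMult DI u v p)) = Dom C (Pb1 D v (Pb1 D u p))"
   "Cod C (mid (IMult DI u v p)) = Dom C (Pb1 D (Cmp C u v) p)"
  and mult_Pb [simp]: "w = Cmp C u v ==>
    Cmp C (Pb1 D w p) (mid (IMult DI u v p)) = Pb1 D v (Pb1 D u p)"
   "w = Cmp C u v ==> Cmp C (Pb2 D w p) (mid (IMult DI u v p)) =
    Cmp C (Pb2 D u p) (Pb2 D v (Pb1 D u p))"
 using assms mult_comm[OF assms] by simp_all

lemma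
 assumes "u \<in> Ar C" "v \<in> Ar C" "Dom C u = Cod C v" "p \<in> Disp D" "Cod C p = Cod C u" "z \<in> Ar C"
  "Cod C z = Dom C (Pb1 D v (Pb1 D u p))" "w = Cmp C u v"
 shows mult_Pb_assoc [simp]: "Cmp C (Pb1 D w p) (Cmp C (mid (IMult DI u v p)) z) =
    Cmp C (Pb1 D v (Pb1 D u p)) z"
   "Cmp C (Pb2 D w p) (Cmp C (mid (IMult DI u v p)) z) =
    Cmp C (Pb2 D u p) (Cmp C (Pb2 D v (Pb1 D u p)) z)"
proof -
 note m = mult_Pb[OF assms(1-5,8)] 
 show "Cmp C (Pb1 D w p) (Cmp C (mid (IMult DI u v p)) z) = Cmp C (Pb1 D v (Pb1 D u p)) z"
  by (rule Cmp_reassoc1[OF m(1)]) (use assms(1-7) in \<open>simp_all add: assms(8) del: disp_mult_simp\<close>)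
 show "Cmp C (Pb2 D w p) (Cmp C (mid (IMult DI u v p)) z) =
    Cmp C (Pb2 D u p) (Cmp C (Pb2 D v (Pb1 D u p)) z)"
  by (rule Cmp_reassoc[OF m(2)]) (use assms(1-7) in \<open>simp_all add: assms(8) del: disp_mult_simp\<close>)
qed

lemma
 assumes "u \<in> Ar C" "t \<in> Ar (Sl (Cod C u))"
 shows re_fst [simp]: "fst (FAr (IRe DI u) t) = Pb1 D u (fst t)"
  and re_snd [simp]: "snd (snd (FAr (IRe DI u) t)) = Pb1 D u (snd (snd t))"
  and re_mid [simp]: "mid (FAr (IRe DI u) t) \<in> Ar C"
   "Dom C (mid (FAr (IRe DI u) t)) = Dom C (Pb1 D u (fst t))"
   "Cod C (mid (FAr (IRe DI u) t)) = Dom C (Pb1 D u (snd (snd t)))"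
  and re_Pb [simp]: "snd (snd t) = q ==>
    Cmp C (Pb1 D u q) (mid (FAr (IRe DI u) t)) = Pb1 D u (fst t)"
   "snd (snd t) = q ==>
    Cmp C (Pb2 D u q) (mid (FAr (IRe DI u) t)) = Cmp C (mid t) (Pb2 D u (fst t))"
 using assms by auto

lemma
 assumes "u \<in> Ar C" "t \<in> Ar (Sl (Cod C u))" "z \<in> Ar C" "Cod C z = Dom C (Pb1 D u (fst t))"
  "snd (snd t) = q"
 shows re_Pb_assoc [simp]: "Cmp C (Pb1 D u q) (Cmp C (mid (FAr (IRe DI u) t)) z) = Cmp C (Pb1 D u (fst t)) z"
   "Cmp C (Pb2 D u q) (Cmp C (mid (FAr (IRe DI u) t)) z) = Cmp C (mid t) (Cmp C (Pb2 D u (fst t)) z)"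
proof -
 note q = assms(5)[symmetric]
 note m = re_Pb[OF assms(1,2,5)]
 show "Cmp C (Pb1 D u q) (Cmp C (mid (FAr (IRe DI u) t)) z) = Cmp C (Pb1 D u (fst t)) z"
  by (rule Cmp_reassoc1[OF m(1)]) (use assms(1-4) in \<open>simp_all add: q del: disp_re_simps(4)\<close>)
 show "Cmp C (Pb2 D u q) (Cmp C (mid (FAr (IRe DI u) t)) z) = Cmp C (mid t) (Cmp C (Pb2 D u (fst t)) z)"
  by (rule Cmp_reassoc[OF m(2)]) (use assms(1-4) in \<open>simp_all add: q del: disp_re_simps(4)\<close>)
qed

declare disp_unit_simp [simp del] disp_mult_simp [simp del] disp_re_simps(4) [simp del]

lemma slice_Cmp_Ar: "s \<in> Ar (Sl A) ==> t \<in> Ar (Sl A) ==> fst s = snd (snd t) ==>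
  Cmp (Sl A) s t \<in> Ar (Sl A)"
 by (rule Cmp_Ar) simp_all

lemma slice_Idn_Ar: "p \<in> Disp D ==> Cod C p = A ==> Idn (Sl A) p \<in> Ar (Sl A)"
 by (rule Idn_Ar) simp_all

lemma disp_unit_nat: "A \<in> Ob C ==>
  nat_iso (id_func (Sl A)) (IRe DI (Idn C A)) (IUnit DI A)"
proof (intro nat_isoI nat_transI)
 assume A: "A \<in> Ob C"
 show "functor (id_func (Sl A))" "functor (IRe DI (Idn C A))"
  "FDom (id_func (Sl A)) = FDom (IRe DI (Idn C A))"
  "FCod (id_func (Sl A)) = FCod (IRe DI (Idn C A))"
  using A disp_re_functor[of "Idn C A"] by simp_all
 show "IUnit DI A \<in> extensional (Ob (FDom (id_func (Sl A))))"
  using A by (simp add: disp_icat_def Let_def)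
 fix x assume "x \<in> Ob (FDom (id_func (Sl A)))"
 then have x: "x \<in> Disp D" "Cod C x = A" by simp_all
 note i = disp_unit_Ar[OF A x]
 show "IUnit DI A x \<in> Ar (FCod (id_func (Sl A))) \<and>
  Dom (FCod (id_func (Sl A))) (IUnit DI A x) = FOb (id_func (Sl A)) x \<and>
  Cod (FCod (id_func (Sl A))) (IUnit DI A x) = FOb (IRe DI (Idn C A)) x"
  using i(1) x A by simp
 show "iso_arrow (FCod (id_func (Sl A))) (IUnit DI A x)"
  using slice_iso[OF i] by simp
next
 fix t assume A: "A \<in> Ob C" and "t \<in> Ar (FDom (id_func (Sl A)))"
 then have t: "t \<in> Ar (Sl A)" by simp
 then have ft: "fst t \<in> Disp D" "Cod C (fst t) = A" "snd (snd t) \<in> Disp D" "Cod C (snd (snd t)) = A"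
  by simp_all
 let ?S = "Sl A"
 note m = disp_unit_Ar(1)[OF A ft(1,2)] disp_unit_Ar(1)[OF A ft(3,4)] disp_re_Ar[of "Idn C A" t]
 have "Cmp ?S (IUnit DI A (snd (snd t))) t = Cmp ?S (FAr (IRe DI (Idn C A)) t) (IUnit DI A (fst t))"
 proof (rule slice_eqI)
  show "mid (Cmp ?S (IUnit DI A (snd (snd t))) t) =
   mid (Cmp ?S (FAr (IRe DI (Idn C A)) t) (IUnit DI A (fst t)))"
   using A t ft m by - (simp, rule Pb_eqI[of "Idn C A" "snd (snd t)"], simp_all)
 qed (use A t ft m in simp_all)
 then show "Cmp (FCod (id_func ?S)) (IUnit DI A (Cod (FDom (id_func ?S)) t)) (FAr (id_func ?S) t) =
  Cmp (FCod (id_func ?S)) (FAr (IRe DI (Idn C A)) t) (IUnit DI A (Dom (FDom (id_func ?S)) t))"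
  using t by simp
qed

lemma disp_mult_nat:
 assumes uv: "u \<in> Ar C" "v \<in> Ar C" "Dom C u = Cod C v"
 shows "nat_iso (comp_func (IRe DI v) (IRe DI u)) (IRe DI (Cmp C u v))
  (IMult DI u v)" (is "nat_iso ?F ?G ?m")
proof (intro nat_isoI nat_transI)
 let ?S = "Sl (Cod C u)" and ?R = "Sl (Dom C v)"
 note f = disp_re_functor[OF uv(1)] disp_re_functor[OF uv(2)]
 show F: "functor ?F" "functor ?G" "FDom ?F = FDom ?G" "FCod ?F = FCod ?G"
  using uv f disp_re_functor[of "Cmp C u v"] by simp_all
 show "?m \<in> extensional (Ob (FDom ?F))"
  using uv by (simp add: disp_icat_def Let_def)
 fix x assume "x \<in> Ob (FDom ?F)"
 then have x: "x \<in> Disp D" "Cod C x = Cod C u" using uv by simp_all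
 note i = disp_mult_Ar[OF uv x]
 show "?m x \<in> Ar (FCod ?F) \<and> Dom (FCod ?F) (?m x) = FOb ?F x \<and> Cod (FCod ?F) (?m x) = FOb ?G x"
  using i(1) x uv by simp
 show "iso_arrow (FCod ?F) (?m x)"
  using slice_iso[OF i] uv by simp
next
 let ?S = "Sl (Cod C u)" and ?R = "Sl (Dom C v)"
 fix t assume "t \<in> Ar (FDom ?F)"
 then have t: "t \<in> Ar ?S" using uv by simp
 then have ft: "fst t \<in> Disp D" "Cod C (fst t) = Cod C u" "snd (snd t) \<in> Disp D" "Cod C (snd (snd t)) = Cod C u"
  by simp_all
 have ut: "FAr (IRe DI u) t \<in> Ar (Sl (Cod C v))" using disp_re_Ar[of u t] uv t by simp
 have vut: "FAr (IRe DI v) (FAr (IRe DI u) t) \<in> Ar ?R"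
  using disp_re_Ar[OF uv(2) ut] .
 have uvt: "FAr (IRe DI (Cmp C u v)) t \<in> Ar ?R" using disp_re_Ar[of "Cmp C u v" t] uv t by simp
 note m = disp_mult_Ar(1)[OF uv ft(1,2)] disp_mult_Ar(1)[OF uv ft(3,4)] ut vut uvt
 have t': "t \<in> Ar (Sl (Cod C (Cmp C u v)))" using t uv by simp
 have "Cmp ?R (?m (snd (snd t))) (FAr (IRe DI v) (FAr (IRe DI u) t)) =
  Cmp ?R (FAr (IRe DI (Cmp C u v)) t) (?m (fst t))"
 proof (rule slice_eqI)
  show "mid (Cmp ?R (?m (snd (snd t))) (FAr (IRe DI v) (FAr (IRe DI u) t))) =
   mid (Cmp ?R (FAr (IRe DI (Cmp C u v)) t) (?m (fst t)))"
   using uv t t' ft m by - (simp, rule Pb_eqI[of "Cmp C u v" "snd (snd t)"], simp_all)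
 qed (use uv t t' ft m in simp_all)
 then show "Cmp (FCod ?F) (?m (Cod (FDom ?F) t)) (FAr ?F t) = Cmp (FCod ?F) (FAr ?G t) (?m (Dom (FDom ?F) t))"
  using uv t by simp
qed

text \<open>Every coherence law equates two maps into a chosen pullback over the base, so by
  \<open>Pb_eqI\<close> it suffices to compare them after both projections.\<close>

lemma disp_indexed: "indexed_category DI"
proof (rule indexed_category.intro, unfold disp_icat_simps(1))
 show "category C" by (rule cat)
 show "IFib DI \<in> extensional (Ob C)" "IRe DI \<in> extensional (Ar C)"
  "IUnit DI \<in> extensional (Ob C)"
  by (simp_all add: disp_icat_def Let_def)
 show "category (IFib DI a)" if "a \<in> Ob C" for a using that by simp
 show "IRe DI u \<in> functors (IFib DI b) (IFib DI a)"
  if "u \<in> hom C a b" for u a b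
  using that disp_re_functor[of u] by (auto simp: hom_iff functors_iff)
 show "nat_iso (id_func (IFib DI a)) (IRe DI (Idn C a)) (IUnit DI a)"
  if "a \<in> Ob C" for a using that disp_unit_nat by simp
 show "IMult DI u v = undefined" if "\<not> composable C u v" for u v
  using that by (simp add: disp_icat_def Let_def)
 show "nat_iso (comp_func (IRe DI v) (IRe DI u)) (IRe DI (Cmp C u v))
  (IMult DI u v)" if "composable C u v" for u v
  using that disp_mult_nat by (simp add: composable_def)
next
 fix u a b x assume u: "u \<in> hom C a b" and x: "x \<in> Ob (IFib DI b)"
 then have u: "u \<in> Ar C" "Dom C u = a" "Cod C u = b" and ab: "a \<in> Ob C" "b \<in> Ob C" by (auto simp: hom_iff)
 then have x: "x \<in> Disp D" "Cod C x = b" using x by simp_all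
 have x1: "Pb1 D u x \<in> Disp D" "Cod C (Pb1 D u x) = a" using u x by simp_all
 let ?S = "Sl a"
 have m: "IMult DI u (Idn C a) x \<in> Ar ?S" "IUnit DI a (Pb1 D u x) \<in> Ar ?S"
  using disp_mult_Ar(1)[of u "Idn C a" x] disp_unit_Ar(1)[OF ab(1) x1] u x ab by simp_all
 have "Cmp ?S (IMult DI u (Idn C a) x) (IUnit DI a (Pb1 D u x)) = Idn ?S (Pb1 D u x)"
 proof (rule slice_eqI)
  show "mid (Cmp ?S (IMult DI u (Idn C a) x) (IUnit DI a (Pb1 D u x))) = mid (Idn ?S (Pb1 D u x))"
   using u x x1 m ab by - (simp, rule Pb_eqI[of u x], simp_all)
 qed (use u x x1 m ab in simp_all)
 then show "Cmp (IFib DI a) (IMult DI u (Idn C a) x)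
    (IUnit DI a (FOb (IRe DI u) x)) =
    Idn (IFib DI a) (FOb (IRe DI u) x)"
  using u x ab by simp
 have un: "IUnit DI b x \<in> Ar (Sl (Cod C u))" using disp_unit_Ar(1)[OF ab(2) x] u by simp
 have m: "IMult DI (Idn C b) u x \<in> Ar ?S" "FAr (IRe DI u) (IUnit DI b x) \<in> Ar ?S"
  using disp_mult_Ar(1)[of "Idn C b" u x] disp_re_Ar[OF u(1) un] u x ab by simp_all
 have "Cmp ?S (IMult DI (Idn C b) u x) (FAr (IRe DI u) (IUnit DI b x)) = Idn ?S (Pb1 D u x)"
 proof (rule slice_eqI)
  show "mid (Cmp ?S (IMult DI (Idn C b) u x) (FAr (IRe DI u) (IUnit DI b x))) =
   mid (Idn ?S (Pb1 D u x))"
   using u x x1 m un ab by - (simp, rule Pb_eqI[of u x], simp_all)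
 qed (use u x x1 m un ab in simp_all)
 then show "Cmp (IFib DI a) (IMult DI (Idn C b) u x)
    (FAr (IRe DI u) (IUnit DI b x)) =
    Idn (IFib DI a) (FOb (IRe DI u) x)"
  using u x ab by simp
next
 fix w v u a b c d x assume h: "w \<in> hom C a b" "v \<in> hom C b c" "u \<in> hom C c d" and x: "x \<in> Ob (IFib DI d)"
 have u: "u \<in> Ar C" "v \<in> Ar C" "w \<in> Ar C" "Dom C u = c" "Cod C u = d" "Dom C v = b" "Cod C v = c"
  "Dom C w = a" "Cod C w = b"
  and ab: "a \<in> Ob C" "b \<in> Ob C" "c \<in> Ob C" "d \<in> Ob C" using h by (auto simp: hom_iff)
 then have x: "x \<in> Disp D" "Cod C x = d" using x by simp_all
 let ?S = "Sl a"
 have um: "IMult DI u v x \<in> Ar (Sl (Cod C w))" 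
  using disp_mult_Ar(1)[of u v x] u x by simp
 have m: "IMult DI u (Cmp C v w) x \<in> Ar ?S" "IMult DI v w (Pb1 D u x) \<in> Ar ?S"
  "IMult DI (Cmp C u v) w x \<in> Ar ?S" "FAr (IRe DI w) (IMult DI u v x) \<in> Ar ?S"
  using disp_mult_Ar(1)[of u "Cmp C v w" x] disp_mult_Ar(1)[of v w "Pb1 D u x"]
   disp_mult_Ar(1)[of "Cmp C u v" w x] disp_re_Ar[OF u(3) um] u x by simp_all
 have "Cmp ?S (IMult DI u (Cmp C v w) x) (IMult DI v w (Pb1 D u x)) =
  Cmp ?S (IMult DI (Cmp C u v) w x) (FAr (IRe DI w) (IMult DI u v x))"
 proof (rule slice_eqI)
  show "mid (Cmp ?S (IMult DI u (Cmp C v w) x) (IMult DI v w (Pb1 D u x))) =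
   mid (Cmp ?S (IMult DI (Cmp C u v) w x) (FAr (IRe DI w) (IMult DI u v x)))"
   using u x um m by - (simp, rule Pb_eqI[of "Cmp C u (Cmp C v w)" x], simp_all)
 qed (use u x m um in simp_all)
 then show "Cmp (IFib DI a) (IMult DI u (Cmp C v w) x)
    (IMult DI v w (FOb (IRe DI u) x)) =
    Cmp (IFib DI a) (IMult DI (Cmp C u v) w x)
    (FAr (IRe DI w) (IMult DI u v x))"
  using u x ab by simp
qed

end

section \<open>Indexed categories\<close>

lemma pull_icat_simps [simp]:
 "IBase (pull_icat F Q) = FDom F" "a \<in> Ob (FDom F) ==> IFib (pull_icat F Q) a = IFib Q (FOb F a)"
 "u \<in> Ar (FDom F) ==> IRe (pull_icat F Q) u = IRe Q (FAr F u)"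
 "a \<in> Ob (FDom F) ==> IUnit (pull_icat F Q) a = IUnit Q (FOb F a)"
 "u \<in> Ar (FDom F) ==> v \<in> Ar (FDom F) ==> Dom (FDom F) u = Cod (FDom F) v ==>
  IMult (pull_icat F Q) u v = IMult Q (FAr F u) (FAr F v)"
 by (simp_all add: pull_icat_def compose_def)

lemma pull_indexed:
 assumes F: "functor F" "FCod F = IBase Q" and Q: "indexed_category Q"
 shows "indexed_category (pull_icat F Q)"
proof (rule indexed_category.intro, unfold pull_icat_simps(1))
 interpret Q: indexed_category Q by (rule Q)
 have c: "category (FDom F)" "category (IBase Q)" using F Q.IBase_category by simp_all
 show "category (FDom F)" by (rule c)
 show "IFib (pull_icat F Q) \<in> extensional (Ob (FDom F))" "IRe (pull_icat F Q) \<in> extensional (Ar (FDom F))"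
  "IUnit (pull_icat F Q) \<in> extensional (Ob (FDom F))"
  by (simp_all add: pull_icat_def)
 show "category (IFib (pull_icat F Q) a)" if "a \<in> Ob (FDom F)" for a using that F Q.IFib_category by simp
 show "IRe (pull_icat F Q) u \<in> functors (IFib (pull_icat F Q) b) (IFib (pull_icat F Q) a)"
  if "u \<in> hom (FDom F) a b" for u a b
  using that Q.IRe_functor[of "FAr F u"] F c by (auto simp: hom_iff)
 show "nat_iso (id_func (IFib (pull_icat F Q) a)) (IRe (pull_icat F Q) (Idn (FDom F) a)) (IUnit (pull_icat F Q) a)"
  if "a \<in> Ob (FDom F)" for a using that Q.IUnit_iso[of "FOb F a"] F c by simp
 show "IMult (pull_icat F Q) u v = undefined" if "\<not> composable (FDom F) u v" for u v
  using that by (simp add: pull_icat_def)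
 show "nat_iso (comp_func (IRe (pull_icat F Q) v) (IRe (pull_icat F Q) u)) (IRe (pull_icat F Q) (Cmp (FDom F) u v))
  (IMult (pull_icat F Q) u v)" if "composable (FDom F) u v" for u v
  using that Q.IMult_iso[of "FAr F u" "FAr F v"] F c by (auto simp: composable_def)
 show "Cmp (IFib (pull_icat F Q) a) (IMult (pull_icat F Q) u (Idn (FDom F) a) x)
   (IUnit (pull_icat F Q) a (FOb (IRe (pull_icat F Q) u) x)) =
   Idn (IFib (pull_icat F Q) a) (FOb (IRe (pull_icat F Q) u) x)"
  "Cmp (IFib (pull_icat F Q) a) (IMult (pull_icat F Q) (Idn (FDom F) b) u x)
   (FAr (IRe (pull_icat F Q) u) (IUnit (pull_icat F Q) b x)) =
   Idn (IFib (pull_icat F Q) a) (FOb (IRe (pull_icat F Q) u) x)"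
  if "u \<in> hom (FDom F) a b" "x \<in> Ob (IFib (pull_icat F Q) b)" for u a b x
  using that Q.IUnit_right[of "FAr F u" "FOb F a" "FOb F b" x]
   Q.IUnit_left[of "FAr F u" "FOb F a" "FOb F b" x] F c by (auto simp: hom_iff)
 show "Cmp (IFib (pull_icat F Q) a) (IMult (pull_icat F Q) u (Cmp (FDom F) v w) x)
   (IMult (pull_icat F Q) v w (FOb (IRe (pull_icat F Q) u) x)) =
   Cmp (IFib (pull_icat F Q) a) (IMult (pull_icat F Q) (Cmp (FDom F) u v) w x)
   (FAr (IRe (pull_icat F Q) w) (IMult (pull_icat F Q) u v x))"
  if "w \<in> hom (FDom F) a b" "v \<in> hom (FDom F) b c" "u \<in> hom (FDom F) c d" "x \<in> Ob (IFib (pull_icat F Q) d)"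
  for u v w a b c d x
  using that Q.IMult_assoc[of "FAr F w" "FOb F a" "FOb F b" "FAr F v" "FOb F c" "FAr F u" "FOb F d" x] F c
  by (auto simp: hom_iff)
qed

lemma pull_strict:
 assumes F: "functor F" "FCod F = IBase Q" and Q: "strict_indexed_category Q"
 shows "strict_indexed_category (pull_icat F Q)"
proof -
 interpret Q: strict_indexed_category Q by (rule Q)
 have c: "category (FDom F)" "category (IBase Q)" using F Q.IBase_category by simp_all
 show ?thesis
 proof (intro strict_indexed_category.intro strict_indexed_category_axioms.intro, unfold pull_icat_simps(1))
  show "indexed_category (pull_icat F Q)" by (rule pull_indexed[OF F Q.indexed_category_axioms])
  show "IRe (pull_icat F Q) (Idn (FDom F) a) = id_func (IFib (pull_icat F Q) a)" if "a \<in> Ob (FDom F)" for a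
   using that Q.IRe_Idn F c by simp
  show "IUnit (pull_icat F Q) a x = Idn (IFib (pull_icat F Q) a) x"
   if "a \<in> Ob (FDom F)" "x \<in> Ob (IFib (pull_icat F Q) a)" for a x
   using that Q.IUnit_Idn F c by simp
  show "IRe (pull_icat F Q) (Cmp (FDom F) u v) = comp_func (IRe (pull_icat F Q) v) (IRe (pull_icat F Q) u)"
   if "composable (FDom F) u v" for u v
   using that Q.IRe_Cmp[of "FAr F u" "FAr F v"] F c by (auto simp: composable_def)
  show "IMult (pull_icat F Q) u v x = Idn (IFib (pull_icat F Q) a) (FOb (IRe (pull_icat F Q) (Cmp (FDom F) u v)) x)"
   if "v \<in> hom (FDom F) a b" "u \<in> hom (FDom F) b c" "x \<in> Ob (IFib (pull_icat F Q) c)" for u v a b c x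
   using that Q.IMult_Idn[of "FAr F v" "FOb F a" "FOb F b" "FAr F u" "FOb F c" x] F c by (auto simp: hom_iff)
 qed
qed

text \<open>Base change must be strictly functorial, because domains and codomains of indexed
  functors are compared as records. All fields being extensional, agreement on the intended domains
  is enough.\<close>

lemma icat_eqI:
 assumes "indexed_category P" "indexed_category Q" "IBase P = IBase Q"
  "\<And>a. a \<in> Ob (IBase Q) ==> IFib P a = IFib Q a" "\<And>u. u \<in> Ar (IBase Q) ==> IRe P u = IRe Q u"
  "\<And>a. a \<in> Ob (IBase Q) ==> IUnit P a = IUnit Q a"
  "\<And>u v. u \<in> Ar (IBase Q) ==> v \<in> Ar (IBase Q) ==> Dom (IBase Q) u = Cod (IBase Q) v ==> IMult P u v = IMult Q u v"
 shows "P = Q"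
proof -
 interpret P: indexed_category P by (rule assms(1))
 interpret Q: indexed_category Q by (rule assms(2))
 have "IFib P = IFib Q" "IRe P = IRe Q" "IUnit P = IUnit Q"
  using assms(3-6) P.IFib_ext P.IRe_ext P.IUnit_ext Q.IFib_ext Q.IRe_ext Q.IUnit_ext
  by (metis extensionalityI)+
 moreover have "IMult P u v = IMult Q u v" for u v
  using assms(3,7) P.IMult_ext[of u v] Q.IMult_ext[of u v] by (cases "composable (IBase Q) u v") (auto simp: composable_def)
 ultimately show ?thesis using assms(3) by (intro icat.equality ext) auto
qed

lemma pull_id: "indexed_category Q ==> IBase Q = B ==> pull_icat (id_func B) Q = Q"
 by (rule icat_eqI) (auto intro!: pull_indexed simp: indexed_category.IBase_category)

lemma pull_comp:
 assumes "indexed_category Q" "functor F" "functor G" "FCod F = FDom G" "FCod G = IBase Q"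
 shows "pull_icat (comp_func G F) Q = pull_icat F (pull_icat G Q)"
proof -
 have c: "category (FDom F)" "category (FDom G)" using assms by simp_all
 have "indexed_category (pull_icat (comp_func G F) Q)" "indexed_category (pull_icat F (pull_icat G Q))"
  using assms by (auto intro!: pull_indexed)
 then show ?thesis by (rule icat_eqI) (use assms c in simp_all)
qed

section \<open>Equivalences of categories\<close>

definition faithful_functor :: "('o, 'a, 'p, 'b) func => bool" where
 "faithful_functor F \<longleftrightarrow> (\<forall>f g. f \<in> Ar (FDom F) --> g \<in> Ar (FDom F) -->
  Dom (FDom F) f = Dom (FDom F) g --> Cod (FDom F) f = Cod (FDom F) g --> FAr F f = FAr F g --> f = g)"

definition full_functor :: "('o, 'a, 'p, 'b) func => bool" where
 "full_functor F \<longleftrightarrow> (\<forall>x y h. x \<in> Ob (FDom F) --> y \<in> Ob (FDom F) --> h \<in> Ar (FCod F) -->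
  Dom (FCod F) h = FOb F x --> Cod (FCod F) h = FOb F y -->
  (\<exists>f. f \<in> Ar (FDom F) \<and> Dom (FDom F) f = x \<and> Cod (FDom F) f = y \<and> FAr F f = h))"

definition eso_functor :: "('o, 'a, 'p, 'b) func => bool" where
 "eso_functor F \<longleftrightarrow> (\<forall>y \<in> Ob (FCod F). \<exists>x \<in> Ob (FDom F). \<exists>i. iso_arrow (FCod F) i \<and>
  Dom (FCod F) i = FOb F x \<and> Cod (FCod F) i = y)"

lemma faithful_functorD: "faithful_functor F ==> f \<in> Ar (FDom F) ==> g \<in> Ar (FDom F) ==>
  Dom (FDom F) f = Dom (FDom F) g ==> Cod (FDom F) f = Cod (FDom F) g ==> FAr F f = FAr F g ==> f = g"
 by (simp add: faithful_functor_def)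

text \<open>Naturality of \<open>s\<close> recovers \<open>f\<close> from \<open>G (F f)\<close>,
  since the components of \<open>s\<close> are invertible.\<close>

lemma faithful_of_nat_iso:
 assumes s: "nat_iso (id_func (FDom F)) (comp_func G F) s" and F: "functor F" and G: "functor G"
  and e: "FDom G = FCod F" "FCod G = FDom F"
 shows "faithful_functor F"
 unfolding faithful_functor_def
proof (intro allI impI)
 let ?C = "FDom F"
 fix f g assume a: "f \<in> Ar ?C" "g \<in> Ar ?C" "Dom ?C f = Dom ?C g" "Cod ?C f = Cod ?C g" "FAr F f = FAr F g"
 have c: "category ?C" using F by simp
 have s': "nat_trans (id_func ?C) (comp_func G F) s" and iso: "\<And>x. x \<in> Ob ?C ==> iso_arrow ?C (s x)"
  using s by (simp_all add: nat_iso_def)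
 have d: "Dom ?C (s x) = x" if "x \<in> Ob ?C" for x using nat_trans_Dom[OF s', of x] that by simp
 show "f = g"
  by (rule iso_cancel_left[of ?C "s (Cod ?C g)"])
   (use nat_trans_nat[OF s', of f] nat_trans_nat[OF s', of g] a c iso d in simp_all)
qed

lemma equivalence_faithful: "equivalence_functor F ==> faithful_functor F"
 unfolding equivalence_functor_def by (auto simp: functors_iff intro: faithful_of_nat_iso)

lemma faithful_of_nat_iso':
 assumes t: "nat_iso (comp_func F G) (id_func (FCod F)) t" and F: "functor F" and G: "functor G"
  and e: "FDom G = FCod F" "FCod G = FDom F"
 shows "faithful_functor G"
 unfolding faithful_functor_def
proof (intro allI impI)
 let ?D = "FDom G"
 fix f g assume a: "f \<in> Ar ?D" "g \<in> Ar ?D" "Dom ?D f = Dom ?D g" "Cod ?D f = Cod ?D g" "FAr G f = FAr G g"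
 have c: "category ?D" using G by simp
 have t': "nat_trans (comp_func F G) (id_func ?D) t" and iso: "\<And>x. x \<in> Ob ?D ==> iso_arrow ?D (t x)"
  using t e by (auto simp: nat_iso_def)
 have d: "Cod ?D (t x) = x" if "x \<in> Ob ?D" for x using nat_trans_Cod[OF t', of x] that e by simp
 show "f = g"
  by (rule iso_cancel_right[of ?D "t (Dom ?D g)"])
   (use nat_trans_nat[OF t', of f] nat_trans_nat[OF t', of g] a c iso d e in simp_all)
qed

lemma equivalence_functorE:
 assumes "equivalence_functor F"
 obtains G s t where "functor G" "FDom G = FCod F" "FCod G = FDom F" "functor F"
  "nat_iso (id_func (FDom F)) (comp_func G F) s" "nat_iso (comp_func F G) (id_func (FCod F)) t"
proof -
 from assms obtain G where "functor F" "G \<in> functors (FCod F) (FDom F)"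
  "\<exists>s. nat_iso (id_func (FDom F)) (comp_func G F) s" "\<exists>t. nat_iso (comp_func F G) (id_func (FCod F)) t"
  unfolding equivalence_functor_def by metis
 then show thesis using that by (auto simp: functors_iff)
qed

text \<open>Conjugating \<open>G h\<close> with the unit gives an arrow \<open>f\<close> such that
  \<open>F f\<close> and \<open>h\<close> have the same image under \<open>G\<close>; the counit
  makes \<open>G\<close> faithful.\<close>

lemma equivalence_full:
 assumes "equivalence_functor F"
 shows "full_functor F"
 unfolding full_functor_def
proof (intro allI impI)
 let ?C = "FDom F" and ?D = "FCod F"
 fix x y h assume a: "x \<in> Ob ?C" "y \<in> Ob ?C" "h \<in> Ar ?D" "Dom ?D h = FOb F x" "Cod ?D h = FOb F y"
 obtain G s t where G: "functor G" "FDom G = ?D" "FCod G = ?C" and F: "functor F"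
  and s: "nat_iso (id_func ?C) (comp_func G F) s" and t: "nat_iso (comp_func F G) (id_func ?D) t"
  using assms by (rule equivalence_functorE)
 have c: "category ?C" "category ?D" using F by simp_all
 have s': "nat_trans (id_func ?C) (comp_func G F) s" and iso: "\<And>x. x \<in> Ob ?C ==> iso_arrow ?C (s x)"
  using s by (simp_all add: nat_iso_def)
 have d: "Dom ?C (s x) = x" "Cod ?C (s x) = FOb G (FOb F x)" if "x \<in> Ob ?C" for x
  using nat_trans_Dom[OF s', of x] nat_trans_Cod[OF s', of x] that by simp_all
 define f where "f = Cmp ?C (inv_arrow ?C (s y)) (Cmp ?C (FAr G h) (s x))"
 have f: "f \<in> Ar ?C" "Dom ?C f = x" "Cod ?C f = y" using a c G d iso by (simp_all add: f_def)
 have "Cmp ?C (s y) f = Cmp ?C (FAr G h) (s x)" using a c G d iso by (simp add: f_def)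
 moreover have "Cmp ?C (s y) f = Cmp ?C (FAr G (FAr F f)) (s x)" using nat_trans_nat[OF s', of f] f by simp
 ultimately have "FAr G (FAr F f) = FAr G h"
  by - (rule iso_cancel_right[of ?C "s x"], use a c G d iso f F in simp_all)
 then have "FAr F f = h"
  using faithful_functorD[OF faithful_of_nat_iso'[OF t F G], of "FAr F f" h] f a F G by simp
 then show "\<exists>f. f \<in> Ar ?C \<and> Dom ?C f = x \<and> Cod ?C f = y \<and> FAr F f = h" using f by blast
qed

lemma equivalence_eso:
 assumes "equivalence_functor F"
 shows "eso_functor F"
 unfolding eso_functor_def
proof
 fix y assume y: "y \<in> Ob (FCod F)"
 obtain G s t where G: "functor G" "FDom G = FCod F" "FCod G = FDom F" and F: "functor F"
  and s: "nat_iso (id_func (FDom F)) (comp_func G F) s" and t: "nat_iso (comp_func F G) (id_func (FCod F)) t"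
  using assms by (rule equivalence_functorE)
 then have "iso_arrow (FCod F) (t y)" "Dom (FCod F) (t y) = FOb F (FOb G y)" "Cod (FCod F) (t y) = y"
  using y nat_trans_Dom[of "comp_func F G" _ t y] nat_trans_Cod[of "comp_func F G" _ t y]
  by (auto simp: nat_iso_def)
 then show "\<exists>x \<in> Ob (FDom F). \<exists>i. iso_arrow (FCod F) i \<and> Dom (FCod F) i = FOb F x \<and> Cod (FCod F) i = y"
  using G y by (intro bexI[of _ "FOb G y"]) auto
qed

text \<open>The definition of equivalence asks for an inverse functor. It is chosen on objects by
  essential surjectivity and on arrows by fullness; its laws and the naturality of the unit are
  reflected by faithfulness.\<close>

lemma equivalenceI:
 assumes F: "functor F" and ff: "faithful_functor F" "full_functor F" and eso: "eso_functor F"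
 shows "equivalence_functor F"
proof -
 let ?C = "FDom F" and ?D = "FCod F"
 have c: "category ?C" "category ?D" using F by simp_all
 obtain g where g: "\<And>y. y \<in> Ob ?D ==> g y \<in> Ob ?C \<and> (\<exists>i. iso_arrow ?D i \<and> Dom ?D i = FOb F (g y) \<and> Cod ?D i = y)"
  using eso unfolding eso_functor_def by metis
 then obtain t where t: "\<And>y. y \<in> Ob ?D ==> iso_arrow ?D (t y) \<and> Dom ?D (t y) = FOb F (g y) \<and> Cod ?D (t y) = y"
  by metis
 have go: "g y \<in> Ob ?C" and ti [simp]: "iso_arrow ?D (t y)" "Dom ?D (t y) = FOb F (g y)" "Cod ?D (t y) = y"
  "t y \<in> Ar ?D" if "y \<in> Ob ?D" for y
  using g[OF that] t[OF that] c by auto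
 have "\<exists>k. \<forall>x y h. x \<in> Ob ?C --> y \<in> Ob ?C --> h \<in> Ar ?D --> Dom ?D h = FOb F x --> Cod ?D h = FOb F y -->
   k x y h \<in> Ar ?C \<and> Dom ?C (k x y h) = x \<and> Cod ?C (k x y h) = y \<and> FAr F (k x y h) = h"
  using ff(2) unfolding full_functor_def by metis
 then obtain k where k: "\<And>x y h. x \<in> Ob ?C ==> y \<in> Ob ?C ==> h \<in> Ar ?D ==> Dom ?D h = FOb F x ==> Cod ?D h = FOb F y ==>
   k x y h \<in> Ar ?C \<and> Dom ?C (k x y h) = x \<and> Cod ?C (k x y h) = y \<and> FAr F (k x y h) = h"
  by blast
 \<comment> \<open>The conjugate of \<open>h\<close> by the chosen isomorphisms \<open>t\<close>
   runs between objects in the image of \<open>F\<close>, so fullness supplies the preimage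
   \<open>ga h\<close>.\<close>
 define m where "m h = Cmp ?D (inv_arrow ?D (t (Cod ?D h))) (Cmp ?D h (t (Dom ?D h)))" for h
 define ga where "ga h = k (g (Dom ?D h)) (g (Cod ?D h)) (m h)" for h
 have m: "m h \<in> Ar ?D" "Dom ?D (m h) = FOb F (g (Dom ?D h))" "Cod ?D (m h) = FOb F (g (Cod ?D h))" if "h \<in> Ar ?D" for h
  using that c by (simp_all add: m_def)
 have ga [simp]: "ga h \<in> Ar ?C" "Dom ?C (ga h) = g (Dom ?D h)" "Cod ?C (ga h) = g (Cod ?D h)" "FAr F (ga h) = m h"
  if "h \<in> Ar ?D" for h
  using k[OF go go m[OF that]] that c by (simp_all add: ga_def)
 define G where "G = \<lparr>FDom = ?D, FCod = ?C, FOb = restrict g (Ob ?D), FAr = restrict ga (Ar ?D)\<rparr>"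
 have Gs [simp]: "FDom G = ?D" "FCod G = ?C" "\<And>y. y \<in> Ob ?D ==> FOb G y = g y" "\<And>h. h \<in> Ar ?D ==> FAr G h = ga h"
  by (simp_all add: G_def)
 have G: "functor G"
 proof (rule functorI)
  fix y assume y: "y \<in> Ob (FDom G)"
  have "ga (Idn ?D y) = Idn ?C (g y)"
   by (rule faithful_functorD[OF ff(1)]) (use y go c F in \<open>simp_all add: m_def\<close>)
  then show "FAr G (Idn (FDom G) y) = Idn (FCod G) (FOb G y)" using y c by simp
 next
  fix h f assume a: "h \<in> Ar (FDom G)" "f \<in> Ar (FDom G)" "Dom (FDom G) h = Cod (FDom G) f"
  have "ga (Cmp ?D h f) = Cmp ?C (ga h) (ga f)"
   by (rule faithful_functorD[OF ff(1)]) (use a go c F in \<open>simp_all add: m_def\<close>)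
  then show "FAr G (Cmp (FDom G) h f) = Cmp (FCod G) (FAr G h) (FAr G f)" using a c by simp
 qed (use c go in simp_all, simp_all add: G_def)
 define s where "s = (\<lambda>x\<in>Ob ?C. k x (g (FOb F x)) (inv_arrow ?D (t (FOb F x))))"
 have s [simp]: "s x \<in> Ar ?C" "Dom ?C (s x) = x" "Cod ?C (s x) = g (FOb F x)" "FAr F (s x) = inv_arrow ?D (t (FOb F x))"
  if "x \<in> Ob ?C" for x
  using k[OF that, of "g (FOb F x)" "inv_arrow ?D (t (FOb F x))"] that go[of "FOb F x"] F c by (simp_all add: s_def)
 have si: "iso_arrow ?C (s x)" if x: "x \<in> Ob ?C" for x
 proof -
  have Fx: "FOb F x \<in> Ob ?D" using x F by simp
  obtain j where j: "j \<in> Ar ?C" "Dom ?C j = g (FOb F x)" "Cod ?C j = x" "FAr F j = t (FOb F x)"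
   using k[OF go[OF Fx] x, of "t (FOb F x)"] Fx by auto
  have "Cmp ?C j (s x) = Idn ?C x"
   by (rule faithful_functorD[OF ff(1)]) (use x Fx go c F j in simp_all)
  moreover have "Cmp ?C (s x) j = Idn ?C (g (FOb F x))"
   by (rule faithful_functorD[OF ff(1)]) (use x Fx go c F j in simp_all)
  ultimately show ?thesis using x c j by (intro iso_arrowI[of _ _ j]) simp_all
 qed
 have "nat_trans (id_func ?C) (comp_func G F) s"
 proof (rule nat_transI)
  fix f assume f: "f \<in> Ar (FDom (id_func ?C))"
  have "Cmp ?C (s (Cod ?C f)) f = Cmp ?C (ga (FAr F f)) (s (Dom ?C f))"
   by (rule faithful_functorD[OF ff(1)]) (use f go c F in \<open>simp_all add: m_def\<close>)
  then show "Cmp (FCod (id_func ?C)) (s (Cod (FDom (id_func ?C)) f)) (FAr (id_func ?C) f) =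
   Cmp (FCod (id_func ?C)) (FAr (comp_func G F) f) (s (Dom (FDom (id_func ?C)) f))"
   using f F by simp
 qed (use c F G in simp_all, simp_all add: s_def)
 then have 1: "nat_iso (id_func ?C) (comp_func G F) s" using si by (simp add: nat_iso_def)
 have "nat_trans (comp_func F G) (id_func ?D) (restrict t (Ob ?D))"
 proof (rule nat_transI)
  fix f assume f: "f \<in> Ar (FDom (comp_func F G))"
  then show "Cmp (FCod (comp_func F G)) (restrict t (Ob ?D) (Cod (FDom (comp_func F G)) f)) (FAr (comp_func F G) f) =
   Cmp (FCod (comp_func F G)) (FAr (id_func ?D) f) (restrict t (Ob ?D) (Dom (FDom (comp_func F G)) f))"
   using c F by (simp add: m_def)
 qed (use c F G in simp_all)
 then have "nat_iso (comp_func F G) (id_func ?D) (restrict t (Ob ?D))" using c by (simp add: nat_iso_def)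
 with 1 show ?thesis unfolding equivalence_functor_def
  using F G by (intro conjI bexI[of _ G]) (auto simp: functors_iff)
qed

section \<open>Strict indexed functors\<close>

lemma
 assumes "strict_indexed_category P"
 shows strict_base [simp]: "category (IBase P)"
  and strict_fib [simp]: "a \<in> Ob (IBase P) ==> category (IFib P a)"
  and strict_re [simp]: "u \<in> Ar (IBase P) ==> functor (IRe P u)"
   "u \<in> Ar (IBase P) ==> FDom (IRe P u) = IFib P (Cod (IBase P) u)"
   "u \<in> Ar (IBase P) ==> FCod (IRe P u) = IFib P (Dom (IBase P) u)"
  and strict_re_Idn [simp]: "IBase P = B ==> a \<in> Ob B ==> IRe P (Idn B a) = id_func (IFib P a)"
  and strict_re_Cmp [simp]: "IBase P = B ==> u \<in> Ar B ==> v \<in> Ar B ==> Dom B u = Cod B v ==>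
   IRe P (Cmp B u v) = comp_func (IRe P v) (IRe P u)"
  and strict_unit: "a \<in> Ob (IBase P) ==> x \<in> Ob (IFib P a) ==> IUnit P a x = Idn (IFib P a) x"
  and strict_mult: "u \<in> Ar (IBase P) ==> v \<in> Ar (IBase P) ==> Dom (IBase P) u = Cod (IBase P) v ==>
   x \<in> Ob (IFib P (Cod (IBase P) u)) ==>
   IMult P u v x = Idn (IFib P (Dom (IBase P) v)) (FOb (IRe P v) (FOb (IRe P u) x))"
proof -
 interpret strict_indexed_category P by (rule assms)
 show "category (IBase P)" by (rule IBase_category)
 show "a \<in> Ob (IBase P) ==> category (IFib P a)" by (rule IFib_category)
 show re: "u \<in> Ar (IBase P) ==> functor (IRe P u)"
   "u \<in> Ar (IBase P) ==> FDom (IRe P u) = IFib P (Cod (IBase P) u)"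
   "u \<in> Ar (IBase P) ==> FCod (IRe P u) = IFib P (Dom (IBase P) u)" for u
  using IRe_functor[of u] by (auto simp: hom_iff functors_iff)
 show "IBase P = B ==> a \<in> Ob B ==> IRe P (Idn B a) = id_func (IFib P a)" using IRe_Idn by auto
 show "IBase P = B ==> u \<in> Ar B ==> v \<in> Ar B ==> Dom B u = Cod B v ==>
   IRe P (Cmp B u v) = comp_func (IRe P v) (IRe P u)" using IRe_Cmp by auto
 show "a \<in> Ob (IBase P) ==> x \<in> Ob (IFib P a) ==> IUnit P a x = Idn (IFib P a) x" by (rule IUnit_Idn)
 assume a: "u \<in> Ar (IBase P)" "v \<in> Ar (IBase P)" "Dom (IBase P) u = Cod (IBase P) v"
   "x \<in> Ob (IFib P (Cod (IBase P) u))"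
 then show "IMult P u v x = Idn (IFib P (Dom (IBase P) v)) (FOb (IRe P v) (FOb (IRe P u) x))"
  using IMult_Idn[of v "Dom (IBase P) v" "Cod (IBase P) v" u "Cod (IBase P) u" x] IRe_Cmp[of u v] re[of u] re[of v]
  by (simp add: hom_iff)
qed

text \<open>When the fibre functors commute strictly with reindexing and the structural isomorphisms
  are identities, all coherence laws collapse to equations between identities.\<close>

lemma strict_ifunI:
 assumes P: "strict_indexed_category (XDom Z)" and Q: "strict_indexed_category (XCod Z)"
  and B: "IBase (XDom Z) = B" "IBase (XCod Z) = B"
  and ext: "XFun Z \<in> extensional (Ob B)"
  and funs: "\<And>a. a \<in> Ob B ==> functor (XFun Z a)" "\<And>a. a \<in> Ob B ==> FDom (XFun Z a) = IFib (XDom Z) a"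
   "\<And>a. a \<in> Ob B ==> FCod (XFun Z a) = IFib (XCod Z) a"
  and str: "\<And>u. u \<in> Ar B ==> comp_func (IRe (XCod Z) u) (XFun Z (Cod B u)) = comp_func (XFun Z (Dom B u)) (IRe (XDom Z) u)"
  and rho: "XRho Z = (\<lambda>u\<in>Ar B. \<lambda>x\<in>Ob (IFib (XDom Z) (Cod B u)).
   Idn (IFib (XCod Z) (Dom B u)) (FOb (XFun Z (Dom B u)) (FOb (IRe (XDom Z) u) x)))"
 shows "strict_indexed_functor Z"
proof -
 have XB: "XBase Z = B" using B by (simp add: XBase_def)
 have Bc: "category B" using strict_base[OF P] B by simp
 note s = P Q B funs Bc
 have fo: "FOb (XFun Z (Dom B u)) (FOb (IRe (XDom Z) u) x) = FOb (IRe (XCod Z) u) (FOb (XFun Z (Cod B u)) x)"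
  if "u \<in> Ar B" "x \<in> Ob (IFib (XDom Z) (Cod B u))" for u x
  using arg_cong[OF str[OF that(1)], of "\<lambda>F. FOb F x"] that s by simp
 show ?thesis
 proof (intro strict_indexed_functor.intro indexed_functor.intro strict_indexed_functor_axioms.intro, unfold XB)
  show "indexed_category (XDom Z)" "indexed_category (XCod Z)"
   using P Q strict_indexed_category.axioms(1) by blast+
  show "IBase (XCod Z) = B" "XFun Z \<in> extensional (Ob B)" "XRho Z \<in> extensional (Ar B)"
   using B ext by (simp_all add: rho)
  show "XFun Z a \<in> functors (IFib (XDom Z) a) (IFib (XCod Z) a)" if "a \<in> Ob B" for a
   using funs that by (simp add: functors_iff)
  show st: "comp_func (IRe (XCod Z) u) (XFun Z b) = comp_func (XFun Z a) (IRe (XDom Z) u)"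
   if "u \<in> hom B a b" for u a b
   using that str by (auto simp: hom_iff)
  show "nat_iso (comp_func (IRe (XCod Z) u) (XFun Z b)) (comp_func (XFun Z a) (IRe (XDom Z) u)) (XRho Z u)"
   if u: "u \<in> hom B a b" for u a b
  proof -
   have u': "u \<in> Ar B" "a = Dom B u" "b = Cod B u" using u by (auto simp: hom_iff)
   have F: "functor (comp_func (XFun Z a) (IRe (XDom Z) u))" using u' s by simp
   show ?thesis unfolding st[OF u]
    by (intro nat_isoI nat_transI) (use F u' s in \<open>simp_all add: rho\<close>)
  qed
  show "Cmp (IFib (XCod Z) a) (XRho Z (Idn B a) x) (IUnit (XCod Z) a (FOb (XFun Z a) x)) =
    FAr (XFun Z a) (IUnit (XDom Z) a x)" if "a \<in> Ob B" "x \<in> Ob (IFib (XDom Z) a)" for a x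
   using that s by (simp add: rho strict_unit)
  show "XRho Z u x = Idn (IFib (XCod Z) a) (FOb (XFun Z a) (FOb (IRe (XDom Z) u) x))"
   if "u \<in> hom B a b" "x \<in> Ob (IFib (XDom Z) b)" for u a b x
   using that by (auto simp: hom_iff rho)
  show "Cmp (IFib (XCod Z) a) (XRho Z (Cmp B u v) x) (IMult (XCod Z) u v (FOb (XFun Z c) x)) =
    Cmp (IFib (XCod Z) a) (FAr (XFun Z a) (IMult (XDom Z) u v x))
     (Cmp (IFib (XCod Z) a) (XRho Z v (FOb (IRe (XDom Z) u) x)) (FAr (IRe (XCod Z) v) (XRho Z u x)))"
   if "v \<in> hom B a b" "u \<in> hom B b c" "x \<in> Ob (IFib (XDom Z) c)" for u v a b c x
  proof -
   have h: "v \<in> Ar B" "u \<in> Ar B" "Dom B v = a" "Cod B v = b" "Dom B u = b" "Cod B u = c"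
    "a \<in> Ob B" "b \<in> Ob B" "c \<in> Ob B"
    using that Bc by (auto simp: hom_iff)
   show ?thesis using h that(3) s fo[of u x] fo[of v "FOb (IRe (XDom Z) u) x"]
    by (simp add: rho strict_mult)
  qed
 qed
qed

lemma
 assumes "strict_indexed_functor Z" "IBase (XDom Z) = B"
 shows strict_XDom: "strict_indexed_functor Z ==> indexed_category (XDom Z)"
  and strict_XBase: "IBase (XCod Z) = B"
  and strict_XFun: "a \<in> Ob B ==> functor (XFun Z a)"
   "a \<in> Ob B ==> FDom (XFun Z a) = IFib (XDom Z) a"
   "a \<in> Ob B ==> FCod (XFun Z a) = IFib (XCod Z) a"
  and strict_XFun_ext: "XFun Z \<in> extensional (Ob B)"
  and strict_XFun_IRe: "u \<in> Ar B ==> comp_func (IRe (XCod Z) u) (XFun Z (Cod B u)) =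
   comp_func (XFun Z (Dom B u)) (IRe (XDom Z) u)"
  and strict_XRho: "u \<in> Ar B ==> x \<in> Ob (IFib (XDom Z) (Cod B u)) ==>
   XRho Z u x = Idn (IFib (XCod Z) (Dom B u)) (FOb (XFun Z (Dom B u)) (FOb (IRe (XDom Z) u) x))"
  and strict_XRho_ext: "XRho Z \<in> extensional (Ar B)"
   "u \<in> Ar B ==> XRho Z u \<in> extensional (Ob (IFib (XDom Z) (Cod B u)))"
proof -
 interpret strict_indexed_functor Z by (rule assms)
 have XB: "XBase Z = B" using assms by (simp add: XBase_def)
 show "indexed_category (XDom Z)" by (rule XDom_indexed)
 show "IBase (XCod Z) = B" using same_base XB by simp
 show f: "a \<in> Ob B ==> functor (XFun Z a)"
   "a \<in> Ob B ==> FDom (XFun Z a) = IFib (XDom Z) a"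
   "a \<in> Ob B ==> FCod (XFun Z a) = IFib (XCod Z) a" for a
  using XFun_functor[of a] XB by (auto simp: functors_iff)
 show "XFun Z \<in> extensional (Ob B)" "XRho Z \<in> extensional (Ar B)" using XFun_ext XRho_ext XB by simp_all
 have Bc: "category B" using indexed_category.IBase_category[OF XDom_indexed] assms by simp
 show "u \<in> Ar B ==> comp_func (IRe (XCod Z) u) (XFun Z (Cod B u)) = comp_func (XFun Z (Dom B u)) (IRe (XDom Z) u)"
  using XFun_IRe[of u] XB by (simp add: hom_iff)
 show "u \<in> Ar B ==> x \<in> Ob (IFib (XDom Z) (Cod B u)) ==>
   XRho Z u x = Idn (IFib (XCod Z) (Dom B u)) (FOb (XFun Z (Dom B u)) (FOb (IRe (XDom Z) u) x))"
  using XRho_Idn[of u] XB by (simp add: hom_iff)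
 show "u \<in> Ar B ==> XRho Z u \<in> extensional (Ob (IFib (XDom Z) (Cod B u)))"
  using XRho_iso[of u "Dom B u" "Cod B u"] XB f[of "Cod B u"] Bc
  by (auto simp: hom_iff nat_iso_def dest: nat_trans_ext)
qed

lemma
 assumes S: "strict_indexed_functor Z" and B: "IBase (XDom Z) = B" and P: "strict_indexed_category (XDom Z)"
  and Q: "strict_indexed_category (XCod Z)" and u: "u \<in> Ar B"
 shows strict_FOb_re: "x \<in> Ob (IFib (XDom Z) (Cod B u)) ==>
   FOb (XFun Z (Dom B u)) (FOb (IRe (XDom Z) u) x) = FOb (IRe (XCod Z) u) (FOb (XFun Z (Cod B u)) x)"
  and strict_FAr_re: "f \<in> Ar (IFib (XDom Z) (Cod B u)) ==>
   FAr (XFun Z (Dom B u)) (FAr (IRe (XDom Z) u) f) = FAr (IRe (XCod Z) u) (FAr (XFun Z (Cod B u)) f)"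
proof -
 have c: "category B" using strict_base[OF P] B by simp
 note s = strict_XFun[OF S B, of "Cod B u"] strict_XFun[OF S B, of "Dom B u"] strict_re[OF P, of u] strict_re[OF Q, of u] c u B
 show "x \<in> Ob (IFib (XDom Z) (Cod B u)) ==>
   FOb (XFun Z (Dom B u)) (FOb (IRe (XDom Z) u) x) = FOb (IRe (XCod Z) u) (FOb (XFun Z (Cod B u)) x)"
  using arg_cong[OF strict_XFun_IRe[OF S B u], of "\<lambda>F. FOb F x"] s by simp
 show "f \<in> Ar (IFib (XDom Z) (Cod B u)) ==>
   FAr (XFun Z (Dom B u)) (FAr (IRe (XDom Z) u) f) = FAr (IRe (XCod Z) u) (FAr (XFun Z (Cod B u)) f)"
  using arg_cong[OF strict_XFun_IRe[OF S B u], of "\<lambda>F. FAr F f"] s by simp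
qed

text \<open>The structural isomorphisms of a strict indexed functor are forced to be identities and
  so carry no information beyond the fibre functors.\<close>

lemma strict_ifun_eqI:
 assumes S: "strict_indexed_functor Z" and T: "strict_indexed_functor W" and e: "XDom Z = XDom W" "XCod Z = XCod W"
  and f: "\<And>a. a \<in> Ob (IBase (XDom W)) ==> XFun Z a = XFun W a"
 shows "Z = W"
proof -
 let ?B = "IBase (XDom W)"
 have c: "category ?B" using strict_XDom[OF T refl T] by (rule indexed_category.IBase_category)
 note s = strict_XFun_ext[OF S, of ?B] strict_XRho_ext[OF S, of ?B] strict_XRho[OF S, of ?B]
 note t = strict_XFun_ext[OF T refl] strict_XRho_ext[OF T refl] strict_XRho[OF T refl]
 have 1: "XFun Z = XFun W" using s(1) t(1) f e by (intro extensionalityI[of _ "Ob ?B"]) auto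
 have "XRho Z u = XRho W u" if u: "u \<in> Ar ?B" for u
 proof (rule extensionalityI)
  show "XRho Z u \<in> extensional (Ob (IFib (XDom W) (Cod ?B u)))" using s(3) e u by simp
  show "XRho W u \<in> extensional (Ob (IFib (XDom W) (Cod ?B u)))" using t(3) u by simp
  show "XRho Z u x = XRho W u x" if "x \<in> Ob (IFib (XDom W) (Cod ?B u))" for x
   using s(4)[of u x] t(4)[of u x] u that e 1 by simp
 qed
 then have 2: "XRho Z = XRho W" using s(2) t(2) e by (intro extensionalityI[of _ "Ar ?B"]) auto
 show ?thesis using 1 2 e by (intro ifun.equality) auto
qed

lemma comp_ifun_simps [simp]:
 "XDom (comp_ifun W Z) = XDom Z" "XCod (comp_ifun W Z) = XCod W"
 "IBase (XDom Z) = B ==> a \<in> Ob B ==> XFun (comp_ifun W Z) a = comp_func (XFun W a) (XFun Z a)"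
 by (simp_all add: comp_ifun_def XBase_def Let_def)

lemma comp_ifun_XRho:
 "IBase (XDom Z) = B ==> XRho (comp_ifun W Z) = (\<lambda>u\<in>Ar B. \<lambda>x\<in>Ob (IFib (XDom Z) (Cod B u)).
  Cmp (IFib (XCod W) (Dom B u)) (FAr (XFun W (Dom B u)) (XRho Z u x))
      (XRho W u (FOb (XFun Z (Cod B u)) x)))"
 by (auto simp: comp_ifun_def XBase_def Let_def)

lemma strict_comp_ifun:
 assumes S: "strict_indexed_functor Z" and T: "strict_indexed_functor W" and e: "XDom W = XCod Z"
  and P: "strict_indexed_category (XDom Z)" and Q: "strict_indexed_category (XCod Z)"
  and R: "strict_indexed_category (XCod W)"
 shows "strict_indexed_functor (comp_ifun W Z)"
proof -
 let ?B = "IBase (XDom Z)"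
 have b: "IBase (XCod Z) = ?B" "IBase (XCod W) = ?B" "IBase (XDom W) = ?B"
  using strict_XBase[OF S refl] strict_XBase[OF T, of ?B] e by auto
 have c: "category ?B" using P by simp
 note f = strict_XFun[OF S refl] strict_XFun[OF T b(3)]
 note sr = strict_re[OF P] strict_re[OF Q] strict_re[OF R]
 note fo = strict_FOb_re[OF S refl P Q] strict_FOb_re[OF T b(3) _ R, unfolded e, OF Q]
 note fa = strict_FAr_re[OF S refl P Q] strict_FAr_re[OF T b(3) _ R, unfolded e, OF Q]
 show ?thesis
 proof (rule strict_ifunI[of _ ?B])
  fix u assume u: "u \<in> Ar ?B"
  then show "comp_func (IRe (XCod (comp_ifun W Z)) u) (XFun (comp_ifun W Z) (Cod ?B u)) =
   comp_func (XFun (comp_ifun W Z) (Dom ?B u)) (IRe (XDom (comp_ifun W Z)) u)"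
   using f P Q R b c e by (intro functor_eqI) (simp_all add: fo fa)
 next
  show "XRho (comp_ifun W Z) = (\<lambda>u\<in>Ar ?B. \<lambda>x\<in>Ob (IFib (XDom (comp_ifun W Z)) (Cod ?B u)).
   Idn (IFib (XCod (comp_ifun W Z)) (Dom ?B u))
    (FOb (XFun (comp_ifun W Z) (Dom ?B u)) (FOb (IRe (XDom (comp_ifun W Z)) u) x)))"
   unfolding comp_ifun_XRho[OF refl] using f P Q R b c e
   by - (rule restrict_ext, simp, rule restrict_ext,
    simp add: fo strict_XRho[OF S refl] strict_XRho[OF T b(3), unfolded e])
  show "XFun (comp_ifun W Z) \<in> extensional (Ob ?B)"
   by (simp add: comp_ifun_def XBase_def Let_def)
 qed (use f P Q R b c e in simp_all)
qed

lemma pull_ifun_simps [simp]: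
 "XDom (pull_ifun F Z) = pull_icat F (XDom Z)" "XCod (pull_ifun F Z) = pull_icat F (XCod Z)"
 "a \<in> Ob (FDom F) ==> XFun (pull_ifun F Z) a = XFun Z (FOb F a)"
 "u \<in> Ar (FDom F) ==> XRho (pull_ifun F Z) u = XRho Z (FAr F u)"
 by (simp_all add: pull_ifun_def compose_def)

lemma strict_pull_ifun:
 assumes S: "strict_indexed_functor Z" and F: "functor F" "FCod F = IBase (XDom Z)"
  and P: "strict_indexed_category (XDom Z)" and Q: "strict_indexed_category (XCod Z)"
 shows "strict_indexed_functor (pull_ifun F Z)"
proof -
 let ?B = "FDom F" and ?D = "IBase (XDom Z)"
 have b: "IBase (XCod Z) = ?D" using strict_XBase[OF S refl] .
 have c: "category ?B" "category ?D" using F by (simp_all add: P)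
 note f = strict_XFun[OF S refl] 
 show ?thesis
 proof (rule strict_ifunI[of _ ?B])
  show "strict_indexed_category (XDom (pull_ifun F Z))" "strict_indexed_category (XCod (pull_ifun F Z))"
   using pull_strict[OF F P] pull_strict[OF F(1) _ Q] b F by simp_all
  show "XRho (pull_ifun F Z) = (\<lambda>u\<in>Ar ?B. \<lambda>x\<in>Ob (IFib (XDom (pull_ifun F Z)) (Cod ?B u)).
   Idn (IFib (XCod (pull_ifun F Z)) (Dom ?B u))
    (FOb (XFun (pull_ifun F Z) (Dom ?B u)) (FOb (IRe (XDom (pull_ifun F Z)) u) x)))"
  proof (rule extensionalityI[of _ "Ar ?B"])
   fix u assume u: "u \<in> Ar ?B"
   show "XRho (pull_ifun F Z) u = (\<lambda>u\<in>Ar ?B. \<lambda>x\<in>Ob (IFib (XDom (pull_ifun F Z)) (Cod ?B u)).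
    Idn (IFib (XCod (pull_ifun F Z)) (Dom ?B u))
     (FOb (XFun (pull_ifun F Z) (Dom ?B u)) (FOb (IRe (XDom (pull_ifun F Z)) u) x))) u"
    by (rule extensionalityI[of _ "Ob (IFib (XDom Z) (FOb F (Cod ?B u)))"])
     (use u c F strict_XRho_ext(2)[OF S refl, of "FAr F u"] strict_XRho[OF S refl, of "FAr F u"] in simp_all)
  qed (simp_all add: pull_ifun_def)
  show "comp_func (IRe (XCod (pull_ifun F Z)) u) (XFun (pull_ifun F Z) (Cod ?B u)) =
   comp_func (XFun (pull_ifun F Z) (Dom ?B u)) (IRe (XDom (pull_ifun F Z)) u)" if "u \<in> Ar ?B" for u
   using strict_XFun_IRe[OF S refl, of "FAr F u"] that c F by simp
  show "XFun (pull_ifun F Z) \<in> extensional (Ob ?B)" by (simp add: pull_ifun_def)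
 qed (use f P Q b c F in simp_all)
qed

lemma strict_id_ifun:
 assumes P: "strict_indexed_category P"
 shows "strict_indexed_functor (id_ifun P)"
proof (rule strict_ifunI[of _ "IBase P"])
 have c: "category (IBase P)" using P by simp
 show "XRho (id_ifun P) = (\<lambda>u\<in>Ar (IBase P). \<lambda>x\<in>Ob (IFib (XDom (id_ifun P)) (Cod (IBase P) u)).
  Idn (IFib (XCod (id_ifun P)) (Dom (IBase P) u)) (FOb (XFun (id_ifun P) (Dom (IBase P) u)) (FOb (IRe (XDom (id_ifun P)) u) x)))"
  using P c by (auto simp: id_ifun_def intro!: restrict_ext)
qed (use P strict_base[OF P] in \<open>simp_all add: id_ifun_def\<close>)

lemma re_ntrans_simps:
 "XDom (re_ntrans \<alpha> Q) = pull_icat (NCod \<alpha>) Q" "XCod (re_ntrans \<alpha> Q) = pull_icat (NDom \<alpha>) Q"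
 "a \<in> Ob (FDom (NDom \<alpha>)) ==> XFun (re_ntrans \<alpha> Q) a = IRe Q (NMap \<alpha> a)"
 by (simp_all add: re_ntrans_def Let_def)

text \<open>By strictness of \<open>Q\<close> the two ways around the naturality square of
  \<open>\<alpha>\<close> reindex by equal functors, and the isomorphisms in
  \<open>re_ntrans\<close> are composites of identities.\<close>

lemma strict_re_ntrans:
 assumes \<alpha>: "ntrans \<alpha>" "FCod (NDom \<alpha>) = IBase Q" and Q: "strict_indexed_category Q"
 shows "strict_indexed_functor (re_ntrans \<alpha> Q)"
proof -
 let ?F = "NDom \<alpha>" and ?G = "NCod \<alpha>" and ?t = "NMap \<alpha>" and ?B = "FDom (NDom \<alpha>)" and ?D = "IBase Q"
 have c: "category ?B" "category ?D" using \<alpha> Q by simp_all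
 have e: "comp_func (IRe Q (FAr ?F u)) (IRe Q (?t (Cod ?B u))) = comp_func (IRe Q (?t (Dom ?B u))) (IRe Q (FAr ?G u))"
  if u: "u \<in> Ar ?B" for u
 proof -
  have "IRe Q (Cmp ?D (?t (Cod ?B u)) (FAr ?F u)) = IRe Q (Cmp ?D (FAr ?G u) (?t (Dom ?B u)))"
   using ntrans_nat[OF \<alpha>(1) u refl \<alpha>(2)] by simp
  then show ?thesis using u \<alpha> Q c by simp
 qed
 show ?thesis
 proof (rule strict_ifunI[of _ ?B])
  show "strict_indexed_category (XDom (re_ntrans \<alpha> Q))" "strict_indexed_category (XCod (re_ntrans \<alpha> Q))"
   using \<alpha> Q by (auto simp: re_ntrans_simps intro!: pull_strict)
  show "comp_func (IRe (XCod (re_ntrans \<alpha> Q)) u) (XFun (re_ntrans \<alpha> Q) (Cod ?B u)) =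
   comp_func (XFun (re_ntrans \<alpha> Q) (Dom ?B u)) (IRe (XDom (re_ntrans \<alpha> Q)) u)" if "u \<in> Ar ?B" for u
   using e[OF that] that c \<alpha> by (simp add: re_ntrans_simps)
  have "Cmp (IFib Q (FOb ?F (Dom ?B u))) (inv_arrow (IFib Q (FOb ?F (Dom ?B u))) (IMult Q (FAr ?G u) (?t (Dom ?B u)) x))
    (IMult Q (?t (Cod ?B u)) (FAr ?F u) x) =
   Idn (IFib Q (FOb ?F (Dom ?B u))) (FOb (IRe Q (?t (Dom ?B u))) (FOb (IRe Q (FAr ?G u)) x))"
   if u: "u \<in> Ar ?B" and x: "x \<in> Ob (IFib Q (FOb ?G (Cod ?B u)))" for u x
  proof -
   have "FOb (IRe Q (FAr ?F u)) (FOb (IRe Q (?t (Cod ?B u))) x) =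
    FOb (IRe Q (?t (Dom ?B u))) (FOb (IRe Q (FAr ?G u)) x)"
    using arg_cong[OF e[OF u], of "\<lambda>F. FOb F x"] u x \<alpha> Q c by simp
   then show ?thesis using u x \<alpha> Q c by (simp add: strict_mult)
  qed
  then show "XRho (re_ntrans \<alpha> Q) = (\<lambda>u\<in>Ar ?B. \<lambda>x\<in>Ob (IFib (XDom (re_ntrans \<alpha> Q)) (Cod ?B u)).
   Idn (IFib (XCod (re_ntrans \<alpha> Q)) (Dom ?B u))
    (FOb (XFun (re_ntrans \<alpha> Q) (Dom ?B u)) (FOb (IRe (XDom (re_ntrans \<alpha> Q)) u) x)))"
   using \<alpha> c unfolding re_ntrans_def Let_def by (auto intro!: restrict_ext)
  show "XFun (re_ntrans \<alpha> Q) \<in> extensional (Ob ?B)" by (simp add: re_ntrans_def Let_def)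
 qed (use \<alpha> Q c in \<open>simp_all add: re_ntrans_simps\<close>)
qed

section \<open>Indexed functors into displays\<close>

text \<open>Common setting for comprehension, where \<open>F\<close> is the identity, and for the
  source and target of \<open>HTau\<close>, where \<open>F\<close> underlies a morphism. The fibre
  functors are given; whether they form an indexed functor \<open>Z\<close> is studied here.\<close>

locale disp_valued = display_category D
 for D :: "('p, 'b) dcat" +
 fixes P :: "('o, 'a, 'x, 'y) icat" and F :: "('o, 'a, 'p, 'b) func"
  and Z :: "('o, 'a, 'x, 'y, 'b, 'b \<times> 'b \<times> 'b) ifun"
 assumes P [simp]: "strict_indexed_category P" and F [simp]: "functor F" "FDom F = IBase P" "FCod F = DCat D"
  and X: "XDom Z = P" "XCod Z = pull_icat F DI"
  and XF [simp]: "a \<in> Ob (IBase P) ==> functor (XFun Z a)" "a \<in> Ob (IBase P) ==> FDom (XFun Z a) = IFib P a"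
   "a \<in> Ob (IBase P) ==> FCod (XFun Z a) = Sl (FOb F a)"
begin

abbreviation B where "B \<equiv> IBase P"
abbreviation pr where "pr a x \<equiv> FOb (XFun Z a) x"
abbreviation cm where "cm a f \<equiv> fst (snd (FAr (XFun Z a) f))"
abbreviation re where "re u x \<equiv> FOb (IRe P u) x"

lemma pr [simp]:
 assumes "a \<in> Ob B" "x \<in> Ob (IFib P a)"
 shows "pr a x \<in> Disp D" "Cod C (pr a x) = FOb F a"
 using FOb_Ob[OF XF(1,3)[OF assms(1)], of x] assms by simp_all

lemma cm_Ar:
 assumes "a \<in> Ob B" "f \<in> Ar (IFib P a)"
 shows "FAr (XFun Z a) f \<in> Ar (Sl (FOb F a))"
 using assms by simp

lemma cm [simp]:
 assumes "a \<in> Ob B" "f \<in> Ar (IFib P a)"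
 shows "fst (FAr (XFun Z a) f) = pr a (Dom (IFib P a) f)"
  "snd (snd (FAr (XFun Z a) f)) = pr a (Cod (IFib P a) f)"
  "cm a f \<in> Ar C" "Dom C (cm a f) = Dom C (pr a (Dom (IFib P a) f))"
  "Cod C (cm a f) = Dom C (pr a (Cod (IFib P a) f))"
  "y = Cod (IFib P a) f ==> Cmp C (pr a y) (cm a f) = pr a (Dom (IFib P a) f)"
proof -
 note h = cm_Ar[OF assms]
 show f: "fst (FAr (XFun Z a) f) = pr a (Dom (IFib P a) f)"
  "snd (snd (FAr (XFun Z a) f)) = pr a (Cod (IFib P a) f)"
  using slice_Dom[OF h] slice_Cod[OF h] assms by simp_all
 show "cm a f \<in> Ar C" "Dom C (cm a f) = Dom C (pr a (Dom (IFib P a) f))"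
  "Cod C (cm a f) = Dom C (pr a (Cod (IFib P a) f))"
  "y = Cod (IFib P a) f ==> Cmp C (pr a y) (cm a f) = pr a (Dom (IFib P a) f)"
  using slice_Ar_simps[OF h] f by simp_all
qed

lemma cm_Cmp [simp]: "a \<in> Ob B ==> g \<in> Ar (IFib P a) ==> f \<in> Ar (IFib P a) ==> Dom (IFib P a) g = Cod (IFib P a) f ==>
  cm a (Cmp (IFib P a) g f) = Cmp C (cm a g) (cm a f)"
 using slice_Cmp[OF cm_Ar cm_Ar, of a g f] by simp

text \<open>The arrows \<open>Q u x\<close> are the upper sides of pullback squares over
  \<open>FAr F u\<close>, natural in the type and strictly functorial in \<open>u\<close>. They
  replace the structural isomorphisms: strict functoriality makes sense because \<open>P\<close> is
  strict.\<close>

definition cartesian_family :: "('a => 'x => 'b) => bool" where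
 "cartesian_family Q \<longleftrightarrow>
  (\<forall>u x. u \<in> Ar B --> x \<in> Ob (IFib P (Cod B u)) -->
   is_pullback C (FAr F u) (pr (Cod B u) x) (pr (Dom B u) (re u x)) (Q u x)) \<and>
  (\<forall>u f. u \<in> Ar B --> f \<in> Ar (IFib P (Cod B u)) -->
   Cmp C (Q u (Cod (IFib P (Cod B u)) f)) (cm (Dom B u) (FAr (IRe P u) f)) =
   Cmp C (cm (Cod B u) f) (Q u (Dom (IFib P (Cod B u)) f))) \<and>
  (\<forall>a x. a \<in> Ob B --> x \<in> Ob (IFib P a) --> Q (Idn B a) x = Idn C (Dom C (pr a x))) \<and>
  (\<forall>u v x. u \<in> Ar B --> v \<in> Ar B --> Dom B u = Cod B v --> x \<in> Ob (IFib P (Cod B u)) -->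
   Q (Cmp B u v) x = Cmp C (Q u x) (Q v (re u x)))"

text \<open>Ties \<open>Q\<close> to the structural isomorphisms: \<open>XRho Z u x\<close> is the
  map from the chosen pullback to the pullback square with upper side \<open>Q u x\<close>.\<close>

definition comparison_family :: "('a => 'x => 'b) => bool" where
 "comparison_family Q \<longleftrightarrow> (\<forall>u x. u \<in> Ar B --> x \<in> Ob (IFib P (Cod B u)) -->
  XRho Z u x \<in> Ar (Sl (FOb F (Dom B u))) \<and> fst (XRho Z u x) = Pb1 D (FAr F u) (pr (Cod B u) x) \<and>
  snd (snd (XRho Z u x)) = pr (Dom B u) (re u x) \<and>
  Cmp C (Q u x) (mid (XRho Z u x)) = Pb2 D (FAr F u) (pr (Cod B u) x))"

lemma base_cat [simp]: "category B"
 by simp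

lemma
 assumes "cartesian_family Q" "u \<in> Ar B" "x \<in> Ob (IFib P (Cod B u))"
 shows Q_pb: "is_pullback C (FAr F u) (pr (Cod B u) x) (pr (Dom B u) (re u x)) (Q u x)"
  and Q_Ar: "Q u x \<in> Ar C" and Q_Dom: "Dom C (Q u x) = Dom C (pr (Dom B u) (re u x))"
  and Q_Cod: "Cod C (Q u x) = Dom C (pr (Cod B u) x)"
  and Q_comm: "Cmp C (pr (Cod B u) x) (Q u x) = Cmp C (FAr F u) (pr (Dom B u) (re u x))"
proof -
 show p: "is_pullback C (FAr F u) (pr (Cod B u) x) (pr (Dom B u) (re u x)) (Q u x)"
  using assms by (simp add: cartesian_family_def)
 show "Q u x \<in> Ar C" "Dom C (Q u x) = Dom C (pr (Dom B u) (re u x))" "Cod C (Q u x) = Dom C (pr (Cod B u) x)"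
  "Cmp C (pr (Cod B u) x) (Q u x) = Cmp C (FAr F u) (pr (Dom B u) (re u x))"
  using pb_Ar[OF cat p] pb_ends[OF cat p] pb_comm[OF cat p] by simp_all
qed

lemma re_Ob [simp]: "u \<in> Ar B ==> x \<in> Ob (IFib P (Cod B u)) ==> re u x \<in> Ob (IFib P (Dom B u))"
 by simp

context
 fixes Q
 assumes R: "comparison_family Q"
  and pb: "\<And>u x. u \<in> Ar B ==> x \<in> Ob (IFib P (Cod B u)) ==>
   is_pullback C (FAr F u) (pr (Cod B u) x) (pr (Dom B u) (re u x)) (Q u x)"
begin

abbreviation rh where "rh u x \<equiv> mid (XRho Z u x)"

lemma rh:
 assumes ux: "u \<in> Ar B" "x \<in> Ob (IFib P (Cod B u))"
 shows "XRho Z u x \<in> Ar (Sl (FOb F (Dom B u)))" "fst (XRho Z u x) = Pb1 D (FAr F u) (pr (Cod B u) x)"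
  "snd (snd (XRho Z u x)) = pr (Dom B u) (re u x)" "rh u x \<in> Ar C" "Dom C (rh u x) = Dom C (Pb1 D (FAr F u) (pr (Cod B u) x))"
  "Cod C (rh u x) = Dom C (pr (Dom B u) (re u x))" "Cmp C (pr (Dom B u) (re u x)) (rh u x) = Pb1 D (FAr F u) (pr (Cod B u) x)"
  "Cmp C (Q u x) (rh u x) = Pb2 D (FAr F u) (pr (Cod B u) x)" "iso_arrow C (rh u x)"
  "Q u x \<in> Ar C" "Dom C (Q u x) = Dom C (pr (Dom B u) (re u x))" "Cod C (Q u x) = Dom C (pr (Cod B u) x)"
proof -
 show r: "XRho Z u x \<in> Ar (Sl (FOb F (Dom B u)))" "fst (XRho Z u x) = Pb1 D (FAr F u) (pr (Cod B u) x)"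
  "snd (snd (XRho Z u x)) = pr (Dom B u) (re u x)" "Cmp C (Q u x) (rh u x) = Pb2 D (FAr F u) (pr (Cod B u) x)"
  using R assms unfolding comparison_family_def by blast+
 show q: "Q u x \<in> Ar C" "Dom C (Q u x) = Dom C (pr (Dom B u) (re u x))" "Cod C (Q u x) = Dom C (pr (Cod B u) x)"
  using pb_Ar[OF cat pb[OF ux]] pb_ends[OF cat pb[OF ux]] by simp_all
 show r2: "rh u x \<in> Ar C" "Dom C (rh u x) = Dom C (Pb1 D (FAr F u) (pr (Cod B u) x))" "Cod C (rh u x) = Dom C (pr (Dom B u) (re u x))"
  "Cmp C (pr (Dom B u) (re u x)) (rh u x) = Pb1 D (FAr F u) (pr (Cod B u) x)"
  using slice_Ar_simps(5-8)[OF r(1)] r by simp_all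
 \<comment> \<open>\<open>rh u x\<close> is the comparison between two pullbacks of the same cospan,
   hence it is this isomorphism.\<close>
 obtain i where i: "iso_arrow C i" "Dom C i = Dom C (Pb1 D (FAr F u) (pr (Cod B u) x))"
  "Cod C i = Dom C (pr (Dom B u) (re u x))" "Cmp C (pr (Dom B u) (re u x)) i = Pb1 D (FAr F u) (pr (Cod B u) x)"
  "Cmp C (Q u x) i = Pb2 D (FAr F u) (pr (Cod B u) x)"
  by (rule pb_iso[OF cat Pb pb[OF ux]]) (use ux in simp_all)
 have "rh u x = i" by (rule pb_unique[OF cat pb[OF ux]]) (use i r r2 in simp_all)
 then show "iso_arrow C (rh u x)" using i by simp
qed

text \<open>Both sides of the slice equation have middle arrows into a pullback. Their composites
  with the display agree by typing, so the equation can be tested after \<open>Q u y\<close>; there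
  the invertible arrow \<open>rh u x\<close> cancels and leaves the square of
  \<open>Q\<close>.\<close>

lemma nat_iff:
 assumes u: "u \<in> Ar B" and f: "f \<in> Ar (IFib P b)" and ab: "a = Dom B u" "b = Cod B u" and xy: "x = Dom (IFib P b) f" "y = Cod (IFib P b) f"
 shows "Cmp (Sl (FOb F a)) (XRho Z u y) (FAr (IRe DI (FAr F u)) (FAr (XFun Z b) f)) =
   Cmp (Sl (FOb F a)) (FAr (XFun Z a) (FAr (IRe P u) f)) (XRho Z u x) \<longleftrightarrow>
  Cmp C (Q u y) (cm a (FAr (IRe P u) f)) = Cmp C (cm b f) (Q u x)" (is "?s \<longleftrightarrow> ?n")
proof -
 have o: "a \<in> Ob B" "b \<in> Ob B" "x \<in> Ob (IFib P b)" "y \<in> Ob (IFib P b)" using u f ab xy by simp_all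
 have uf: "FAr (IRe P u) f \<in> Ar (IFib P a)" "Dom (IFib P a) (FAr (IRe P u) f) = re u x" "Cod (IFib P a) (FAr (IRe P u) f) = re u y"
  using u f ab xy by simp_all
 have Fu: "FAr F u \<in> Ar C" "Cod C (FAr F u) = FOb F b" "Dom C (FAr F u) = FOb F a" using u ab by simp_all
 have m: "FAr (XFun Z b) f \<in> Ar (Sl (Cod C (FAr F u)))" using cm_Ar[OF o(2) f] Fu by simp
 note rx = rh[OF u, of x, folded ab, OF o(3)] and ry = rh[OF u, of y, folded ab, OF o(4)]
 define N where "N = mid (FAr (IRe DI (FAr F u)) (FAr (XFun Z b) f))"
 let ?g = "cm a (FAr (IRe P u) f)"
 have N: "N \<in> Ar C" "Dom C N = Dom C (Pb1 D (FAr F u) (pr b x))" "Cod C N = Dom C (Pb1 D (FAr F u) (pr b y))"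
  "Cmp C (Pb1 D (FAr F u) (pr b y)) N = Pb1 D (FAr F u) (pr b x)" "Cmp C (Pb2 D (FAr F u) (pr b y)) N = Cmp C (cm b f) (Pb2 D (FAr F u) (pr b x))"
  unfolding N_def using re_mid[OF Fu(1) m] re_Pb[OF Fu(1) m refl] o f xy by simp_all
 have g: "?g \<in> Ar C" "Dom C ?g = Dom C (pr a (re u x))" "Cod C ?g = Dom C (pr a (re u y))" "Cmp C (pr a (re u y)) ?g = pr a (re u x)"
  using o uf by simp_all
 have c: "cm b f \<in> Ar C" "Dom C (cm b f) = Dom C (pr b x)" using o f xy by simp_all
 have P: "pr a (re u x) \<in> Ar C" "pr a (re u y) \<in> Ar C" "pr b x \<in> Disp D" "pr b y \<in> Disp D" "Cod C (pr b x) = FOb F b" "Cod C (pr b y) = FOb F b"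
  using o u ab by simp_all
 have QN: "Cmp C (Q u y) (Cmp C (rh u y) N) = Cmp C (Cmp C (cm b f) (Q u x)) (rh u x)"
  unfolding Cmp_reassoc1[OF ry(8) cat N(1) N(3)[folded ry(5)] ry(10,4) ry(11)[folded ry(6)]] N(5) rx(8)[symmetric] using c rx by simp
 let ?t = "FAr (IRe DI (FAr F u)) (FAr (XFun Z b) f)" and ?k = "FAr (XFun Z a) (FAr (IRe P u) f)"
 have t: "?t \<in> Ar (Sl (FOb F a))" "fst ?t = Pb1 D (FAr F u) (pr b x)" "snd (snd ?t) = Pb1 D (FAr F u) (pr b y)"
  using disp_re_Ar[OF Fu(1) m] re_fst[OF Fu(1) m] re_snd[OF Fu(1) m] o f xy Fu by simp_all
 have k: "?k \<in> Ar (Sl (FOb F a))" "fst ?k = pr a (re u x)" "snd (snd ?k) = pr a (re u y)"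
  using cm_Ar[OF o(1) uf(1)] o uf by simp_all
 have "?s \<longleftrightarrow> Cmp C (rh u y) N = Cmp C ?g (rh u x)"
  unfolding N_def slice_Cmp[OF ry(1) t(1) ry(2)[folded t(3)]] slice_Cmp[OF k(1) rx(1) k(2)[folded rx(3)]]
  by (simp only: t(2) rx(2) ry(3) k(3) prod.inject simp_thms)
 also have "\<dots> \<longleftrightarrow> Cmp C (Cmp C (cm b f) (Q u x)) (rh u x) = Cmp C (Cmp C (Q u y) ?g) (rh u x)"
 proof
  assume "Cmp C (Cmp C (cm b f) (Q u x)) (rh u x) = Cmp C (Cmp C (Q u y) ?g) (rh u x)"
  then have "Cmp C (Q u y) (Cmp C (rh u y) N) = Cmp C (Q u y) (Cmp C ?g (rh u x))" unfolding QN using g rx ry by simp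
  moreover have "Cmp C (pr a (re u y)) (Cmp C (rh u y) N) = Cmp C (pr a (re u y)) (Cmp C ?g (rh u x))"
   unfolding Cmp_reassoc1[OF ry(7) cat N(1) N(3)[folded ry(5)] P(2) ry(4) ry(6)[symmetric]] N(4)
   by (subst Cmp_reassoc1[OF g(4)]) (use g rx P in simp_all)
  ultimately show "Cmp C (rh u y) N = Cmp C ?g (rh u x)"
   by - (rule pb_unique[OF cat pb[OF u, of y, folded ab, OF o(4)]], use g rx ry N in simp_all)
 qed (use QN g rx ry in simp)
 also have "\<dots> \<longleftrightarrow> ?n"
 proof -
  have "Cmp C (cm b f) (Q u x) \<in> Ar C" "Cmp C (Q u y) ?g \<in> Ar C" "Dom C (Cmp C (cm b f) (Q u x)) = Cod C (rh u x)"
   "Dom C (Cmp C (Q u y) ?g) = Cod C (rh u x)"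
   using c g rx(6,10-12) ry(10-12) by (simp_all only: Cmp_Ar Dom_Cmp cat)
  from iso_cancel_right[OF cat rx(9) this] show ?thesis by metis
 qed
 finally show ?thesis .
qed

text \<open>The unit of displays is a section of the second projection, so \<open>Q\<close> composed
  with both arrows of the law is always an identity; the law then says that \<open>Q\<close> itself
  is one.\<close>

lemma unit_iff:
 assumes a: "a \<in> Ob B" and x: "x \<in> Ob (IFib P a)"
 shows "Cmp (Sl (FOb F a)) (XRho Z (Idn B a) x) (IUnit DI (FOb F a) (pr a x)) = FAr (XFun Z a) (IUnit P a x) \<longleftrightarrow>
  Q (Idn B a) x = Idn C (Dom C (pr a x))" (is "?s \<longleftrightarrow> ?n")
proof -
 have p: "FOb F a \<in> Ob C" "pr a x \<in> Disp D" "Cod C (pr a x) = FOb F a" using a x by simp_all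
 note n = unit_mid[OF p] unit_fst[OF p] unit_snd[OF p] disp_unit_Ar(1)[OF p]
 let ?r = "rh (Idn B a) x" and ?n = "mid (IUnit DI (FOb F a) (pr a x))" and ?q = "Q (Idn B a) x"
 have i: "re (Idn B a) x = x" "Idn B a \<in> Ar B" "Dom B (Idn B a) = a" "Cod B (Idn B a) = a" "FAr F (Idn B a) = Idn C (FOb F a)" using a x by simp_all
 note r = rh[of "Idn B a" x, unfolded i, OF i(2) x]
 have q: "Cmp C ?q (Cmp C ?r ?n) = Idn C (Dom C (pr a x))"
  by (subst Cmp_reassoc1[OF r(8)]) (use r n in simp_all)
 have "?s \<longleftrightarrow> Cmp C ?r ?n = Idn C (Dom C (pr a x))"
  using slice_Cmp[OF r(1) n(8)] r(2,3) n a x by (simp add: strict_unit)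
 also have "\<dots> \<longleftrightarrow> ?q = Idn C (Dom C (pr a x))" using q r n by auto
 finally show ?thesis .
qed

text \<open>The multiplicativity law of the structural isomorphisms is strict compositionality of
  the upper sides of the squares.\<close>

lemma mult_iff:
 assumes uv: "u \<in> Ar B" "v \<in> Ar B" "Dom B u = Cod B v" and x: "x \<in> Ob (IFib P (Cod B u))" and S: "S = Sl (FOb F (Dom B v))"
 shows "Cmp S (XRho Z (Cmp B u v) x) (IMult DI (FAr F u) (FAr F v) (pr (Cod B u) x)) =
   Cmp S (FAr (XFun Z (Dom B v)) (IMult P u v x)) (Cmp S (XRho Z v (re u x)) (FAr (IRe DI (FAr F v)) (XRho Z u x))) \<longleftrightarrow>
  Q (Cmp B u v) x = Cmp C (Q u x) (Q v (re u x))" (is "?s \<longleftrightarrow> ?n")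
proof -
 let ?p = "pr (Cod B u) x" and ?w = "Cmp C (FAr F u) (FAr F v)" and ?y = "re v (re u x)"
 have Fuv: "FAr F v \<in> Ar C" "FAr F u \<in> Ar C" "Dom C (FAr F u) = Cod C (FAr F v)" using uv by simp_all
 have ux: "re u x \<in> Ob (IFib P (Cod B v))" using uv x re_Ob[of u x] by simp
 have p: "?p \<in> Disp D" "Cod C ?p = Cod C (FAr F u)" using uv x by simp_all
 have c: "Cmp B u v \<in> Ar B" "Dom B (Cmp B u v) = Dom B v" "Cod B (Cmp B u v) = Cod B u" "FAr F (Cmp B u v) = ?w" "re (Cmp B u v) x = ?y"
  using uv x by simp_all
 note mu = disp_mult_Ar[OF Fuv(2,1,3) p] mult_mid[OF Fuv(2,1,3) p] mult_Pb[OF Fuv(2,1,3) p refl] and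
  R = rh[OF c(1), of x, unfolded c, OF x] and U = rh[OF uv(1) x] and V = rh[OF uv(2) ux]
 have ru: "XRho Z u x \<in> Ar (Sl (Cod C (FAr F v)))" using U(1) uv by simp
 note ri = disp_re_Ar[OF Fuv(1) ru]
 have pv: "Pb2 D (FAr F v) (Pb1 D (FAr F u) ?p) \<in> Ar C" "Cod C (Pb2 D (FAr F v) (Pb1 D (FAr F u) ?p)) = Dom C (Pb1 D (FAr F u) ?p)"
  using Fuv p by simp_all
 have py: "pr (Dom B v) ?y \<in> Ar C" using uv ux by simp
 let ?M = "IMult DI (FAr F u) (FAr F v) ?p" and ?N = "FAr (IRe DI (FAr F v)) (XRho Z u x)"
 define M where "M = mid ?M"
 define N where "N = mid ?N"
 define \<rho> where "\<rho> = rh (Cmp B u v) x"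
 define \<sigma> where "\<sigma> = rh v (re u x)"
 define q where "q = Q (Cmp B u v) x"
 define q' where "q' = Cmp C (Q u x) (Q v (re u x))"
 have N: "N \<in> Ar C" "Dom C N = Dom C (Pb1 D (FAr F v) (Pb1 D (FAr F u) ?p))" "Cod C N = Dom C (Pb1 D (FAr F v) (pr (Dom B u) (re u x)))"
  "Cmp C (Pb1 D (FAr F v) (pr (Dom B u) (re u x))) N = Pb1 D (FAr F v) (Pb1 D (FAr F u) ?p)"
  "Cmp C (Pb2 D (FAr F v) (pr (Dom B u) (re u x))) N = Cmp C (rh u x) (Pb2 D (FAr F v) (Pb1 D (FAr F u) ?p))"
  unfolding N_def using re_mid[OF Fuv(1) ru] re_Pb[OF Fuv(1) ru refl] U(2,3) by simp_all
 note M = mu(3-)[folded M_def] and mi = mu(2)[folded M_def] and R' = R(4-)[folded \<rho>_def q_def] and V' = V(4-)[folded \<sigma>_def, folded uv(3)]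
 have cs: "Cmp S (XRho Z v (re u x)) ?N \<in> Ar S" unfolding S
  by (rule slice_Cmp_Ar[OF V(1)]) (use U V ru ri Fuv uv in simp_all)
 \<comment> \<open>\<open>P\<close> is strict, so its own multiplication is an identity and
   disappears from the law.\<close>
 have "FAr (XFun Z (Dom B v)) (IMult P u v x) = Idn S (pr (Dom B v) ?y)" using uv x ux by (simp add: strict_mult S)
 moreover have "Cod S (Cmp S (XRho Z v (re u x)) ?N) = pr (Dom B v) ?y"
  using slice_Cod[OF cs[unfolded S]] V ri ru U Fuv uv by (simp add: S)
 ultimately have i: "Cmp S (FAr (XFun Z (Dom B v)) (IMult P u v x)) (Cmp S (XRho Z v (re u x)) ?N) = Cmp S (XRho Z v (re u x)) ?N"
  using cs Cmp_Idn_l[OF slice_category cs[unfolded S]] by (simp add: S)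
 have s: "?s \<longleftrightarrow> Cmp C \<rho> M = Cmp C \<sigma> N"
  unfolding i using slice_Cmp[OF R(1), of ?M] slice_Cmp[OF V(1), of ?N] mu(1) R(2,3) V(2,3) U(2,3) ri ru Fuv p uv
  by (simp add: S M_def N_def \<rho>_def \<sigma>_def)
 have q': "q' \<in> Ar C" "Dom C q' = Dom C (pr (Dom B v) ?y)" unfolding q'_def using U V uv(3) by simp_all
 \<comment> \<open>In any case \<open>q\<close> after \<open>\<rho> M\<close> equals
   \<open>q'\<close> after \<open>\<sigma> N\<close>. Hence the slice law gives
   \<open>q = q'\<close> by cancelling an isomorphism, and the converse follows from uniqueness of
   arrows into the pullback.\<close>
 have "Cmp C q (Cmp C \<rho> M) = Cmp C (Pb2 D ?w ?p) M"
  by (rule Cmp_reassoc1[OF R'(5)]) (use R' M in simp_all)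
 also have "\<dots> = Cmp C (Q u x) (Cmp C (rh u x) (Pb2 D (FAr F v) (Pb1 D (FAr F u) ?p)))"
  unfolding M(5) by (rule Cmp_reassoc1[OF U(8), symmetric]) (use U pv in simp_all)
 also have "\<dots> = Cmp C (Q u x) (Cmp C (Q v (re u x)) (Cmp C \<sigma> N))"
  unfolding N(5)[symmetric] by (subst Cmp_reassoc1[OF V'(5)]) (use V' N in simp_all)
 also have "\<dots> = Cmp C q' (Cmp C \<sigma> N)" unfolding q'_def using U V' N by simp
 finally have qq: "Cmp C q (Cmp C \<rho> M) = Cmp C q' (Cmp C \<sigma> N)" .
 show ?thesis unfolding s unfolding q_def[symmetric] q'_def[symmetric]
 proof
  assume e: "Cmp C \<rho> M = Cmp C \<sigma> N"
  have "iso_arrow C (Cmp C \<rho> M)" using R' mi M by simp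
  from iso_cancel_right[OF cat this] show "q = q'" using qq[folded e] q' R' M by simp
 next
  assume e: "q = q'"
  have "Cmp C (pr (Dom B v) ?y) (Cmp C \<rho> M) = Cmp C (pr (Dom B v) ?y) (Cmp C \<sigma> N)"
   unfolding Cmp_reassoc1[OF R'(4) cat M(1) M(3)[folded R'(2)] py R'(1) R'(3)[symmetric]]
    Cmp_reassoc1[OF V'(4) cat N(1) N(3)[folded V'(2)] py V'(1) V'(3)[symmetric]] M(4) N(4) ..
  then show "Cmp C \<rho> M = Cmp C \<sigma> N" using qq[folded e]
   by - (rule pb_unique[OF cat pb[OF c(1), of x, unfolded c, OF x, folded q_def]], use R' V' M N in simp_all)
 qed
qed

end

text \<open>Through \<open>nat_iff\<close>, \<open>unit_iff\<close> and \<open>mult_iff\<close> the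
  three laws of an indexed functor are the laws of the cartesian family, so coherence never has to
  be checked in slices again.\<close>

lemma disp_valuedI:
 assumes Q: "cartesian_family Q" and R: "comparison_family Q"
  and ext: "XFun Z \<in> extensional (Ob B)" "XRho Z \<in> extensional (Ar B)"
   "\<And>u. u \<in> Ar B ==> XRho Z u \<in> extensional (Ob (IFib P (Cod B u)))"
 shows "indexed_functor Z"
proof -
 let ?I = "DI"
 have XB: "XBase Z = B" using X by (simp add: XBase_def)
 note pb = Q_pb[OF Q]
 note r = rh[OF R pb]
 show ?thesis
 proof (rule indexed_functor.intro, unfold XB)
  show "indexed_category (XDom Z)" using P X strict_indexed_category.axioms(1) by metis
  show "indexed_category (XCod Z)" unfolding X by (rule pull_indexed) (simp_all add: disp_indexed)
  show "IBase (XCod Z) = B" using X by simp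
  show "XFun Z \<in> extensional (Ob B)" "XRho Z \<in> extensional (Ar B)" by (fact ext)+
  show "XFun Z a \<in> functors (IFib (XDom Z) a) (IFib (XCod Z) a)" if "a \<in> Ob B" for a
   using that X by (simp add: functors_iff)
  show "nat_iso (comp_func (IRe (XCod Z) u) (XFun Z b)) (comp_func (XFun Z a) (IRe (XDom Z) u)) (XRho Z u)"
   if u: "u \<in> hom B a b" for u a b
  proof -
   have u': "u \<in> Ar B" and ab: "a = Dom B u" "b = Cod B u" using u by (auto simp: hom_iff)
   have i: "functor (IRe ?I (FAr F u))" using u' by (intro disp_re_functor) simp
   show ?thesis
    unfolding X ab
   proof (intro nat_isoI nat_transI)
    show "functor (comp_func (IRe (pull_icat F ?I) u) (XFun Z (Cod B u)))"
     "functor (comp_func (XFun Z (Dom B u)) (IRe P u))" using u' i by simp_all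
    fix f assume "f \<in> Ar (FDom (comp_func (IRe (pull_icat F ?I) u) (XFun Z (Cod B u))))"
    then have f: "f \<in> Ar (IFib P (Cod B u))" using u' by simp
    show "Cmp (FCod (comp_func (IRe (pull_icat F ?I) u) (XFun Z (Cod B u))))
      (XRho Z u (Cod (FDom (comp_func (IRe (pull_icat F ?I) u) (XFun Z (Cod B u)))) f))
      (FAr (comp_func (IRe (pull_icat F ?I) u) (XFun Z (Cod B u))) f) =
     Cmp (FCod (comp_func (IRe (pull_icat F ?I) u) (XFun Z (Cod B u)))) (FAr (comp_func (XFun Z (Dom B u)) (IRe P u)) f)
      (XRho Z u (Dom (FDom (comp_func (IRe (pull_icat F ?I) u) (XFun Z (Cod B u)))) f))"
     using nat_iff[OF R pb u' f refl refl refl refl] Q u' f by (simp add: cartesian_family_def)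
   qed (use u' i r(1-3) ext slice_iso[OF r(1,9)] in simp_all)
  qed
  show "Cmp (IFib (XCod Z) a) (XRho Z (Idn B a) x) (IUnit (XCod Z) a (FOb (XFun Z a) x)) =
    FAr (XFun Z a) (IUnit (XDom Z) a x)" if a: "a \<in> Ob B" and "x \<in> Ob (IFib (XDom Z) a)" for a x
   using unit_iff[OF R pb a, of x] that Q by (simp add: X cartesian_family_def del: disp_unit_simp)
  show "Cmp (IFib (XCod Z) a) (XRho Z (Cmp B u v) x) (IMult (XCod Z) u v (FOb (XFun Z c) x)) =
    Cmp (IFib (XCod Z) a) (FAr (XFun Z a) (IMult (XDom Z) u v x))
     (Cmp (IFib (XCod Z) a) (XRho Z v (FOb (IRe (XDom Z) u) x)) (FAr (IRe (XCod Z) v) (XRho Z u x)))"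
   if h: "v \<in> hom B a b" "u \<in> hom B b c" "x \<in> Ob (IFib (XDom Z) c)" for u v a b c x
  proof -
   have uv: "u \<in> Ar B" "v \<in> Ar B" "Dom B u = Cod B v" and abc: "a = Dom B v" "c = Cod B u"
    and x: "x \<in> Ob (IFib P (Cod B u))" using h X by (auto simp: hom_iff)
   then have "Q (Cmp B u v) x = Cmp C (Q u x) (Q v (re u x))" using Q by (simp add: cartesian_family_def)
   then show ?thesis using mult_iff[OF R pb uv x refl] uv x abc by (simp add: X del: slice_Cmp disp_mult_simp)
  qed
 qed
qed

text \<open>The passage back: an indexed functor determines its cartesian family, by transporting
  the second projections of the chosen pullbacks along the inverses of the structural
  isomorphisms.\<close>

definition canonical_family :: "'a => 'x => 'b" where
 "canonical_family u x = Cmp C (Pb2 D (FAr F u) (pr (Cod B u) x)) (inv_arrow C (mid (XRho Z u x)))"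

context
 assumes I: "indexed_functor Z"
begin

lemma XB: "XBase Z = B"
 using X by (simp add: XBase_def)

lemma rho_nat_iso:
 assumes "u \<in> Ar B"
 shows "nat_iso (comp_func (IRe DI (FAr F u)) (XFun Z (Cod B u))) (comp_func (XFun Z (Dom B u)) (IRe P u))
  (XRho Z u)"
 using indexed_functor.XRho_iso[OF I, of u "Dom B u" "Cod B u"] assms X XB by (simp add: hom_iff)

lemma
 assumes "u \<in> Ar B" "x \<in> Ob (IFib P (Cod B u))"
 shows rho_Ar: "XRho Z u x \<in> Ar (Sl (FOb F (Dom B u)))"
  and rho_fst: "fst (XRho Z u x) = Pb1 D (FAr F u) (pr (Cod B u) x)"
  and rho_snd: "snd (snd (XRho Z u x)) = pr (Dom B u) (re u x)"
  and rho_iso: "iso_arrow C (mid (XRho Z u x))"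
proof -
 note n = rho_nat_iso[OF assms(1)]
 then have t: "nat_trans (comp_func (IRe DI (FAr F u)) (XFun Z (Cod B u)))
   (comp_func (XFun Z (Dom B u)) (IRe P u)) (XRho Z u)" by (simp add: nat_iso_def)
 show a: "XRho Z u x \<in> Ar (Sl (FOb F (Dom B u)))"
  using nat_trans_Ar[OF t, of x] assms by simp
 show "fst (XRho Z u x) = Pb1 D (FAr F u) (pr (Cod B u) x)"
  "snd (snd (XRho Z u x)) = pr (Dom B u) (re u x)"
  using nat_trans_Dom[OF t, of x] nat_trans_Cod[OF t, of x] assms slice_Dom[OF a] slice_Cod[OF a] by simp_all
 have "iso_arrow (Sl (FOb F (Dom B u))) (XRho Z u x)"
  using n assms by (simp add: nat_iso_def)
 then show "iso_arrow C (mid (XRho Z u x))" by (rule slice_iso_mid)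
qed

lemma
 assumes "u \<in> Ar B" "x \<in> Ob (IFib P (Cod B u))"
 shows rho_mid [simp]: "mid (XRho Z u x) \<in> Ar C" "Dom C (mid (XRho Z u x)) = Dom C (Pb1 D (FAr F u) (pr (Cod B u) x))"
  "Cod C (mid (XRho Z u x)) = Dom C (pr (Dom B u) (re u x))"
  "Cmp C (pr (Dom B u) (re u x)) (mid (XRho Z u x)) = Pb1 D (FAr F u) (pr (Cod B u) x)"
 using slice_Ar_simps[OF rho_Ar[OF assms]] rho_fst[OF assms] rho_snd[OF assms] by simp_all

lemma canonical_rho:
 assumes "u \<in> Ar B" "x \<in> Ob (IFib P (Cod B u))"
 shows "Cmp C (canonical_family u x) (mid (XRho Z u x)) = Pb2 D (FAr F u) (pr (Cod B u) x)"
  and "canonical_family u x \<in> Ar C" "Dom C (canonical_family u x) = Dom C (pr (Dom B u) (re u x))"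
  "Cod C (canonical_family u x) = Dom C (pr (Cod B u) x)"
 using assms rho_iso[OF assms] by (simp_all add: canonical_family_def)

lemma comparison_canonical: "comparison_family canonical_family"
 unfolding comparison_family_def using rho_Ar rho_fst rho_snd canonical_rho by blast

lemma canonical_pb:
 assumes ux: "u \<in> Ar B" "x \<in> Ob (IFib P (Cod B u))"
 shows "is_pullback C (FAr F u) (pr (Cod B u) x) (pr (Dom B u) (re u x)) (canonical_family u x)"
proof -
 let ?i = "inv_arrow C (mid (XRho Z u x))"
 have pb: "is_pullback C (FAr F u) (pr (Cod B u) x) (Pb1 D (FAr F u) (pr (Cod B u) x)) (Pb2 D (FAr F u) (pr (Cod B u) x))"
  using ux by (intro Pb) simp_all
 have "is_pullback C (FAr F u) (pr (Cod B u) x) (Cmp C (Pb1 D (FAr F u) (pr (Cod B u) x)) ?i) (canonical_family u x)"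
  unfolding canonical_family_def by (rule pb_transport[OF cat pb]) (use ux rho_iso[OF ux] in simp_all)
 moreover have "Cmp C (Pb1 D (FAr F u) (pr (Cod B u) x)) ?i = pr (Dom B u) (re u x)"
  using Cmp_assoc[of C "pr (Dom B u) (re u x)" "mid (XRho Z u x)" ?i] ux rho_iso[OF ux] by simp
 ultimately show ?thesis by simp
qed

lemma canonical_nat:
 assumes u: "u \<in> Ar B" and f: "f \<in> Ar (IFib P (Cod B u))"
 shows "Cmp C (canonical_family u (Cod (IFib P (Cod B u)) f)) (cm (Dom B u) (FAr (IRe P u) f)) =
   Cmp C (cm (Cod B u) f) (canonical_family u (Dom (IFib P (Cod B u)) f))"
proof -
 have "nat_trans (comp_func (IRe DI (FAr F u)) (XFun Z (Cod B u))) (comp_func (XFun Z (Dom B u)) (IRe P u)) (XRho Z u)"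
  using rho_nat_iso[OF u] by (simp add: nat_iso_def)
 from nat_trans_nat[OF this, of f]
 show ?thesis using nat_iff[OF comparison_canonical canonical_pb u f refl refl refl refl] u f by simp
qed

lemma canonical_Idn:
 assumes a: "a \<in> Ob B" and x: "x \<in> Ob (IFib P a)"
 shows "canonical_family (Idn B a) x = Idn C (Dom C (pr a x))"
 using unit_iff[OF comparison_canonical canonical_pb a x] indexed_functor.XRho_unit[OF I, of a x] a x XB
 by (simp add: X del: disp_unit_simp slice_Cmp)

lemma canonical_Cmp:
 assumes uv: "u \<in> Ar B" "v \<in> Ar B" "Dom B u = Cod B v" and x: "x \<in> Ob (IFib P (Cod B u))"
 shows "canonical_family (Cmp B u v) x = Cmp C (canonical_family u x) (canonical_family v (re u x))"
 using mult_iff[OF comparison_canonical canonical_pb uv x refl]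
  indexed_functor.XRho_mult[OF I, of v "Dom B v" "Cod B v" u "Cod B u" x] uv x XB
 by (simp add: X hom_iff del: disp_mult_simp slice_Cmp)

lemma cartesian_canonical: "cartesian_family canonical_family"
 unfolding cartesian_family_def
 using canonical_pb canonical_nat canonical_Idn canonical_Cmp by blast

end

end

section \<open>Categories with attributes\<close>

abbreviation Ctx where "Ctx C \<equiv> Ob (WCat C)"
abbreviation Sub where "Sub C \<equiv> Ar (WCat C)"
abbreviation Dm where "Dm C \<equiv> Dom (WCat C)"
abbreviation Cd where "Cd C \<equiv> Cod (WCat C)"
abbreviation Cm where "Cm C \<equiv> Cmp (WCat C)"
abbreviation Tp where "Tp C \<equiv> IFib (WTp C)"
abbreviation Re where "Re C u \<equiv> FOb (IRe (WTp C) u)"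
abbreviation Rf where "Rf C u \<equiv> FAr (IRe (WTp C) u)"

text \<open>Smallness plays no role in most of what follows, so it is split off from the structure.\<close>

abbreviation cw :: "'u cwa => bool" where "cw C \<equiv> cwa (\<lambda>_. True) C"
abbreviation cw_mor :: "'u cwa_mor => bool" where "cw_mor H \<equiv> cwa_mor (\<lambda>_. True) H"
abbreviation cw_cell :: "'u cwa_cell => bool" where "cw_cell L \<equiv> cwa_cell (\<lambda>_. True) L"

definition small_cwa :: "('u set => bool) => 'u cwa => bool" where
 "small_cwa small C \<longleftrightarrow> small (Ctx C) \<and> small (Sub C) \<and>
  (\<forall>X \<in> Ctx C. small (Ob (Tp C X)) \<and> small (Ar (Tp C X)))"

lemma cwa_iff: "cwa small C \<longleftrightarrow> cw C \<and> small_cwa small C"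
 by (auto simp: cwa_def small_category_def small_cwa_def)

lemma cwa_mor_iff: "cwa_mor small H \<longleftrightarrow> cw_mor H \<and> cwa small (HSrc H) \<and> cwa small (HTrg H)"
 unfolding cwa_mor_def Let_def using cwa_iff[of small "HSrc H"] cwa_iff[of small "HTrg H"] by blast

lemma cwa_cell_iff: "cwa_cell small L \<longleftrightarrow> cw_cell L \<and> cwa_mor small (LSrc L)"
 unfolding cwa_cell_def Let_def
 using cwa_mor_iff[of small "LSrc L"] cwa_mor_iff[of small "LTrg L"] by metis

definition proj :: "'u cwa => 'u => 'u => 'u" where
 "proj C X A = FOb (XFun (WComp C) X) A"

definition ext_map :: "'u cwa => 'u => 'u => 'u" where
 "ext_map C X f = fst (snd (FAr (XFun (WComp C) X) f))"

text \<open>The upper side of the pullback square that comprehension assigns to \<open>u\<close> and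
  \<open>A\<close>, from the extension by the reindexed type to the extension by \<open>A\<close>:
  the \<open>canonical_family\<close> of comprehension, written out. It turns the coherence of
  comprehension into \<open>cart_nat\<close>, \<open>cart_Idn\<close> and
  \<open>cart_Cmp\<close>.\<close>

definition cart :: "'u cwa => 'u => 'u => 'u" where
 "cart C u A = Cm C (Pb2 (WDisp C) u (proj C (Cd C u) A))
  (inv_arrow (WCat C) (fst (snd (XRho (WComp C) u A))))"

text \<open>
 The arrow \<open>X.A \<rightarrow> Y.B\<close> over \<open>u : X \<rightarrow> Y\<close> that a map of types \<open>f : A \<rightarrow> B[u]\<close> induces. Since
 comprehension is an equivalence, \<open>f \<mapsto> realize C u B f\<close> is a bijection onto such arrows.
\<close>

definition realize :: "'u cwa => 'u => 'u => 'u => 'u" where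
 "realize C u B f = Cm C (cart C u B) (ext_map C (Dm C u) f)"

abbreviation cext :: "'u cwa => 'u => 'u => 'u" where
 "cext C X A \<equiv> Dm C (proj C X A)"

lemma
 assumes "cw C"
 shows cw_disp: "display_category (WDisp C)" and cw_cat [simp]: "category (WCat C)"
  and cw_tp [simp]: "strict_indexed_category (WTp C)" and cw_base [simp]: "IBase (WTp C) = WCat C"
  and cw_fib [simp]: "X \<in> Ctx C ==> category (Tp C X)"
  and cw_re [simp]: "u \<in> Sub C ==> FDom (IRe (WTp C) u) = Tp C (Cd C u)"
   "u \<in> Sub C ==> FCod (IRe (WTp C) u) = Tp C (Dm C u)"
   "u \<in> Sub C ==> functor (IRe (WTp C) u)"
  and cw_XFun: "X \<in> Ctx C ==> functor (XFun (WComp C) X)"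
   "X \<in> Ctx C ==> FDom (XFun (WComp C) X) = Tp C X"
   "X \<in> Ctx C ==> FCod (XFun (WComp C) X) = disp_slice (WDisp C) X"
  and cw_equiv: "X \<in> Ctx C ==> equivalence_functor (XFun (WComp C) X)"
  and cw_indexed: "indexed_functor (WComp C)"
  and cw_dv: "disp_valued (WDisp C) (WTp C) (id_func (WCat C)) (WComp C)"
proof -
 show d: "display_category (WDisp C)" using assms by (simp add: cwa_def)
 then interpret display_category "WDisp C" .
 show c: "category (WCat C)" by (rule cat)
 show t: "strict_indexed_category (WTp C)" and b: "IBase (WTp C) = WCat C" using assms by (simp_all add: cwa_def)
 show "X \<in> Ctx C ==> category (Tp C X)"
   "u \<in> Sub C ==> FDom (IRe (WTp C) u) = Tp C (Cd C u)"
   "u \<in> Sub C ==> FCod (IRe (WTp C) u) = Tp C (Dm C u)"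
   "u \<in> Sub C ==> functor (IRe (WTp C) u)"
  using strict_fib[OF t] strict_re[OF t] b by simp_all
 have e: "indexed_equivalence (WComp C)" "XDom (WComp C) = WTp C" "XCod (WComp C) = disp_icat (WDisp C)"
  using assms by (simp_all add: cwa_def)
 have XB: "XBase (WComp C) = WCat C" using e b by (simp add: XBase_def)
 show i: "indexed_functor (WComp C)" using e by (simp add: indexed_equivalence_def)
 show "X \<in> Ctx C ==> equivalence_functor (XFun (WComp C) X)"
  using e XB by (simp add: indexed_equivalence_def)
 show f: "X \<in> Ctx C ==> functor (XFun (WComp C) X)"
   "X \<in> Ctx C ==> FDom (XFun (WComp C) X) = Tp C X"
   "X \<in> Ctx C ==> FCod (XFun (WComp C) X) = disp_slice (WDisp C) X" for X
  using indexed_functor.XFun_functor[OF i, of X] XB e by (simp_all add: functors_iff)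
 \<comment> \<open>Displays are presented as their own base change along the identity functor, which
   makes comprehension an instance of \<open>disp_valued\<close>.\<close>
 have "pull_icat (id_func (WCat C)) (disp_icat (WDisp C)) = disp_icat (WDisp C)"
  by (rule pull_id) (simp_all add: disp_indexed)
 then show "disp_valued (WDisp C) (WTp C) (id_func (WCat C)) (WComp C)"
  using c t b e f d by (intro disp_valued.intro disp_valued_axioms.intro) simp_all
qed

lemma
 assumes "cw C" "X \<in> Ctx C" "A \<in> Ob (Tp C X)"
 shows proj_Disp [simp]: "proj C X A \<in> Disp (WDisp C)" and proj_Ar [simp]: "proj C X A \<in> Sub C"
  and Cod_proj [simp]: "Cd C (proj C X A) = X"
  and ext_map_Idn [simp]: "ext_map C X (Idn (Tp C X) A) = Idn (WCat C) (cext C X A)"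
proof -
 interpret disp_valued "WDisp C" "WTp C" "id_func (WCat C)" "WComp C" by (rule cw_dv[OF assms(1)])
 show "proj C X A \<in> Disp (WDisp C)" "proj C X A \<in> Sub C" "Cd C (proj C X A) = X"
  "ext_map C X (Idn (Tp C X) A) = Idn (WCat C) (cext C X A)"
  using assms by (simp_all add: proj_def ext_map_def)
qed

lemma
 assumes "cw C" "X \<in> Ctx C" "f \<in> Ar (Tp C X)"
 shows ext_map_Ar [simp]: "ext_map C X f \<in> Sub C"
  and Dom_ext_map [simp]: "Dm C (ext_map C X f) = cext C X (Dom (Tp C X) f)"
  and Cod_ext_map [simp]: "Cd C (ext_map C X f) = cext C X (Cod (Tp C X) f)"
  and proj_ext_map [simp]: "B = Cod (Tp C X) f ==>
   Cm C (proj C X B) (ext_map C X f) = proj C X (Dom (Tp C X) f)"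
  and FAr_WComp: "FAr (XFun (WComp C) X) f =
   (proj C X (Dom (Tp C X) f), ext_map C X f, proj C X (Cod (Tp C X) f))"
proof -
 interpret disp_valued "WDisp C" "WTp C" "id_func (WCat C)" "WComp C" by (rule cw_dv[OF assms(1)])
 have h: "X \<in> Ob (IBase (WTp C))" using assms by simp
 note m = cm[OF h assms(3)]
 show "ext_map C X f \<in> Sub C" "Dm C (ext_map C X f) = cext C X (Dom (Tp C X) f)"
  "Cd C (ext_map C X f) = cext C X (Cod (Tp C X) f)"
  "B = Cod (Tp C X) f ==>
   Cm C (proj C X B) (ext_map C X f) = proj C X (Dom (Tp C X) f)"
  unfolding proj_def ext_map_def using m(3-6) by simp_all
 show "FAr (XFun (WComp C) X) f =
   (proj C X (Dom (Tp C X) f), ext_map C X f, proj C X (Cod (Tp C X) f))"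
  unfolding proj_def ext_map_def using m(1,2) by (simp add: prod_eq_iff)
qed

lemma ext_map_Cmp [simp]:
 assumes "cw C" "X \<in> Ctx C" "f \<in> Ar (Tp C X)" "g \<in> Ar (Tp C X)"
  "Dom (Tp C X) g = Cod (Tp C X) f"
 shows "ext_map C X (Cmp (Tp C X) g f) = Cm C (ext_map C X g) (ext_map C X f)"
proof -
 interpret disp_valued "WDisp C" "WTp C" "id_func (WCat C)" "WComp C" by (rule cw_dv[OF assms(1)])
 show ?thesis unfolding ext_map_def using assms by (intro cm_Cmp) simp_all
qed

lemma
 assumes "cw C" "u \<in> Sub C" "A \<in> Ob (Tp C (Cd C u))"
 shows cart_pb: "is_pullback (WCat C) u (proj C (Cd C u) A)
   (proj C (Dm C u) (Re C u A)) (cart C u A)"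
  and cart_Ar [simp]: "cart C u A \<in> Sub C"
  and Dom_cart [simp]: "Dm C (cart C u A) = cext C (Dm C u) (Re C u A)"
  and Cod_cart [simp]: "Cd C (cart C u A) = cext C (Cd C u) A"
  and cart_comm: "Y = Cd C u ==> Cm C (proj C Y A) (cart C u A) =
   Cm C u (proj C (Dm C u) (Re C u A))"
  and WComp_XRho: "XRho (WComp C) u A \<in> Ar (disp_slice (WDisp C) (Dm C u))"
   "fst (XRho (WComp C) u A) = Pb1 (WDisp C) u (proj C (Cd C u) A)"
   "snd (snd (XRho (WComp C) u A)) = proj C (Dm C u) (Re C u A)"
   "Cm C (cart C u A) (fst (snd (XRho (WComp C) u A))) = Pb2 (WDisp C) u (proj C (Cd C u) A)"
proof -
 interpret disp_valued "WDisp C" "WTp C" "id_func (WCat C)" "WComp C" by (rule cw_dv[OF assms(1)])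
 have h: "u \<in> Ar (IBase (WTp C))" "A \<in> Ob (Tp C (Cod (IBase (WTp C)) u))" using assms by simp_all
 have q: "canonical_family u A = cart C u A" using assms by (simp add: canonical_family_def cart_def proj_def)
 note i = cw_indexed[OF assms(1)]
 note p = canonical_pb[OF i h] canonical_rho[OF i h] Q_comm[OF cartesian_canonical[OF i] h]
 show "is_pullback (WCat C) u (proj C (Cd C u) A)
   (proj C (Dm C u) (Re C u A)) (cart C u A)"
  "cart C u A \<in> Sub C" "Dm C (cart C u A) = cext C (Dm C u) (Re C u A)"
  "Cd C (cart C u A) = cext C (Cd C u) A"
  "Y = Cd C u ==> Cm C (proj C Y A) (cart C u A) =
   Cm C u (proj C (Dm C u) (Re C u A))"
  "Cm C (cart C u A) (fst (snd (XRho (WComp C) u A))) = Pb2 (WDisp C) u (proj C (Cd C u) A)"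
  using p assms unfolding q proj_def by simp_all
 show "XRho (WComp C) u A \<in> Ar (disp_slice (WDisp C) (Dm C u))"
   "fst (XRho (WComp C) u A) = Pb1 (WDisp C) u (proj C (Cd C u) A)"
   "snd (snd (XRho (WComp C) u A)) = proj C (Dm C u) (Re C u A)"
  using rho_Ar[OF i h] rho_fst[OF i h] rho_snd[OF i h] assms unfolding proj_def by simp_all
qed

lemma cart_nat:
 assumes "cw C" "u \<in> Sub C" "f \<in> Ar (Tp C (Cd C u))"
 shows "Cm C (cart C u (Cod (Tp C (Cd C u)) f)) (ext_map C (Dm C u) (Rf C u f)) =
  Cm C (ext_map C (Cd C u) f) (cart C u (Dom (Tp C (Cd C u)) f))"
proof -
 interpret disp_valued "WDisp C" "WTp C" "id_func (WCat C)" "WComp C" by (rule cw_dv[OF assms(1)])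
 have h: "u \<in> Ar (IBase (WTp C))" "f \<in> Ar (Tp C (Cod (IBase (WTp C)) u))" using assms by simp_all
 show ?thesis using canonical_nat[OF cw_indexed[OF assms(1)] h] assms
  by (simp add: canonical_family_def cart_def proj_def ext_map_def)
qed

lemma cart_Idn [simp]:
 assumes "cw C" "X \<in> Ctx C" "A \<in> Ob (Tp C X)"
 shows "cart C (Idn (WCat C) X) A = Idn (WCat C) (cext C X A)"
proof -
 interpret disp_valued "WDisp C" "WTp C" "id_func (WCat C)" "WComp C" by (rule cw_dv[OF assms(1)])
 show ?thesis using canonical_Idn[OF cw_indexed[OF assms(1)], of X A] assms
  by (simp add: canonical_family_def cart_def proj_def)
qed

lemma cart_Cmp:
 assumes "cw C" "u \<in> Sub C" "v \<in> Sub C" "Dm C u = Cd C v"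
  "A \<in> Ob (Tp C (Cd C u))"
 shows "cart C (Cm C u v) A = Cm C (cart C u A) (cart C v (Re C u A))"
proof -
 interpret disp_valued "WDisp C" "WTp C" "id_func (WCat C)" "WComp C" by (rule cw_dv[OF assms(1)])
 show ?thesis using canonical_Cmp[OF cw_indexed[OF assms(1)], of u v A] assms
  by (simp add: canonical_family_def cart_def proj_def)
qed

text \<open>An arrow \<open>(u, f)\<close> from \<open>A\<close> to \<open>B\<close> in the total
  category (Grothendieck construction) of the indexed category of types.\<close>

definition over :: "'u cwa => 'u => 'u => 'u => 'u => bool" where
 "over C u f B A \<longleftrightarrow> u \<in> Sub C \<and> B \<in> Ob (Tp C (Cd C u)) \<and>
  f \<in> Ar (Tp C (Dm C u)) \<and> Dom (Tp C (Dm C u)) f = A \<and>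
  Cod (Tp C (Dm C u)) f = Re C u B"

lemma
 assumes "cw C" "over C u f B A"
 shows over_Ob: "A \<in> Ob (Tp C (Dm C u))"
  and realize_Ar [simp]: "realize C u B f \<in> Sub C"
  and Dom_realize: "Dm C (realize C u B f) = cext C (Dm C u) A"
  and Cod_realize: "Cd C (realize C u B f) = cext C (Cd C u) B"
  and proj_realize: "Cm C (proj C (Cd C u) B) (realize C u B f) =
   Cm C u (proj C (Dm C u) A)"
proof -
 note h = assms(2)[unfolded over_def]
 show "A \<in> Ob (Tp C (Dm C u))"
  using h assms(1) Dom_Ob[of "Tp C (Dm C u)" f] by simp
 show "realize C u B f \<in> Sub C" "Dm C (realize C u B f) = cext C (Dm C u) A"
  "Cd C (realize C u B f) = cext C (Cd C u) B"
  using h assms(1) by (simp_all add: realize_def)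
 have "Cm C (proj C (Cd C u) B) (Cm C (cart C u B) (ext_map C (Dm C u) f)) =
  Cm C u (Cm C (proj C (Dm C u) (Re C u B)) (ext_map C (Dm C u) f))"
  by (rule Cmp_reassoc[OF cart_comm]) (use h assms(1) in simp_all)
 then show "Cm C (proj C (Cd C u) B) (realize C u B f) = Cm C u (proj C (Dm C u) A)"
  using h assms(1) by (simp add: realize_def)
qed

lemma realize_Idn [simp]:
 "cw C ==> u = Idn (WCat C) X ==> X \<in> Ctx C ==> f \<in> Ar (Tp C X) ==> B = Cod (Tp C X) f ==>
  realize C u B f = ext_map C X f"
 by (simp add: realize_def)

lemma realize_cart:
 "cw C ==> u \<in> Sub C ==> B \<in> Ob (Tp C (Cd C u)) ==>
  realize C u B (Idn (Tp C (Dm C u)) (Re C u B)) = cart C u B"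
 by (simp add: realize_def)

text \<open>Realization respects composition in the total category of types: \<open>cart\<close>
  splits along the composite and is natural at \<open>g\<close>, which moves \<open>ext_map\<close>
  of \<open>g\<close> past it.\<close>

lemma
 assumes C: "cw C" and f: "over C u f B A" and g: "over C v g D B" and vu: "Dm C v = Cd C u"
 defines "k \<equiv> Cmp (Tp C (Dm C u)) (Rf C u g) f"
 shows over_Cmp: "over C (Cm C v u) k D A"
  and realize_Cmp: "realize C (Cm C v u) D k = Cm C (realize C v D g) (realize C u B f)"
proof -
 note h = f[unfolded over_def] g[unfolded over_def]
 show o: "over C (Cm C v u) k D A"
  using h C vu by (simp add: over_def k_def)
 have "Cm C (cart C u (Re C v D)) (ext_map C (Dm C u) (Rf C u g)) =
  Cm C (ext_map C (Dm C v) g) (cart C u B)"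
  using cart_nat[OF C, of u g] h vu by simp
 note n = Cmp_reassoc[OF this, of "ext_map C (Dm C u) f"]
 show "realize C (Cm C v u) D k = Cm C (realize C v D g) (realize C u B f)"
  using h C vu n by (simp add: realize_def k_def cart_Cmp)
qed

text \<open>The pullback property of \<open>cart\<close> separates the arrows
  \<open>ext_map\<close>, and comprehension is faithful.\<close>

lemma realize_inj:
 assumes C: "cw C" and f: "over C u f B A" and g: "over C u g B A" and e: "realize C u B f = realize C u B g"
 shows "f = g"
proof -
 note h = f[unfolded over_def] g[unfolded over_def]
 have u: "u \<in> Sub C" "B \<in> Ob (Tp C (Cd C u))" using h by simp_all
 have "ext_map C (Dm C u) f = ext_map C (Dm C u) g"
  by (rule pb_unique[OF _ cart_pb[OF C u]]) (use h e C in \<open>simp_all add: realize_def\<close>)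
 then have "FAr (XFun (WComp C) (Dm C u)) f = FAr (XFun (WComp C) (Dm C u)) g"
  using h C by (simp add: FAr_WComp)
 then show ?thesis
  using faithful_functorD[OF equivalence_faithful[OF cw_equiv[OF C]], of "Dm C u" f g] h C
  by (simp add: cw_XFun)
qed

text \<open>An arrow over \<open>u\<close> factors through the pullback square of
  \<open>cart\<close>; the factor is an arrow in the slice, and comprehension is full.\<close>

lemma realize_surj:
 assumes C: "cw C" and u: "u \<in> Sub C" "B \<in> Ob (Tp C (Cd C u))"
  "A \<in> Ob (Tp C (Dm C u))"
  and h: "h \<in> Sub C" "Dm C h = cext C (Dm C u) A" "Cd C h = cext C (Cd C u) B"
   "Cm C (proj C (Cd C u) B) h = Cm C u (proj C (Dm C u) A)"
 shows "\<exists>f. over C u f B A \<and> realize C u B f = h"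
proof -
 interpret display_category "WDisp C" by (rule cw_disp[OF C])
 let ?X = "Dm C u"
 let ?B = "Re C u B"
 have B: "?B \<in> Ob (Tp C ?X)" using u C by simp
 obtain k where k: "k \<in> Sub C" "Dm C k = cext C ?X A" "Cd C k = cext C ?X ?B"
  "Cm C (proj C ?X ?B) k = proj C ?X A" "Cm C (cart C u B) k = h"
  by (rule pb_ex[OF _ cart_pb[OF C u(1,2)], of "proj C ?X A" h]) (use u h C in simp_all)
 have "(proj C ?X A, k, proj C ?X ?B) \<in> Ar (disp_slice (WDisp C) ?X)"
  by (subst slice_Ar) (use u B k C in simp)
 then have "\<exists>f. f \<in> Ar (Tp C ?X) \<and> Dom (Tp C ?X) f = A \<and> Cod (Tp C ?X) f = ?B \<and>
  FAr (XFun (WComp C) ?X) f = (proj C ?X A, k, proj C ?X ?B)"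
  using equivalence_full[OF cw_equiv[OF C, of ?X]] u B C unfolding full_functor_def
  by (simp add: cw_XFun proj_def)
 then obtain f where f: "f \<in> Ar (Tp C ?X)" "Dom (Tp C ?X) f = A" "Cod (Tp C ?X) f = ?B"
  "FAr (XFun (WComp C) ?X) f = (proj C ?X A, k, proj C ?X ?B)" by blast
 then have "realize C u B f = h" using k by (simp add: realize_def ext_map_def)
 then show ?thesis using f u by (auto simp: over_def)
qed

text \<open>Essential surjectivity of comprehension, moved from the slice to the base
  category.\<close>

lemma cwa_eso:
 assumes C: "cw C" and p: "p \<in> Disp (WDisp C)" "Cd C p = X"
 shows "\<exists>A i. A \<in> Ob (Tp C X) \<and> iso_arrow (WCat C) i \<and> Dm C i = cext C X A \<and>
  Cd C i = Dm C p \<and> Cm C p i = proj C X A"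
proof -
 interpret display_category "WDisp C" by (rule cw_disp[OF C])
 have G: "X \<in> Ctx C" using p by auto
 then obtain A i where a: "A \<in> Ob (Tp C X)" "iso_arrow (disp_slice (WDisp C) X) i"
  "Dom (disp_slice (WDisp C) X) i = proj C X A" "Cod (disp_slice (WDisp C) X) i = p"
 proof -
  have "p \<in> Ob (FCod (XFun (WComp C) X))" using p G C by (simp add: cw_XFun)
  then have "\<exists>x \<in> Ob (FDom (XFun (WComp C) X)). \<exists>i. iso_arrow (FCod (XFun (WComp C) X)) i \<and>
   Dom (FCod (XFun (WComp C) X)) i = FOb (XFun (WComp C) X) x \<and> Cod (FCod (XFun (WComp C) X)) i = p"
   using equivalence_eso[OF cw_equiv[OF C G]] unfolding eso_functor_def by blast
  then show ?thesis using that unfolding cw_XFun[OF C G] proj_def by blast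
 qed
 have i: "i \<in> Ar (disp_slice (WDisp C) X)" using a by simp
 show ?thesis
  using a slice_iso_mid[OF a(2)] slice_Ar_simps[OF i] slice_Dom[OF i] slice_Cod[OF i]
  by (intro exI[of _ A] exI[of _ "mid i"]) simp
qed

section \<open>The indexed functor on displays induced by a display functor\<close>

context display_functor
begin

interpretation C: display_category C by (rule display_source)
interpretation D: display_category D by (rule display_target)

lemma F_simps [simp]: "functor F" "FDom F = DCat C" "FCod F = DCat D"
 using F_functor by (simp_all add: functors_iff)

lemma disp_fun_simps:
 assumes "A \<in> Ob (DCat C)"
 shows "FDom (XFun (disp_ifun C D F) A) = disp_slice C A" "FCod (XFun (disp_ifun C D F) A) = disp_slice D (FOb F A)"
  "p \<in> Disp C ==> Cod (DCat C) p = A ==> FOb (XFun (disp_ifun C D F) A) p = FAr F p"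
  "t \<in> Ar (disp_slice C A) ==> FAr (XFun (disp_ifun C D F) A) t = (FAr F (fst t), FAr F (fst (snd t)), FAr F (snd (snd t)))"
 using assms by (simp_all add: disp_ifun_def split: prod.split)

lemma disp_fun_Ar:
 assumes "A \<in> Ob (DCat C)" "t \<in> Ar (disp_slice C A)"
 shows "(FAr F (fst t), FAr F (fst (snd t)), FAr F (snd (snd t))) \<in> Ar (disp_slice D (FOb F A))"
proof -
 note t = C.slice_Ar_simps[OF assms(2)]
 have "Cmp (DCat D) (FAr F (snd (snd t))) (FAr F (fst (snd t))) = FAr F (fst t)"
  using FAr_Cmp'[OF F_simps(1,2) C.Disp_Ar[OF t(3)] t(5)] t by simp
 then show ?thesis using t F_Disp by (subst D.slice_Ar) simp
qed

lemma disp_fun_functor: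
 assumes A: "A \<in> Ob (DCat C)"
 shows "functor (XFun (disp_ifun C D F) A)"
proof (rule functorI, unfold disp_fun_simps(1,2)[OF A])
 show "category (disp_slice C A)" "category (disp_slice D (FOb F A))" by simp_all
 show "FOb (XFun (disp_ifun C D F) A) \<in> extensional (Ob (disp_slice C A))"
  "FAr (XFun (disp_ifun C D F) A) \<in> extensional (Ar (disp_slice C A))"
  using A by (simp_all add: disp_ifun_def)
 show "FOb (XFun (disp_ifun C D F) A) x \<in> Ob (disp_slice D (FOb F A))" if "x \<in> Ob (disp_slice C A)" for x
  using that A F_Disp by (auto simp: disp_fun_simps)
 show "FAr (XFun (disp_ifun C D F) A) f \<in> Ar (disp_slice D (FOb F A)) \<and>
  Dom (disp_slice D (FOb F A)) (FAr (XFun (disp_ifun C D F) A) f) =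
   FOb (XFun (disp_ifun C D F) A) (Dom (disp_slice C A) f) \<and>
  Cod (disp_slice D (FOb F A)) (FAr (XFun (disp_ifun C D F) A) f) =
   FOb (XFun (disp_ifun C D F) A) (Cod (disp_slice C A) f)" if f: "f \<in> Ar (disp_slice C A)" for f
  using disp_fun_Ar[OF A f] f A by (simp add: disp_fun_simps)
 show "FAr (XFun (disp_ifun C D F) A) (Idn (disp_slice C A) x) =
  Idn (disp_slice D (FOb F A)) (FOb (XFun (disp_ifun C D F) A) x)" if "x \<in> Ob (disp_slice C A)" for x
  using that A F_Disp C.slice_Idn_Ar[of x A] by (simp add: disp_fun_simps)
 show "FAr (XFun (disp_ifun C D F) A) (Cmp (disp_slice C A) g f) =
  Cmp (disp_slice D (FOb F A)) (FAr (XFun (disp_ifun C D F) A) g) (FAr (XFun (disp_ifun C D F) A) f)"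
  if gf: "g \<in> Ar (disp_slice C A)" "f \<in> Ar (disp_slice C A)" "Dom (disp_slice C A) g = Cod (disp_slice C A) f" for g f
 proof -
  have "fst g = snd (snd f)" using gf by simp
  moreover have "Cmp (disp_slice C A) g f \<in> Ar (disp_slice C A)" using gf by (intro Cmp_Ar) simp_all
  ultimately show ?thesis
   using gf disp_fun_Ar[OF A gf(1)] disp_fun_Ar[OF A gf(2)] C.slice_Ar_simps[OF gf(1)] C.slice_Ar_simps[OF gf(2)] A
   by (simp add: disp_fun_simps)
 qed
qed

lemma
 assumes u: "u \<in> Ar (DCat C)" and p: "p \<in> Disp C" "Cod (DCat C) p = Cod (DCat C) u"
 shows disp_rho_Ar: "XRho (disp_ifun C D F) u p \<in> Ar (disp_slice D (FOb F (Dom (DCat C) u)))"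
  and disp_rho_fst: "fst (XRho (disp_ifun C D F) u p) = Pb1 D (FAr F u) (FAr F p)"
  and disp_rho_snd: "snd (snd (XRho (disp_ifun C D F) u p)) = FAr F (Pb1 C u p)"
  and disp_rho_mid: "Cmp (DCat D) (FAr F (Pb2 C u p)) (fst (snd (XRho (disp_ifun C D F) u p))) =
   Pb2 D (FAr F u) (FAr F p)"
proof -
 have pb: "is_pullback (DCat D) (FAr F u) (FAr F p) (FAr F (Pb1 C u p)) (FAr F (Pb2 C u p))"
  using u p by (intro F_pullback C.Pb) simp_all
 have Fp: "FAr F p \<in> Disp D" "FAr F u \<in> Ar (DCat D)" "Cod (DCat D) (FAr F u) = Cod (DCat D) (FAr F p)"
  using u p F_Disp by simp_all
 have e: "XRho (disp_ifun C D F) u p = (Pb1 D (FAr F u) (FAr F p),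
  (THE h. h \<in> hom (DCat D) (Dom (DCat D) (Pb1 D (FAr F u) (FAr F p))) (FOb F (Dom (DCat C) (Pb1 C u p))) \<and>
      Cmp (DCat D) (FAr F (Pb1 C u p)) h = Pb1 D (FAr F u) (FAr F p) \<and>
      Cmp (DCat D) (FAr F (Pb2 C u p)) h = Pb2 D (FAr F u) (FAr F p)), FAr F (Pb1 C u p))"
  (is "_ = (_, The ?h, _)")
  using u p by (simp add: disp_ifun_def Let_def)
 have "\<exists>!h. ?h h"
  using pb_ex1[OF pb, of "Pb1 D (FAr F u) (FAr F p)" "Pb2 D (FAr F u) (FAr F p)"] u p Fp by simp
 from theI'[OF this] have h: "?h (The ?h)" .
 show "fst (XRho (disp_ifun C D F) u p) = Pb1 D (FAr F u) (FAr F p)"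
  "snd (snd (XRho (disp_ifun C D F) u p)) = FAr F (Pb1 C u p)"
  "Cmp (DCat D) (FAr F (Pb2 C u p)) (fst (snd (XRho (disp_ifun C D F) u p))) = Pb2 D (FAr F u) (FAr F p)"
  using h unfolding e by simp_all
 show "XRho (disp_ifun C D F) u p \<in> Ar (disp_slice D (FOb F (Dom (DCat C) u)))"
  using h Fp u p F_Disp unfolding e by (subst D.slice_Ar) (simp add: hom_iff)
qed

end

lemma disp_ifun_simps [simp]: "XDom (disp_ifun C D F) = disp_icat C" "XCod (disp_ifun C D F) = pull_icat F (disp_icat D)"
 by (simp_all add: disp_ifun_def)

section \<open>Modifications between display-valued indexed functors\<close>

lemma (in display_category) slice_iso_iff:
 assumes "p \<in> Disp D" "Cod C p = A" "q \<in> Disp D" "Cod C q = A"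
 shows "t \<in> Ar (disp_slice D A) \<and> Dom (disp_slice D A) t = p \<and> Cod (disp_slice D A) t = q \<and> iso_arrow (disp_slice D A) t \<longleftrightarrow>
  t = (p, mid t, q) \<and> iso_arrow C (mid t) \<and> Dom C (mid t) = Dom C p \<and> Cod C (mid t) = Dom C q \<and> Cmp C q (mid t) = p" (is "?l \<longleftrightarrow> ?r")
proof
 assume l: ?l
 then show ?r using slice_iso_mid[of A t] slice_Dom[of t A] slice_Cod[of t A] slice_Ar_simps[of t A] by (simp add: prod_eq_iff)
next
 assume r: ?r
 then obtain m where m: "t = (p, m, q)" by blast
 have t: "t \<in> Ar (disp_slice D A)" using r assms iso_Ar[of C m] unfolding m by (subst slice_Ar) simp
 show ?l using t slice_iso[OF t] slice_Dom[OF t] slice_Cod[OF t] r m by simp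
qed

text \<open>Two display-valued indexed functors over the same \<open>F\<close>, each with a
  cartesian family. An invertible modification between them is to be described by its middle arrows
  alone, through squares with \<open>Q\<close> and \<open>R\<close>.\<close>

locale disp_valued_pair = t: disp_valued D P F Z + c: disp_valued D P F W for D P F Z W +
 fixes Q R
 assumes Q: "t.cartesian_family Q" "t.comparison_family Q" and R: "c.cartesian_family R" "c.comparison_family R"
  and I: "indexed_functor Z" "indexed_functor W"
begin

abbreviation S where "S a \<equiv> disp_slice D (FOb F a)"
abbreviation n where "n m a x \<equiv> fst (snd (m a x))"

definition typed where
 "typed m \<longleftrightarrow> m \<in> extensional (Ob t.B) \<and> (\<forall>a \<in> Ob t.B. m a \<in> extensional (Ob (IFib P a)) \<and> (\<forall>x \<in> Ob (IFib P a).
  m a x = (t.pr a x, n m a x, c.pr a x) \<and> iso_arrow t.C (n m a x) \<and> Dom t.C (n m a x) = Dom t.C (t.pr a x) \<and>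
  Cod t.C (n m a x) = Dom t.C (c.pr a x) \<and> Cmp t.C (c.pr a x) (n m a x) = t.pr a x))"

lemma typedD:
 assumes "typed m" "a \<in> Ob t.B" "x \<in> Ob (IFib P a)"
 shows "m a x \<in> Ar (S a)" "fst (m a x) = t.pr a x" "snd (snd (m a x)) = c.pr a x" "n m a x \<in> Ar t.C"
  "Dom t.C (n m a x) = Dom t.C (t.pr a x)" "Cod t.C (n m a x) = Dom t.C (c.pr a x)" "Cmp t.C (c.pr a x) (n m a x) = t.pr a x"
proof -
 have r: "m a x = (t.pr a x, n m a x, c.pr a x) \<and> iso_arrow t.C (n m a x) \<and> Dom t.C (n m a x) = Dom t.C (t.pr a x) \<and>
  Cod t.C (n m a x) = Dom t.C (c.pr a x) \<and> Cmp t.C (c.pr a x) (n m a x) = t.pr a x"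
  using assms unfolding typed_def by blast
 show s: "m a x \<in> Ar (S a)" using t.slice_iso_iff[OF t.pr[OF assms(2,3)] c.pr[OF assms(2,3)], of "m a x"] r by blast
 show "fst (m a x) = t.pr a x" "snd (snd (m a x)) = c.pr a x" using r by (metis fst_conv, metis snd_conv)
 show "n m a x \<in> Ar t.C" "Dom t.C (n m a x) = Dom t.C (t.pr a x)" "Cod t.C (n m a x) = Dom t.C (c.pr a x)"
  "Cmp t.C (c.pr a x) (n m a x) = t.pr a x" using r t.slice_Ar_simps(5)[OF s] by blast+
qed

lemma fibre_iff:
 assumes m: "typed m" and a: "a \<in> Ob t.B" and f: "f \<in> Ar (IFib P a)"
 shows "Cmp (S a) (m a (Cod (IFib P a) f)) (FAr (XFun Z a) f) = Cmp (S a) (FAr (XFun W a) f) (m a (Dom (IFib P a) f)) \<longleftrightarrow>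
  Cmp t.C (n m a (Cod (IFib P a) f)) (t.cm a f) = Cmp t.C (c.cm a f) (n m a (Dom (IFib P a) f))"
proof -
 have o: "Dom (IFib P a) f \<in> Ob (IFib P a)" "Cod (IFib P a) f \<in> Ob (IFib P a)" using a f by simp_all
 note d = typedD(1-3)[OF m a o(1)] and e = typedD(1-3)[OF m a o(2)]
 have "fst (m a (Cod (IFib P a) f)) = snd (snd (FAr (XFun Z a) f))" "fst (FAr (XFun W a) f) = snd (snd (m a (Dom (IFib P a) f)))"
  using d e a f by simp_all
 from t.slice_Cmp[OF e(1) t.cm_Ar[OF a f] this(1)] t.slice_Cmp[OF c.cm_Ar[OF a f] d(1) this(2)] show ?thesis
  using d e a f by simp
qed

text \<open>The arrows compared end in the pullback with upper side \<open>R u x\<close> and agree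
  after its display, so they are tested after \<open>R u x\<close>; cancelling the invertible
  structural arrow of \<open>Z\<close> leaves a square without structural isomorphisms.\<close>

lemma square_iff:
 assumes m: "typed m" and u: "u \<in> Ar t.B" and x: "x \<in> Ob (IFib P (Cod t.B u))" and ab: "a = Dom t.B u" "b = Cod t.B u"
 shows "Cmp (S a) (m a (t.re u x)) (XRho Z u x) = Cmp (S a) (XRho W u x) (FAr (IRe (disp_icat D) (FAr F u)) (m b x)) \<longleftrightarrow>
  Cmp t.C (n m b x) (Q u x) = Cmp t.C (R u x) (n m a (t.re u x))" (is "?s \<longleftrightarrow> ?n")
proof -
 have o: "a \<in> Ob t.B" "b \<in> Ob t.B" "x \<in> Ob (IFib P b)" "t.re u x \<in> Ob (IFib P a)" using u x ab by simp_all
 have Fu: "FAr F u \<in> Ar t.C" "Cod t.C (FAr F u) = FOb F b" "Dom t.C (FAr F u) = FOb F a" using u ab by simp_all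
 note d = typedD[OF m o(2,3)] and e = typedD[OF m o(1,4)]
 note rq = t.rho_Ar[OF I(1) u x] t.rho_fst[OF I(1) u x] t.rho_snd[OF I(1) u x] t.rho_mid[OF I(1) u x]
 note rr = c.rho_Ar[OF I(2) u x] c.rho_fst[OF I(2) u x] c.rho_snd[OF I(2) u x] c.rho_mid[OF I(2) u x]
 have d1: "m b x \<in> Ar (disp_slice D (Cod t.C (FAr F u)))" using d(1) Fu by simp
 note N = t.re_fst[OF Fu(1) d1] t.re_snd[OF Fu(1) d1] t.re_mid[OF Fu(1) d1] t.re_Pb[OF Fu(1) d1 refl]
 have N1: "FAr (IRe (disp_icat D) (FAr F u)) (m b x) \<in> Ar (S a)" using t.disp_re_Ar[OF Fu(1) d1] Fu by simp
 define r where "r = fst (snd (XRho Z u x))"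
 define s where "s = fst (snd (XRho W u x))"
 define k where "k = fst (snd (FAr (IRe (disp_icat D) (FAr F u)) (m b x)))"
 let ?p = "t.pr b x" and ?q = "c.pr b x" and ?p' = "t.pr a (t.re u x)" and ?q' = "c.pr a (t.re u x)"
 let ?nb = "n m b x" and ?na = "n m a (t.re u x)"
 have r: "r \<in> Ar t.C" "Dom t.C r = Dom t.C (Pb1 D (FAr F u) ?p)" "Cod t.C r = Dom t.C ?p'" "Cmp t.C ?p' r = Pb1 D (FAr F u) ?p"
  "Cmp t.C (Q u x) r = Pb2 D (FAr F u) ?p" "iso_arrow t.C r"
  using rq t.rho_iso[OF I(1) u x] Q(2) u x unfolding r_def ab t.comparison_family_def by simp_all
 have s: "s \<in> Ar t.C" "Dom t.C s = Dom t.C (Pb1 D (FAr F u) ?q)" "Cod t.C s = Dom t.C ?q'" "Cmp t.C ?q' s = Pb1 D (FAr F u) ?q"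
  "Cmp t.C (R u x) s = Pb2 D (FAr F u) ?q"
  using rr R(2) u x unfolding s_def ab c.comparison_family_def by simp_all
 have k: "k \<in> Ar t.C" "Dom t.C k = Dom t.C (Pb1 D (FAr F u) ?p)" "Cod t.C k = Dom t.C (Pb1 D (FAr F u) ?q)"
  "Cmp t.C (Pb1 D (FAr F u) ?q) k = Pb1 D (FAr F u) ?p" "Cmp t.C (Pb2 D (FAr F u) ?q) k = Cmp t.C ?nb (Pb2 D (FAr F u) ?p)"
  using N d unfolding k_def by simp_all
 have P: "?p \<in> Disp D" "?q \<in> Disp D" "Cod t.C ?p = Cod t.C (FAr F u)" "Cod t.C ?q = Cod t.C (FAr F u)" "?p' \<in> Disp D" "?q' \<in> Disp D"
  using o Fu by simp_all
 note q = t.Q_pb[OF Q(1) u x] t.Q_Ar[OF Q(1) u x] t.Q_Dom[OF Q(1) u x, folded ab] t.Q_Cod[OF Q(1) u x, folded ab]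
 note R' = c.Q_pb[OF R(1) u x, folded ab] c.Q_Ar[OF R(1) u x] c.Q_Dom[OF R(1) u x, folded ab] c.Q_Cod[OF R(1) u x, folded ab]
 \<comment> \<open>After \<open>R u x\<close>, the side through reindexing becomes the component at
   \<open>x\<close> after \<open>Q u x\<close>, up to the isomorphism \<open>r\<close>.\<close>
 have Rr: "Cmp t.C (R u x) (Cmp t.C s k) = Cmp t.C ?nb (Cmp t.C (Q u x) r)"
  unfolding r(5) k(5)[symmetric] by (rule Cmp_reassoc1[OF s(5)]) (use k(1,3) s(1-3) R'(2-4) in simp_all)
 have "?s \<longleftrightarrow> Cmp t.C ?na r = Cmp t.C s k"
 proof -
  have c1: "fst (m a (t.re u x)) = snd (snd (XRho Z u x))" using e(2) rq(3) ab by simp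
  have c2: "fst (XRho W u x) = snd (snd (FAr (IRe (disp_icat D) (FAr F u)) (m b x)))" using rr(2) N(2) d(3) ab by simp
  have c3: "XRho Z u x \<in> Ar (S a)" "XRho W u x \<in> Ar (S a)" using rq(1) rr(1) ab by simp_all
  show ?thesis unfolding t.slice_Cmp[OF e(1) c3(1) c1] t.slice_Cmp[OF c3(2) N1 c2] r_def s_def k_def
   using rq(2) N(1) d(2) e(3) rr(3) ab by simp
 qed
 also have "\<dots> \<longleftrightarrow> Cmp t.C (R u x) (Cmp t.C ?na r) = Cmp t.C (R u x) (Cmp t.C s k)"
 proof
  assume "Cmp t.C (R u x) (Cmp t.C ?na r) = Cmp t.C (R u x) (Cmp t.C s k)"
  moreover have "Cmp t.C ?q' (Cmp t.C ?na r) = Cmp t.C ?q' (Cmp t.C s k)"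
   using Cmp_reassoc1[OF e(7) _ r(1)] Cmp_reassoc1[OF s(4) _ k(1)] r s k e P Fu by simp
  ultimately show "Cmp t.C ?na r = Cmp t.C s k"
   by - (rule pb_unique[OF t.cat R'(1)], use r s k e in simp_all)
 qed simp
 also have "\<dots> \<longleftrightarrow> Cmp t.C (Cmp t.C (R u x) ?na) r = Cmp t.C (Cmp t.C ?nb (Q u x)) r"
  unfolding Rr using r s k e d q R' by simp
 also have "\<dots> \<longleftrightarrow> ?n"
 proof
  assume "Cmp t.C (Cmp t.C (R u x) ?na) r = Cmp t.C (Cmp t.C ?nb (Q u x)) r"
  then show ?n by - (rule iso_cancel_right[OF t.cat r(6)], use r(1-3) e(4-6) d(4-6) q R' in simp_all)
 qed (simp only:)
 finally show ?thesis .
qed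

text \<open>Separates an indexed natural isomorphism into typing of its components, naturality
  within fibres and compatibility with reindexing, the last two as equations in the base
  category.\<close>

lemma modification_iff: "indexed_nat_iso Z W m \<longleftrightarrow> typed m \<and>
  (\<forall>a f. a \<in> Ob t.B --> f \<in> Ar (IFib P a) -->
   Cmp t.C (n m a (Cod (IFib P a) f)) (t.cm a f) = Cmp t.C (c.cm a f) (n m a (Dom (IFib P a) f))) \<and>
  (\<forall>u x. u \<in> Ar t.B --> x \<in> Ob (IFib P (Cod t.B u)) -->
   Cmp t.C (n m (Cod t.B u) x) (Q u x) = Cmp t.C (R u x) (n m (Dom t.B u) (t.re u x)))"
proof -
 have ni: "nat_iso (XFun Z a) (XFun W a) (m a) \<longleftrightarrow> m a \<in> extensional (Ob (IFib P a)) \<and>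
   (\<forall>x \<in> Ob (IFib P a). m a x \<in> Ar (S a) \<and> Dom (S a) (m a x) = t.pr a x \<and> Cod (S a) (m a x) = c.pr a x \<and> iso_arrow (S a) (m a x)) \<and>
   (\<forall>f \<in> Ar (IFib P a). Cmp (S a) (m a (Cod (IFib P a) f)) (FAr (XFun Z a) f) = Cmp (S a) (FAr (XFun W a) f) (m a (Dom (IFib P a) f)))"
  if a: "a \<in> Ob t.B" for a
  unfolding nat_iso_def nat_trans_def using a by (auto simp: hom_iff)
 have ty: "typed m \<longleftrightarrow> m \<in> extensional (Ob t.B) \<and> (\<forall>a \<in> Ob t.B. m a \<in> extensional (Ob (IFib P a)) \<and>
   (\<forall>x \<in> Ob (IFib P a). m a x \<in> Ar (S a) \<and> Dom (S a) (m a x) = t.pr a x \<and> Cod (S a) (m a x) = c.pr a x \<and> iso_arrow (S a) (m a x)))"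
  unfolding typed_def using t.slice_iso_iff t.pr c.pr by simp
 have e: "indexed_nat_iso Z W m \<longleftrightarrow> m \<in> extensional (Ob t.B) \<and> (\<forall>a \<in> Ob t.B. nat_iso (XFun Z a) (XFun W a) (m a)) \<and>
  (\<forall>u \<in> Ar t.B. \<forall>x \<in> Ob (IFib P (Cod t.B u)). Cmp (S (Dom t.B u)) (m (Dom t.B u) (t.re u x)) (XRho Z u x) =
   Cmp (S (Dom t.B u)) (XRho W u x) (FAr (IRe (disp_icat D) (FAr F u)) (m (Cod t.B u) x)))"
  unfolding indexed_nat_iso_def indexed_nat_def t.XB[OF I(1)] t.X c.X using I by (auto simp: hom_iff nat_iso_def)
 have "indexed_nat_iso Z W m \<longleftrightarrow> typed m \<and>
  (\<forall>a \<in> Ob t.B. \<forall>f \<in> Ar (IFib P a). Cmp (S a) (m a (Cod (IFib P a) f)) (FAr (XFun Z a) f) = Cmp (S a) (FAr (XFun W a) f) (m a (Dom (IFib P a) f))) \<and>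
  (\<forall>u \<in> Ar t.B. \<forall>x \<in> Ob (IFib P (Cod t.B u)). Cmp (S (Dom t.B u)) (m (Dom t.B u) (t.re u x)) (XRho Z u x) =
   Cmp (S (Dom t.B u)) (XRho W u x) (FAr (IRe (disp_icat D) (FAr F u)) (m (Cod t.B u) x)))"
  unfolding e ty using ni by blast
 then show ?thesis using fibre_iff square_iff by blast
qed

end

section \<open>Morphisms of categories with attributes\<close>

abbreviation fo :: "'u cwa_mor => 'u => 'u => 'u" where "fo H X \<equiv> FOb (XFun (HTp H) X)"
abbreviation fa :: "'u cwa_mor => 'u => 'u => 'u" where "fa H X \<equiv> FAr (XFun (HTp H) X)"

definition tau :: "'u cwa_mor => 'u => 'u => 'u" where
 "tau H X A = fst (snd (HTau H X A))"

text \<open>The source of the transformation \<open>HTau\<close>; its target is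
  \<open>type_side\<close>. Both are display-valued over \<open>HFun H\<close>, which brings them
  under \<open>disp_valued_pair\<close>.\<close>

definition disp_side :: "'u cwa_mor => ('u, 'u, 'u, 'u, 'u, 'u \<times> 'u \<times> 'u) ifun" where
 "disp_side H = comp_ifun (disp_ifun (WDisp (HSrc H)) (WDisp (HTrg H)) (HFun H)) (WComp (HSrc H))"

definition type_side :: "'u cwa_mor => ('u, 'u, 'u, 'u, 'u, 'u \<times> 'u \<times> 'u) ifun" where
 "type_side H = comp_ifun (pull_ifun (HFun H) (WComp (HTrg H))) (HTp H)"

lemma cw_XDom: "cw C ==> XDom (WComp C) = WTp C" and cw_XCod: "cw C ==> XCod (WComp C) = disp_icat (WDisp C)"
 unfolding cwa_def by blast+

text \<open>A morphism of CwAs with the requirements on \<open>HTau\<close> left out, so that they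
  can be restated here in terms of arrows of the base.\<close>

locale cwa_mor_data =
 fixes H :: "'u cwa_mor" and C D F
 defines "F \<equiv> HFun H"
 assumes src: "HSrc H = C" and trg: "HTrg H = D" and C [simp]: "cw C" and D [simp]: "cw D"
  and disp: "display_functor (WDisp C) (WDisp D) F"
  and tp: "strict_indexed_functor (HTp H)" "XDom (HTp H) = WTp C" "XCod (HTp H) = pull_icat F (WTp D)"
begin

sublocale display_functor "WDisp C" "WDisp D" F by (rule disp)
sublocale C: display_category "WDisp C" by (rule display_source)
sublocale D: display_category "WDisp D" by (rule display_target)

lemma base: "IBase (XDom (HTp H)) = WCat C"
 using tp C by simp

lemma tp_fun [simp]:
 assumes "X \<in> Ctx C"
 shows "functor (XFun (HTp H) X)" "FDom (XFun (HTp H) X) = Tp C X"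
  "FCod (XFun (HTp H) X) = Tp D (FOb F X)"
 using strict_XFun[OF tp(1) base assms] tp assms by simp_all

lemma
 assumes "u \<in> Sub C" "X = Dm C u"
 shows fo_re [simp]: "A \<in> Ob (Tp C (Cd C u)) ==>
   fo H X (Re C u A) = Re D (FAr F u) (fo H (Cd C u) A)"
  and fa_re [simp]: "f \<in> Ar (Tp C (Cd C u)) ==>
   fa H X (Rf C u f) = Rf D (FAr F u) (fa H (Cd C u) f)"
proof -
 have P: "strict_indexed_category (XDom (HTp H))" "strict_indexed_category (XCod (HTp H))"
  using tp C D pull_strict[of F "WTp D"] by simp_all
 show "A \<in> Ob (Tp C (Cd C u)) ==>
   fo H X (Re C u A) = Re D (FAr F u) (fo H (Cd C u) A)"
  "f \<in> Ar (Tp C (Cd C u)) ==>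
   fa H X (Rf C u f) = Rf D (FAr F u) (fa H (Cd C u) f)"
  using strict_FOb_re[OF tp(1) base P assms(1), of A] strict_FAr_re[OF tp(1) base P assms(1), of f] tp assms by simp_all
qed

lemma over_fa: "over C u f B A ==> over D (FAr F u) (fa H (Dm C u) f) (fo H (Cd C u) B) (fo H (Dm C u) A)"
 by (auto simp: over_def)

lemma F_cart_pb: "u \<in> Sub C ==> A \<in> Ob (Tp C (Cd C u)) ==>
  is_pullback (WCat D) (FAr F u) (FAr F (proj C (Cd C u) A))
   (FAr F (proj C (Dm C u) (Re C u A))) (FAr F (cart C u A))"
 by (intro F_pullback cart_pb) simp_all

lemma disp_side_fun:
 assumes "X \<in> Ctx C"
 shows "XFun (disp_side H) X = comp_func (XFun (disp_ifun (WDisp C) (WDisp D) F) X) (XFun (WComp C) X)"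
  "functor (XFun (disp_side H) X)" "FDom (XFun (disp_side H) X) = Tp C X"
  "FCod (XFun (disp_side H) X) = disp_slice (WDisp D) (FOb F X)"
  "A \<in> Ob (Tp C X) ==> FOb (XFun (disp_side H) X) A = FAr F (proj C X A)"
  "f \<in> Ar (Tp C X) ==> FAr (XFun (disp_side H) X) f =
   (FAr F (proj C X (Dom (Tp C X) f)), FAr F (ext_map C X f), FAr F (proj C X (Cod (Tp C X) f)))"
proof -
 show e: "XFun (disp_side H) X = comp_func (XFun (disp_ifun (WDisp C) (WDisp D) F) X) (XFun (WComp C) X)"
  using assms by (simp add: disp_side_def src trg F_def cw_XDom)
 note f = cw_XFun[OF C assms] disp_fun_functor[OF assms] disp_fun_simps[OF assms]
 show "functor (XFun (disp_side H) X)" "FDom (XFun (disp_side H) X) = Tp C X"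
  "FCod (XFun (disp_side H) X) = disp_slice (WDisp D) (FOb F X)"
  unfolding e using f by simp_all
 show "A \<in> Ob (Tp C X) ==> FOb (XFun (disp_side H) X) A = FAr F (proj C X A)"
  unfolding e using f proj_Disp[OF C assms, of A] Cod_proj[OF C assms, of A] by (simp add: proj_def)
 assume a: "f \<in> Ar (Tp C X)"
 then have "FAr (XFun (WComp C) X) f \<in> Ar (disp_slice (WDisp C) X)" using f by simp
 then show "FAr (XFun (disp_side H) X) f =
   (FAr F (proj C X (Dom (Tp C X) f)), FAr F (ext_map C X f), FAr F (proj C X (Cod (Tp C X) f)))"
  unfolding e using f a by (simp add: FAr_WComp[OF C assms a])
qed

lemma type_side_fun:
 assumes "X \<in> Ctx C"
 shows "XFun (type_side H) X = comp_func (XFun (WComp D) (FOb F X)) (XFun (HTp H) X)"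
  "functor (XFun (type_side H) X)" "FDom (XFun (type_side H) X) = Tp C X"
  "FCod (XFun (type_side H) X) = disp_slice (WDisp D) (FOb F X)"
  "A \<in> Ob (Tp C X) ==> FOb (XFun (type_side H) X) A = proj D (FOb F X) (fo H X A)"
  "f \<in> Ar (Tp C X) ==> FAr (XFun (type_side H) X) f =
   (proj D (FOb F X) (fo H X (Dom (Tp C X) f)), ext_map D (FOb F X) (fa H X f),
    proj D (FOb F X) (fo H X (Cod (Tp C X) f)))"
proof -
 show e: "XFun (type_side H) X = comp_func (XFun (WComp D) (FOb F X)) (XFun (HTp H) X)"
  using assms by (simp add: type_side_def trg tp F_def[symmetric])
 have FG: "FOb F X \<in> Ctx D" using assms by simp
 note f = cw_XFun[OF D FG] tp_fun[OF assms]
 show "functor (XFun (type_side H) X)" "FDom (XFun (type_side H) X) = Tp C X"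
  "FCod (XFun (type_side H) X) = disp_slice (WDisp D) (FOb F X)"
  unfolding e using f by simp_all
 show "A \<in> Ob (Tp C X) ==> FOb (XFun (type_side H) X) A = proj D (FOb F X) (fo H X A)"
  unfolding e using f by (simp add: proj_def)
 assume a: "f \<in> Ar (Tp C X)"
 then have "fa H X f \<in> Ar (Tp D (FOb F X))" using f by simp
 from FAr_WComp[OF D FG this] show "FAr (XFun (type_side H) X) f =
   (proj D (FOb F X) (fo H X (Dom (Tp C X) f)), ext_map D (FOb F X) (fa H X f),
    proj D (FOb F X) (fo H X (Cod (Tp C X) f)))"
  unfolding e using f a by simp
qed

lemma side_XDom: "XDom (disp_side H) = WTp C" "XCod (disp_side H) = pull_icat F (disp_icat (WDisp D))"
  "XDom (type_side H) = WTp C" "XCod (type_side H) = pull_icat F (disp_icat (WDisp D))"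
 by (simp_all add: disp_side_def type_side_def src trg tp cw_XDom cw_XCod F_def[symmetric])

lemma disp_side_valued: "disp_valued (WDisp D) (WTp C) F (disp_side H)"
 by (intro disp_valued.intro disp_valued_axioms.intro display_target)
  (simp_all add: side_XDom disp_side_fun(2-4))

lemma type_side_valued: "disp_valued (WDisp D) (WTp C) F (type_side H)"
 by (intro disp_valued.intro disp_valued_axioms.intro display_target)
  (simp_all add: side_XDom type_side_fun(2-4))

lemma disp_side_XRho:
 assumes u: "u \<in> Sub C" and A: "A \<in> Ob (Tp C (Cd C u))"
 shows "XRho (disp_side H) u A = Cmp (disp_slice (WDisp D) (FOb F (Dm C u)))
   (FAr (XFun (disp_ifun (WDisp C) (WDisp D) F) (Dm C u)) (XRho (WComp C) u A))
   (XRho (disp_ifun (WDisp C) (WDisp D) F) u (proj C (Cd C u) A))"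
 using assms
 by (simp add: disp_side_def src trg F_def[symmetric] cw_XDom proj_def
  comp_ifun_XRho[where Z = "WComp C" and B = "WCat C"])

lemma disp_side_rho:
 assumes u: "u \<in> Sub C" and A: "A \<in> Ob (Tp C (Cd C u))"
 shows "XRho (disp_side H) u A \<in> Ar (disp_slice (WDisp D) (FOb F (Dm C u)))"
  "fst (XRho (disp_side H) u A) = Pb1 (WDisp D) (FAr F u) (FAr F (proj C (Cd C u) A))"
  "snd (snd (XRho (disp_side H) u A)) = FAr F (proj C (Dm C u) (Re C u A))"
  "Cm D (FAr F (cart C u A)) (fst (snd (XRho (disp_side H) u A))) =
   Pb2 (WDisp D) (FAr F u) (FAr F (proj C (Cd C u) A))"
proof -
 let ?p = "proj C (Cd C u) A" and ?X = "Dm C u"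
 let ?S = "disp_slice (WDisp D) (FOb F ?X)"
 let ?r = "XRho (disp_ifun (WDisp C) (WDisp D) F) u ?p"
 have p: "?p \<in> Disp (WDisp C)" "Cd C ?p = Cd C u" using u A by simp_all
 have G: "?X \<in> Ctx C" using u by simp
 note r = disp_rho_Ar[OF u p] disp_rho_fst[OF u p] disp_rho_snd[OF u p] disp_rho_mid[OF u p]
 note w = WComp_XRho[OF C u A]
 note t = disp_fun_Ar[OF G w(1)]
 note s = disp_fun_simps(4)[OF G w(1)]
 have c: "fst (FAr F (fst (XRho (WComp C) u A)), FAr F (fst (snd (XRho (WComp C) u A))), FAr F (snd (snd (XRho (WComp C) u A)))) = snd (snd ?r)"
  using r w by simp
 have e: "XRho (disp_side H) u A = (fst ?r, Cm D (FAr F (fst (snd (XRho (WComp C) u A)))) (fst (snd ?r)),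
   FAr F (snd (snd (XRho (WComp C) u A))))"
  unfolding disp_side_XRho[OF u A] s D.slice_Cmp[OF t r(1) c] by simp
 show "XRho (disp_side H) u A \<in> Ar ?S"
  unfolding disp_side_XRho[OF u A] s by (rule D.slice_Cmp_Ar[OF t r(1) c])
 show "fst (XRho (disp_side H) u A) = Pb1 (WDisp D) (FAr F u) (FAr F ?p)"
  "snd (snd (XRho (disp_side H) u A)) = FAr F (proj C ?X (Re C u A))"
  unfolding e using r w by simp_all
 note wm = C.slice_Ar_simps[OF w(1)]
 note rm = D.slice_Ar_simps[OF r(1)]
 have "Cm D (FAr F (cart C u A)) (FAr F (fst (snd (XRho (WComp C) u A)))) = FAr F (Pb2 (WDisp C) u ?p)"
  using FAr_Cmp'[OF F_simps(1,2), of "cart C u A" "fst (snd (XRho (WComp C) u A))"] wm w u A by simp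
 then have "Cm D (FAr F (cart C u A)) (Cm D (FAr F (fst (snd (XRho (WComp C) u A)))) (fst (snd ?r))) =
  Cm D (FAr F (Pb2 (WDisp C) u ?p)) (fst (snd ?r))"
 proof (rule Cmp_reassoc1)
  have W: "fst (snd (XRho (WComp C) u A)) \<in> Sub C"
   "Dm C (fst (snd (XRho (WComp C) u A))) = Dm C (Pb1 (WDisp C) u ?p)"
   "Cd C (fst (snd (XRho (WComp C) u A))) = Dm C (cart C u A)"
   using wm(5-7) w(2,3) u A by simp_all
  have "Cd D (fst (snd ?r)) = FOb F (Dm C (Pb1 (WDisp C) u ?p))"
   using rm(7) r(3) u p by simp
  then show "Cd D (fst (snd ?r)) = Dm D (FAr F (fst (snd (XRho (WComp C) u A))))"
   using W by simp
  show "fst (snd ?r) \<in> Sub D" by (rule rm(5))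
  show "category (WCat D)" "FAr F (cart C u A) \<in> Sub D" "FAr F (fst (snd (XRho (WComp C) u A))) \<in> Sub D"
   "Dm D (FAr F (cart C u A)) = Cd D (FAr F (fst (snd (XRho (WComp C) u A))))"
   using W u A by simp_all
 qed
 then show "Cm D (FAr F (cart C u A)) (fst (snd (XRho (disp_side H) u A))) = Pb2 (WDisp D) (FAr F u) (FAr F ?p)"
  unfolding e using r by simp
qed

text \<open>The arrows \<open>cart C u A\<close> are sides of pullbacks of displays, and
  \<open>F\<close> preserves these; applying \<open>F\<close> to the laws of \<open>cart\<close>
  gives the laws of the image family.\<close>

lemma disp_side_family:
 "disp_valued.cartesian_family (WDisp D) (WTp C) F (disp_side H) (\<lambda>u A. FAr F (cart C u A))"
 "disp_valued.comparison_family (WDisp D) (WTp C) F (disp_side H) (\<lambda>u A. FAr F (cart C u A))"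
proof -
 interpret v: disp_valued "WDisp D" "WTp C" F "disp_side H" by (rule disp_side_valued)
 have n: "Cm D (FAr F (cart C u (Cod (Tp C (Cd C u)) f))) (FAr F (ext_map C (Dm C u) (Rf C u f))) =
   Cm D (FAr F (ext_map C (Cd C u) f)) (FAr F (cart C u (Dom (Tp C (Cd C u)) f)))"
  if "u \<in> Sub C" "f \<in> Ar (Tp C (Cd C u))" for u f
  using arg_cong[OF cart_nat[OF C that], of "FAr F"] that by simp
 show "v.cartesian_family (\<lambda>u A. FAr F (cart C u A))"
  unfolding v.cartesian_family_def cw_base[OF C] using n by (simp add: disp_side_fun(5,6) F_cart_pb cart_Cmp)
 show "v.comparison_family (\<lambda>u A. FAr F (cart C u A))"
  unfolding v.comparison_family_def using disp_side_rho by (simp add: disp_side_fun(5,6))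
qed

lemma disp_side_indexed: "indexed_functor (disp_side H)"
 by (rule disp_valued.disp_valuedI[OF disp_side_valued disp_side_family])
  (simp_all add: disp_side_def comp_ifun_def XBase_def src trg cw_XDom Let_def)

text \<open>The action on types is strict, so only the structural isomorphism of comprehension in
  the target survives.\<close>

lemma type_side_XRho:
 assumes u: "u \<in> Sub C" and A: "A \<in> Ob (Tp C (Cd C u))"
 shows "XRho (type_side H) u A = XRho (WComp D) (FAr F u) (fo H (Cd C u) A)"
proof -
 let ?X = "Dm C u" and ?A = "fo H (Cd C u) A"
 let ?S = "disp_slice (WDisp D) (FOb F ?X)"
 have G: "?X \<in> Ctx C" "FOb F ?X \<in> Ctx D" using u by simp_all
 have Fu: "FAr F u \<in> Sub D" "?A \<in> Ob (Tp D (Cd D (FAr F u)))"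
  using u A by simp_all
 note r = WComp_XRho[OF D Fu]
 have rA: "fo H ?X (Re C u A) \<in> Ob (Tp D (FOb F ?X))"
  using u A G by simp
 have r1: "XRho (WComp D) (FAr F u) ?A \<in> Ar ?S" using r(1) u by simp
 have r2: "Cod ?S (XRho (WComp D) (FAr F u) ?A) = proj D (FOb F ?X) (fo H ?X (Re C u A))"
  using D.slice_Cod[OF r1] r(3) u A by simp
 have "XRho (HTp H) u A = Idn (Tp D (FOb F ?X)) (fo H ?X (Re C u A))"
  using strict_XRho[OF tp(1) base u, of A] tp G A by simp
 then have "FAr (XFun (WComp D) (FOb F ?X)) (XRho (HTp H) u A) = Idn ?S (proj D (FOb F ?X) (fo H ?X (Re C u A)))"
  using cw_XFun[OF D G(2)] rA by (simp add: proj_def)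
 moreover have "XRho (type_side H) u A = Cmp ?S (FAr (XFun (WComp D) (FOb F ?X)) (XRho (HTp H) u A)) (XRho (WComp D) (FAr F u) ?A)"
  using assms
  by (simp add: type_side_def trg F_def[symmetric] tp cw_XDom cw_XCod comp_ifun_XRho[where B = "WCat C"])
 ultimately show ?thesis using Cmp_Idn_l[OF D.slice_category r1 r2] by simp
qed

text \<open>The laws of \<open>cart\<close> in the target, at the images of \<open>u\<close> and of
  the type; they match because the action on types commutes strictly with reindexing.\<close>

lemma type_side_family:
 "disp_valued.cartesian_family (WDisp D) (WTp C) F (type_side H) (\<lambda>u A. cart D (FAr F u) (fo H (Cd C u) A))"
 "disp_valued.comparison_family (WDisp D) (WTp C) F (type_side H) (\<lambda>u A. cart D (FAr F u) (fo H (Cd C u) A))"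
proof -
 interpret v: disp_valued "WDisp D" "WTp C" F "type_side H" by (rule type_side_valued)
 have Fu: "FAr F u \<in> Sub D" "Dm D (FAr F u) = FOb F (Dm C u)" "Cd D (FAr F u) = FOb F (Cd C u)"
  if "u \<in> Sub C" for u using that by simp_all
 have n: "Cm D (cart D (FAr F u) (fo H (Cd C u) (Cod (Tp C (Cd C u)) f)))
    (ext_map D (FOb F (Dm C u)) (fa H (Dm C u) (Rf C u f))) =
   Cm D (ext_map D (FOb F (Cd C u)) (fa H (Cd C u) f))
    (cart D (FAr F u) (fo H (Cd C u) (Dom (Tp C (Cd C u)) f)))"
  if u: "u \<in> Sub C" "f \<in> Ar (Tp C (Cd C u))" for u f
  using cart_nat[OF D Fu(1)[OF u(1)], of "fa H (Cd C u) f"] u by simp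
 have c: "Re D (FAr F u) (fo H (Cd C u) A) = fo H (Cd C v) (Re C u A)"
  if "u \<in> Sub C" "Dm C u = Cd C v" "A \<in> Ob (Tp C (Cd C u))" for u v A
  using that by (simp flip: that(2))
 show "v.cartesian_family (\<lambda>u A. cart D (FAr F u) (fo H (Cd C u) A))"
  unfolding v.cartesian_family_def cw_base[OF C]
 proof (intro conjI allI impI)
  fix u A assume u: "u \<in> Sub C" and A: "A \<in> Ob (Tp C (Cd C u))"
  show "is_pullback (WCat D) (FAr F u) (FOb (XFun (type_side H) (Cd C u)) A)
   (FOb (XFun (type_side H) (Dm C u)) (Re C u A)) (cart D (FAr F u) (fo H (Cd C u) A))"
   using cart_pb[OF D Fu(1)[OF u], of "fo H (Cd C u) A"] u A by (simp add: type_side_fun(5))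
 qed (use n c in \<open>simp_all add: type_side_fun(5,6) cart_Cmp\<close>)
 show "v.comparison_family (\<lambda>u A. cart D (FAr F u) (fo H (Cd C u) A))"
  unfolding v.comparison_family_def cw_base[OF C]
 proof (intro allI impI)
  fix u A assume u: "u \<in> Sub C" and A: "A \<in> Ob (Tp C (Cd C u))"
  show "XRho (type_side H) u A \<in> Ar (disp_slice (WDisp D) (FOb F (Dm C u))) \<and>
   fst (XRho (type_side H) u A) = Pb1 (WDisp D) (FAr F u) (FOb (XFun (type_side H) (Cd C u)) A) \<and>
   snd (snd (XRho (type_side H) u A)) = FOb (XFun (type_side H) (Dm C u)) (Re C u A) \<and>
   Cm D (cart D (FAr F u) (fo H (Cd C u) A)) (fst (snd (XRho (type_side H) u A))) =
   Pb2 (WDisp D) (FAr F u) (FOb (XFun (type_side H) (Cd C u)) A)"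
   unfolding type_side_XRho[OF u A] using WComp_XRho[OF D Fu(1)[OF u], of "fo H (Cd C u) A"] u A by (simp add: type_side_fun(5))
 qed
qed

lemma type_side_indexed: "indexed_functor (type_side H)"
 by (rule disp_valued.disp_valuedI[OF type_side_valued type_side_family])
  (simp_all add: type_side_def comp_ifun_def XBase_def tp Let_def)

sublocale disp_valued_pair "WDisp D" "WTp C" F "disp_side H" "type_side H" "\<lambda>u A. FAr F (cart C u A)"
 "\<lambda>u A. cart D (FAr F u) (fo H (Cd C u) A)"
 by (intro disp_valued_pair.intro disp_valued_pair_axioms.intro disp_side_valued type_side_valued disp_side_family type_side_family
  disp_side_indexed type_side_indexed)

end

text \<open>One naturality square for every arrow of the total category of types; it merges
  naturality of \<open>HTau\<close> within fibres with its compatibility with reindexing.\<close>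

definition tau_nat :: "'u cwa_mor => bool" where
 "tau_nat H \<longleftrightarrow> (\<forall>u f B A. over (HSrc H) u f B A -->
  Cm (HTrg H) (tau H (Cd (HSrc H) u) B) (FAr (HFun H) (realize (HSrc H) u B f)) =
  Cm (HTrg H) (realize (HTrg H) (FAr (HFun H) u) (fo H (Cd (HSrc H) u) B) (fa H (Dm (HSrc H) u) f))
   (tau H (Dm (HSrc H) u) A))"

definition tau_typed :: "'u cwa_mor => bool" where
 "tau_typed H \<longleftrightarrow> HTau H \<in> extensional (Ctx (HSrc H)) \<and>
  (\<forall>X \<in> Ctx (HSrc H). HTau H X \<in> extensional (Ob (Tp (HSrc H) X)) \<and>
   (\<forall>A \<in> Ob (Tp (HSrc H) X).
    HTau H X A = (FAr (HFun H) (proj (HSrc H) X A), tau H X A, proj (HTrg H) (FOb (HFun H) X) (fo H X A)) \<and>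
    iso_arrow (WCat (HTrg H)) (tau H X A) \<and>
    Dm (HTrg H) (tau H X A) = FOb (HFun H) (cext (HSrc H) X A) \<and>
    Cd (HTrg H) (tau H X A) = cext (HTrg H) (FOb (HFun H) X) (fo H X A) \<and>
    Cm (HTrg H) (proj (HTrg H) (FOb (HFun H) X) (fo H X A)) (tau H X A) = FAr (HFun H) (proj (HSrc H) X A)))"

definition cwa_mor_struct :: "'u cwa_mor => bool" where
 "cwa_mor_struct H \<longleftrightarrow> cw (HSrc H) \<and> cw (HTrg H) \<and> display_functor (WDisp (HSrc H)) (WDisp (HTrg H)) (HFun H) \<and>
  strict_indexed_functor (HTp H) \<and> XDom (HTp H) = WTp (HSrc H) \<and> XCod (HTp H) = pull_icat (HFun H) (WTp (HTrg H))"

lemma cwa_mor_data_iff: "cwa_mor_data H C D \<longleftrightarrow> cwa_mor_struct H \<and> HSrc H = C \<and> HTrg H = D"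
 unfolding cwa_mor_data_def cwa_mor_struct_def by auto

context cwa_mor_data
begin

text \<open>\<open>realize\<close> composes a \<open>cart\<close> with an \<open>ext_map\<close>.
  Identities in the base specialize the single square to fibre naturality, identity maps of types to
  compatibility with reindexing; conversely the two squares paste.\<close>

lemma tau_iff: "indexed_nat_iso (disp_side H) (type_side H) (HTau H) \<longleftrightarrow> tau_typed H \<and> tau_nat H"
proof -
 let ?N1 = "\<forall>X f. X \<in> Ctx C --> f \<in> Ar (Tp C X) -->
  Cm D (tau H X (Cod (Tp C X) f)) (FAr F (ext_map C X f)) =
  Cm D (ext_map D (FOb F X) (fa H X f)) (tau H X (Dom (Tp C X) f))"
 let ?N2 = "\<forall>u A. u \<in> Sub C --> A \<in> Ob (Tp C (Cd C u)) -->
  Cm D (tau H (Cd C u) A) (FAr F (cart C u A)) =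
  Cm D (cart D (FAr F u) (fo H (Cd C u) A)) (tau H (Dm C u) (Re C u A))"
 have ty: "typed (HTau H) \<longleftrightarrow> tau_typed H"
  unfolding typed_def tau_typed_def src trg F_def[symmetric] cw_base[OF C] tau_def[symmetric]
  by (simp add: disp_side_fun(5) type_side_fun(5))
 have "indexed_nat_iso (disp_side H) (type_side H) (HTau H) \<longleftrightarrow> tau_typed H \<and> ?N1 \<and> ?N2"
  unfolding modification_iff ty cw_base[OF C] tau_def[symmetric] by (simp add: disp_side_fun(6) type_side_fun(6))
 moreover have "?N1 \<and> ?N2 \<longleftrightarrow> tau_nat H" if "tau_typed H"
 proof
  have t: "tau H X A \<in> Sub D" "Dm D (tau H X A) = FOb F (cext C X A)"
   "Cd D (tau H X A) = cext D (FOb F X) (fo H X A)"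
   if "X \<in> Ctx C" "A \<in> Ob (Tp C X)" for X A
   using \<open>tau_typed H\<close> that iso_Ar[of "WCat D" "tau H X A"] unfolding tau_typed_def src trg F_def[symmetric] by simp_all
  assume N: "?N1 \<and> ?N2"
  show "tau_nat H"
   unfolding tau_nat_def src trg F_def[symmetric]
  proof (intro allI impI)
   fix u f B A assume ov: "over C u f B A"
   note h = ov[unfolded over_def]
   let ?X = "Dm C u" and ?Y = "Cd C u" and ?B = "Re C u B"
   have G: "?X \<in> Ctx C" "?Y \<in> Ctx C" "?B \<in> Ob (Tp C ?X)" "A \<in> Ob (Tp C ?X)"
    using h over_Ob[OF C ov] by auto
   have c: "Cm D (tau H ?Y B) (FAr F (cart C u B)) = Cm D (cart D (FAr F u) (fo H ?Y B)) (tau H ?X ?B)"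
    using N h by blast
   have f: "Cm D (tau H ?X ?B) (FAr F (ext_map C ?X f)) = Cm D (ext_map D (FOb F ?X) (fa H ?X f)) (tau H ?X A)"
    using N h G(1) by metis
   note ts = t[OF G(2), of B] t[OF G(1,3)] t[OF G(1,4)]
   have "Cm D (tau H ?Y B) (Cm D (FAr F (cart C u B)) (FAr F (ext_map C ?X f))) =
    Cm D (cart D (FAr F u) (fo H ?Y B)) (Cm D (tau H ?X ?B) (FAr F (ext_map C ?X f)))"
    by (rule Cmp_reassoc[OF c]) (use h G ts in simp_all)
   then show "Cm D (tau H ?Y B) (FAr F (realize C u B f)) =
    Cm D (realize D (FAr F u) (fo H ?Y B) (fa H ?X f)) (tau H ?X A)"
    unfolding f using h G ts by (simp add: realize_def)
  qed
 next
  assume "tau_nat H"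
  then have n: "Cm D (tau H (Cd C u) B) (FAr F (realize C u B f)) =
   Cm D (realize D (FAr F u) (fo H (Cd C u) B) (fa H (Dm C u) f)) (tau H (Dm C u) A)"
   if "over C u f B A" for u f B A
   using that unfolding tau_nat_def src trg F_def[symmetric] by blast
  show "?N1 \<and> ?N2"
  proof (intro conjI allI impI)
   fix X f assume G: "X \<in> Ctx C" and f: "f \<in> Ar (Tp C X)"
   have "over C (Idn (WCat C) X) f (Cod (Tp C X) f) (Dom (Tp C X) f)" using G f by (simp add: over_def)
   from n[OF this] show "Cm D (tau H X (Cod (Tp C X) f)) (FAr F (ext_map C X f)) =
    Cm D (ext_map D (FOb F X) (fa H X f)) (tau H X (Dom (Tp C X) f))" using G f by simp
  next
   fix u A assume u: "u \<in> Sub C" and A: "A \<in> Ob (Tp C (Cd C u))"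
   have "over C u (Idn (Tp C (Dm C u)) (Re C u A)) A (Re C u A)"
    using u A by (simp add: over_def)
   from n[OF this] show "Cm D (tau H (Cd C u) A) (FAr F (cart C u A)) =
    Cm D (cart D (FAr F u) (fo H (Cd C u) A)) (tau H (Dm C u) (Re C u A))"
    using u A realize_cart[OF D, of "FAr F u" "fo H (Cd C u) A"] by (simp add: realize_cart)
  qed
 qed
 ultimately show ?thesis by blast
qed

end

lemma cw_mor_iff: "cw_mor H \<longleftrightarrow> cwa_mor_struct H \<and> tau_typed H \<and> tau_nat H"
proof (cases "cwa_mor_struct H")
 case True
 then interpret cwa_mor_data H "HSrc H" "HTrg H" "HFun H"
  by (simp add: cwa_mor_data_iff)
 show ?thesis
  using True tau_iff unfolding cwa_mor_def cwa_mor_struct_def Let_def disp_side_def type_side_def by blast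
next
 case False
 then show ?thesis unfolding cwa_mor_def cwa_mor_struct_def Let_def by blast
qed

locale cwa_morphism = cwa_mor_data H C D F for H :: "'u cwa_mor" and C D F +
 assumes typed: "tau_typed H" and natural: "tau_nat H"
begin

lemma
 assumes "X \<in> Ctx C" "A \<in> Ob (Tp C X)"
 shows HTau_eq: "HTau H X A = (FAr F (proj C X A), tau H X A, proj D (FOb F X) (fo H X A))"
  and tau_iso [simp]: "iso_arrow (WCat D) (tau H X A)"
  and tau_Ar [simp]: "tau H X A \<in> Sub D"
  and Dom_tau [simp]: "Dm D (tau H X A) = FOb F (cext C X A)"
  and Cod_tau [simp]: "Cd D (tau H X A) = cext D (FOb F X) (fo H X A)"
  and proj_tau: "Cm D (proj D (FOb F X) (fo H X A)) (tau H X A) = FAr F (proj C X A)"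
  and HTau_Ar: "HTau H X A \<in> Ar (disp_slice (WDisp D) (FOb F X))"
  and fo_Ob [simp]: "fo H X A \<in> Ob (Tp D (FOb F X))"
proof -
 show e: "HTau H X A = (FAr F (proj C X A), tau H X A, proj D (FOb F X) (fo H X A))"
  and i: "iso_arrow (WCat D) (tau H X A)"
  and d: "Dm D (tau H X A) = FOb F (cext C X A)"
   "Cd D (tau H X A) = cext D (FOb F X) (fo H X A)"
   "Cm D (proj D (FOb F X) (fo H X A)) (tau H X A) = FAr F (proj C X A)"
  using typed assms unfolding tau_typed_def src trg F_def by blast+
 show t: "tau H X A \<in> Sub D" using i by simp
 show f: "fo H X A \<in> Ob (Tp D (FOb F X))" using assms by simp
 show "HTau H X A \<in> Ar (disp_slice (WDisp D) (FOb F X))"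
  unfolding e by (subst D.slice_Ar) (use assms d t f F_Disp in simp)
qed

lemma tau_natural:
 assumes "over C u f B A"
 shows "Cm D (tau H (Cd C u) B) (FAr F (realize C u B f)) =
  Cm D (realize D (FAr F u) (fo H (Cd C u) B) (fa H (Dm C u) f)) (tau H (Dm C u) A)"
 using natural assms unfolding tau_nat_def src trg F_def by blast

lemma HTau_ext: "HTau H \<in> extensional (Ctx C)"
  "X \<in> Ctx C ==> HTau H X \<in> extensional (Ob (Tp C X))"
 using typed unfolding tau_typed_def src trg by blast+

end

lemma cwa_morphism_iff: "cwa_morphism H C D \<longleftrightarrow> cw_mor H \<and> HSrc H = C \<and> HTrg H = D"
 unfolding cwa_morphism_def cwa_morphism_axioms_def cwa_mor_data_iff cw_mor_iff by blast

section \<open>Cells of categories with attributes\<close>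

text \<open>Two parallel morphisms and a natural transformation between their underlying functors:
  the data of a 2-cell before its action on types is known.\<close>

locale parallel = F: cwa_morphism F C D F0 + G: cwa_morphism G C D G0
 for F G :: "'u cwa_mor" and C D F0 G0 +
 fixes \<alpha> :: "('u, 'u, 'u, 'u) ntrans"
 assumes nt [simp]: "ntrans \<alpha>" and NDom [simp]: "NDom \<alpha> = F0" and NCod [simp]: "NCod \<alpha> = G0"
begin

abbreviation al where "al X \<equiv> NMap \<alpha> X"

lemma C_cw [simp]: "cw C" and D_cw [simp]: "cw D" by (rule F.C, rule F.D)

lemma
 assumes "X \<in> Ctx C"
 shows al_Ar [simp]: "al X \<in> Sub D" and Dom_al [simp]: "Dm D (al X) = FOb F0 X"
  and Cod_al [simp]: "Cd D (al X) = FOb G0 X"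
 using ntrans_Ar[OF nt, of "WCat D" X] ntrans_Dom[OF nt, of "WCat D" X] ntrans_Cod[OF nt, of "WCat D" X] assms
 by simp_all

lemma al_nat: "f \<in> Sub C ==> x = Dm C f ==> y = Cd C f ==>
  Cm D (al y) (FAr F0 f) = Cm D (FAr G0 f) (al x)"
 using ntrans_nat[OF nt, of f "WCat C" "WCat D"] by simp

text \<open>The compatibility with \<open>HTau\<close> that a 2-cell must satisfy at
  \<open>A\<close>, in terms of realization: the realized component, conjugated by
  \<open>tau\<close>, is the component of \<open>\<alpha>\<close> at the extension of
  \<open>A\<close>. No slices or chosen pullbacks occur.\<close>

definition component :: "'u => 'u => 'u => bool" where
 "component X A l \<longleftrightarrow> over D (al X) l (fo G X A) (fo F X A) \<and>
  Cm D (realize D (al X) (fo G X A) l) (tau F X A) =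
  Cm D (tau G X A) (al (cext C X A))"

lemma realize_typing:
 assumes G: "X \<in> Ctx C" and o: "over D (al X) l B A"
 shows "realize D (al X) B l \<in> Sub D" "Dm D (realize D (al X) B l) = cext D (FOb F0 X) A"
  "Cd D (realize D (al X) B l) = cext D (FOb G0 X) B"
  "Cm D (proj D (FOb G0 X) B) (realize D (al X) B l) = Cm D (al X) (proj D (FOb F0 X) A)"
 using realize_Ar[OF D_cw o] Dom_realize[OF D_cw o] Cod_realize[OF D_cw o] proj_realize[OF D_cw o] G by simp_all

text \<open>\<open>tau\<close> is invertible, so the square determines the realization, and
  realization is injective.\<close>

lemma component_unique:
 assumes G: "X \<in> Ctx C" and A: "A \<in> Ob (Tp C X)" and l: "component X A l" and k: "component X A k"
 shows "l = k"
proof -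
 have o: "over D (al X) l (fo G X A) (fo F X A)" "over D (al X) k (fo G X A) (fo F X A)"
  using l k by (simp_all add: component_def)
 note r = realize_typing[OF G o(1)] realize_typing[OF G o(2)]
 show ?thesis
 proof (rule realize_inj[OF D_cw o])
  show "realize D (al X) (fo G X A) l = realize D (al X) (fo G X A) k"
   by (rule iso_cancel_right[of "WCat D" "tau F X A"]) (use l k r G A in \<open>simp_all add: component_def\<close>)
 qed
qed

text \<open>The realization is forced by the square; it lies over \<open>al X\<close> by naturality
  of \<open>\<alpha>\<close> at the projection, so \<open>realize_surj\<close> turns it into a map
  of types.\<close>

lemma component_exists:
 assumes G: "X \<in> Ctx C" and A: "A \<in> Ob (Tp C X)"
 shows "\<exists>l. component X A l"
proof -
 let ?E = "cext C X A" and ?t = "inv_arrow (WCat D) (tau F X A)"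
 \<comment> \<open>The component of \<open>\<alpha>\<close> at the extension, conjugated by the
   isomorphisms \<open>tau\<close> of \<open>F\<close> and \<open>G\<close>.\<close>
 define h where "h = Cm D (tau G X A) (Cm D (al ?E) ?t)"
 have E: "?E \<in> Ctx C" using G A by simp
 have h: "h \<in> Sub D" "Dm D h = cext D (FOb F0 X) (fo F X A)" "Cd D h = cext D (FOb G0 X) (fo G X A)"
  unfolding h_def using G A E by simp_all
 have "Cm D (proj D (FOb G0 X) (fo G X A)) h = Cm D (FAr G0 (proj C X A)) (Cm D (al ?E) ?t)"
  unfolding h_def by (rule Cmp_reassoc1[OF G.proj_tau[OF G A]]) (use G A E in simp_all)
 also have "\<dots> = Cm D (al X) (Cm D (FAr F0 (proj C X A)) ?t)"
  by (rule Cmp_reassoc[OF al_nat[symmetric]]) (use G A E in simp_all)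
 also have "Cm D (FAr F0 (proj C X A)) ?t = proj D (FOb F0 X) (fo F X A)"
  unfolding F.proj_tau[OF G A, symmetric] using G A by simp
 finally have p: "Cm D (proj D (FOb G0 X) (fo G X A)) h = Cm D (al X) (proj D (FOb F0 X) (fo F X A))" .
 obtain l where l: "over D (al X) l (fo G X A) (fo F X A)" "realize D (al X) (fo G X A) l = h"
  using realize_surj[OF D_cw, of "al X" "fo G X A" "fo F X A" h] h p G A by auto
 have "Cm D h (tau F X A) = Cm D (tau G X A) (al ?E)"
  unfolding h_def using G A E by simp
 then show ?thesis using l by (auto simp: component_def)
qed

text \<open>Both laws of an indexed natural transformation, in one square over an arbitrary
  \<open>u\<close>, follow from the components alone. Injectivity of realization reduces it to
  naturality of \<open>tau\<close> and of \<open>\<alpha>\<close>.\<close>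

lemma component_nat:
 assumes l: "\<And>X A. X \<in> Ctx C ==> A \<in> Ob (Tp C X) ==> component X A (l X A)"
  and f: "over C u f B A" and E: "X = Dm C u" "Y = Cd C u"
 shows "Cmp (Tp D (FOb F0 X)) (Rf D (al X) (fa G X f)) (l X A) =
  Cmp (Tp D (FOb F0 X)) (Rf D (FAr F0 u) (l Y B)) (fa F X f)" (is "?x = ?y")
proof -
 have u: "u \<in> Sub C" "B \<in> Ob (Tp C Y)" using f E by (simp_all add: over_def)
 have A: "A \<in> Ob (Tp C X)" using over_Ob[OF C_cw f] E by simp
 have G: "X \<in> Ctx C" "Y \<in> Ctx C" using u E by simp_all
 have lA: "over D (al X) (l X A) (fo G X A) (fo F X A)"
  and rA: "Cm D (realize D (al X) (fo G X A) (l X A)) (tau F X A) = Cm D (tau G X A) (al (cext C X A))"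
  using l[OF G(1) A] by (simp_all add: component_def)
 have lB: "over D (al Y) (l Y B) (fo G Y B) (fo F Y B)"
  and rB: "Cm D (realize D (al Y) (fo G Y B) (l Y B)) (tau F Y B) = Cm D (tau G Y B) (al (cext C Y B))"
  using l[OF G(2) u(2)] by (simp_all add: component_def)
 have Ff: "over D (FAr F0 u) (fa F X f) (fo F Y B) (fo F X A)"
  and Gf: "over D (FAr G0 u) (fa G X f) (fo G Y B) (fo G X A)"
  using F.over_fa[OF f] G.over_fa[OF f] E by simp_all
 have d: "Dm D (FAr G0 u) = Cd D (al X)" "Dm D (al Y) = Cd D (FAr F0 u)"
  "Dm D (al X) = FOb F0 X" "Dm D (FAr F0 u) = FOb F0 X"
  using u G E by simp_all
 have bc: "Cm D (al Y) (FAr F0 u) = Cm D (FAr G0 u) (al X)" by (rule al_nat) (use u E in simp_all)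
 define R where "R = realize C u B f"
 define RF where "RF = realize D (FAr F0 u) (fo F Y B) (fa F X f)"
 define RG where "RG = realize D (FAr G0 u) (fo G Y B) (fa G X f)"
 define RA where "RA = realize D (al X) (fo G X A) (l X A)"
 define RB where "RB = realize D (al Y) (fo G Y B) (l Y B)"
 have ty: "R \<in> Sub C" "Dm C R = cext C X A" "Cd C R = cext C Y B"
  "RF \<in> Sub D" "Dm D RF = cext D (FOb F0 X) (fo F X A)" "Cd D RF = cext D (FOb F0 Y) (fo F Y B)"
  "RG \<in> Sub D" "Dm D RG = cext D (FOb G0 X) (fo G X A)" "Cd D RG = cext D (FOb G0 Y) (fo G Y B)"
  "RA \<in> Sub D" "Dm D RA = cext D (FOb F0 X) (fo F X A)" "Cd D RA = cext D (FOb G0 X) (fo G X A)"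
  "RB \<in> Sub D" "Dm D RB = cext D (FOb F0 Y) (fo F Y B)" "Cd D RB = cext D (FOb G0 Y) (fo G Y B)"
  unfolding R_def RF_def RG_def RA_def RB_def
  using f Ff Gf lA lB Dom_realize[OF C_cw f] Cod_realize[OF C_cw f] Dom_realize[OF D_cw Ff] Cod_realize[OF D_cw Ff]
   Dom_realize[OF D_cw Gf] Cod_realize[OF D_cw Gf] realize_typing[OF G(1) lA] realize_typing[OF G(2) lB] E u G
  by (simp_all del: realize_Idn)
 have nF: "Cm D (tau F Y B) (FAr F0 R) = Cm D RF (tau F X A)"
  and nG: "Cm D (tau G Y B) (FAr G0 R) = Cm D RG (tau G X A)"
  using F.tau_natural[OF f] G.tau_natural[OF f] unfolding R_def RF_def RG_def E by simp_all
 \<comment> \<open>Both realizations are compared after the isomorphism \<open>tau F X A\<close>: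
   pass to \<open>G\<close>, use naturality of \<open>\<alpha>\<close> at the arrow \<open>R\<close>
   between extensions, and return to \<open>F\<close>.\<close>
 have "Cm D (Cm D RG RA) (tau F X A) = Cm D RG (Cm D (tau G X A) (al (cext C X A)))"
  using ty G A rA[folded RA_def] by simp
 also have "\<dots> = Cm D (tau G Y B) (Cm D (FAr G0 R) (al (cext C X A)))"
  by (rule Cmp_reassoc[OF nG[symmetric]]) (use ty G A u in simp_all)
 also have "Cm D (FAr G0 R) (al (cext C X A)) = Cm D (al (cext C Y B)) (FAr F0 R)"
  by (rule al_nat[symmetric]) (use ty in simp_all)
 also have "Cm D (tau G Y B) (Cm D (al (cext C Y B)) (FAr F0 R)) =
  Cm D RB (Cm D (tau F Y B) (FAr F0 R))"
  by (rule Cmp_reassoc[OF rB[folded RB_def, symmetric]]) (use ty G A u in simp_all)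
 also have "\<dots> = Cm D (Cm D RB RF) (tau F X A)" unfolding nF using ty G A by simp
 finally have "Cm D RG RA = Cm D RB RF"
  by - (rule iso_cancel_right[of "WCat D" "tau F X A"], use ty G A in simp_all)
 moreover have "over D (Cm D (FAr G0 u) (al X)) ?x (fo G Y B) (fo F X A)"
  "realize D (Cm D (FAr G0 u) (al X)) (fo G Y B) ?x = Cm D RG RA"
  using over_Cmp[OF D_cw lA Gf d(1)] realize_Cmp[OF D_cw lA Gf d(1)] d unfolding RG_def RA_def by simp_all
 moreover have "over D (Cm D (al Y) (FAr F0 u)) ?y (fo G Y B) (fo F X A)"
  "realize D (Cm D (al Y) (FAr F0 u)) (fo G Y B) ?y = Cm D RB RF"
  using over_Cmp[OF D_cw Ff lB d(2)] realize_Cmp[OF D_cw Ff lB d(2)] d unfolding RF_def RB_def by simp_all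
 ultimately show ?thesis using realize_inj[OF D_cw] bc by metis
qed

text \<open>Both sides of the slice equation have middle arrows into the pullback with upper side
  \<open>cart\<close>. Their composites with the projection agree automatically; their composites
  with \<open>cart\<close> are the two sides of \<open>component\<close>.\<close>

lemma compat_iff:
 assumes G: "X \<in> Ctx C" and A: "A \<in> Ob (Tp C X)"
  and o: "over D (al X) l (fo G X A) (fo F X A)"
 shows "(let S = disp_slice (WDisp D) (FOb F0 X); u = NMap \<alpha> X in
     Cmp S (FAr (XFun (WComp D) (FOb F0 X)) l) (HTau F X A) =
     Cmp S (XRho (WComp D) u (FOb (XFun (HTp G) X) A))
      (Cmp S (FAr (IRe (disp_icat (WDisp D)) u) (HTau G X A))
       (disp_nat (WDisp C) (WDisp D) \<alpha> (FOb (XFun (WComp C) X) A)))) \<longleftrightarrow> component X A l"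
proof -
 let ?S = "disp_slice (WDisp D) (FOb F0 X)" and ?u = "al X" and ?Gp = "FAr G0 (proj C X A)" and ?E = "cext C X A"
 let ?R = "XRho (WComp D) ?u (fo G X A)" and ?N = "FAr (IRe (disp_icat (WDisp D)) ?u) (HTau G X A)"
  and ?d = "disp_nat (WDisp C) (WDisp D) \<alpha> (proj C X A)" and ?L = "FAr (XFun (WComp D) (FOb F0 X)) l"
 have E: "?E \<in> Ctx C" using G A by simp
 have l: "l \<in> Ar (Tp D (FOb F0 X))" "Dom (Tp D (FOb F0 X)) l = fo F X A"
  "Cod (Tp D (FOb F0 X)) l = Re D ?u (fo G X A)"
  using o G by (simp_all add: over_def)
 have Fo: "FOb F0 X \<in> Ctx D" "FOb G0 X \<in> Ctx D" using G by simp_all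
 have L: "?L = (proj D (FOb F0 X) (fo F X A), ext_map D (FOb F0 X) l, proj D (FOb F0 X) (Re D ?u (fo G X A)))"
  unfolding FAr_WComp[OF D_cw Fo(1) l(1)] l by simp
 have u: "?u \<in> Sub D" "fo G X A \<in> Ob (Tp D (Cd D ?u))" using G A by simp_all
 have tG: "HTau G X A \<in> Ar (disp_slice (WDisp D) (Cd D ?u))" using G.HTau_Ar[OF G A] G by simp
 have Gp: "?Gp \<in> Disp (WDisp D)" "Cd D ?Gp = Cd D ?u" "FAr F0 (proj C X A) \<in> Disp (WDisp D)"
  using G.F_Disp F.F_Disp G A by simp_all
 define g where "g = gap (WDisp D) ?u ?Gp (FAr F0 (proj C X A)) (al ?E)"
 have sq: "Cm D ?u (FAr F0 (proj C X A)) = Cm D ?Gp (al ?E)" by (rule al_nat) (use G A in simp_all)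
 have g: "g \<in> Sub D" "Dm D g = FOb F0 ?E" "Cd D g = Dm D (Pb1 (WDisp D) ?u ?Gp)"
  "Cm D (Pb1 (WDisp D) ?u ?Gp) g = FAr F0 (proj C X A)" "Cm D (Pb2 (WDisp D) ?u ?Gp) g = al ?E"
  unfolding g_def using u Gp sq G A E by simp_all
 have d: "?d = (FAr F0 (proj C X A), g, Pb1 (WDisp D) ?u ?Gp)"
  unfolding disp_nat_def g_def Let_def using G A by simp
 have dA: "?d \<in> Ar ?S" unfolding d by (subst F.D.slice_Ar) (use g Gp u G A in simp)
 have NA: "?N \<in> Ar ?S" using F.D.disp_re_Ar[OF u(1) tG] G by simp
 note WR = WComp_XRho[OF D_cw u]
 have RA: "?R \<in> Ar ?S" using WR(1) G by simp
 have LA: "?L \<in> Ar ?S" unfolding L by (subst F.D.slice_Ar) (use l Fo G A u in simp)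
 have tF: "HTau F X A \<in> Ar ?S" by (rule F.HTau_Ar[OF G A])
 define R where "R = fst (snd ?R)"
 define N where "N = fst (snd ?N)"
 note Nf = F.D.re_fst[OF u(1) tG] F.D.re_snd[OF u(1) tG] F.D.re_mid[OF u(1) tG] F.D.re_Pb[OF u(1) tG refl]
 have tGp: "fst (HTau G X A) = ?Gp" "snd (snd (HTau G X A)) = proj D (FOb G0 X) (fo G X A)" "fst (snd (HTau G X A)) = tau G X A"
  unfolding G.HTau_eq[OF G A] by simp_all
 have Rf: "fst ?R = Pb1 (WDisp D) ?u (proj D (FOb G0 X) (fo G X A))" "R \<in> Sub D"
  "Dm D R = Dm D (Pb1 (WDisp D) ?u (proj D (FOb G0 X) (fo G X A)))"
  "Cd D R = cext D (FOb F0 X) (Re D ?u (fo G X A))"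
  "Cm D (cart D ?u (fo G X A)) R = Pb2 (WDisp D) ?u (proj D (FOb G0 X) (fo G X A))"
  "Cm D (proj D (FOb F0 X) (Re D ?u (fo G X A))) R = Pb1 (WDisp D) ?u (proj D (FOb G0 X) (fo G X A))"
  "snd (snd ?R) = proj D (FOb F0 X) (Re D ?u (fo G X A))"
  using WR F.D.slice_Ar_simps(5-8)[OF RA] unfolding R_def Dom_al[OF G] Cod_al[OF G]
  by argo+
 have Nf': "fst ?N = Pb1 (WDisp D) ?u ?Gp" "snd (snd ?N) = Pb1 (WDisp D) ?u (proj D (FOb G0 X) (fo G X A))"
  "N \<in> Sub D" "Dm D N = Dm D (Pb1 (WDisp D) ?u ?Gp)" "Cd D N = Dm D (Pb1 (WDisp D) ?u (proj D (FOb G0 X) (fo G X A)))"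
  "Cm D (Pb1 (WDisp D) ?u (proj D (FOb G0 X) (fo G X A))) N = Pb1 (WDisp D) ?u ?Gp"
  "Cm D (Pb2 (WDisp D) ?u (proj D (FOb G0 X) (fo G X A))) N = Cm D (tau G X A) (Pb2 (WDisp D) ?u ?Gp)"
  using Nf unfolding N_def tGp by simp_all
 let ?m = "Cm D R (Cm D N g)" and ?e = "Cm D (ext_map D (FOb F0 X) l) (tau F X A)"
 have lhs: "Cmp ?S ?L (HTau F X A) = (FAr F0 (proj C X A), ?e, snd (snd ?R))"
  using F.D.slice_Cmp[OF LA tF] Rf(7) unfolding L F.HTau_eq[OF G A] by simp
 have Nd: "Cmp ?S ?N ?d \<in> Ar ?S" "Cmp ?S ?N ?d = (FAr F0 (proj C X A), Cm D N g, snd (snd ?N))"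
  using F.D.slice_Cmp_Ar[OF NA dA] F.D.slice_Cmp[OF NA dA] Nf' unfolding d N_def by simp_all
 have rhs: "Cmp ?S ?R (Cmp ?S ?N ?d) = (FAr F0 (proj C X A), ?m, snd (snd ?R))"
  using F.D.slice_Cmp[OF RA Nd(1)] Rf(1) Nf'(2) unfolding Nd(2) R_def by simp
 let ?p = "proj D (FOb F0 X) (Re D ?u (fo G X A))" and ?c = "cart D ?u (fo G X A)"
 have cty: "?c \<in> Sub D" "Dm D ?c = cext D (FOb F0 X) (Re D ?u (fo G X A))"
  using cart_Ar[OF D_cw u] Dom_cart[OF D_cw u] G by simp_all
 have pO: "Re D ?u (fo G X A) \<in> Ob (Tp D (FOb F0 X))" using u G by simp
 have pA: "?p \<in> Sub D" using pO Fo by simp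
 have ety: "ext_map D (FOb F0 X) l \<in> Sub D" "Dm D (ext_map D (FOb F0 X) l) = cext D (FOb F0 X) (fo F X A)"
  "Cd D (ext_map D (FOb F0 X) l) = Dm D ?p"
  using ext_map_Ar[OF D_cw Fo(1) l(1)] Dom_ext_map[OF D_cw Fo(1) l(1)] Cod_ext_map[OF D_cw Fo(1) l(1)] l by simp_all
 have m: "?m \<in> Sub D" "Dm D ?m = FOb F0 ?E" "Cd D ?m = Dm D ?p"
  "?e \<in> Sub D" "Dm D ?e = FOb F0 ?E" "Cd D ?e = Dm D ?p"
  using Rf Nf' g ety G A by simp_all
 have cm: "Cm D ?c ?m = Cm D (tau G X A) (al ?E)"
 proof -
  have "Cm D ?c ?m = Cm D (Pb2 (WDisp D) ?u (proj D (FOb G0 X) (fo G X A))) (Cm D N g)"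
   by (rule Cmp_reassoc1[OF Rf(5)]) (use Rf Nf' g cty in simp_all)
  also have "\<dots> = Cm D (tau G X A) (Cm D (Pb2 (WDisp D) ?u ?Gp) g)"
   by (rule Cmp_reassoc[OF Nf'(7)]) (use Nf' g cty u G A Gp in simp_all)
  finally show ?thesis using g by simp
 qed
 have ce: "Cm D ?c ?e = Cm D (realize D ?u (fo G X A) l) (tau F X A)"
  unfolding realize_def using cty ety G A by simp
 have pm: "Cm D ?p ?m = FAr F0 (proj C X A)"
 proof -
  have "Cm D ?p ?m = Cm D (Pb1 (WDisp D) ?u (proj D (FOb G0 X) (fo G X A))) (Cm D N g)"
   by (rule Cmp_reassoc1[OF Rf(6)]) (use Rf Nf' g pA in simp_all)
  also have "\<dots> = Cm D (Pb1 (WDisp D) ?u ?Gp) g"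
   by (rule Cmp_reassoc1[OF Nf'(6)]) (use Nf' g u G A in simp_all)
  finally show ?thesis using g by simp
 qed
 have pe: "Cm D ?p ?e = FAr F0 (proj C X A)"
 proof -
  have "Cm D ?p ?e = Cm D (proj D (FOb F0 X) (fo F X A)) (tau F X A)"
   by (rule Cmp_reassoc1[OF proj_ext_map[OF D_cw Fo(1) l(1), unfolded l, OF refl]]) (use pA ety G A in simp_all)
  then show ?thesis using F.proj_tau[OF G A] by simp
 qed
 have pb: "is_pullback (WCat D) ?u (proj D (FOb G0 X) (fo G X A)) ?p ?c"
  using cart_pb[OF D_cw u] G by simp
 have "?e = ?m" if "Cm D ?c ?e = Cm D ?c ?m"
  by (rule pb_unique[OF _ pb]) (use m pm pe that in simp_all)
 then have "?e = ?m \<longleftrightarrow> component X A l" unfolding component_def using o ce cm by metis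
 then show ?thesis unfolding Let_def lhs[unfolded proj_def] rhs[unfolded proj_def] by (simp add: lhs rhs flip: proj_def)
qed

lemma sides:
 assumes "X \<in> Ctx C"
 shows "XFun (comp_ifun (re_ntrans \<alpha> (WTp D)) (HTp G)) X = comp_func (IRe (WTp D) (al X)) (XFun (HTp G) X)"
  "functor (comp_func (IRe (WTp D) (al X)) (XFun (HTp G) X))"
 using assms G.tp by (simp_all add: re_ntrans_simps)

lemma sides_strict: "strict_indexed_functor (comp_ifun (re_ntrans \<alpha> (WTp D)) (HTp G))"
proof (rule strict_comp_ifun)
 show "strict_indexed_functor (re_ntrans \<alpha> (WTp D))" by (rule strict_re_ntrans) simp_all
 show "strict_indexed_category (XCod (re_ntrans \<alpha> (WTp D)))" "strict_indexed_category (XCod (HTp G))"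
  "strict_indexed_category (XDom (HTp G))"
  using pull_strict[of G0 "WTp D"] pull_strict[of F0 "WTp D"] G.tp by (simp_all add: re_ntrans_simps)
qed (use G.tp in \<open>simp_all add: re_ntrans_simps\<close>)

text \<open>Once the components are correct, \<open>component_nat\<close> supplies the naturality
  and reindexing laws: with the identity of the base it is fibre naturality, with an identity map of
  types the law for reindexing.\<close>

lemma cell_iff:
 "(indexed_nat (HTp F) (comp_ifun (re_ntrans \<alpha> (WTp D)) (HTp G)) l \<and>
  (\<forall>X \<in> Ctx C. \<forall>A \<in> Ob (Tp C X).
    (let S = disp_slice (WDisp D) (FOb F0 X); u = NMap \<alpha> X in
     Cmp S (FAr (XFun (WComp D) (FOb F0 X)) (l X A)) (HTau F X A) =
     Cmp S (XRho (WComp D) u (FOb (XFun (HTp G) X) A))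
      (Cmp S (FAr (IRe (disp_icat (WDisp D)) u) (HTau G X A))
       (disp_nat (WDisp C) (WDisp D) \<alpha> (FOb (XFun (WComp C) X) A)))))) \<longleftrightarrow>
  (l \<in> extensional (Ctx C) \<and> (\<forall>X \<in> Ctx C. l X \<in> extensional (Ob (Tp C X)) \<and>
   (\<forall>A \<in> Ob (Tp C X). component X A (l X A))))" (is "?N \<and> ?K \<longleftrightarrow> ?R")
proof
 assume NK: "?N \<and> ?K"
 then have ext: "l \<in> extensional (Ctx C)"
  and nt: "\<And>X. X \<in> Ctx C ==> nat_trans (XFun (HTp F) X) (comp_func (IRe (WTp D) (al X)) (XFun (HTp G) X)) (l X)"
  unfolding indexed_nat_def XBase_def F.base by (simp_all add: sides)
 show ?R
 proof (intro conjI ballI ext)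
  fix X assume G: "X \<in> Ctx C"
  show "l X \<in> extensional (Ob (Tp C X))" using nat_trans_ext[OF nt[OF G]] G by simp
  fix A assume A: "A \<in> Ob (Tp C X)"
  have "over D (al X) (l X A) (fo G X A) (fo F X A)"
   unfolding over_def using nat_trans_Ar[OF nt[OF G], of A] nat_trans_Dom[OF nt[OF G], of A] nat_trans_Cod[OF nt[OF G], of A] G A by simp
  from compat_iff[OF G A this] show "component X A (l X A)" using NK G A by blast
 qed
next
 assume R: ?R
 then have l: "\<And>X A. X \<in> Ctx C ==> A \<in> Ob (Tp C X) ==> component X A (l X A)" by blast
 have o: "over D (al X) (l X A) (fo G X A) (fo F X A)" if "X \<in> Ctx C" "A \<in> Ob (Tp C X)" for X A
  using l[OF that] by (simp add: component_def)
 have lA: "l X A \<in> Ar (Tp D (FOb F0 X))" "Dom (Tp D (FOb F0 X)) (l X A) = fo F X A"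
  "Cod (Tp D (FOb F0 X)) (l X A) = Re D (al X) (fo G X A)"
  if "X \<in> Ctx C" "A \<in> Ob (Tp C X)" for X A
  using o[OF that] that by (simp_all add: over_def)
 have K: ?K
 proof (intro ballI)
  show "let S = disp_slice (WDisp D) (FOb F0 X); u = NMap \<alpha> X in
     Cmp S (FAr (XFun (WComp D) (FOb F0 X)) (l X A)) (HTau F X A) =
     Cmp S (XRho (WComp D) u (FOb (XFun (HTp G) X) A))
      (Cmp S (FAr (IRe (disp_icat (WDisp D)) u) (HTau G X A))
       (disp_nat (WDisp C) (WDisp D) \<alpha> (FOb (XFun (WComp C) X) A)))"
   if "X \<in> Ctx C" "A \<in> Ob (Tp C X)" for X A
   by (rule compat_iff[THEN iffD2, OF that o[OF that] l[OF that]])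
 qed
 have N: ?N
  unfolding indexed_nat_def XBase_def F.base
 proof (intro conjI ballI allI impI)
  show "indexed_functor (HTp F)" "indexed_functor (comp_ifun (re_ntrans \<alpha> (WTp D)) (HTp G))"
   using F.tp(1) sides_strict by (simp_all add: strict_indexed_functor_def)
  show "XDom (HTp F) = XDom (comp_ifun (re_ntrans \<alpha> (WTp D)) (HTp G))"
   "XCod (HTp F) = XCod (comp_ifun (re_ntrans \<alpha> (WTp D)) (HTp G))"
   using F.tp G.tp by (simp_all add: re_ntrans_simps)
  show "l \<in> extensional (Ctx C)" using R by blast
 next
  fix X assume G: "X \<in> Ctx C"
  show "nat_trans (XFun (HTp F) X) (XFun (comp_ifun (re_ntrans \<alpha> (WTp D)) (HTp G)) X) (l X)"
   unfolding sides[OF G]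
  proof (rule nat_transI)
   fix f assume "f \<in> Ar (FDom (XFun (HTp F) X))"
   then have f: "f \<in> Ar (Tp C X)" using G by simp
   let ?A = "Dom (Tp C X) f" and ?B = "Cod (Tp C X) f"
   have ov: "over C (Idn (WCat C) X) f ?B ?A" using f G by (simp add: over_def)
   have B: "?B \<in> Ob (Tp C X)" using f G by simp
   show "Cmp (FCod (XFun (HTp F) X)) (l X (Cod (FDom (XFun (HTp F) X)) f)) (FAr (XFun (HTp F) X) f) =
    Cmp (FCod (XFun (HTp F) X)) (FAr (comp_func (IRe (WTp D) (al X)) (XFun (HTp G) X)) f) (l X (Dom (FDom (XFun (HTp F) X)) f))"
    using component_nat[of l, OF l ov] G f lA[OF G B] by simp
  qed (use R G lA in simp_all)
 next
  fix u a b x assume ux: "u \<in> hom (WCat C) a b \<and> x \<in> Ob (IFib (XDom (HTp F)) b)"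
  then have u: "u \<in> Sub C" "a = Dm C u" "b = Cd C u" and x: "x \<in> Ob (Tp C b)"
   using F.tp by (simp_all add: hom_iff)
  let ?B = "Re C u x"
  have G: "a \<in> Ctx C" "b \<in> Ctx C" "?B \<in> Ob (Tp C a)" using u x by simp_all
  have ov: "over C u (Idn (Tp C a) ?B) x ?B" using u x G by (simp add: over_def)
  have B: "IBase (XDom (HTp F)) = WCat C" "IBase (XDom (comp_ifun (re_ntrans \<alpha> (WTp D)) (HTp G))) = WCat C"
   using F.tp G.tp by simp_all
  have x': "x \<in> Ob (IFib (XDom (HTp F)) (Cd C u))" "x \<in> Ob (IFib (XDom (comp_ifun (re_ntrans \<alpha> (WTp D)) (HTp G))) (Cd C u))"
   using x u F.tp G.tp by simp_all
  have "l a ?B = Rf D (FAr F0 u) (l b x)"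
   using component_nat[of l, OF l ov u(2,3)] lA[OF G(2) x] lA[OF G(1,3)] u G x by simp
  moreover have "XRho (HTp F) u x = Idn (Tp D (FOb F0 a)) (fo F a ?B)"
   unfolding strict_XRho[OF F.tp(1) B(1) u(1) x'(1)] using u G x F.tp by simp
  moreover have "XRho (comp_ifun (re_ntrans \<alpha> (WTp D)) (HTp G)) u x = Idn (Tp D (FOb F0 a)) (Re D (al a) (fo G a ?B))"
   unfolding strict_XRho[OF sides_strict B(2) u(1) x'(2)] using u G x G.tp sides[OF G(1)] by (simp add: re_ntrans_simps)
  moreover have "IFib (XCod (HTp F)) a = Tp D (FOb F0 a)" "IRe (XCod (HTp F)) u = IRe (WTp D) (FAr F0 u)"
   "IRe (XDom (HTp F)) u = IRe (WTp C) u"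
   using F.tp G u by simp_all
  ultimately show "Cmp (IFib (XCod (HTp F)) a) (l a (FOb (IRe (XDom (HTp F)) u) x)) (XRho (HTp F) u x) =
   Cmp (IFib (XCod (HTp F)) a) (XRho (comp_ifun (re_ntrans \<alpha> (WTp D)) (HTp G)) u x) (FAr (IRe (XCod (HTp F)) u) (l b x))"
   using lA[OF G(1,3)] G by simp
 qed
 show "?N \<and> ?K" using N K by blast
qed

end

lemma parallelI:
 "cw_mor F ==> cw_mor G ==> HSrc F = C ==> HSrc G = C ==> HTrg F = D ==> HTrg G = D ==> ntrans \<alpha> ==>
  NDom \<alpha> = HFun F ==> NCod \<alpha> = HFun G ==> parallel F G C D \<alpha>"
 unfolding parallel_def parallel_axioms_def by (simp add: cwa_morphism_iff)

definition cell_ntrans :: "'u cwa_mor => 'u cwa_mor => ('u, 'u, 'u, 'u) ntrans => bool" where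
 "cell_ntrans F G \<alpha> \<longleftrightarrow> cw_mor F \<and> cw_mor G \<and> HSrc G = HSrc F \<and> HTrg G = HTrg F \<and> ntrans \<alpha> \<and>
  NDom \<alpha> = HFun F \<and> NCod \<alpha> = HFun G"

lemma cell_ntrans_parallel: "cell_ntrans F G \<alpha> ==> parallel F G (HSrc F) (HTrg F) \<alpha>"
 unfolding cell_ntrans_def by (intro parallelI) simp_all

lemma cw_cell_iff: "cw_cell L \<longleftrightarrow> cell_ntrans (LSrc L) (LTrg L) (LNat L) \<and>
  LTp L \<in> extensional (Ctx (HSrc (LSrc L))) \<and>
  (\<forall>X \<in> Ctx (HSrc (LSrc L)). LTp L X \<in> extensional (Ob (Tp (HSrc (LSrc L)) X)) \<and>
   (\<forall>A \<in> Ob (Tp (HSrc (LSrc L)) X).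
    parallel.component (LSrc L) (LTrg L) (HSrc (LSrc L)) (HTrg (LSrc L)) (LNat L) X A (LTp L X A)))"
proof (cases "cell_ntrans (LSrc L) (LTrg L) (LNat L)")
 case True
 interpret parallel "LSrc L" "LTrg L" "HSrc (LSrc L)" "HTrg (LSrc L)" "HFun (LSrc L)" "HFun (LTrg L)" "LNat L"
  using cell_ntrans_parallel[OF True] by simp
 show ?thesis using True cell_iff[of "LTp L"] unfolding cwa_cell_def Let_def cell_ntrans_def by blast
next
 case False
 then show ?thesis unfolding cwa_cell_def Let_def cell_ntrans_def by blast
qed

text \<open>Faithfulness of the forgetful 2-functor on 2-cells, through
  \<open>component_unique\<close> and extensionality of the action on types.\<close>

lemma cw_cell_eqI:
 assumes L: "cw_cell L" and M: "cw_cell M" and e: "LSrc L = LSrc M" "LTrg L = LTrg M" "LNat L = LNat M"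
 shows "L = M"
proof -
 let ?C = "HSrc (LSrc M)"
 note l = L[unfolded cw_cell_iff e] and m = M[unfolded cw_cell_iff]
 interpret parallel "LSrc M" "LTrg M" ?C "HTrg (LSrc M)" "HFun (LSrc M)" "HFun (LTrg M)" "LNat M"
  using cell_ntrans_parallel m by blast
 have "LTp L X A = LTp M X A" for X A
 proof (cases "X \<in> Ctx ?C")
  case True
  then show ?thesis
  proof (cases "A \<in> Ob (Tp ?C X)")
   case A: True
   then show ?thesis using l m component_unique[OF True A] True by blast
  next
   case False
   then show ?thesis using l m True by (auto simp: extensional_def)
  qed
 next
  case False
  then show ?thesis using l m by (auto simp: extensional_def)
 qed
 then show ?thesis using e by (cases L, cases M) (simp add: fun_eq_iff)
qed

text \<open>Fullness on 2-cells. The components may be chosen independently for each type, since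
  naturality is then automatic.\<close>

lemma cw_cell_exists:
 assumes "cell_ntrans F G \<alpha>"
 shows "\<exists>L. cw_cell L \<and> LSrc L = F \<and> LTrg L = G \<and> LNat L = \<alpha>"
proof -
 interpret parallel F G "HSrc F" "HTrg F" "HFun F" "HFun G" \<alpha>
  using cell_ntrans_parallel[OF assms] by simp
 define L where "L = \<lparr>LSrc = F, LTrg = G, LNat = \<alpha>, LTp = (\<lambda>X\<in>Ctx (HSrc F). \<lambda>A\<in>Ob (Tp (HSrc F) X).
  SOME l. component X A l)\<rparr>"
 have "component X A (SOME l. component X A l)" if "X \<in> Ctx (HSrc F)" "A \<in> Ob (Tp (HSrc F) X)" for X A
  using component_exists[OF that] by (rule someI_ex)
 then have "cw_cell L" unfolding cw_cell_iff L_def using assms by simp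
 then show ?thesis by (auto simp: L_def)
qed

section \<open>The 2-category of categories with attributes\<close>

lemma cw_mor_morphism: "cw_mor H ==> cwa_morphism H (HSrc H) (HTrg H)"
 by (simp add: cwa_morphism_iff)

text \<open>The ends of each \<open>HTau X A\<close> are prescribed by typing, so the middle arrows
  \<open>tau\<close> suffice; outside its domain \<open>HTau\<close> is undefined on both
  sides.\<close>

lemma cwa_mor_eqI:
 assumes H: "cw_mor H" and K: "cw_mor K" and e: "HSrc H = HSrc K" "HTrg H = HTrg K" "HFun H = HFun K"
  and fo: "\<And>X A. X \<in> Ctx (HSrc K) ==> A \<in> Ob (Tp (HSrc K) X) ==> fo H X A = fo K X A"
  and fa: "\<And>X f. X \<in> Ctx (HSrc K) ==> f \<in> Ar (Tp (HSrc K) X) ==> fa H X f = fa K X f"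
  and tau: "\<And>X A. X \<in> Ctx (HSrc K) ==> A \<in> Ob (Tp (HSrc K) X) ==> tau H X A = tau K X A"
 shows "H = K"
proof -
 let ?C = "HSrc K"
 interpret H: cwa_morphism H ?C "HTrg K" "HFun H" using H e by (simp_all add: cwa_morphism_iff)
 interpret K: cwa_morphism K ?C "HTrg K" "HFun K" using K by (simp add: cwa_morphism_iff)
 have "HTau H X A = HTau K X A" for X A
 proof (cases "X \<in> Ctx ?C")
  case G: True
  show ?thesis
  proof (cases "A \<in> Ob (Tp ?C X)")
   case True
   then show ?thesis using H.HTau_eq[OF G True] K.HTau_eq[OF G True] fo tau G e by simp
  next
   case False
   then show ?thesis using H.HTau_ext(2)[OF G] K.HTau_ext(2)[OF G] by (auto simp: extensional_def)
  qed
 next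
  case False
  then show ?thesis using H.HTau_ext(1) K.HTau_ext(1) by (auto simp: extensional_def)
 qed
 then have "HTau H = HTau K" by blast
 moreover have "HTp H = HTp K"
 proof (rule strict_ifun_eqI[OF H.tp(1) K.tp(1)])
  show "XFun (HTp H) a = XFun (HTp K) a" if "a \<in> Ob (IBase (XDom (HTp K)))" for a
   using that fo fa K.base e by (intro functor_eqI) simp_all
 qed (use H.tp K.tp e in simp_all)
 ultimately show ?thesis using e by (cases H, cases K) simp
qed

lemma display_functor_id:
 assumes "display_category D"
 shows "display_functor D D (id_func (DCat D))"
proof -
 interpret display_category D by (rule assms)
 show ?thesis
 proof (rule display_functor.intro[OF assms assms])
  show "is_pullback C (FAr (id_func C) f) (FAr (id_func C) p) (FAr (id_func C) p') (FAr (id_func C) f')"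
   if "p \<in> Disp D" "is_pullback C f p p' f'" for f p p' f'
   using that pb_Ar[of C f p p' f'] by simp
 qed (simp_all add: functors_iff)
qed

lemma display_functor_comp:
 assumes F: "display_functor A B F" and G: "display_functor B D G"
 shows "display_functor A D (comp_func G F)"
proof -
 interpret F: display_functor A B F by (rule F)
 interpret G: display_functor B D G by (rule G)
 interpret A: display_category A by (rule F.display_source)
 show ?thesis
 proof (rule display_functor.intro[OF F.display_source G.display_target])
  show "comp_func G F \<in> functors (DCat A) (DCat D)" by (simp add: functors_iff)
  show "FAr (comp_func G F) p \<in> Disp D" if "p \<in> Disp A" for p
   using that F.F_Disp G.F_Disp by simp
  show "is_pullback (DCat D) (FAr (comp_func G F) f) (FAr (comp_func G F) p) (FAr (comp_func G F) p') (FAr (comp_func G F) f')"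
   if "p \<in> Disp A" and pb: "is_pullback (DCat A) f p p' f'" for f p p' f'
   using pb_Ar[OF _ pb] G.F_pullback[OF F.F_Disp[OF that(1)] F.F_pullback[OF that]] by simp
 qed
qed

lemma
 assumes C: "cw C"
 shows id_cwa_simps: "HSrc (id_cwa C) = C" "HTrg (id_cwa C) = C" "HFun (id_cwa C) = id_func (WCat C)"
  "X \<in> Ctx C ==> A \<in> Ob (Tp C X) ==> fo (id_cwa C) X A = A"
  "X \<in> Ctx C ==> f \<in> Ar (Tp C X) ==> fa (id_cwa C) X f = f"
  "X \<in> Ctx C ==> A \<in> Ob (Tp C X) ==> tau (id_cwa C) X A = Idn (WCat C) (cext C X A)"
  and cw_mor_id: "cw_mor (id_cwa C)"
proof -
 interpret D: display_category "WDisp C" using C by (rule cw_disp)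
 show [simp]: "HSrc (id_cwa C) = C" "HTrg (id_cwa C) = C" "HFun (id_cwa C) = id_func (WCat C)"
  by (simp_all add: id_cwa_def)
 show fo [simp]: "fo (id_cwa C) X A = A" if "X \<in> Ctx C" "A \<in> Ob (Tp C X)" for X A
  using that C by (simp add: id_cwa_def id_ifun_def)
 show fa [simp]: "fa (id_cwa C) X f = f" if "X \<in> Ctx C" "f \<in> Ar (Tp C X)" for X f
  using that C by (simp add: id_cwa_def id_ifun_def)
 have h: "HTau (id_cwa C) X A = (proj C X A, Idn (WCat C) (cext C X A), proj C X A)"
  if "X \<in> Ctx C" "A \<in> Ob (Tp C X)" for X A
  using that C D.slice_Idn[of "proj C X A" X] by (simp add: id_cwa_def proj_def[symmetric])
 then show tau [simp]: "tau (id_cwa C) X A = Idn (WCat C) (cext C X A)" if "X \<in> Ctx C" "A \<in> Ob (Tp C X)" for X A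
  using that by (simp add: tau_def)
 show "cw_mor (id_cwa C)" unfolding cw_mor_iff
 proof (intro conjI)
  show "cwa_mor_struct (id_cwa C)"
   unfolding cwa_mor_struct_def using C display_functor_id[OF cw_disp[OF C]] strict_id_ifun[of "WTp C"]
    pull_id[of "WTp C" "WCat C"] cw_tp[OF C, unfolded strict_indexed_category_def]
   by (simp add: id_cwa_def id_ifun_def)
  show "tau_typed (id_cwa C)"
   unfolding tau_typed_def
  proof (intro conjI ballI)
   show "HTau (id_cwa C) \<in> extensional (Ctx (HSrc (id_cwa C)))"
    "X \<in> Ctx (HSrc (id_cwa C)) ==> HTau (id_cwa C) X \<in> extensional (Ob (Tp (HSrc (id_cwa C)) X))" for X
    by (simp_all add: id_cwa_def)
  qed (use C h in simp_all)
  show "tau_nat (id_cwa C)"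
   unfolding tau_nat_def
  proof (intro allI impI)
   fix u f B A assume o: "over (HSrc (id_cwa C)) u f B A"
   then have o: "over C u f B A" by simp
   have ob: "u \<in> Sub C" "B \<in> Ob (Tp C (Cd C u))" "A \<in> Ob (Tp C (Dm C u))"
    "f \<in> Ar (Tp C (Dm C u))"
    using o over_Ob[OF C o] by (simp_all add: over_def)
   show "Cm (HTrg (id_cwa C)) (tau (id_cwa C) (Cd (HSrc (id_cwa C)) u) B) (FAr (HFun (id_cwa C)) (realize (HSrc (id_cwa C)) u B f)) =
    Cm (HTrg (id_cwa C)) (realize (HTrg (id_cwa C)) (FAr (HFun (id_cwa C)) u) (fo (id_cwa C) (Cd (HSrc (id_cwa C)) u) B)
     (fa (id_cwa C) (Dm (HSrc (id_cwa C)) u) f)) (tau (id_cwa C) (Dm (HSrc (id_cwa C)) u) A)"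
    using ob o C Dom_realize[OF C o] Cod_realize[OF C o] realize_Ar[OF C o] by (simp del: realize_Idn)
  qed
 qed
qed

locale composable_cwa = F: cwa_morphism F C D F0 + G: cwa_morphism G D E G0
 for F G :: "'u cwa_mor" and C D E F0 G0
begin

lemma comp_simps:
 "HSrc (comp_cwa G F) = C" "HTrg (comp_cwa G F) = E" "HFun (comp_cwa G F) = comp_func G0 F0"
 "X \<in> Ctx C ==> A \<in> Ob (Tp C X) ==> fo (comp_cwa G F) X A = fo G (FOb F0 X) (fo F X A)"
 "X \<in> Ctx C ==> f \<in> Ar (Tp C X) ==> fa (comp_cwa G F) X f = fa G (FOb F0 X) (fa F X f)"
 by (simp_all add: comp_cwa_def F.src G.trg F.F_def[symmetric] G.F_def[symmetric] F.tp)

lemma comp_HTau: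
 assumes G: "X \<in> Ctx C" and A: "A \<in> Ob (Tp C X)"
 shows "HTau (comp_cwa G F) X A = (FAr G0 (FAr F0 (proj C X A)),
  Cm E (tau G (FOb F0 X) (fo F X A)) (FAr G0 (tau F X A)),
  proj E (FOb G0 (FOb F0 X)) (fo G (FOb F0 X) (fo F X A)))"
proof -
 let ?Y = "FOb F0 X" and ?B = "fo F X A"
 have B: "?Y \<in> Ctx D" "?B \<in> Ob (Tp D ?Y)" using G A by simp_all
 note t = F.HTau_Ar[OF G A]
 have "HTau (comp_cwa G F) X A = Cmp (disp_slice (WDisp E) (FOb G0 ?Y)) (HTau G ?Y ?B)
  (FAr (XFun (disp_ifun (WDisp D) (WDisp E) G0) ?Y) (HTau F X A))"
  using G A by (simp add: comp_cwa_def F.src G.src G.trg F.F_def[symmetric] G.F_def[symmetric] Let_def)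
 also have "\<dots> = (fst (FAr (XFun (disp_ifun (WDisp D) (WDisp E) G0) ?Y) (HTau F X A)),
  Cm E (fst (snd (HTau G ?Y ?B))) (fst (snd (FAr (XFun (disp_ifun (WDisp D) (WDisp E) G0) ?Y) (HTau F X A)))),
  snd (snd (HTau G ?Y ?B)))"
 proof (rule G.D.slice_Cmp[OF G.HTau_Ar[OF B]])
  show "FAr (XFun (disp_ifun (WDisp D) (WDisp E) G0) ?Y) (HTau F X A) \<in> Ar (disp_slice (WDisp E) (FOb G0 ?Y))"
   unfolding G.disp_fun_simps(4)[OF B(1) t] by (rule G.disp_fun_Ar[OF B(1) t])
  show "fst (HTau G ?Y ?B) = snd (snd (FAr (XFun (disp_ifun (WDisp D) (WDisp E) G0) ?Y) (HTau F X A)))"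
   unfolding G.disp_fun_simps(4)[OF B(1) t] unfolding G.HTau_eq[OF B] F.HTau_eq[OF G A] by simp
 qed
 finally show ?thesis unfolding G.disp_fun_simps(4)[OF B(1) t] unfolding G.HTau_eq[OF B] F.HTau_eq[OF G A] by simp
qed

lemma comp_tau: "X \<in> Ctx C ==> A \<in> Ob (Tp C X) ==>
  tau (comp_cwa G F) X A = Cm E (tau G (FOb F0 X) (fo F X A)) (FAr G0 (tau F X A))"
 unfolding tau_def[of "comp_cwa G F"] by (simp add: comp_HTau)

lemma comp_strict: "strict_indexed_functor (comp_ifun (pull_ifun F0 (HTp G)) (HTp F))"
proof (rule strict_comp_ifun)
 have Q: "strict_indexed_category (pull_icat G0 (WTp E))" using pull_strict[of G0 "WTp E"] G.D by simp
 show "strict_indexed_functor (pull_ifun F0 (HTp G))"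
  using strict_pull_ifun[OF G.tp(1), of F0] Q G.tp F.D by simp
 show "strict_indexed_category (XCod (pull_ifun F0 (HTp G)))" using G.tp pull_strict[of F0 "pull_icat G0 (WTp E)"] Q by simp
 show "strict_indexed_category (XCod (HTp F))" using F.tp F.D pull_strict[of F0 "WTp D"] by simp
qed (use F.tp G.tp F.C in simp_all)

text \<open>The naturality square of the composite is the square of \<open>F\<close>, mapped by
  \<open>G0\<close>, pasted with the square of \<open>G\<close> at the image type map.\<close>

lemma cw_mor_comp: "cw_mor (comp_cwa G F)"
 unfolding cw_mor_iff
proof (intro conjI)
 show "cwa_mor_struct (comp_cwa G F)"
  unfolding cwa_mor_struct_def comp_simps
 proof (intro conjI)
  show "display_functor (WDisp C) (WDisp E) (comp_func G0 F0)"
   by (rule display_functor_comp[OF F.disp G.disp])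
  show "strict_indexed_functor (HTp (comp_cwa G F))"
   using comp_strict by (simp add: comp_cwa_def F.F_def)
  show "XDom (HTp (comp_cwa G F)) = WTp C" by (simp add: comp_cwa_def F.tp)
  show "XCod (HTp (comp_cwa G F)) = pull_icat (comp_func G0 F0) (WTp E)"
   using cw_tp[OF G.D] by (simp add: comp_cwa_def G.tp F.F_def[symmetric] pull_comp strict_indexed_category_def)
 qed (rule F.C, rule G.D)
 show "tau_typed (comp_cwa G F)"
  unfolding tau_typed_def comp_simps
 proof (intro conjI ballI)
  show "HTau (comp_cwa G F) \<in> extensional (Ctx C)"
   "X \<in> Ctx C ==> HTau (comp_cwa G F) X \<in> extensional (Ob (Tp C X))" for X
   by (simp_all add: comp_cwa_def F.src)
  fix X A assume G: "X \<in> Ctx C" and A: "A \<in> Ob (Tp C X)"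
  have B: "FOb F0 X \<in> Ctx D" "fo F X A \<in> Ob (Tp D (FOb F0 X))" using G A by simp_all
  show "HTau (comp_cwa G F) X A = (FAr (comp_func G0 F0) (proj C X A), tau (comp_cwa G F) X A,
   proj E (FOb (comp_func G0 F0) X) (fo (comp_cwa G F) X A))"
   using G A by (simp add: comp_HTau comp_tau comp_simps)
  show "iso_arrow (WCat E) (tau (comp_cwa G F) X A)"
   "Dm E (tau (comp_cwa G F) X A) = FOb (comp_func G0 F0) (cext C X A)"
   "Cd E (tau (comp_cwa G F) X A) = cext E (FOb (comp_func G0 F0) X) (fo (comp_cwa G F) X A)"
   using G A B by (simp_all add: comp_tau comp_simps)
  have "Cm E (proj E (FOb G0 (FOb F0 X)) (fo G (FOb F0 X) (fo F X A))) (Cm E (tau G (FOb F0 X) (fo F X A)) (FAr G0 (tau F X A))) =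
   Cm E (FAr G0 (proj D (FOb F0 X) (fo F X A))) (FAr G0 (tau F X A))"
   by (rule Cmp_reassoc1[OF G.proj_tau[OF B]]) (use G A B in simp_all)
  also have "\<dots> = FAr G0 (Cm D (proj D (FOb F0 X) (fo F X A)) (tau F X A))"
   using G A B by simp
  finally show "Cm E (proj E (FOb (comp_func G0 F0) X) (fo (comp_cwa G F) X A)) (tau (comp_cwa G F) X A) =
   FAr (comp_func G0 F0) (proj C X A)"
   using G A by (simp add: comp_tau comp_simps F.proj_tau)
 qed
 show "tau_nat (comp_cwa G F)"
  unfolding tau_nat_def comp_simps
 proof (intro allI impI)
  fix u f B A assume o: "over C u f B A"
  let ?X = "Dm C u" and ?Y = "Cd C u"
  have u: "u \<in> Sub C" "B \<in> Ob (Tp C ?Y)" "f \<in> Ar (Tp C ?X)" using o by (simp_all add: over_def)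
  have A: "A \<in> Ob (Tp C ?X)" by (rule over_Ob[OF F.C o])
  have G: "?X \<in> Ctx C" "?Y \<in> Ctx C" using u by simp_all
  have oF: "over D (FAr F0 u) (fa F ?X f) (fo F ?Y B) (fo F ?X A)" by (rule F.over_fa[OF o])
  have Fu: "FAr F0 u \<in> Sub D" "Dm D (FAr F0 u) = FOb F0 ?X" "Cd D (FAr F0 u) = FOb F0 ?Y" using u by simp_all
  note oG = G.over_fa[OF oF, unfolded Fu]
  define R where "R = realize C u B f"
  define RF where "RF = realize D (FAr F0 u) (fo F ?Y B) (fa F ?X f)"
  define RG where "RG = realize E (FAr G0 (FAr F0 u)) (fo G (FOb F0 ?Y) (fo F ?Y B)) (fa G (FOb F0 ?X) (fa F ?X f))"
  have ty: "R \<in> Sub C" "Dm C R = cext C ?X A" "Cd C R = cext C ?Y B"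
   "RF \<in> Sub D" "Dm D RF = cext D (FOb F0 ?X) (fo F ?X A)" "Cd D RF = cext D (FOb F0 ?Y) (fo F ?Y B)"
   "RG \<in> Sub E" "Dm E RG = cext E (FOb G0 (FOb F0 ?X)) (fo G (FOb F0 ?X) (fo F ?X A))"
   using realize_Ar[OF F.C o] Dom_realize[OF F.C o] Cod_realize[OF F.C o] realize_Ar[OF F.D oF] Dom_realize[OF F.D oF]
    Cod_realize[OF F.D oF] realize_Ar[OF G.D oG] Dom_realize[OF G.D oG] Fu u
   unfolding R_def RF_def RG_def by (simp_all del: realize_Idn)
  have n: "Cm D (tau F ?Y B) (FAr F0 R) = Cm D RF (tau F ?X A)"
   "Cm E (tau G (FOb F0 ?Y) (fo F ?Y B)) (FAr G0 RF) = Cm E RG (tau G (FOb F0 ?X) (fo F ?X A))"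
   using F.tau_natural[OF o] G.tau_natural[OF oF] Fu unfolding R_def RF_def RG_def by simp_all
  have B': "FOb F0 ?X \<in> Ctx D" "fo F ?X A \<in> Ob (Tp D (FOb F0 ?X))" "FOb F0 ?Y \<in> Ctx D" "fo F ?Y B \<in> Ob (Tp D (FOb F0 ?Y))"
   using G A u by simp_all
  have "Cm E (Cm E (tau G (FOb F0 ?Y) (fo F ?Y B)) (FAr G0 (tau F ?Y B))) (FAr G0 (FAr F0 R)) =
   Cm E (tau G (FOb F0 ?Y) (fo F ?Y B)) (FAr G0 (Cm D (tau F ?Y B) (FAr F0 R)))"
   using G A B' u ty by simp
  also have "FAr G0 (Cm D (tau F ?Y B) (FAr F0 R)) = Cm E (FAr G0 RF) (FAr G0 (tau F ?X A))"
   unfolding n(1) using G(1) A ty(4,5) by simp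
  also have "Cm E (tau G (FOb F0 ?Y) (fo F ?Y B)) (Cm E (FAr G0 RF) (FAr G0 (tau F ?X A))) = Cm E RG (Cm E (tau G (FOb F0 ?X) (fo F ?X A)) (FAr G0 (tau F ?X A)))"
  proof (rule Cmp_reassoc[OF n(2)])
   show "category (WCat E)" by simp
   show "FAr G0 (tau F ?X A) \<in> Sub E" using G(1) A by simp
   show "Cd E (FAr G0 (tau F ?X A)) = Dm E (FAr G0 RF)" using G(1) A ty(4,5) by simp
   show "tau G (FOb F0 ?Y) (fo F ?Y B) \<in> Sub E" by (rule G.tau_Ar[OF B'(3,4)])
   show "FAr G0 RF \<in> Sub E" using ty(4) by simp
   show "RG \<in> Sub E" by (rule ty(7))
   show "tau G (FOb F0 ?X) (fo F ?X A) \<in> Sub E" by (rule G.tau_Ar[OF B'(1,2)])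
   show "Dm E (tau G (FOb F0 ?Y) (fo F ?Y B)) = Cd E (FAr G0 RF)"
    unfolding G.Dom_tau[OF B'(3,4)] using ty(4,6) by simp
   show "Dm E RG = Cd E (tau G (FOb F0 ?X) (fo F ?X A))"
    unfolding G.Cod_tau[OF B'(1,2)] by (rule ty(8))
  qed
  finally have fin: "Cm E (Cm E (tau G (FOb F0 ?Y) (fo F ?Y B)) (FAr G0 (tau F ?Y B))) (FAr G0 (FAr F0 R)) =
   Cm E RG (Cm E (tau G (FOb F0 ?X) (fo F ?X A)) (FAr G0 (tau F ?X A)))" .
  show "Cm E (tau (comp_cwa G F) ?Y B) (FAr (comp_func G0 F0) (realize C u B f)) =
   Cm E (realize E (FAr (comp_func G0 F0) u) (fo (comp_cwa G F) ?Y B) (fa (comp_cwa G F) ?X f)) (tau (comp_cwa G F) ?X A)"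
  proof -
   have "FAr (comp_func G0 F0) R = FAr G0 (FAr F0 R)" "FAr (comp_func G0 F0) u = FAr G0 (FAr F0 u)" using ty(1) u(1) by simp_all
   then show ?thesis
    using fin unfolding comp_tau[OF G(1) A] comp_tau[OF G(2) u(2)] comp_simps(4)[OF G(2) u(2)] comp_simps(5)[OF G(1) u(3)] R_def RG_def
    by (simp only:)
  qed
 qed
qed

end

lemma composable_cwa_iff: "composable_cwa F G C D E \<longleftrightarrow>
  cw_mor F \<and> cw_mor G \<and> HSrc F = C \<and> HTrg F = D \<and> HSrc G = D \<and> HTrg G = E"
 unfolding composable_cwa_def cwa_morphism_iff by blast

lemma comp_cwa_id:
 assumes "cw_mor F"
 shows "comp_cwa (id_cwa (HTrg F)) F = F" "comp_cwa F (id_cwa (HSrc F)) = F"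
proof -
 interpret F: cwa_morphism F "HSrc F" "HTrg F" "HFun F" by (rule cw_mor_morphism[OF assms])
 note C = F.C and D = F.D
 note ids = id_cwa_simps[OF C] id_cwa_simps[OF D]
 interpret l: composable_cwa F "id_cwa (HTrg F)" "HSrc F" "HTrg F" "HTrg F" "HFun F" "HFun (id_cwa (HTrg F))"
  using assms cw_mor_id[OF D] ids composable_cwa_iff[of F "id_cwa (HTrg F)"] by simp_all
 interpret r: composable_cwa "id_cwa (HSrc F)" F "HSrc F" "HSrc F" "HTrg F" "HFun (id_cwa (HSrc F))" "HFun F"
  using assms cw_mor_id[OF C] ids composable_cwa_iff[of "id_cwa (HSrc F)" F] by simp_all
 show "comp_cwa (id_cwa (HTrg F)) F = F"
  by (rule cwa_mor_eqI[OF l.cw_mor_comp assms]) (simp_all add: l.comp_simps l.comp_tau ids)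
 show "comp_cwa F (id_cwa (HSrc F)) = F"
  by (rule cwa_mor_eqI[OF r.cw_mor_comp assms]) (simp_all add: r.comp_simps r.comp_tau ids)
qed

lemma comp_cwa_assoc:
 assumes F: "cw_mor F" and G: "cw_mor G" and H: "cw_mor H" and e: "HSrc G = HTrg F" "HSrc H = HTrg G"
 shows "comp_cwa H (comp_cwa G F) = comp_cwa (comp_cwa H G) F"
proof -
 let ?A = "HSrc F" and ?B = "HTrg F" and ?C = "HTrg G" and ?D = "HTrg H"
 interpret gf: composable_cwa F G ?A ?B ?C "HFun F" "HFun G" using assms by (simp add: composable_cwa_iff)
 interpret hg: composable_cwa G H ?B ?C ?D "HFun G" "HFun H" using assms by (simp add: composable_cwa_iff)
 interpret h_gf: composable_cwa "comp_cwa G F" H ?A ?C ?D "HFun (comp_cwa G F)" "HFun H"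
  using composable_cwa_iff[of "comp_cwa G F" H ?A ?C ?D] assms gf.cw_mor_comp gf.comp_simps by simp_all
 interpret hg_f: composable_cwa F "comp_cwa H G" ?A ?B ?D "HFun F" "HFun (comp_cwa H G)"
  using composable_cwa_iff[of F "comp_cwa H G" ?A ?B ?D] assms hg.cw_mor_comp hg.comp_simps by simp_all
 show ?thesis
 proof (rule cwa_mor_eqI[OF h_gf.cw_mor_comp hg_f.cw_mor_comp])
  show "HFun (comp_cwa H (comp_cwa G F)) = HFun (comp_cwa (comp_cwa H G) F)"
   unfolding h_gf.comp_simps hg_f.comp_simps gf.comp_simps hg.comp_simps by (rule comp_func_assoc) simp_all
  show "tau (comp_cwa H (comp_cwa G F)) X A = tau (comp_cwa (comp_cwa H G) F) X A"
   if "X \<in> Ob (WCat (HSrc (comp_cwa (comp_cwa H G) F)))" "A \<in> Ob (IFib (WTp (HSrc (comp_cwa (comp_cwa H G) F))) X)" for X A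
  proof -
   have G: "X \<in> Ctx ?A" and A: "A \<in> Ob (Tp ?A X)" using that by (simp_all add: hg_f.comp_simps)
   have "FOb (HFun F) X \<in> Ctx ?B" "fo F X A \<in> Ob (Tp ?B (FOb (HFun F) X))" using G A by simp_all
   then show ?thesis using G A by (simp add: h_gf.comp_tau hg_f.comp_tau gf.comp_tau hg.comp_tau gf.comp_simps hg.comp_simps)
  qed
 qed (simp_all add: h_gf.comp_simps hg_f.comp_simps gf.comp_simps hg.comp_simps)
qed

locale cwa_cell_data = parallel F G C D F0 G0 \<alpha> for F G :: "'u cwa_mor" and C D F0 G0 \<alpha> +
 fixes L :: "'u cwa_cell"
 assumes L: "cw_cell L" and LSrc: "LSrc L = F" and LTrg: "LTrg L = G" and LNat: "LNat L = \<alpha>"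
begin

lemma
 assumes "X \<in> Ctx C" "A \<in> Ob (Tp C X)"
 shows cell_over: "over D (al X) (LTp L X A) (fo G X A) (fo F X A)"
  and cell_realize: "Cm D (realize D (al X) (fo G X A) (LTp L X A)) (tau F X A) =
   Cm D (tau G X A) (al (cext C X A))"
proof -
 have "component X A (LTp L X A)" using L assms unfolding cw_cell_iff LSrc LTrg LNat F.src F.trg by blast
 then show "over D (al X) (LTp L X A) (fo G X A) (fo F X A)"
  "Cm D (realize D (al X) (fo G X A) (LTp L X A)) (tau F X A) =
   Cm D (tau G X A) (al (cext C X A))"
  by (simp_all add: component_def)
qed

end

lemma cw_cell_data: "cw_cell L ==> cwa_cell_data (LSrc L) (LTrg L) (HSrc (LSrc L)) (HTrg (LSrc L)) (LNat L) L"
 unfolding cwa_cell_data_def cwa_cell_data_axioms_def using cell_ntrans_parallel cw_cell_iff by blast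

lemma cw_cell_typing:
 assumes "cw_cell L"
 shows "cw_mor (LSrc L)" "cw_mor (LTrg L)" "HSrc (LTrg L) = HSrc (LSrc L)" "HTrg (LTrg L) = HTrg (LSrc L)"
  "ntrans (LNat L)" "NDom (LNat L) = HFun (LSrc L)" "NCod (LNat L) = HFun (LTrg L)"
 using assms unfolding cw_cell_iff cell_ntrans_def by blast+

lemma cell_simps [simp]:
 "LSrc (id_cwa_cell F) = F" "LTrg (id_cwa_cell F) = F" "LNat (id_cwa_cell F) = id_ntrans (HFun F)"
 "LSrc (vcomp_cwa M L) = LSrc L" "LTrg (vcomp_cwa M L) = LTrg M" "LNat (vcomp_cwa M L) = vcomp_ntrans (LNat M) (LNat L)"
 "LSrc (hcomp_cwa M L) = comp_cwa (LSrc M) (LSrc L)" "LTrg (hcomp_cwa M L) = comp_cwa (LTrg M) (LTrg L)"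
 "LNat (hcomp_cwa M L) = hcomp_ntrans (LNat M) (LNat L)"
 by (simp_all add: id_cwa_cell_def vcomp_cwa_def hcomp_cwa_def Let_def)

lemma mor_simps [simp]:
 "HSrc (id_cwa C) = C" "HTrg (id_cwa C) = C" "HFun (id_cwa C) = id_func (WCat C)"
 "HSrc (comp_cwa G F) = HSrc F" "HTrg (comp_cwa G F) = HTrg G" "HFun (comp_cwa G F) = comp_func (HFun G) (HFun F)"
 by (simp_all add: id_cwa_def comp_cwa_def)

lemma cw_cellI:
 assumes "cell_ntrans (LSrc L) (LTrg L) (LNat L)" "LTp L \<in> extensional (Ctx (HSrc (LSrc L)))"
  "\<And>X. X \<in> Ctx (HSrc (LSrc L)) ==> LTp L X \<in> extensional (Ob (Tp (HSrc (LSrc L)) X))"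
  "\<And>X A. X \<in> Ctx (HSrc (LSrc L)) ==> A \<in> Ob (Tp (HSrc (LSrc L)) X) ==>
   over (HTrg (LSrc L)) (NMap (LNat L) X) (LTp L X A) (fo (LTrg L) X A) (fo (LSrc L) X A) \<and>
   Cm (HTrg (LSrc L)) (realize (HTrg (LSrc L)) (NMap (LNat L) X) (fo (LTrg L) X A) (LTp L X A)) (tau (LSrc L) X A) =
   Cm (HTrg (LSrc L)) (tau (LTrg L) X A) (NMap (LNat L) (cext (HSrc (LSrc L)) X A))"
 shows "cw_cell L"
 unfolding cw_cell_iff using assms parallel.component_def[OF cell_ntrans_parallel[OF assms(1)]] by simp

lemma cw_cell_id:
 assumes "cw_mor F"
 shows "cw_cell (id_cwa_cell F)"
proof -
 interpret F: cwa_morphism F "HSrc F" "HTrg F" "HFun F" by (rule cw_mor_morphism[OF assms])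
 show ?thesis
 proof (rule cw_cellI)
  show "cell_ntrans (LSrc (id_cwa_cell F)) (LTrg (id_cwa_cell F)) (LNat (id_cwa_cell F))"
   using assms by (simp add: id_cwa_cell_def cell_ntrans_def)
 qed (simp_all add: id_cwa_cell_def over_def)
qed

text \<open>By \<open>realize_Cmp\<close> the composite component realizes to the composite of the
  realizations, so the two compatibility squares paste.\<close>

lemma cw_cell_vcomp:
 assumes L: "cw_cell L" and M: "cw_cell M" and e: "LSrc M = LTrg L"
 shows "cw_cell (vcomp_cwa M L)"
proof -
 let ?C = "HSrc (LSrc L)" and ?D = "HTrg (LSrc L)" and ?F = "LSrc L" and ?G = "LTrg L" and ?H = "LTrg M"
 let ?a = "LNat L" and ?b = "LNat M"
 have s: "HSrc ?G = ?C" "HTrg ?G = ?D" using L unfolding cw_cell_iff cell_ntrans_def by blast+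
 interpret L: cwa_cell_data ?F ?G ?C ?D "HFun ?F" "HFun ?G" ?a L by (rule cw_cell_data[OF L])
 interpret M: cwa_cell_data ?G ?H ?C ?D "HFun ?G" "HFun ?H" ?b M by (rule cw_cell_data[OF M, unfolded e s])
 show ?thesis
 proof (rule cw_cellI, unfold cell_simps)
  show "cell_ntrans ?F ?H (vcomp_ntrans ?b ?a)"
   unfolding cell_ntrans_def using cw_cell_typing[OF L] cw_cell_typing[OF M] e by simp
  show "LTp (vcomp_cwa M L) \<in> extensional (Ctx ?C)"
   "X \<in> Ctx ?C ==> LTp (vcomp_cwa M L) X \<in> extensional (Ob (Tp ?C X))" for X
   by (simp_all add: vcomp_cwa_def Let_def)
  fix X A assume G: "X \<in> Ctx ?C" and A: "A \<in> Ob (Tp ?C X)"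
  have E: "cext ?C X A \<in> Ctx ?C" using G A by simp
  note oL = L.cell_over[OF G A] and oM = M.cell_over[OF G A]
  have d: "Dm ?D (NMap ?b X) = Cd ?D (NMap ?a X)" "Dm ?D (NMap ?a X) = FOb (HFun ?F) X" using G by simp_all
  have k: "LTp (vcomp_cwa M L) X A = Cmp (Tp ?D (Dm ?D (NMap ?a X))) (Rf ?D (NMap ?a X) (LTp M X A)) (LTp L X A)"
   using G A d by (simp add: vcomp_cwa_def Let_def)
  have v: "NMap (vcomp_ntrans ?b ?a) x = Cm ?D (NMap ?b x) (NMap ?a x)" if "x \<in> Ctx ?C" for x using that by simp
  note rL = L.realize_typing[OF G oL] and rM = M.realize_typing[OF G oM]
  show "over ?D (NMap (vcomp_ntrans ?b ?a) X) (LTp (vcomp_cwa M L) X A) (fo ?H X A) (fo ?F X A) \<and>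
   Cm ?D (realize ?D (NMap (vcomp_ntrans ?b ?a) X) (fo ?H X A) (LTp (vcomp_cwa M L) X A)) (tau ?F X A) =
   Cm ?D (tau ?H X A) (NMap (vcomp_ntrans ?b ?a) (cext ?C X A))"
   unfolding v[OF G] v[OF E] k
  proof (intro conjI)
   show "over ?D (Cm ?D (NMap ?b X) (NMap ?a X)) (Cmp (Tp ?D (Dm ?D (NMap ?a X))) (Rf ?D (NMap ?a X) (LTp M X A)) (LTp L X A)) (fo ?H X A) (fo ?F X A)"
    by (rule over_Cmp[OF L.D_cw oL oM d(1)])
   show "Cm ?D (realize ?D (Cm ?D (NMap ?b X) (NMap ?a X)) (fo ?H X A) (Cmp (Tp ?D (Dm ?D (NMap ?a X))) (Rf ?D (NMap ?a X) (LTp M X A)) (LTp L X A))) (tau ?F X A) =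
    Cm ?D (tau ?H X A) (Cm ?D (NMap ?b (cext ?C X A)) (NMap ?a (cext ?C X A)))"
    unfolding realize_Cmp[OF L.D_cw oL oM d(1)]
    using rL rM G A E L.cell_realize[OF G A] Cmp_reassoc[OF M.cell_realize[OF G A], of "NMap ?a (cext ?C X A)"] by simp
  qed
 qed
qed

text \<open>Beyond the two compatibility squares this uses naturality of the second transformation
  at \<open>tau\<close> of the first source, and naturality of \<open>tau\<close> of the second
  target at the component of the first cell.\<close>

lemma cw_cell_hcomp:
 assumes L: "cw_cell L" and M: "cw_cell M" and e: "HSrc (LSrc M) = HTrg (LSrc L)"
 shows "cw_cell (hcomp_cwa M L)"
proof -
 let ?C = "HSrc (LSrc L)" and ?D = "HTrg (LSrc L)" and ?E = "HTrg (LSrc M)" and ?F = "LSrc L" and ?G = "LTrg L" and ?H = "LSrc M" and ?K = "LTrg M"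
 let ?a = "LNat L" and ?b = "LNat M"
 interpret L: cwa_cell_data ?F ?G ?C ?D "HFun ?F" "HFun ?G" ?a L by (rule cw_cell_data[OF L])
 interpret M: cwa_cell_data ?H ?K ?D ?E "HFun ?H" "HFun ?K" ?b M by (rule cw_cell_data[OF M, unfolded e])
 interpret HF: composable_cwa ?F ?H ?C ?D ?E "HFun ?F" "HFun ?H" by unfold_locales
 interpret KG: composable_cwa ?G ?K ?C ?D ?E "HFun ?G" "HFun ?K" by unfold_locales
 have s: "LSrc (hcomp_cwa M L) = comp_cwa ?H ?F" "LTrg (hcomp_cwa M L) = comp_cwa ?K ?G" "LNat (hcomp_cwa M L) = hcomp_ntrans ?b ?a"
  by (rule cell_simps)+
 show ?thesis
 proof (rule cw_cellI, unfold s HF.comp_simps(1-3) KG.comp_simps(1-3))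
  show "cell_ntrans (comp_cwa ?H ?F) (comp_cwa ?K ?G) (hcomp_ntrans ?b ?a)"
   unfolding cell_ntrans_def using HF.cw_mor_comp KG.cw_mor_comp cw_cell_typing(3,4)[OF L] cw_cell_typing(3,4)[OF M] by (simp add: HF.comp_simps KG.comp_simps)
  show "LTp (hcomp_cwa M L) \<in> extensional (Ctx ?C)"
   "X \<in> Ctx ?C ==> LTp (hcomp_cwa M L) X \<in> extensional (Ob (Tp ?C X))" for X
   by (simp_all add: hcomp_cwa_def Let_def)
  fix X A assume G: "X \<in> Ctx ?C" and A: "A \<in> Ob (Tp ?C X)"
  let ?Y = "FOb (HFun ?F) X" and ?B = "fo ?F X A" and ?Z = "cext ?C X A"
  have E: "?Z \<in> Ctx ?C" "?Y \<in> Ctx ?D" "?B \<in> Ob (Tp ?D ?Y)" using G A by simp_all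
  have E': "cext ?D ?Y ?B \<in> Ctx ?D" "FOb (HFun ?F) ?Z \<in> Ctx ?D" "FOb (HFun ?G) X \<in> Ctx ?D"
   "fo ?G X A \<in> Ob (Tp ?D (FOb (HFun ?G) X))" using E G A by simp_all
  note oL = L.cell_over[OF G A] and oM = M.cell_over[OF E(2,3)]
  have aG: "NMap ?a X \<in> Sub ?D" "Dm ?D (NMap ?a X) = ?Y" "Cd ?D (NMap ?a X) = FOb (HFun ?G) X" using G by simp_all
  note oK = M.G.over_fa[OF oL, unfolded aG]
  have d: "Dm ?E (FAr (HFun ?K) (NMap ?a X)) = Cd ?E (NMap ?b ?Y)" "Dm ?E (NMap ?b ?Y) = FOb (HFun ?H) ?Y"
   using E aG by simp_all
  have k: "LTp (hcomp_cwa M L) X A = Cmp (Tp ?E (Dm ?E (NMap ?b ?Y)))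
   (Rf ?E (NMap ?b ?Y) (fa ?K ?Y (LTp L X A))) (LTp M ?Y ?B)"
   using G A d by (simp add: hcomp_cwa_def Let_def)
  have v: "NMap (hcomp_ntrans ?b ?a) x = Cm ?E (FAr (HFun ?K) (NMap ?a x)) (NMap ?b (FOb (HFun ?F) x))" if "x \<in> Ctx ?C" for x using that by simp
  define l where "l = realize ?D (NMap ?a X) (fo ?G X A) (LTp L X A)"
  define Kl where "Kl = realize ?E (FAr (HFun ?K) (NMap ?a X)) (fo ?K (FOb (HFun ?G) X) (fo ?G X A)) (fa ?K ?Y (LTp L X A))"
  define m where "m = realize ?E (NMap ?b ?Y) (fo ?K ?Y ?B) (LTp M ?Y ?B)"
  note l = L.realize_typing[OF G oL, folded l_def] and m = M.realize_typing[OF E(2) oM, folded m_def]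
  have Kl: "Kl \<in> Sub ?E" "Dm ?E Kl = cext ?E (FOb (HFun ?K) ?Y) (fo ?K ?Y ?B)"
   "Cm ?E (tau ?K (FOb (HFun ?G) X) (fo ?G X A)) (FAr (HFun ?K) l) = Cm ?E Kl (tau ?K ?Y ?B)"
   using realize_Ar[OF M.D_cw oK] Dom_realize[OF M.D_cw oK] M.G.tau_natural[OF oL] aG unfolding Kl_def l_def by (simp_all del: realize_Idn)
  let ?b1 = "NMap ?b (cext ?D ?Y ?B)" and ?b2 = "NMap ?b (FOb (HFun ?F) ?Z)"
  have bt: "Cm ?E ?b1 (FAr (HFun ?H) (tau ?F X A)) = Cm ?E (FAr (HFun ?K) (tau ?F X A)) ?b2"
   by (rule M.al_nat) (use G A in simp_all)
  have mt: "Cm ?E m (tau ?H ?Y ?B) = Cm ?E (tau ?K ?Y ?B) ?b1"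
   using M.cell_realize[OF E(2,3)] unfolding m_def .
  have lt: "Cm ?D l (tau ?F X A) = Cm ?D (tau ?G X A) (NMap ?a ?Z)"
   using L.cell_realize[OF G A] unfolding l_def .
  have "Cm ?E (Cm ?E Kl m) (Cm ?E (tau ?H ?Y ?B) (FAr (HFun ?H) (tau ?F X A))) =
   Cm ?E Kl (Cm ?E m (Cm ?E (tau ?H ?Y ?B) (FAr (HFun ?H) (tau ?F X A))))"
   using G A E E' Kl m by simp
  also have "\<dots> = Cm ?E Kl (Cm ?E (tau ?K ?Y ?B) (Cm ?E ?b1 (FAr (HFun ?H) (tau ?F X A))))"
   by (rule arg_cong[where f = "Cm ?E Kl"], rule Cmp_reassoc[OF mt]) (use G A E E' m in simp_all)
  also have "\<dots> = Cm ?E (tau ?K (FOb (HFun ?G) X) (fo ?G X A)) (Cm ?E (FAr (HFun ?K) l) (Cm ?E (FAr (HFun ?K) (tau ?F X A)) ?b2))"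
   unfolding bt by (rule Cmp_reassoc[OF Kl(3)[symmetric]]) (use G A E E' Kl l in simp_all)
  also have "Cm ?E (FAr (HFun ?K) l) (Cm ?E (FAr (HFun ?K) (tau ?F X A)) ?b2) =
   Cm ?E (FAr (HFun ?K) (Cm ?D l (tau ?F X A))) ?b2"
   using G A E E' l by simp
  also have "\<dots> = Cm ?E (FAr (HFun ?K) (tau ?G X A)) (Cm ?E (FAr (HFun ?K) (NMap ?a ?Z)) ?b2)"
   unfolding lt using G A E E' by simp
  finally have fin: "Cm ?E (Cm ?E Kl m) (Cm ?E (tau ?H ?Y ?B) (FAr (HFun ?H) (tau ?F X A))) =
   Cm ?E (Cm ?E (tau ?K (FOb (HFun ?G) X) (fo ?G X A)) (FAr (HFun ?K) (tau ?G X A))) (Cm ?E (FAr (HFun ?K) (NMap ?a ?Z)) ?b2)"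
   using G A E E' by simp
  show "over ?E (NMap (hcomp_ntrans ?b ?a) X) (LTp (hcomp_cwa M L) X A) (fo (comp_cwa ?K ?G) X A) (fo (comp_cwa ?H ?F) X A) \<and>
   Cm ?E (realize ?E (NMap (hcomp_ntrans ?b ?a) X) (fo (comp_cwa ?K ?G) X A) (LTp (hcomp_cwa M L) X A)) (tau (comp_cwa ?H ?F) X A) =
   Cm ?E (tau (comp_cwa ?K ?G) X A) (NMap (hcomp_ntrans ?b ?a) ?Z)"
   unfolding v[OF G] v[OF E(1)] k KG.comp_simps(4)[OF G A] HF.comp_simps(4)[OF G A] KG.comp_tau[OF G A] HF.comp_tau[OF G A]
  proof (intro conjI)
   show "over ?E (Cm ?E (FAr (HFun ?K) (NMap ?a X)) (NMap ?b ?Y)) (Cmp (Tp ?E (Dm ?E (NMap ?b ?Y)))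
    (Rf ?E (NMap ?b ?Y) (fa ?K ?Y (LTp L X A))) (LTp M ?Y ?B)) (fo ?K (FOb (HFun ?G) X) (fo ?G X A)) (fo ?H ?Y ?B)"
    by (rule over_Cmp[OF M.D_cw oM oK d(1)])
  qed (unfold realize_Cmp[OF M.D_cw oM oK d(1)], use fin in \<open>simp only: Kl_def m_def\<close>)
 qed
qed

lemma CwA_simps [simp]:
 "Zero (CwA small) = {C. cwa small C}" "One (CwA small) = {F. cwa_mor small F}" "Two (CwA small) = {L. cwa_cell small L}"
 "Src1 (CwA small) = HSrc" "Trg1 (CwA small) = HTrg" "Src2 (CwA small) = LSrc" "Trg2 (CwA small) = LTrg"
 "Id1 (CwA small) = id_cwa" "Id2 (CwA small) = id_cwa_cell" "Cmp1 (CwA small) = comp_cwa"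
 "VCmp (CwA small) = vcomp_cwa" "HCmp (CwA small) = hcomp_cwa"
 by (simp_all add: CwA_def)

lemma cw_mor_functor:
 assumes "cw_mor F"
 shows "functor (HFun F)" "FDom (HFun F) = WCat (HSrc F)" "FCod (HFun F) = WCat (HTrg F)" "cw (HSrc F)" "cw (HTrg F)"
proof -
 interpret cwa_morphism F "HSrc F" "HTrg F" "HFun F" by (rule cw_mor_morphism[OF assms])
 show "functor (HFun F)" "FDom (HFun F) = WCat (HSrc F)" "FCod (HFun F) = WCat (HTrg F)" "cw (HSrc F)" "cw (HTrg F)" by simp_all
qed

lemma cw_mor_comp: "cw_mor F ==> cw_mor G ==> HSrc G = HTrg F ==> cw_mor (comp_cwa G F)"
 using composable_cwa.cw_mor_comp[of F G] composable_cwa_iff[of F G] by metis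

lemma cell2_iff: "L \<in> cells2 (CwA small) F G \<longleftrightarrow> cw_cell L \<and> cwa_mor small F \<and> LSrc L = F \<and> LTrg L = G"
 by (auto simp: cells2_iff cwa_cell_iff[of small])

lemma cell1_iff: "F \<in> cells1 (CwA small) C D \<longleftrightarrow> cw_mor F \<and> cwa small C \<and> cwa small D \<and> HSrc F = C \<and> HTrg F = D"
 by (auto simp: cells1_iff cwa_mor_iff[of small])

text \<open>By \<open>cw_cell_eqI\<close> a 2-cell is known from its ends and its underlying
  transformation, so every law for 2-cells is the corresponding law of \<open>Cat\<close>; the laws
  for 1-cells are \<open>comp_cwa_id\<close> and \<open>comp_cwa_assoc\<close>.\<close>

lemma CwA_2cat: "strict_two_category (CwA small)"
proof -
 let ?T = "\<lambda>_. True"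
 have cwD: "cwa small C ==> cw C" for C :: "'a cwa" by (simp add: cwa_iff[of small])
 \<comment> \<open>With every set counted as small, the laws of \<open>Cat\<close> cover all
   underlying functors and transformations.\<close>
 interpret Cat: strict_two_category "Cat ?T" by (rule Cat_2cat)
 note ty = cw_cell_typing cw_mor_functor
 show ?thesis
 proof (rule strict_two_category.intro)
  show "Src1 (CwA small) f \<in> Zero (CwA small)" "Trg1 (CwA small) f \<in> Zero (CwA small)" if "f \<in> One (CwA small)" for f
   using that by (simp_all add: cwa_mor_iff[of small])
  show "Id1 (CwA small) A \<in> cells1 (CwA small) A A" if "A \<in> Zero (CwA small)" for A
   using that cw_mor_id[OF cwD] by (simp add: cell1_iff)
  show "Cmp1 (CwA small) g f \<in> cells1 (CwA small) A C" if "f \<in> cells1 (CwA small) A B" "g \<in> cells1 (CwA small) B C" for f g A B C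
   using that by (auto simp: cell1_iff intro!: cw_mor_comp)
  show "Cmp1 (CwA small) (Id1 (CwA small) B) f = f" "Cmp1 (CwA small) f (Id1 (CwA small) A) = f" if "f \<in> cells1 (CwA small) A B" for f A B
   using that comp_cwa_id by (auto simp: cell1_iff)
  show "Cmp1 (CwA small) h (Cmp1 (CwA small) g f) = Cmp1 (CwA small) (Cmp1 (CwA small) h g) f"
   if "f \<in> cells1 (CwA small) A B" "g \<in> cells1 (CwA small) B C" "h \<in> cells1 (CwA small) C D" for f g h A B C D
   using that comp_cwa_assoc[of f g h] by (simp add: cell1_iff)
  show "\<exists>A B. Src2 (CwA small) a \<in> cells1 (CwA small) A B \<and> Trg2 (CwA small) a \<in> cells1 (CwA small) A B"
   if "a \<in> Two (CwA small)" for a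
   using that ty by (auto simp: cell1_iff cwa_cell_iff[of small] cwa_mor_iff[of small])
  show "category (Hom (CwA small) A B)" for A B
  proof (rule Hom_categoryI)
   show "Id2 (CwA small) f \<in> cells2 (CwA small) f f" if "f \<in> cells1 (CwA small) A B" for f
    using that cw_cell_id by (auto simp: cell1_iff cell2_iff cwa_mor_iff[of small])
   show "VCmp (CwA small) b a \<in> cells2 (CwA small) f h" if "a \<in> cells2 (CwA small) f g" "b \<in> cells2 (CwA small) g h" for a b f g h
    using that by (auto simp: cell2_iff intro!: cw_cell_vcomp)
   show "VCmp (CwA small) (Id2 (CwA small) g) a = a" if "a \<in> cells2 (CwA small) f g" for a f g
   proof -
    have a: "cw_cell a" "LTrg a = g" using that by (simp_all add: cell2_iff)
    note t = ty(1-7)[OF a(1)] ty(8-12)[OF ty(1)[OF a(1)]] ty(8-12)[OF ty(2)[OF a(1)]]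
    show ?thesis using a t Cat.VCmp_Id_l[of "LNat a"] ty(8)[of g]
     by - (rule cw_cell_eqI, simp_all add: cw_cell_vcomp cw_cell_id small_category_def)
   qed
   show "VCmp (CwA small) a (Id2 (CwA small) f) = a" if "a \<in> cells2 (CwA small) f g" for a f g
   proof -
    have a: "cw_cell a" "LSrc a = f" using that by (simp_all add: cell2_iff)
    note t = ty(1-7)[OF a(1)] ty(8-12)[OF ty(1)[OF a(1)]] ty(8-12)[OF ty(2)[OF a(1)]]
    show ?thesis using a t Cat.VCmp_Id_r[of "LNat a"]
     by - (rule cw_cell_eqI, simp_all add: cw_cell_vcomp cw_cell_id small_category_def)
   qed
   show "VCmp (CwA small) c (VCmp (CwA small) b a) = VCmp (CwA small) (VCmp (CwA small) c b) a"
    if "a \<in> cells2 (CwA small) f g" "b \<in> cells2 (CwA small) g h" "c \<in> cells2 (CwA small) h k" for a b c f g h k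
   proof -
    have a: "cw_cell a" "cw_cell b" "cw_cell c" "LTrg a = LSrc b" "LTrg b = LSrc c" using that by (simp_all add: cell2_iff)
    note t = ty(5-7)[OF a(1)] ty(5-7)[OF a(2)] ty(5-7)[OF a(3)] ty(8-12)[OF ty(1)[OF a(1)]]
      ty(8-12)[OF ty(1)[OF a(2)]] ty(8-12)[OF ty(1)[OF a(3)]]
    show ?thesis using a t Cat.VCmp_assoc[of "LNat a" "LNat b" "LNat c"]
     by - (rule cw_cell_eqI, simp_all add: cw_cell_vcomp small_category_def ty)
   qed
  qed
  fix A B and a :: "'a cwa_cell" assume a: "a \<in> Ar (Hom (CwA small) A B)"
  have ca: "cw_cell a" "HSrc (LSrc a) = A" "HTrg (LSrc a) = B" "cwa small A" "cwa small B"
   using a by (simp_all add: Hom_simps cell1_iff cwa_cell_iff[of small])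
  note ta = ty(1-7)[OF ca(1)] ty(8-12)[OF ty(1)[OF ca(1)]] ty(8-12)[OF ty(2)[OF ca(1)]]
  show "HCmp (CwA small) (Id2 (CwA small) (Id1 (CwA small) B)) a = a"
   using ca ta Cat.HCmp_Id_l[of "LNat a" "WCat B"] comp_cwa_id[of "LSrc a"] comp_cwa_id[of "LTrg a"] cw_mor_id[OF cwD]
   by - (rule cw_cell_eqI, simp_all add: cw_cell_hcomp cw_cell_id small_category_def)
  show "HCmp (CwA small) a (Id2 (CwA small) (Id1 (CwA small) A)) = a"
   using ca ta Cat.HCmp_Id_r[of "LNat a" "WCat A"] comp_cwa_id[of "LSrc a"] comp_cwa_id[of "LTrg a"] cw_mor_id[OF cwD]
   by - (rule cw_cell_eqI, simp_all add: cw_cell_hcomp cw_cell_id small_category_def)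
  fix C and b :: "'a cwa_cell" assume b: "b \<in> Ar (Hom (CwA small) B C)"
  have cb: "cw_cell b" "HSrc (LSrc b) = B" "HTrg (LSrc b) = C" "cwa small C"
   using b by (simp_all add: Hom_simps cell1_iff cwa_cell_iff[of small])
  note tb = ty(1-7)[OF cb(1)] ty(8-12)[OF ty(1)[OF cb(1)]] ty(8-12)[OF ty(2)[OF cb(1)]]
  show "HCmp (CwA small) b a \<in> cells2 (CwA small) (Cmp1 (CwA small) (Src2 (CwA small) b) (Src2 (CwA small) a))
    (Cmp1 (CwA small) (Trg2 (CwA small) b) (Trg2 (CwA small) a))"
   using ca cb ta tb by (simp add: cell2_iff cw_cell_hcomp cwa_mor_iff[of small] cw_mor_comp)
  fix D and c :: "'a cwa_cell" assume c: "c \<in> Ar (Hom (CwA small) C D)"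
  have cc: "cw_cell c" "HSrc (LSrc c) = C" "HTrg (LSrc c) = D"
   using c by (simp_all add: Hom_simps cell1_iff cwa_cell_iff[of small])
  note tc = ty(1-7)[OF cc(1)] ty(8-12)[OF ty(1)[OF cc(1)]] ty(8-12)[OF ty(2)[OF cc(1)]]
  show "HCmp (CwA small) c (HCmp (CwA small) b a) = HCmp (CwA small) (HCmp (CwA small) c b) a"
   using ca cb cc ta tb tc hcomp_ntrans_assoc[of "LNat a" "LNat b" "LNat c"]
   by - (rule cw_cell_eqI, simp_all add: cw_cell_hcomp comp_cwa_assoc)
 next
  show "HCmp (CwA small) (Id2 (CwA small) g) (Id2 (CwA small) f) = Id2 (CwA small) (Cmp1 (CwA small) g f)"
   if "f \<in> cells1 (CwA small) A B" "g \<in> cells1 (CwA small) B C" for f g A B C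
  proof -
   have f: "cw_mor f" "cw_mor g" "HSrc g = HTrg f" using that by (simp_all add: cell1_iff)
   show ?thesis using f ty(8-12)[OF f(1)] ty(8-12)[OF f(2)] Cat.HCmp_Id2'[of "HFun f" "HFun g"]
    by - (rule cw_cell_eqI, simp_all add: cw_cell_hcomp cw_cell_id cw_mor_comp small_category_def FDom_category' FCod_category')
  qed
  show "HCmp (CwA small) (VCmp (CwA small) b' b) (VCmp (CwA small) a' a) =
   VCmp (CwA small) (HCmp (CwA small) b' a') (HCmp (CwA small) b a)"
   if "composable (Hom (CwA small) A B) a' a" "composable (Hom (CwA small) B C) b' b" for a a' b b' A B C
  proof -
   have c: "cw_cell a" "cw_cell a'" "cw_cell b" "cw_cell b'" "LSrc a' = LTrg a" "LSrc b' = LTrg b" "HTrg (LSrc a) = HSrc (LSrc b)"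
    using Hom_composableD[OF that(1)] Hom_composableD[OF that(2)] by (auto simp: Hom_simps cell1_iff cwa_cell_iff[of small])
   note t = ty(1-7)[OF c(1)] ty(1-7)[OF c(2)] ty(1-7)[OF c(3)] ty(1-7)[OF c(4)]
   show ?thesis using c t ty(8-12)[OF ty(1)[OF c(1)]] ty(8-12)[OF ty(1)[OF c(3)]]
     interchange_ntrans[of "LNat a" "LNat a'" "LNat b" "LNat b'"]
    by - (rule cw_cell_eqI, simp_all add: cw_cell_hcomp cw_cell_vcomp)
  qed
 qed
qed

lemma CwA_forget_simps [simp]: "P0 CwA_forget = WCat" "P1 CwA_forget = HFun" "P2 CwA_forget = LNat"
 by (simp_all add: CwA_forget_def)

lemma cwa_small_category: "cwa small C ==> small_category small (WCat C)"
 unfolding cwa_def by blast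

lemma CwA_forget_functor: "strict_two_functor (CwA small) (Cat small) CwA_forget"
proof (rule strict_two_functor.intro[OF CwA_2cat Cat_2cat])
 have c1: "HFun f \<in> cells1 (Cat small) (WCat A) (WCat B)" if "f \<in> cells1 (CwA small) A B" for f A B
  using that cw_mor_functor[of f] by (simp add: cell1_iff) (auto simp: cells1_iff cwa_small_category)
 have c2: "LNat a \<in> cells2 (Cat small) (HFun f) (HFun g)" if "a \<in> cells2 (CwA small) f g" for a f g
  using that cw_cell_typing[of a] cw_mor_functor[of f] by (simp add: cell2_iff) (auto simp: cells2_iff cwa_small_category cwa_mor_iff[of small])
 show "P0 CwA_forget A \<in> Zero (Cat small)" if "A \<in> Zero (CwA small)" for A using that by (simp add: cwa_small_category)
 show "P1 CwA_forget f \<in> cells1 (Cat small) (P0 CwA_forget A) (P0 CwA_forget B)" if "f \<in> cells1 (CwA small) A B" for f A B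
  using c1[OF that] by simp
 show "P2 CwA_forget a \<in> cells2 (Cat small) (P1 CwA_forget f) (P1 CwA_forget g)" if "a \<in> cells2 (CwA small) f g" for a f g
  using c2[OF that] by simp
qed simp_all

section \<open>Constructing categories with attributes\<close>

text \<open>Prescribing identities as structural isomorphisms leaves functoriality of reindexing as
  the only substantial condition.\<close>

lemma strict_icatI:
 assumes B: "IBase P = B" "category B" and ext: "IFib P \<in> extensional (Ob B)" "IRe P \<in> extensional (Ar B)"
  and fib: "\<And>a. a \<in> Ob B ==> category (IFib P a)"
  and re: "\<And>u. u \<in> Ar B ==> functor (IRe P u)" "\<And>u. u \<in> Ar B ==> FDom (IRe P u) = IFib P (Cod B u)"
   "\<And>u. u \<in> Ar B ==> FCod (IRe P u) = IFib P (Dom B u)"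
  and id: "\<And>a. a \<in> Ob B ==> IRe P (Idn B a) = id_func (IFib P a)"
  and comp: "\<And>u v. u \<in> Ar B ==> v \<in> Ar B ==> Dom B u = Cod B v ==> IRe P (Cmp B u v) = comp_func (IRe P v) (IRe P u)"
  and U: "IUnit P = (\<lambda>a\<in>Ob B. \<lambda>x\<in>Ob (IFib P a). Idn (IFib P a) x)"
  and M: "IMult P = (\<lambda>u v. if composable B u v then \<lambda>x\<in>Ob (IFib P (Cod B u)).
   Idn (IFib P (Dom B v)) (FOb (IRe P v) (FOb (IRe P u) x)) else undefined)"
 shows "strict_indexed_category P"
proof -
 have idn: "nat_iso F F t" if "functor F" "t = (\<lambda>x\<in>Ob (FDom F). Idn (FCod F) (FOb F x))" for F :: "('c, 'd, 'c, 'd) func" and t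
  using that by (intro nat_isoI nat_transI) simp_all
 have co: "composable B u v \<longleftrightarrow> u \<in> Ar B \<and> v \<in> Ar B \<and> Dom B u = Cod B v" for u v by (auto simp: composable_def)
 have mu: "IMult P u v x = Idn (IFib P (Dom B v)) (FOb (IRe P v) (FOb (IRe P u) x))"
  if "u \<in> Ar B" "v \<in> Ar B" "Dom B u = Cod B v" "x \<in> Ob (IFib P (Cod B u))" for u v x
  using that by (simp add: M)
 show ?thesis
 proof (intro strict_indexed_category.intro indexed_category.intro strict_indexed_category_axioms.intro, unfold B(1))
  show "nat_iso (id_func (IFib P a)) (IRe P (Idn B a)) (IUnit P a)" if "a \<in> Ob B" for a
   using that fib id by (simp add: U) (rule idn, auto)
  show "nat_iso (comp_func (IRe P v) (IRe P u)) (IRe P (Cmp B u v)) (IMult P u v)" if "composable B u v" for u v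
   unfolding comp[OF that[unfolded co, THEN conjunct1] that[unfolded co, THEN conjunct2, THEN conjunct1] that[unfolded co, THEN conjunct2, THEN conjunct2]]
   using that re by (intro idn) (auto simp: co M intro!: functor_comp restrict_ext)
 qed (use B(2) ext fib re id comp in \<open>auto simp: co hom_iff functors_iff U mu M\<close>)
qed

text \<open>Comprehension assembled from fibre functors \<open>G\<close> and upper sides
  \<open>Q\<close>; its structural isomorphisms are defined as the comparison maps from the chosen
  pullbacks to the squares of \<open>Q\<close>.\<close>

definition family_ifun :: "('o, 'a) dcat => ('o, 'a, 'x, 'y) icat => ('o => ('x, 'y, 'a, 'a \<times> 'a \<times> 'a) func) =>
  ('a => 'x => 'a) => ('o, 'a, 'x, 'y, 'a, 'a \<times> 'a \<times> 'a) ifun" where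
 "family_ifun D P G Q = (let C = DCat D in \<lparr>XDom = P, XCod = disp_icat D, XFun = restrict G (Ob C),
  XRho = (\<lambda>u\<in>Ar C. \<lambda>x\<in>Ob (IFib P (Cod C u)).
   (let p = FOb (G (Cod C u)) x; p' = FOb (G (Dom C u)) (FOb (IRe P u) x) in
    (Pb1 D u p, THE h. h \<in> Ar C \<and> Dom C h = Dom C (Pb1 D u p) \<and> Cod C h = Dom C p' \<and>
     Cmp C p' h = Pb1 D u p \<and> Cmp C (Q u x) h = Pb2 D u p, p')))\<rparr>)"

text \<open>The assumptions on \<open>Q\<close> form a cartesian family over the identity functor,
  so \<open>disp_valuedI\<close> supplies all coherence. The second conclusion identifies the
  derived \<open>cart\<close>, which makes realization in the new CwA computable.\<close>

lemma cwaI: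
 fixes W :: "'u cwa"
 assumes D: "display_category (WDisp W)" and P: "strict_indexed_category (WTp W)" "IBase (WTp W) = WCat W"
  and W: "WComp W = family_ifun (WDisp W) (WTp W) G Q"
  and G: "\<And>a. a \<in> Ctx W ==> equivalence_functor (G a)" "\<And>a. a \<in> Ctx W ==> FDom (G a) = Tp W a"
   "\<And>a. a \<in> Ctx W ==> FCod (G a) = disp_slice (WDisp W) a"
  and pb: "\<And>u x. u \<in> Sub W ==> x \<in> Ob (Tp W (Cd W u)) ==>
   is_pullback (WCat W) u (FOb (G (Cd W u)) x) (FOb (G (Dm W u)) (Re W u x)) (Q u x)"
  and nat: "\<And>u f. u \<in> Sub W ==> f \<in> Ar (Tp W (Cd W u)) ==>
   Cm W (Q u (Cod (Tp W (Cd W u)) f)) (fst (snd (FAr (G (Dm W u)) (Rf W u f)))) =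
   Cm W (fst (snd (FAr (G (Cd W u)) f))) (Q u (Dom (Tp W (Cd W u)) f))"
  and Idn: "\<And>a x. a \<in> Ctx W ==> x \<in> Ob (Tp W a) ==> Q (Idn (WCat W) a) x = Idn (WCat W) (Dm W (FOb (G a) x))"
  and Cmp: "\<And>u v x. u \<in> Sub W ==> v \<in> Sub W ==> Dm W u = Cd W v ==>
   x \<in> Ob (Tp W (Cd W u)) ==> Q (Cm W u v) x = Cm W (Q u x) (Q v (Re W u x))"
 shows "cw W" and "u \<in> Sub W ==> A \<in> Ob (Tp W (Cd W u)) ==> cart W u A = Q u A"
proof -
 interpret display_category "WDisp W" by (rule D)
 have cat [simp]: "category (WCat W)" by (rule DCat_category)
 have w: "XDom (WComp W) = WTp W" "XCod (WComp W) = disp_icat (WDisp W)"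
  and XF [simp]: "\<And>a. a \<in> Ctx W ==> XFun (WComp W) a = G a"
  and Xe: "XFun (WComp W) \<in> extensional (Ctx W)" "XRho (WComp W) \<in> extensional (Sub W)"
   "\<And>u. u \<in> Sub W ==> XRho (WComp W) u \<in> extensional (Ob (Tp W (Cd W u)))"
  by (simp_all add: W family_ifun_def Let_def)
 have Gf [simp]: "\<And>a. a \<in> Ctx W ==> functor (G a)" using G(1) by (simp add: equivalence_functor_def)
 have c: "pull_icat (id_func (WCat W)) (disp_icat (WDisp W)) = disp_icat (WDisp W)" by (rule pull_id[OF disp_indexed]) simp
 interpret v: disp_valued "WDisp W" "WTp W" "id_func (WCat W)" "WComp W"
  by (intro disp_valued.intro disp_valued_axioms.intro) (use D P w c G in simp_all)
 have Gp: "FOb (G a) x \<in> Disp (WDisp W)" "Cd W (FOb (G a) x) = a" if "a \<in> Ctx W" "x \<in> Ob (Tp W a)" for a x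
  using v.pr[of a x] that P(2) by simp_all
 have "v.cartesian_family Q"
  unfolding v.cartesian_family_def P(2) using pb nat Idn Cmp strict_re(1,2,3)[OF P(1), unfolded P(2)] by simp
 moreover have R: "v.comparison_family Q"
  unfolding v.comparison_family_def P(2)
 proof (intro allI impI)
  fix u x assume u: "u \<in> Sub W" and x: "x \<in> Ob (Tp W (Cd W u))"
  let ?p = "FOb (G (Cd W u)) x" and ?p' = "FOb (G (Dm W u)) (Re W u x)"
  let ?h = "\<lambda>h. h \<in> Sub W \<and> Dm W h = Dm W (Pb1 (WDisp W) u ?p) \<and> Cd W h = Dm W ?p' \<and>
   Cm W ?p' h = Pb1 (WDisp W) u ?p \<and> Cm W (Q u x) h = Pb2 (WDisp W) u ?p"
  have x': "Re W u x \<in> Ob (Tp W (Dm W u))"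
   using u x strict_re(1,2,3)[OF P(1), unfolded P(2)] by simp
  note g = Gp[OF _ x] Gp[OF _ x']
  have "\<exists>!h. ?h h"
   using pb_ex1[OF pb[OF u x], of "Pb1 (WDisp W) u ?p" "Pb2 (WDisp W) u ?p"] u g by (simp add: hom_iff conj_assoc)
  from theI'[OF this] have h: "?h (The ?h)" .
  have "XRho (WComp W) u x = (Pb1 (WDisp W) u ?p, The ?h, ?p')" using u x by (simp add: W family_ifun_def Let_def)
  then show "XRho (WComp W) u x \<in> Ar (disp_slice (WDisp W) (FOb (id_func (WCat W)) (Dm W u))) \<and>
   fst (XRho (WComp W) u x) = Pb1 (WDisp W) (FAr (id_func (WCat W)) u) (FOb (XFun (WComp W) (Cd W u)) x) \<and>
   snd (snd (XRho (WComp W) u x)) = FOb (XFun (WComp W) (Dm W u)) (Re W u x) \<and>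
   Cm W (Q u x) (mid (XRho (WComp W) u x)) = Pb2 (WDisp W) (FAr (id_func (WCat W)) u) (FOb (XFun (WComp W) (Cd W u)) x)"
   using h u g by (simp add: slice_Ar)
 qed
 ultimately have I: "indexed_functor (WComp W)" using v.disp_valuedI Xe P(2) by metis
 show cw: "cw W"
  unfolding cwa_def indexed_equivalence_def small_category_def XBase_def w using D P I G w by simp
 show "cart W u A = Q u A" if u: "u \<in> Sub W" "A \<in> Ob (Tp W (Cd W u))"
 proof -
  have q: "Q u A \<in> Sub W" "Dm W (Q u A) = Dm W (FOb (G (Dm W u)) (Re W u A))"
   using pb_Ar(4)[OF _ pb[OF u]] pb_ends(3)[OF _ pb[OF u]] by simp_all
  have "Cm W (Q u A) (mid (XRho (WComp W) u A)) = Pb2 (WDisp W) u (proj W (Cd W u) A)"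
   using R[unfolded v.comparison_family_def P(2)] u by (simp add: proj_def)
  then have "cart W u A = Cm W (Cm W (Q u A) (mid (XRho (WComp W) u A))) (inv_arrow (WCat W) (mid (XRho (WComp W) u A)))"
   by (simp add: cart_def)
  also have "\<dots> = Q u A" using q u v.rho_iso[OF I, unfolded P(2), OF u] v.rho_mid[OF I, unfolded P(2), OF u] by simp
  finally show ?thesis .
 qed
qed

section \<open>The display category of coalgebras\<close>

text \<open>Only the underlying comonad and the fact that its functor preserves displays and their pullbacks enter
 the construction; the action on types is determined up to the equivalence with displays.\<close>

locale coalg_cwa =
 fixes small :: "'u set => bool" and pair T M
 assumes cc: "cat_comonad small pair T" and MOb: "MOb T = WCat M" and M [simp]: "cw M"
  and disp: "display_functor (WDisp M) (WDisp M) (MEnd T)"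
begin

sublocale cat_comonad small pair T rewrites "MOb T = WCat M" by (rule cc) (rule MOb)
sublocale D: display_category "WDisp M" by (rule cw_disp) simp
sublocale E: display_functor "WDisp M" "WDisp M" E by (rule disp)

abbreviation cmp (infixr "\<cdot>" 70) where "g \<cdot> f \<equiv> Cm M g f"
abbreviation dm where "dm \<equiv> Dm M"
abbreviation cd where "cd \<equiv> Cd M"
abbreviation A1 where "A1 \<equiv> Sub M"
abbreviation idn where "idn \<equiv> Idn (WCat M)"
abbreviation e where "e f \<equiv> FAr E f"
abbreviation cmap where "cmap x f y \<equiv> mk x f y \<in> Ar X"

section \<open>Coalgebra maps, and pullbacks of coalgebras along displays\<close>

lemma X_Cmp_mk [simp]: "cmap y g z ==> cmap x f y ==> Cmp X (mk y g z) (mk x f y) = mk x (g \<cdot> f) z"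
 by (simp add: X_Cmp del: X_mk_Ar)

lemma cmap_comp: "cmap y g z ==> cmap x f y ==> cmap x (g \<cdot> f) z"
 using X_Cmp_Ar[of "mk y g z" "mk x f y"] by (simp del: X_mk_Ar)

lemma cmap_id: "x \<in> Ob X ==> cmap x (idn (und x)) x"
 using Idn_Ar[OF X_category, of x] by (simp add: X_Idn del: X_mk_Ar)

lemma cmap_inv:
 assumes "cmap x i y" "iso_arrow (WCat M) i"
 shows "cmap y (inv_arrow (WCat M) i) x"
proof -
 let ?j = "inv_arrow (WCat M) i"
 have i: "x \<in> Ob X" "y \<in> Ob X" "i \<in> A1" "dm i = und x" "cd i = und y" "str y \<cdot> i = e i \<cdot> str x" using assms by simp_all
 have ei: "iso_arrow (WCat M) (e i)" using assms by simp
 have "str x \<cdot> ?j = e ?j \<cdot> str y"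
 proof (rule iso_cancel_left[of _ "e i"])
  have "e i \<cdot> (str x \<cdot> ?j) = str y \<cdot> (i \<cdot> ?j)"
   by (rule Cmp_reassoc[OF i(6)[symmetric]]) (use i assms in simp_all)
  moreover have "e i \<cdot> (e ?j \<cdot> str y) = e (i \<cdot> ?j) \<cdot> str y"
   using i assms(2) by (subst FAr_Cmp') (simp_all del: inv_right)
  ultimately show "e i \<cdot> (str x \<cdot> ?j) = e i \<cdot> (e ?j \<cdot> str y)" using i assms(2) by simp
 qed (use i assms ei in simp_all)
 then show ?thesis using i assms(2) by simp
qed

lemma eps_simps [simp]:
 "A \<in> Ctx M ==> eps A \<in> A1" "A \<in> Ctx M ==> dm (eps A) = FOb E A" "A \<in> Ctx M ==> cd (eps A) = A"
 "A \<in> Ctx M ==> del A \<in> A1" "A \<in> Ctx M ==> dm (del A) = FOb E A" "A \<in> Ctx M ==> cd (del A) = FOb E (FOb E A)"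
 by simp_all

lemma eps_nat: "f \<in> A1 ==> eps (cd f) \<cdot> e f = f \<cdot> eps (dm f)" and del_nat: "f \<in> A1 ==> del (cd f) \<cdot> e f = e (e f) \<cdot> del (dm f)"
 using ntrans_nat[of "MEps T" f "WCat M" "WCat M"] ntrans_nat[of "MDel T" f "WCat M" "WCat M"] by simp_all

text \<open>The coalgebra structure on the common source of \<open>p\<close> and \<open>f\<close>
  that makes them coalgebra maps to \<open>x\<close> and \<open>y\<close>; the description
  determines it when they are the two projections of a pullback of a display.\<close>

definition lift where
 "lift x y p f = pair (dm p) (THE s. s \<in> A1 \<and> dm s = dm p \<and> cd s = FOb E (dm p) \<and> e p \<cdot> s = str x \<cdot> p \<and> e f \<cdot> s = str y \<cdot> f)"

context
 fixes z x y f p p' f'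
 assumes f: "cmap z f x" and p: "cmap y p x" and d: "p \<in> Disp (WDisp M)" and pb: "is_pullback (WCat M) f p p' f'"
begin

text \<open>The image of a display is again a display, so the functor can be applied twice; the
  second pullback serves coassociativity.\<close>

lemma pbs: "is_pullback (WCat M) (e f) (e p) (e p') (e f')" "is_pullback (WCat M) (e (e f)) (e (e p)) (e (e p')) (e (e f'))"
 using E.F_pullback[OF d pb] E.F_pullback[OF E.F_Disp[OF d] E.F_pullback[OF d pb]] .

lemma fp: "f \<in> A1" "p \<in> A1" "p' \<in> A1" "f' \<in> A1" "dm f = und z" "cd f = und x" "dm p = und y" "cd p = und x"
  "cd p' = und z" "cd f' = und y" "dm f' = dm p'" "f \<cdot> p' = p \<cdot> f'" "z \<in> Ob X" "x \<in> Ob X" "y \<in> Ob X"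
  "str x \<cdot> f = e f \<cdot> str z" "str x \<cdot> p = e p \<cdot> str y"
 using f p pb_Ar[OF _ pb] pb_ends[OF _ pb] pb_comm[OF _ pb] by simp_all

lemma lift_und: "und (lift z y p' f') = dm p'"
 by (simp add: lift_def)

lemma lift_str:
 defines "s \<equiv> str (lift z y p' f')"
 shows "s \<in> A1" "dm s = dm p'" "cd s = FOb E (dm p')" "e p' \<cdot> s = str z \<cdot> p'" "e f' \<cdot> s = str y \<cdot> f'"
proof -
 let ?s = "\<lambda>s. s \<in> A1 \<and> dm s = dm p' \<and> cd s = FOb E (dm p') \<and> e p' \<cdot> s = str z \<cdot> p' \<and> e f' \<cdot> s = str y \<cdot> f'"
 note [simp] = fp
 \<comment> \<open>The structure maps of \<open>z\<close> and \<open>y\<close>, restricted to the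
   apex, agree over the structure map of \<open>x\<close> and so induce an arrow into the image
   pullback.\<close>
 have "e f \<cdot> (str z \<cdot> p') = str x \<cdot> (f \<cdot> p')" by (rule Cmp_reassoc[OF fp(16)[symmetric]]) simp_all
 moreover have "e p \<cdot> (str y \<cdot> f') = str x \<cdot> (p \<cdot> f')" by (rule Cmp_reassoc[OF fp(17)[symmetric]]) simp_all
 ultimately have "\<exists>!s. ?s s"
  using pb_ex1[OF pbs(1), of "str z \<cdot> p'" "str y \<cdot> f'"] by (simp add: hom_iff conj_assoc)
 from theI'[OF this] show "s \<in> A1" "dm s = dm p'" "cd s = FOb E (dm p')" "e p' \<cdot> s = str z \<cdot> p'" "e f' \<cdot> s = str y \<cdot> f'"
  unfolding s_def lift_def by simp_all
qed

text \<open>Each law is tested after two jointly monic arrows, where it reduces to the same law for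
  \<open>z\<close> and for \<open>y\<close>. The counit law lives in the pullback itself,
  coassociativity in its image under the functor applied twice.\<close>

lemma lift_coalg: "coalg (dm p') (str (lift z y p' f'))"
proof -
 define s where "s = str (lift z y p' f')"
 note s [simp] = lift_str[folded s_def]
 note [simp] = fp
 have P: "dm p' \<in> Ctx M" by simp
 have c: "h = k" if "h \<in> A1" "k \<in> A1" "cd h = dm p'" "cd k = dm p'" "dm h = dm k" "p' \<cdot> h = p' \<cdot> k" "f' \<cdot> h = f' \<cdot> k" for h k
  by (rule pb_unique[OF _ pb]) (use that in simp_all)
 \<comment> \<open>Stated for an arbitrary coalgebra map \<open>q\<close> out of the apex, so that
   it serves both projections; \<open>eps\<close> is moved past \<open>q\<close> by
   naturality.\<close>
 have cu: "q \<cdot> (eps (dm p') \<cdot> s) = q" if q: "q \<in> A1" "dm q = dm p'" "cd q = und w" "w \<in> Ob X" "e q \<cdot> s = str w \<cdot> q" for q w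
 proof -
  have "q \<cdot> (eps (dm p') \<cdot> s) = eps (und w) \<cdot> (e q \<cdot> s)"
   by (rule Cmp_reassoc[OF eps_nat[OF q(1), unfolded q, symmetric]]) (use q in simp_all)
  also have "\<dots> = idn (und w) \<cdot> q"
   unfolding q(5) by (rule Cmp_reassoc1[OF X_Ob_simps(5)[OF q(4)]]) (use q in simp_all)
  finally show ?thesis using q by simp
 qed
 have "eps (dm p') \<cdot> s = idn (dm p')"
  by (rule c) (use cu[OF fp(3) refl fp(9,13) s(4)] cu[OF fp(4,11,10,15) s(5)] P in simp_all)
 moreover have ca: "e (e q) \<cdot> (del (dm p') \<cdot> s) = e (e q) \<cdot> (e s \<cdot> s)"
  if q: "q \<in> A1" "dm q = dm p'" "cd q = und w" "w \<in> Ob X" "e q \<cdot> s = str w \<cdot> q" for q w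
 proof -
  have "e (e q) \<cdot> (del (dm p') \<cdot> s) = del (und w) \<cdot> (str w \<cdot> q)"
   unfolding q(5)[symmetric] by (rule Cmp_reassoc[OF del_nat[OF q(1), unfolded q, symmetric]]) (use q in simp_all)
  also have "\<dots> = e (str w) \<cdot> (e q \<cdot> s)"
   unfolding q(5) by (rule Cmp_reassoc[OF X_Ob_simps(6)[OF q(4)]]) (use q in simp_all)
  also have "\<dots> = e (str w \<cdot> q) \<cdot> s" using q(1-4) by simp
  also have "\<dots> = e (e q) \<cdot> (e s \<cdot> s)" unfolding q(5)[symmetric] using q(1-4) by simp
  finally show ?thesis .
 qed
 have "del (dm p') \<cdot> s = e s \<cdot> s"
  by (rule pb_unique[OF _ pbs(2)]) (use ca[OF fp(3) refl fp(9,13) s(4)] ca[OF fp(4,11,10,15) s(5)] P in simp_all)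
 ultimately show ?thesis unfolding coalg_def s_def[symmetric] using P by simp
qed

lemma lift: "cmap (lift z y p' f') p' z" "cmap (lift z y p' f') f' y"
proof -
 have "pair (dm p') (str (lift z y p' f')) = lift z y p' f'" by (simp add: lift_def)
 then have "lift z y p' f' \<in> Ob X" using lift_coalg X_pair_Ob by metis
 then show "cmap (lift z y p' f') p' z" "cmap (lift z y p' f') f' y" using lift_str lift_und fp by simp_all
qed

text \<open>The square that makes \<open>h\<close> a coalgebra map ends in the image pullback, whose
  projections reduce it to the squares of the two composites. This is why the pullback is a pullback
  of coalgebras.\<close>

lemma detect:
 assumes w: "cmap w p' z" "cmap w f' y" and h: "h \<in> A1" "cd h = und w" "cmap v (p' \<cdot> h) z" "cmap v (f' \<cdot> h) y"
 shows "cmap v h w"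
proof -
 note [simp] = fp
 have w': "w \<in> Ob X" "und w = dm p'" "str z \<cdot> p' = e p' \<cdot> str w" "str y \<cdot> f' = e f' \<cdot> str w" using w by simp_all
 have hd: "dm h = und v" "v \<in> Ob X" "str z \<cdot> (p' \<cdot> h) = e (p' \<cdot> h) \<cdot> str v" "str y \<cdot> (f' \<cdot> h) = e (f' \<cdot> h) \<cdot> str v"
  using h w' by simp_all
 have "str w \<cdot> h = e h \<cdot> str v"
 proof (rule pb_unique[OF _ pbs(1)])
  show "e p' \<cdot> (str w \<cdot> h) = e p' \<cdot> (e h \<cdot> str v)"
  proof -
   have "e p' \<cdot> (str w \<cdot> h) = str z \<cdot> (p' \<cdot> h)"
    by (rule Cmp_reassoc[OF w'(3)[symmetric]]) (use h(1,2) w' in simp_all)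
   then show ?thesis using h(1,2) w' hd by simp
  qed
  show "e f' \<cdot> (str w \<cdot> h) = e f' \<cdot> (e h \<cdot> str v)"
  proof -
   have "e f' \<cdot> (str w \<cdot> h) = str y \<cdot> (f' \<cdot> h)"
    by (rule Cmp_reassoc[OF w'(4)[symmetric]]) (use h(1,2) w' in simp_all)
   then show ?thesis using h(1,2) w' hd by simp
  qed
 qed (use h(1,2) w' hd X_Ob_simps[OF w'(1)] in simp_all)
 then show ?thesis using h(1,2) w' hd by simp
qed

text \<open>By \<open>detect\<close> the identity of the apex is a coalgebra map between the two
  structures, hence they are equal. Strictness of reindexing rests on this.\<close>

lemma lift_unique:
 assumes "cmap w p' z" "cmap w f' y"
 shows "w = lift z y p' f'"
proof -
 have W: "w \<in> Ob X" "und w = dm p'" and L: "lift z y p' f' \<in> Ob X" using assms lift by simp_all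
 have "cmap w (idn (dm p')) (lift z y p' f')"
  by (rule detect[OF lift]) (use assms fp lift_und in simp_all)
 then have "str (lift z y p' f') \<cdot> idn (dm p') = e (idn (dm p')) \<cdot> str w" by simp
 then have "str (lift z y p' f') = str w" using X_Ob_simps(1-4)[OF W(1)] lift_str(1,2) W(2) fp(3) by simp
 then show ?thesis using X_Ob_simps(7)[OF W(1)] X_Ob_simps(7)[OF L] lift_und W by metis
qed

lemma X_pullback:
 assumes w: "cmap w p' z" "cmap w f' y"
 shows "is_pullback X (mk z f x) (mk y p x) (mk w p' z) (mk w f' y)"
proof -
 note mk [simp] = f p w X_mk_Dom[OF f] X_mk_Dom[OF p] X_mk_Dom[OF w(1)] X_mk_Dom[OF w(2)]
  X_mk_Cod[OF f] X_mk_Cod[OF p] X_mk_Cod[OF w(1)] X_mk_Cod[OF w(2)] and [simp del] = X_mk_Ar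
 have W: "und w = dm p'" using w by (simp add: X_mk_Ar)
 show ?thesis
 proof (rule pbI)
  show "Cmp X (mk z f x) (mk w p' z) = Cmp X (mk y p x) (mk w f' y)" using fp(12) by simp
  fix g k assume g: "g \<in> Ar X" "k \<in> Ar X" "Cod X g = Dom X (mk z f x)" "Cod X k = Dom X (mk y p x)" "Dom X g = Dom X k"
   "Cmp X (mk z f x) g = Cmp X (mk y p x) k"
  have "f \<cdot> ar g = p \<cdot> ar k" using arg_cong[OF g(6), of ar] g(1-5) by simp
  then obtain h where h: "h \<in> A1" "dm h = dm (ar g)" "cd h = dm p'" "p' \<cdot> h = ar g" "f' \<cdot> h = ar k"
   by - (rule pb_ex[OF _ pb, of "ar g" "ar k"], use g fp in simp_all)
  have gk: "mk (Dom X g) (ar g) z = g" "mk (Dom X g) (ar k) y = k" using g X_mk_eq[of g] X_mk_eq[of k] by simp_all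
  have c: "cmap (Dom X g) h w" by (rule detect[OF w]) (use h g gk W in simp_all)
  show "\<exists>h. h \<in> Ar X \<and> Dom X h = Dom X g \<and> Cod X h = Dom X (mk w p' z) \<and> Cmp X (mk w p' z) h = g \<and> Cmp X (mk w f' y) h = k"
   by (rule exI[of _ "mk (Dom X g) h w"]) (use c h gk in simp)
 next
  fix h k assume h: "h \<in> Ar X" "k \<in> Ar X" "Cod X h = Dom X (mk w p' z)" "Cod X k = Dom X (mk w p' z)" "Dom X h = Dom X k"
   "Cmp X (mk w p' z) h = Cmp X (mk w p' z) k" "Cmp X (mk w f' y) h = Cmp X (mk w f' y) k"
  have "ar h = ar k"
   by (rule pb_unique[OF _ pb]) (use h(1-5) arg_cong[OF h(6), of ar] arg_cong[OF h(7), of ar] W in simp_all)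
  then show "h = k" using h(1-5) by - (rule X_Ar_eqI, simp_all)
 qed simp_all
qed

end

text \<open>The chosen pullbacks are those of \<open>M\<close>, with the lifted structure on the
  apex, so \<open>U\<close> carries chosen pullbacks to chosen pullbacks.\<close>

definition DX where
 "DX = (let pb = (\<lambda>f p. let p' = Pb1 (WDisp M) (ar f) (ar p); f' = Pb2 (WDisp M) (ar f) (ar p) in
   (lift (Dom X f) (Dom X p) p' f', p', f')); Ds = {p \<in> Ar X. ar p \<in> Disp (WDisp M)};
   ok = (\<lambda>f p. f \<in> Ar X \<and> p \<in> Ds \<and> Cod X f = Cod X p)
  in \<lparr>DCat = X, Disp = Ds,
   Pb1 = (\<lambda>f p. if ok f p then (case pb f p of (w, p', f') => mk w p' (Dom X f)) else undefined),
   Pb2 = (\<lambda>f p. if ok f p then (case pb f p of (w, p', f') => mk w f' (Dom X p)) else undefined)\<rparr>)"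

lemma DX_simps [simp]: "DCat DX = X" "p \<in> Disp DX \<longleftrightarrow> p \<in> Ar X \<and> ar p \<in> Disp (WDisp M)"
 by (simp_all add: DX_def Let_def)

lemma DX_pb:
 assumes "f \<in> Ar X" "p \<in> Ar X" "ar p \<in> Disp (WDisp M)" "Cod X f = Cod X p"
 shows "is_pullback X f p (Pb1 DX f p) (Pb2 DX f p)" "ar (Pb1 DX f p) = Pb1 (WDisp M) (ar f) (ar p)"
  "ar (Pb2 DX f p) = Pb2 (WDisp M) (ar f) (ar p)"
  "Pb1 DX f p \<in> Ar X"
proof -
 let ?p = "Pb1 (WDisp M) (ar f) (ar p)" and ?f = "Pb2 (WDisp M) (ar f) (ar p)" and ?z = "Dom X f" and ?y = "Dom X p" and ?x = "Cod X p"
 have m: "mk ?z (ar f) ?x = f" "mk ?y (ar p) ?x = p" using assms X_mk_eq[of f] X_mk_eq[of p] by simp_all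
 have c: "cmap ?z (ar f) ?x" "cmap ?y (ar p) ?x" using assms m by (simp_all del: X_mk_Ar)
 have pb: "is_pullback (WCat M) (ar f) (ar p) ?p ?f" using assms by (intro D.Pb) simp_all
 have q: "Pb1 DX f p = mk (lift ?z ?y ?p ?f) ?p ?z" "Pb2 DX f p = mk (lift ?z ?y ?p ?f) ?f ?y"
  using assms by (simp_all add: DX_def Let_def)
 show "is_pullback X f p (Pb1 DX f p) (Pb2 DX f p)"
  using X_pullback[OF c assms(3) pb lift[OF c assms(3) pb]] unfolding m q .
 show "ar (Pb1 DX f p) = ?p" "ar (Pb2 DX f p) = ?f" "Pb1 DX f p \<in> Ar X"
  using lift(1)[OF c assms(3) pb] by (simp_all add: q del: X_mk_Ar)
qed

lemma ar_iso: "iso_arrow X i ==> iso_arrow (WCat M) (ar i)"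
 using functor_iso[of U "WCat M" i] by (simp add: U_simps(4)[OF iso_Ar[OF X_category]])

lemma DX_category [simp]: "display_category DX"
proof (rule display_category.intro)
 show "\<not> disp_cospan DX f p ==> Pb1 DX f p = undefined" "\<not> disp_cospan DX f p ==> Pb2 DX f p = undefined" for f p
  by (auto simp: disp_cospan_def) (auto simp: DX_def)
 show "Pb1 DX f p \<in> Disp DX" "is_pullback (DCat DX) f p (Pb1 DX f p) (Pb2 DX f p)" if "disp_cospan DX f p" for f p
  using that DX_pb[of f p] by (simp_all add: disp_cospan_def)
 show "Cmp (DCat DX) i p \<in> Disp DX" if "p \<in> Disp DX" "iso_arrow (DCat DX) i" "composable (DCat DX) i p" for i p
  using that ar_iso[of i] D.Disp_iso_left[of "ar p" "ar i"] by (simp add: composable_def X_Cmp_Ar)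
 show "Cmp (DCat DX) p i \<in> Disp DX" if "p \<in> Disp DX" "iso_arrow (DCat DX) i" "composable (DCat DX) p i" for i p
  using that ar_iso[of i] D.Disp_iso_right[of "ar p" "ar i"] by (simp add: composable_def X_Cmp_Ar)
qed (auto simp: DX_def Let_def)

text \<open>By \<open>pb_functor_transport\<close> only chosen pullbacks have to be inspected, and
  they lie over chosen pullbacks of \<open>M\<close>.\<close>

lemma U_display: "display_functor DX (WDisp M) U"
proof (rule display_functor.intro)
 show "is_pullback (WCat M) (FAr U f) (FAr U p) (FAr U p') (FAr U f')"
  if p: "p \<in> Disp DX" and pb: "is_pullback (DCat DX) f p p' f'" for f p p' f'
 proof -
  note pb = pb[simplified]
  note a = pb_Ar[OF X_category pb] pb_ends[OF X_category pb]
  have a': "ar p \<in> Disp (WDisp M)" using p by simp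
  note q = DX_pb[OF a(1,2) a' a(8)[symmetric]]
  show ?thesis
   by (rule pb_functor_transport[OF U_functor U_simps(1,2) q(1) pb])
    (use a a' q(2-4) pb_Ar(4)[OF X_category q(1)] in \<open>simp add: D.Pb\<close>)
 qed
qed (use DX_category D.display_category_axioms in \<open>auto simp: functors_iff\<close>)

end

section \<open>Types over coalgebras\<close>

text \<open>Composed with an isomorphism, this square presents transport of a coalgebra structure
  along that isomorphism as a pullback along an identity, so that \<open>lift\<close> and its
  uniqueness apply.\<close>

lemma pb_Idn: "category C ==> p \<in> Ar C ==> is_pullback C (Idn C (Cod C p)) p p (Idn C (Dom C p))"
proof (rule pbI)
 show "\<exists>h. h \<in> Ar C \<and> Dom C h = Dom C x \<and> Cod C h = Dom C p \<and> Cmp C p h = x \<and> Cmp C (Idn C (Dom C p)) h = y"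
  if "category C" "p \<in> Ar C" "x \<in> Ar C" "y \<in> Ar C" "Cod C x = Dom C (Idn C (Cod C p))" "Cod C y = Dom C p" "Dom C x = Dom C y"
   "Cmp C (Idn C (Cod C p)) x = Cmp C p y" for x y
  using that by (intro exI[of _ y]) simp
qed simp_all

context coalg_cwa
begin

declare X_mk_Ar [simp del]

lemma cmapD:
 assumes "cmap x f y"
 shows "x \<in> Ob X" "y \<in> Ob X" "f \<in> A1" "dm f = und x" "cd f = und y"
 using assms by (simp_all add: X_mk_Ar)

lemma ar_cmap: "f \<in> Ar X ==> cmap (Dom X f) (ar f) (Cod X f)"
 by (simp add: X_mk_eq)

abbreviation P where "P x \<equiv> Tp M (und x)"
abbreviation re where "re w \<equiv> Re M w"
abbreviation rf where "rf w \<equiv> Rf M w"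
abbreviation pj where "pj x A \<equiv> proj M (und x) A"
text \<open>A type over \<open>x\<close> is coded as the pair of a base type and a structure map on
  its extension; this regroups the structure map with the extension into a coalgebra.\<close>

abbreviation xt where "xt x a \<equiv> pair (cext M (und x) (und a)) (str a)"

text \<open>A type over a coalgebra is a type over the underlying object together with a coalgebra structure on its extension,
 for which the projection is a coalgebra map.\<close>

definition ty where
 "ty x a \<longleftrightarrow> x \<in> Ob X \<and> pair (und a) (str a) = a \<and> und a \<in> Ob (P x) \<and> cmap (xt x a) (pj x (und a)) x"

definition tm where
 "tm x a f b \<longleftrightarrow> ty x a \<and> ty x b \<and> f \<in> Ar (P x) \<and> Dom (P x) f = und a \<and> Cod (P x) f = und b \<and>
  cmap (xt x a) (ext_map M (und x) f) (xt x b)"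

text \<open>Arrows carry their ends, as in \<open>coalg_cat\<close>, because one map of base types
  may underlie maps between different coalgebra structures.\<close>

definition TF where
 "TF x = (let ars = {mk a f b |a f b. tm x a f b} in
  \<lparr>Ob = {a. ty x a}, Ar = ars, Dom = restrict und ars, Cod = (\<lambda>g\<in>ars. str (str g)),
   Idn = (\<lambda>a\<in>{a. ty x a}. mk a (Idn (P x) (und a)) a),
   Cmp = (\<lambda>g f. if g \<in> ars \<and> f \<in> ars \<and> und g = str (str f)
    then mk (und f) (Cmp (P x) (ar g) (ar f)) (str (str g)) else undefined)\<rparr>)"

lemma tyD:
 assumes "ty x a"
 shows "x \<in> Ob X" "und x \<in> Ctx M" "und a \<in> Ob (P x)" "cmap (xt x a) (pj x (und a)) x" "xt x a \<in> Ob X" "pair (und a) (str a) = a"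
 using assms cmapD(1)[of "xt x a" "pj x (und a)" x] by (simp_all add: ty_def)

lemma tmD:
 assumes "tm x a f b"
 shows "ty x a" "ty x b" "f \<in> Ar (P x)" "Dom (P x) f = und a" "Cod (P x) f = und b" "cmap (xt x a) (ext_map M (und x) f) (xt x b)"
 using assms by (simp_all add: tm_def)

lemma tm_id: "ty x a ==> tm x a (Idn (P x) (und a)) a"
 using tyD[of x a] cmap_id[of "xt x a"] by (simp add: tm_def)

lemma tm_comp:
 assumes f: "tm x a f b" and g: "tm x b g c"
 shows "tm x a (Cmp (P x) g f) c"
 using tmD[OF f] tmD[OF g] tyD[OF tmD(1)[OF f]] cmap_comp[OF tmD(6)[OF g] tmD(6)[OF f]] by (simp add: tm_def)

lemma TF_simps [simp]:
 "a \<in> Ob (TF x) \<longleftrightarrow> ty x a" "mk a f b \<in> Ar (TF x) \<longleftrightarrow> tm x a f b"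
 "tm x a f b ==> Dom (TF x) (mk a f b) = a" "tm x a f b ==> Cod (TF x) (mk a f b) = b"
 "ty x a ==> Idn (TF x) a = mk a (Idn (P x) (und a)) a"
 "tm x a f b ==> tm x b g c ==> Cmp (TF x) (mk b g c) (mk a f b) = mk a (Cmp (P x) g f) c"
 by (auto simp: TF_def Let_def)

lemma TF_ArE: "g \<in> Ar (TF x) ==> (\<And>a f b. g = mk a f b ==> tm x a f b ==> Q) ==> Q"
 by (auto simp: TF_def Let_def)

lemma TF_category [simp]: "category (TF x)"
proof (rule category.intro)
 show "Dom (TF x) \<in> Ar (TF x) \<rightarrow>\<^sub>E Ob (TF x)" "Cod (TF x) \<in> Ar (TF x) \<rightarrow>\<^sub>E Ob (TF x)" "Idn (TF x) \<in> extensional (Ob (TF x))"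
  by (auto simp: TF_def Let_def tm_def)
 show "\<not> composable (TF x) g f ==> Cmp (TF x) g f = undefined" for g f
  by (auto simp: TF_def Let_def composable_def)
 show "a \<in> Ob (TF x) ==> Idn (TF x) a \<in> hom (TF x) a a" for a
  using tm_id[of x a] by (simp add: hom_iff)
 show "f \<in> Ar (TF x) ==> Cmp (TF x) (Idn (TF x) (Cod (TF x) f)) f = f" for f
  by (erule TF_ArE, frule tmD(1), frule tmD(2), frule tyD(2)) (simp add: tm_id tmD)
 show "f \<in> Ar (TF x) ==> Cmp (TF x) f (Idn (TF x) (Dom (TF x) f)) = f" for f
  by (erule TF_ArE, frule tmD(1), frule tmD(2), frule tyD(2)) (simp add: tm_id tmD)
 show "Cmp (TF x) g f \<in> hom (TF x) (Dom (TF x) f) (Cod (TF x) g)" if "composable (TF x) g f" for g f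
 proof -
  from that have "g \<in> Ar (TF x)" "f \<in> Ar (TF x)" "Dom (TF x) g = Cod (TF x) f" by (auto simp: composable_def)
  then show ?thesis by (elim TF_ArE) (simp add: hom_iff tm_comp)
 qed
 show "Cmp (TF x) h (Cmp (TF x) g f) = Cmp (TF x) (Cmp (TF x) h g) f" if "composable (TF x) h g" "composable (TF x) g f" for h g f
 proof -
  from that have "h \<in> Ar (TF x)" "g \<in> Ar (TF x)" "f \<in> Ar (TF x)" "Dom (TF x) h = Cod (TF x) g" "Dom (TF x) g = Cod (TF x) f"
   by (auto simp: composable_def)
  then show ?thesis by (elim TF_ArE) (simp add: tm_comp tmD tyD(2)[OF tmD(1)])
 qed
qed

lemma lift_pair: "pair (dm p') (str (lift z y p' f')) = lift z y p' f'"
 by (simp add: lift_def)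

text \<open>The base type is reindexed strictly; its extension is the apex of the pullback square of
  \<open>cart\<close>, so the structure on it is the lifted one.\<close>

definition tre where
 "tre w a = (let A' = re (ar w) (und a) in
  pair A' (str (lift (Dom X w) (xt (Cod X w) a) (pj (Dom X w) A') (cart M (ar w) (und a)))))"

lemma und_tre [simp]: "und (tre w a) = re (ar w) (und a)"
 by (simp add: tre_def Let_def)

context
 fixes w z x a
 assumes w: "w \<in> Ar X" and z: "z = Dom X w" and x: "x = Cod X w" and a: "ty x a"
begin

lemma tre_pb: "is_pullback (WCat M) (ar w) (pj x (und a)) (pj z (re (ar w) (und a))) (cart M (ar w) (und a))"
 using cart_pb[OF M, of "ar w" "und a"] w z x tyD[OF a] by simp

lemma lift_pjs: "cmap z (ar w) x" "cmap (xt x a) (pj x (und a)) x" "pj x (und a) \<in> Disp (WDisp M)"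
 using w z x tyD[OF a] by (simp_all add: X_mk_eq)

lemma xt_tre: "xt z (tre w a) = lift z (xt x a) (pj z (re (ar w) (und a))) (cart M (ar w) (und a))"
 by (simp add: tre_def Let_def z x lift_pair)

lemma tre: "ty z (tre w a)" "cmap (xt z (tre w a)) (cart M (ar w) (und a)) (xt x a)"
proof -
 note l = lift[OF lift_pjs tre_pb, folded xt_tre]
 show "cmap (xt z (tre w a)) (cart M (ar w) (und a)) (xt x a)" by (rule l(2))
 have "re (ar w) (und a) \<in> Ob (P z)" using w z x tyD[OF a] by simp
 then show "ty z (tre w a)" unfolding ty_def using l(1) cmapD(2)[OF l(1)] by (simp add: tre_def Let_def)
qed

text \<open>The projection and \<open>cart\<close> are the two pullback projections, and at most one
  structure makes both coalgebra maps. This characterization proves that reindexing is strictly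
  functorial and, later, that a morphism into the new CwA commutes with it.\<close>

lemma tre_unique:
 assumes b: "ty z b" "und b = re (ar w) (und a)" and c: "cmap (xt z b) (cart M (ar w) (und a)) (xt x a)"
 shows "b = tre w a"
proof -
 have "xt z b = xt z (tre w a)"
  unfolding xt_tre by (rule lift_unique[OF lift_pjs tre_pb]) (use tyD(4)[OF b(1)] b(2) c in simp_all)
 then have "str b = str (tre w a)" by simp
 then show ?thesis using tyD(6)[OF b(1)] tyD(6)[OF tre(1)] b(2) by simp
qed

lemma tre_detect:
 assumes "h \<in> A1" "cd h = cext M (und z) (re (ar w) (und a))" "cmap v (pj z (re (ar w) (und a)) \<cdot> h) z" "cmap v (cart M (ar w) (und a) \<cdot> h) (xt x a)"
 shows "cmap v h (xt z (tre w a))"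
 by (rule detect[OF lift_pjs tre_pb]) (use tyD(4)[OF tre(1)] tre(2) assms in simp_all)

lemma Q_pb: "is_pullback X w (mk (xt x a) (pj x (und a)) x) (mk (xt z (tre w a)) (pj z (und (tre w a))) z)
  (mk (xt z (tre w a)) (cart M (ar w) (und a)) (xt x a))"
 using X_pullback[OF lift_pjs tre_pb tyD(4)[OF tre(1), unfolded und_tre] tre(2)[unfolded und_tre]] X_mk_eq[OF w] z x by simp

end

text \<open>Tested on the two projections of the target extension: the first composite is the
  projection of the source, and \<open>cart_nat\<close> rewrites the second as a composite of
  coalgebra maps.\<close>

lemma tm_re:
 assumes w: "w \<in> Ar X" and z: "z = Dom X w" and x: "x = Cod X w" and f: "tm x a f b"
 shows "tm z (tre w a) (rf (ar w) f) (tre w b)"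
proof -
 note a = tmD(1)[OF f] and b = tmD(2)[OF f]
 have F: "f \<in> Ar (Tp M (cd (ar w)))" "ar w \<in> A1" "dm (ar w) = und z" "cd (ar w) = und x" "und z \<in> Ctx M"
  using w z x tmD[OF f] by simp_all
 have r: "rf (ar w) f \<in> Ar (P z)" "Dom (P z) (rf (ar w) f) = re (ar w) (und a)" "Cod (P z) (rf (ar w) f) = re (ar w) (und b)"
  using F tmD[OF f] M by simp_all
 note ta = tre[OF w z x a] and tb = tre[OF w z x b]
 have "cmap (xt z (tre w a)) (ext_map M (und z) (rf (ar w) f)) (xt z (tre w b))"
 proof (rule tre_detect[OF w z x b])
  show "cmap (xt z (tre w a)) (pj z (re (ar w) (und b)) \<cdot> ext_map M (und z) (rf (ar w) f)) z"
   using tyD(4)[OF ta(1)] r F by simp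
  have "cart M (ar w) (und b) \<cdot> ext_map M (und z) (rf (ar w) f) = ext_map M (und x) f \<cdot> cart M (ar w) (und a)"
   using cart_nat[OF M F(2,1)] F tmD[OF f] by simp
  then show "cmap (xt z (tre w a)) (cart M (ar w) (und b) \<cdot> ext_map M (und z) (rf (ar w) f)) (xt x b)"
   using cmap_comp[OF tmD(6)[OF f] ta(2)] by simp
 qed (use r F in simp_all)
 then show ?thesis unfolding tm_def using ta tb r by simp
qed

lemma tre_Idn: "ty x a ==> tre (Idn X x) a = a"
 using tyD[of x a] cmap_id[of "xt x a"]
 by (intro tre_unique[symmetric, where z = x and x = x]) simp_all

text \<open>The iterated reindexing satisfies \<open>tre_unique\<close> for the composite: base
  types agree by strictness in \<open>M\<close>, and \<open>cart_Cmp\<close> splits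
  \<open>cart\<close> into two coalgebra maps.\<close>

lemma tre_Cmp:
 assumes "w \<in> Ar X" "v \<in> Ar X" "Dom X w = Cod X v" "ty (Cod X w) a"
 shows "tre (Cmp X w v) a = tre v (tre w a)"
proof (rule tre_unique[symmetric, OF X_Cmp_Ar])
 note t = tre[OF assms(1) refl refl assms(4)]
 note t' = tre[OF assms(2) refl refl t(1)[unfolded assms(3)]]
 show "cmap (xt (Dom X v) (tre v (tre w a))) (cart M (ar (Cmp X w v)) (und a)) (xt (Cod X w) a)"
  using cmap_comp[OF t(2) t'(2)[folded assms(3)]] assms tyD[OF assms(4)] by (simp add: cart_Cmp und_tre)
 show "ty (Dom X v) (tre v (tre w a))" "und (tre v (tre w a)) = re (ar (Cmp X w v)) (und a)"
  using t' assms tyD[OF assms(4)] by (simp_all add: und_tre)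
qed (use assms in simp_all)

definition TX where
 "TX = \<lparr>IBase = X, IFib = restrict TF (Ob X),
  IRe = (\<lambda>w\<in>Ar X. \<lparr>FDom = TF (Cod X w), FCod = TF (Dom X w), FOb = restrict (tre w) (Ob (TF (Cod X w))),
   FAr = (\<lambda>g\<in>Ar (TF (Cod X w)). mk (tre w (und g)) (rf (ar w) (ar g)) (tre w (str (str g))))\<rparr>),
  IUnit = (\<lambda>x\<in>Ob X. \<lambda>a\<in>Ob (TF x). Idn (TF x) a),
  IMult = (\<lambda>w v. if composable X w v then \<lambda>a\<in>Ob (TF (Cod X w)). Idn (TF (Dom X v)) (tre v (tre w a)) else undefined)\<rparr>"

lemma TX_simps [simp]:
 "IBase TX = X" "x \<in> Ob X ==> IFib TX x = TF x"
 "w \<in> Ar X ==> FDom (IRe TX w) = TF (Cod X w)" "w \<in> Ar X ==> FCod (IRe TX w) = TF (Dom X w)"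
 "w \<in> Ar X ==> ty (Cod X w) a ==> FOb (IRe TX w) a = tre w a"
 "w \<in> Ar X ==> tm (Cod X w) a f b ==> FAr (IRe TX w) (mk a f b) = mk (tre w a) (rf (ar w) f) (tre w b)"
 by (simp_all add: TX_def)

lemma TX_functor [simp]:
 assumes w: "w \<in> Ar X"
 shows "functor (IRe TX w)"
proof (rule functorI, unfold TX_simps(3,4)[OF w])
 note r = tm_re[OF w refl refl]
 show "FOb (IRe TX w) \<in> extensional (Ob (TF (Cod X w)))" "FAr (IRe TX w) \<in> extensional (Ar (TF (Cod X w)))"
  using w by (simp_all add: TX_def)
 fix f assume f: "f \<in> Ar (TF (Cod X w))"
 then show "FAr (IRe TX w) f \<in> Ar (TF (Dom X w)) \<and> Dom (TF (Dom X w)) (FAr (IRe TX w) f) = FOb (IRe TX w) (Dom (TF (Cod X w)) f) \<and>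
  Cod (TF (Dom X w)) (FAr (IRe TX w) f) = FOb (IRe TX w) (Cod (TF (Cod X w)) f)"
  by (rule TF_ArE) (use w r in \<open>simp add: tmD(1,2)\<close>)
 fix g assume "g \<in> Ar (TF (Cod X w))" "Dom (TF (Cod X w)) g = Cod (TF (Cod X w)) f"
 with f obtain a b c f' g' where fg: "f = mk a f' b" "g = mk b g' c" "tm (Cod X w) a f' b" "tm (Cod X w) b g' c"
  by (elim TF_ArE) auto
 have "rf (ar w) (Cmp (P (Cod X w)) g' f') = Cmp (P (Dom X w)) (rf (ar w) g') (rf (ar w) f')"
  using FAr_Cmp'[of "IRe (WTp M) (ar w)" "P (Cod X w)" g' f'] w tmD[OF fg(3)] tmD[OF fg(4)] by simp
 then show "FAr (IRe TX w) (Cmp (TF (Cod X w)) g f) = Cmp (TF (Dom X w)) (FAr (IRe TX w) g) (FAr (IRe TX w) f)"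
  using w fg(3,4) tm_comp[OF fg(3,4)] r[OF fg(3)] r[OF fg(4)] unfolding fg(1,2) by simp
qed (use w tm_id in \<open>simp_all add: tre(1)[OF w refl refl] und_tre tyD\<close>)

lemma TX_strict: "strict_indexed_category TX"
proof (rule strict_icatI)
 show "IRe TX (Idn X x) = id_func (IFib TX x)" if "x \<in> Ob X" for x
 proof (rule functor_eqI)
  show "FAr (IRe TX (Idn X x)) g = FAr (id_func (IFib TX x)) g" if "g \<in> Ar (FDom (id_func (IFib TX x)))" for g
   using that \<open>x \<in> Ob X\<close> by simp (erule TF_ArE, simp add: tre_Idn tmD(1-3))
 qed (use that in \<open>simp_all add: tre_Idn\<close>)
 show "IRe TX (Cmp X w v) = comp_func (IRe TX v) (IRe TX w)" if uv: "w \<in> Ar X" "v \<in> Ar X" "Dom X w = Cod X v" for w v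
 proof (rule functor_eqI)
  note t = tre(1)[OF uv(1) refl refl, unfolded uv(3)] tm_re[OF uv(1) refl refl, unfolded uv(3)]
  show "FAr (IRe TX (Cmp X w v)) g = FAr (comp_func (IRe TX v) (IRe TX w)) g" if "g \<in> Ar (FDom (comp_func (IRe TX v) (IRe TX w)))" for g
   using that uv by simp (erule TF_ArE, simp add: X_Cmp_Ar tre_Cmp tmD(1-3) t)
  show "FOb (IRe TX (Cmp X w v)) a = FOb (comp_func (IRe TX v) (IRe TX w)) a" if "a \<in> Ob (FDom (comp_func (IRe TX v) (IRe TX w)))" for a
   using that uv by (simp add: X_Cmp_Ar tre_Cmp t)
 qed (use uv in \<open>simp_all add: X_Cmp_Ar\<close>)
 show "IUnit TX = (\<lambda>a\<in>Ob X. \<lambda>x\<in>Ob (IFib TX a). Idn (IFib TX a) x)" by (auto simp: TX_def)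
 show "IMult TX = (\<lambda>w v. if composable X w v then \<lambda>x\<in>Ob (IFib TX (Cod X w)).
   Idn (IFib TX (Dom X v)) (FOb (IRe TX v) (FOb (IRe TX w) x)) else undefined)"
 proof (intro ext)
  fix w v a
  have m: "IMult TX w v = (if composable X w v then \<lambda>a\<in>Ob (TF (Cod X w)). Idn (TF (Dom X v)) (tre v (tre w a)) else undefined)"
   by (simp add: TX_def)
  show "IMult TX w v a = (if composable X w v then \<lambda>x\<in>Ob (IFib TX (Cod X w)).
   Idn (IFib TX (Dom X v)) (FOb (IRe TX v) (FOb (IRe TX w) x)) else undefined) a"
  proof (cases "composable X w v")
   case True
   then have wv: "w \<in> Ar X" "v \<in> Ar X" "Dom X w = Cod X v" by (auto simp: composable_def)
   show ?thesis unfolding m using True wv tre(1)[OF wv(1) refl refl, of a] by (cases "ty (Cod X w) a") simp_all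
  qed (simp add: m)
 qed
 show "IFib TX \<in> extensional (Ob X)" "IRe TX \<in> extensional (Ar X)" by (simp_all add: TX_def)
qed simp_all

definition G where
 "G x = \<lparr>FDom = TF x, FCod = disp_slice DX x, FOb = (\<lambda>a\<in>Ob (TF x). mk (xt x a) (pj x (und a)) x),
  FAr = (\<lambda>g\<in>Ar (TF x). (mk (xt x (und g)) (pj x (und (und g))) x, mk (xt x (und g)) (ext_map M (und x) (ar g)) (xt x (str (str g))),
   mk (xt x (str (str g))) (pj x (und (str (str g)))) x))\<rparr>"

lemma G_simps [simp]:
 "FDom (G x) = TF x" "FCod (G x) = disp_slice DX x" "ty x a ==> FOb (G x) a = mk (xt x a) (pj x (und a)) x"
 "tm x a f b ==> FAr (G x) (mk a f b) =
  (mk (xt x a) (pj x (und a)) x, mk (xt x a) (ext_map M (und x) f) (xt x b), mk (xt x b) (pj x (und b)) x)"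
 by (simp_all add: G_def)

sublocale DX: display_category DX by (rule DX_category)

lemma G_Ar:
 assumes f: "tm x a f b"
 shows "FAr (G x) (mk a f b) \<in> Ar (disp_slice DX x)"
proof -
 note a = tyD[OF tmD(1)[OF f]] and b = tyD[OF tmD(2)[OF f]] and t = tmD[OF f]
 show ?thesis unfolding G_simps(4)[OF f] using a b t by (subst DX.slice_Ar) simp
qed

lemma G_functor [simp]: "functor (G x)"
proof (rule functorI, unfold G_simps(1,2))
 fix f assume f: "f \<in> Ar (TF x)"
 then show "FAr (G x) f \<in> Ar (disp_slice DX x) \<and> Dom (disp_slice DX x) (FAr (G x) f) = FOb (G x) (Dom (TF x) f) \<and>
  Cod (disp_slice DX x) (FAr (G x) f) = FOb (G x) (Cod (TF x) f)"
  by (rule TF_ArE) (use G_Ar[of x] DX.slice_Dom[OF G_Ar, of x] DX.slice_Cod[OF G_Ar, of x] in \<open>simp add: tmD(1,2) del: DX.slice_Dom DX.slice_Cod\<close>)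
 fix g assume "g \<in> Ar (TF x)" "Dom (TF x) g = Cod (TF x) f"
 with f obtain a b c f' g' where fg: "f = mk a f' b" "g = mk b g' c" "tm x a f' b" "tm x b g' c"
  by (elim TF_ArE) auto
 show "FAr (G x) (Cmp (TF x) g f) = Cmp (disp_slice DX x) (FAr (G x) g) (FAr (G x) f)"
  unfolding fg(1,2) using DX.slice_Cmp[OF G_Ar[OF fg(4)] G_Ar[OF fg(3)]] fg(3,4) tmD[OF fg(3)] tmD[OF fg(4)] tyD[OF tmD(1)[OF fg(3)]]
  by (simp add: tm_comp)
next
 show "FOb (G x) a \<in> Ob (disp_slice DX x)" if "a \<in> Ob (TF x)" for a using that tyD[of x a] by simp
 show "FAr (G x) (Idn (TF x) a) = Idn (disp_slice DX x) (FOb (G x) a)" if "a \<in> Ob (TF x)" for a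
  using that tyD[of x a] tm_id[of x a] by (simp add: X_Idn)
qed (simp_all add: G_def)

text \<open>Faithfulness and fullness come from realization over an identity in \<open>M\<close>,
  the coalgebra condition on an arrow of extensions being the one in \<open>tm\<close>. For
  essential surjectivity the structure of a display is moved to the extension of an isomorphic
  type.\<close>

lemma G_equivalence:
 assumes x: "x \<in> Ob X"
 shows "equivalence_functor (G x)"
proof (rule equivalenceI[OF G_functor])
 have ux: "und x \<in> Ctx M" using x by simp
 have ov: "over M (idn (und x)) f (und b) (und a)" if "tm x a f b" for a f b
  using tmD[OF that] tyD[OF tmD(1)[OF that]] tyD[OF tmD(2)[OF that]] by (simp add: over_def)
 show "faithful_functor (G x)"
  unfolding faithful_functor_def G_simps(1)
 proof (intro allI impI)
  fix f g assume fg: "f \<in> Ar (TF x)" "g \<in> Ar (TF x)" "Dom (TF x) f = Dom (TF x) g" "Cod (TF x) f = Cod (TF x) g" "FAr (G x) f = FAr (G x) g"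
  then obtain a b k l where k: "f = mk a k b" "g = mk a l b" "tm x a k b" "tm x a l b" by (elim TF_ArE) auto
  then have "ext_map M (und x) k = ext_map M (und x) l" using fg(5) by simp
  then have "k = l" using realize_inj[OF M ov[OF k(3)] ov[OF k(4)]] k tmD[OF k(3)] tmD[OF k(4)] ux by simp
  then show "f = g" using k by simp
 qed
 show "full_functor (G x)"
  unfolding full_functor_def G_simps(1,2) TF_simps(1)
 proof (intro allI impI)
  fix a b h assume ab: "ty x a" "ty x b" and h: "h \<in> Ar (disp_slice DX x)" "Dom (disp_slice DX x) h = FOb (G x) a" "Cod (disp_slice DX x) h = FOb (G x) b"
  let ?m = "fst (snd h)"
  have h': "fst h = mk (xt x a) (pj x (und a)) x" "snd (snd h) = mk (xt x b) (pj x (und b)) x" using h ab by simp_all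
  note s = DX.slice_Ar_simps(5-8)[OF h(1), unfolded h', simplified]
  have m: "?m \<in> Ar X" "Dom X ?m = xt x a" "Cod X ?m = xt x b" using s tyD(4)[OF ab(1)] tyD(4)[OF ab(2)] by simp_all
  then have c: "cmap (xt x a) (ar ?m) (xt x b)" using ar_cmap[OF m(1)] by simp
  have p: "pj x (und b) \<cdot> ar ?m = pj x (und a)"
   using arg_cong[OF s(4), of ar] m tyD(4)[OF ab(2)] by simp
  obtain f where f: "over M (idn (und x)) f (und b) (und a)" "realize M (idn (und x)) (und b) f = ar ?m"
   using realize_surj[OF M, of "idn (und x)" "und b" "und a" "ar ?m"] ux m p tyD(3)[OF ab(1)] tyD(3)[OF ab(2)] by auto
  then have f': "f \<in> Ar (P x)" "Dom (P x) f = und a" "Cod (P x) f = und b" "ext_map M (und x) f = ar ?m"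
   using ux tyD(3)[OF ab(2)] M by (auto simp: over_def)
  have t: "tm x a f b" unfolding tm_def using ab f' c by simp
  have "FAr (G x) (mk a f b) = h"
   by (rule DX.slice_eqI) (use t h' f' m X_mk_eq[OF m(1)] in simp_all)
  then show "\<exists>f. f \<in> Ar (TF x) \<and> Dom (TF x) f = a \<and> Cod (TF x) f = b \<and> FAr (G x) f = h"
   using t by (intro exI[of _ "mk a f b"]) simp
 qed
 show "eso_functor (G x)"
  unfolding eso_functor_def G_simps(1,2)
 proof
  fix q assume q: "q \<in> Ob (disp_slice DX x)"
  let ?p = "ar q" and ?y = "Dom X q"
  have q': "q \<in> Ar X" "?p \<in> Disp (WDisp M)" "Cod X q = x" using q by simp_all
  then have p: "cmap ?y ?p x" "cd ?p = und x" "dm ?p = und ?y" using ar_cmap[of q] by auto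
  obtain A i where A: "A \<in> Ob (P x)" "iso_arrow (WCat M) i" "dm i = cext M (und x) A" "cd i = dm ?p" "?p \<cdot> i = proj M (und x) A"
   using cwa_eso[OF M q'(2) p(2)] by auto
  \<comment> \<open>The isomorphism \<open>i\<close> over \<open>und x\<close> is viewed as a side
    of a pullback along the identity, so \<open>lift\<close> moves the structure of
    \<open>?y\<close> to the extension of \<open>A\<close>.\<close>
  have pb: "is_pullback (WCat M) (idn (und x)) ?p (proj M (und x) A) i"
   using pb_transport[OF cw_cat[OF M] pb_Idn[OF cw_cat[OF M] D.Disp_Ar[OF q'(2)]] A(2)] A p ux q' by simp
  define a where "a = pair A (str (lift x ?y (proj M (und x) A) i))"
  have xa: "xt x a = lift x ?y (proj M (und x) A) i" unfolding a_def by (simp add: lift_pair)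
  note l = lift[OF cmap_id[OF x] p(1) q'(2) pb, folded xa]
  have t: "ty x a" unfolding ty_def using l(1) x A by (simp add: a_def)
  have s: "(mk (xt x a) (pj x A) x, mk (xt x a) i ?y, q) \<in> Ar (disp_slice DX x)"
   using l A q' ux X_mk_eq[of q] X_Cmp_mk[OF p(1) l(2)] by (subst DX.slice_Ar) (simp add: a_def)
  have "iso_arrow X (mk (xt x a) i ?y)"
   using cmap_inv[OF l(2) A(2)] l(2) A(2) cmapD[OF l(2)]
   by (intro iso_arrowI[of X _ "mk ?y (inv_arrow (WCat M) i) (xt x a)"]) (simp_all add: X_Idn)
  then have "iso_arrow (disp_slice DX x) (mk (xt x a) (pj x A) x, mk (xt x a) i ?y, q)"
   by - (rule DX.slice_iso[OF s], simp)
  then show "\<exists>a\<in>Ob (TF x). \<exists>i. iso_arrow (disp_slice DX x) i \<and> Dom (disp_slice DX x) i = FOb (G x) a \<and> Cod (disp_slice DX x) i = q"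
   using t DX.slice_Dom[OF s] DX.slice_Cod[OF s] by (intro bexI[of _ a] exI[of _ "(mk (xt x a) (pj x A) x, mk (xt x a) i ?y, q)"]) (simp_all add: a_def)
 qed
qed

text \<open>The upper side of the reindexing square is that of \<open>M\<close>, regarded as a
  coalgebra map.\<close>

definition Q where "Q w a = mk (xt (Dom X w) (tre w a)) (cart M (ar w) (und a)) (xt (Cod X w) a)"

definition XW where "XW = \<lparr>WDisp = DX, WTp = TX, WComp = family_ifun DX TX G Q\<rparr>"

lemma XW_simps [simp]: "WDisp XW = DX" "WTp XW = TX"
 by (simp_all add: XW_def)

lemma XW_facts: "cw XW \<and> (\<forall>w a. w \<in> Ar X --> ty (Cod X w) a --> cart XW w a = Q w a)"
proof -
 have pb: "is_pullback X w (FOb (G (Cod X w)) a) (FOb (G (Dom X w)) (FOb (IRe TX w) a)) (Q w a)"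
  if "w \<in> Ar X" "a \<in> Ob (IFib TX (Cod X w))" for w a
  using that Q_pb[of w "Dom X w" "Cod X w" a] tre(1)[of w "Dom X w" "Cod X w" a] by (simp add: Q_def)
 have Qc: "cmap (xt (Dom X w) (tre w a)) (cart M (ar w) (und a)) (xt (Cod X w) a)" if "w \<in> Ar X" "ty (Cod X w) a" for w a
  using tre(2)[OF that(1) refl refl that(2)] .
 have nat: "Cmp X (Q w (Cod (IFib TX (Cod X w)) f)) (fst (snd (FAr (G (Dom X w)) (FAr (IRe TX w) f)))) =
   Cmp X (fst (snd (FAr (G (Cod X w)) f))) (Q w (Dom (IFib TX (Cod X w)) f))"
  if w: "w \<in> Ar X" and f: "f \<in> Ar (IFib TX (Cod X w))" for w f
 proof -
  from w f obtain a b k where k: "f = mk a k b" "tm (Cod X w) a k b" by (auto elim: TF_ArE)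
  note t = tm_re[OF w refl refl k(2)] and d = tmD[OF k(2)]
  show ?thesis using w k t d tmD(6)[OF t] Qc[OF w d(1)] Qc[OF w d(2)] cart_nat[OF M, of "ar w" k] by (simp add: Q_def)
 qed
 have I: "Q (Idn X x) a = Idn X (Dom X (FOb (G x) a))" if "x \<in> Ob X" "a \<in> Ob (IFib TX x)" for x a
  using that tyD[of x a] by (simp add: Q_def tre_Idn) (simp add: X_Idn)
 have c: "Q (Cmp X w v) a = Cmp X (Q w a) (Q v (FOb (IRe TX w) a))"
  if uv: "w \<in> Ar X" "v \<in> Ar X" "Dom X w = Cod X v" "a \<in> Ob (IFib TX (Cod X w))" for w v a
  using uv tyD[of "Cod X w" a] Qc[of w a] Qc[of v "tre w a"] tre(1)[of w "Dom X w" "Cod X w" a]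
  by (simp add: Q_def tre_Cmp cart_Cmp und_tre)
 have XC: "WCat XW = X" "WComp XW = family_ifun (WDisp XW) (WTp XW) G Q" by (simp, simp add: XW_def)
 note r = cwaI[of XW G Q, unfolded XW_simps DX_simps(1), OF DX_category TX_strict TX_simps(1) XC(2)[unfolded XW_simps]]
 have "cw XW" by (rule r(1)[OF G_equivalence _ _ pb nat I c]) simp_all
 moreover have "cart XW w a = Q w a" if "w \<in> Ar X" "ty (Cod X w) a" for w a
  by (rule r(2)[OF G_equivalence _ _ pb nat I c]) (use that in simp_all)
 ultimately show ?thesis by blast
qed

end

section \<open>The universal coalgebra\<close>

context strict_two_functor
begin

text \<open>Equations between 2-cells are tested in \<open>L\<close>, and 2-cells found there are
  pulled back by fullness. A 1-cell factorization is first formed in \<open>L\<close>;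
  \<open>lift\<close> says that it comes from a unique factorization in \<open>K\<close>.\<close>

lemma universal_coalgebra_reflect:
 assumes T: "comonad K T"
  and faithful: "\<And>a b f g. a \<in> cells2 K f g ==> b \<in> cells2 K f g ==> P2 \<Phi> a = P2 \<Phi> b ==> a = b"
  and full: "\<And>f g A B c. f \<in> cells1 K A B ==> g \<in> cells1 K A B ==> c \<in> cells2 L (P1 \<Phi> f) (P1 \<Phi> g) ==>
   \<exists>a. a \<in> cells2 K f g \<and> P2 \<Phi> a = c"
  and X: "X \<in> Zero K" and U: "U \<in> cells1 K X (MOb T)" and u: "u \<in> cells2 K U (Cmp1 K (MEnd T) U)"
  and univ: "universal_coalgebra L (map_comonad \<Phi> T) (P0 \<Phi> X) (P1 \<Phi> U) (P2 \<Phi> u)"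
  and lift: "\<And>D f h. D \<in> Zero K ==> f \<in> cells1 K D (MOb T) ==> h \<in> cells1 L (P0 \<Phi> D) (P0 \<Phi> X) ==>
   Cmp1 L (P1 \<Phi> U) h = P1 \<Phi> f ==> \<exists>!k. k \<in> cells1 K D X \<and> P1 \<Phi> k = h \<and> Cmp1 K U k = f"
 shows "universal_coalgebra K T X U u"
proof -
 have t [simp]: "MOb T \<in> Zero K" "MEnd T \<in> One K" "Src1 K (MEnd T) = MOb T" "Trg1 K (MEnd T) = MOb T"
  "MEps T \<in> Two K" "Src2 K (MEps T) = MEnd T" "Trg2 K (MEps T) = Id1 K (MOb T)"
  "MDel T \<in> Two K" "Src2 K (MDel T) = MEnd T" "Trg2 K (MDel T) = Cmp1 K (MEnd T) (MEnd T)"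
  using T by (auto simp: comonad_def cells1_iff cells2_iff)
 have m: "MOb (map_comonad \<Phi> T) = P0 \<Phi> (MOb T)" "MEnd (map_comonad \<Phi> T) = P1 \<Phi> (MEnd T)"
  "MEps (map_comonad \<Phi> T) = P2 \<Phi> (MEps T)" "MDel (map_comonad \<Phi> T) = P2 \<Phi> (MDel T)"
  by (simp_all add: map_comonad_def)
 note [simp] = X and [simp] = U[unfolded cells1_iff, THEN conjunct1] U[unfolded cells1_iff, THEN conjunct2, THEN conjunct1]
  U[unfolded cells1_iff, THEN conjunct2, THEN conjunct2] u[unfolded cells2_iff, THEN conjunct1]
  u[unfolded cells2_iff, THEN conjunct2, THEN conjunct1] u[unfolded cells2_iff, THEN conjunct2, THEN conjunct2]
 note v = univ[unfolded universal_coalgebra_def]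
 have c: "coalgebra_on K T X U u"
  unfolding coalgebra_on_def
 proof (intro conjI U u)
  note w = v[THEN conjunct2, THEN conjunct1, unfolded coalgebra_on_def m]
  show "VCmp K (HCmp K (MEps T) (Id2 K U)) u = Id2 K U"
   by (rule faithful[of _ U U]) (use w in \<open>simp_all add: cells2_iff\<close>)
  show "VCmp K (HCmp K (MDel T) (Id2 K U)) u = VCmp K (HCmp K (Id2 K (MEnd T)) u) u"
   by (rule faithful[of _ U "Cmp1 K (MEnd T) (Cmp1 K (MEnd T) U)"]) (use w in \<open>simp_all add: cells2_iff\<close>)
 qed
 show ?thesis unfolding universal_coalgebra_def
 proof (intro conjI X c allI impI)
  fix D f t assume D: "D \<in> Zero K" and ft: "coalgebra_on K T D f t"
  have f: "f \<in> cells1 K D (MOb T)" and t: "t \<in> cells2 K f (Cmp1 K (MEnd T) f)" using ft by (simp_all add: coalgebra_on_def)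
  \<comment> \<open>Universality in \<open>L\<close> gives the underlying factorization; its
    compatibility with the structure 2-cells returns to \<open>K\<close> by faithfulness.\<close>
  obtain h where h: "h \<in> cells1 L (P0 \<Phi> D) (P0 \<Phi> X)" "Cmp1 L (P1 \<Phi> U) h = P1 \<Phi> f" "HCmp L (P2 \<Phi> u) (Id2 L h) = P2 \<Phi> t"
   and hu: "\<And>k. k \<in> cells1 L (P0 \<Phi> D) (P0 \<Phi> X) ==> Cmp1 L (P1 \<Phi> U) k = P1 \<Phi> f ==> HCmp L (P2 \<Phi> u) (Id2 L k) = P2 \<Phi> t ==> k = h"
   using v[THEN conjunct2, THEN conjunct2, THEN conjunct1, rule_format, OF P0_Zero[OF D] map_coalgebra[OF T ft D]] by blast
  from lift[OF D f h(1,2)] obtain k where k: "k \<in> cells1 K D X" "P1 \<Phi> k = h" "Cmp1 K U k = f"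
   and ku: "\<And>l. l \<in> cells1 K D X ==> P1 \<Phi> l = h ==> Cmp1 K U l = f ==> l = k" by blast
  have "HCmp K u (Id2 K k) = t"
   by (rule faithful[OF _ t]) (use k h(3) in \<open>auto simp: cells1_iff cells2_iff\<close>)
  moreover have "l = k" if l: "l \<in> cells1 K D X" "Cmp1 K U l = f" "HCmp K u (Id2 K l) = t" for l
  proof (rule ku[OF l(1) hu l(2)])
   show "P1 \<Phi> l \<in> cells1 L (P0 \<Phi> D) (P0 \<Phi> X)" by (rule P1_cell[OF l(1)])
   show "Cmp1 L (P1 \<Phi> U) (P1 \<Phi> l) = P1 \<Phi> f" "HCmp L (P2 \<Phi> u) (Id2 L (P1 \<Phi> l)) = P2 \<Phi> t"
    using l(1) unfolding l(2,3)[symmetric] by (auto simp: cells1_iff)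
  qed
  ultimately show "\<exists>!h. h \<in> cells1 K D X \<and> Cmp1 K U h = f \<and> HCmp K u (Id2 K h) = t" using k by blast
 next
  fix D h h' a assume D: "D \<in> Zero K" and h: "h \<in> cells1 K D X" "h' \<in> cells1 K D X"
   and a: "a \<in> cells2 K (Cmp1 K U h) (Cmp1 K U h')"
   and e: "VCmp K (HCmp K (Id2 K (MEnd T)) a) (HCmp K u (Id2 K h)) = VCmp K (HCmp K u (Id2 K h')) a"
  have s [simp]: "h \<in> One K" "Src1 K h = D" "Trg1 K h = X" "h' \<in> One K" "Src1 K h' = D" "Trg1 K h' = X"
   "a \<in> Two K" "Src2 K a = Cmp1 K U h" "Trg2 K a = Cmp1 K U h'" using h a by (simp_all add: cells1_iff cells2_iff)
  have a': "P2 \<Phi> a \<in> cells2 L (Cmp1 L (P1 \<Phi> U) (P1 \<Phi> h)) (Cmp1 L (P1 \<Phi> U) (P1 \<Phi> h'))" using P2_cell[OF a] by simp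
  have e': "VCmp L (HCmp L (Id2 L (MEnd (map_comonad \<Phi> T))) (P2 \<Phi> a)) (HCmp L (P2 \<Phi> u) (Id2 L (P1 \<Phi> h))) =
   VCmp L (HCmp L (P2 \<Phi> u) (Id2 L (P1 \<Phi> h'))) (P2 \<Phi> a)"
   using arg_cong[OF e, of "P2 \<Phi>"] by (simp add: m)
  note ex = v[THEN conjunct2, THEN conjunct2, THEN conjunct2, rule_format, OF P0_Zero[OF D] P1_cell[OF h(1)] P1_cell[OF h(2)] a' e']
  then obtain b' where b': "b' \<in> cells2 L (P1 \<Phi> h) (P1 \<Phi> h')" "HCmp L (Id2 L (P1 \<Phi> U)) b' = P2 \<Phi> a" by blast
  obtain b where b: "b \<in> cells2 K h h'" "P2 \<Phi> b = b'" using full[OF h b'(1)] by blast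
  have bU: "P2 \<Phi> (HCmp K (Id2 K U) b) = HCmp L (Id2 L (P1 \<Phi> U)) (P2 \<Phi> b)" if "b \<in> cells2 K h h'" for b
   using that by (simp add: cells2_iff)
  have "HCmp K (Id2 K U) b = a"
   by (rule faithful[OF _ a]) (use b b' bU[OF b(1)] in \<open>auto simp: cells2_iff\<close>)
  moreover have "c = b" if "c \<in> cells2 K h h'" "HCmp K (Id2 K U) c = a" for c
  proof (rule faithful[OF that(1) b(1)])
   show "P2 \<Phi> c = P2 \<Phi> b" using ex P2_cell[OF that(1)] bU[OF that(1)] that(2) b b' by metis
  qed
  ultimately show "\<exists>!b. b \<in> cells2 K h h' \<and> HCmp K (Id2 K U) b = a" using b by blast
 qed
qed

end

lemma CwA_faithful: "a \<in> cells2 (CwA small) f g ==> b \<in> cells2 (CwA small) f g ==> P2 CwA_forget a = P2 CwA_forget b ==> a = b"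
 by (rule cw_cell_eqI) (simp_all add: cell2_iff)

lemma CwA_full:
 assumes "f \<in> cells1 (CwA small) A B" "g \<in> cells1 (CwA small) A B" "c \<in> cells2 (Cat small) (P1 CwA_forget f) (P1 CwA_forget g)"
 shows "\<exists>a. a \<in> cells2 (CwA small) f g \<and> P2 CwA_forget a = c"
 using cw_cell_exists[of f g c] assms by (auto simp: cell_ntrans_def cell1_iff cell2_iff cells2_iff[of c] cwa_mor_iff[of small])

section \<open>The forgetful morphism of CwAs\<close>

context coalg_cwa
begin

text \<open>Turns the base type \<open>B\<close> into a type over \<open>x\<close> when its
  extension is identified by \<open>i\<close> with the source \<open>y\<close> of a display of
  coalgebras: the structure of \<open>y\<close> is transported along \<open>i\<close>.\<close>

definition tyi where "tyi x y B i = pair B (str (lift x y (pj x B) i))"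

context
 fixes x y p B i
 assumes p: "cmap y p x" "p \<in> Disp (WDisp M)" and B: "B \<in> Ob (P x)"
  and i: "iso_arrow (WCat M) i" "dm i = cext M (und x) B" "cd i = dm p" "p \<cdot> i = pj x B"
begin

lemma tyi_pb: "is_pullback (WCat M) (idn (und x)) p (pj x B) i"
 using pb_transport[OF cw_cat[OF M] pb_Idn[OF cw_cat[OF M] D.Disp_Ar[OF p(2)]] i(1)] i cmapD[OF p(1)] by simp

lemma tyi: "ty x (tyi x y B i)" "cmap (xt x (tyi x y B i)) i y" "und (tyi x y B i) = B"
 and tyi_unique: "ty x b ==> und b = B ==> cmap (xt x b) i y ==> b = tyi x y B i"
proof -
 note L = cmap_id[OF cmapD(2)[OF p(1)]] p tyi_pb
 have xa: "xt x (tyi x y B i) = lift x y (pj x B) i" unfolding tyi_def by (simp add: lift_pair)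
 note l = lift[OF L, folded xa]
 show "cmap (xt x (tyi x y B i)) i y" by (rule l(2))
 show "und (tyi x y B i) = B" by (simp add: tyi_def)
 then show t: "ty x (tyi x y B i)" unfolding ty_def using l(1) cmapD(2)[OF p(1)] B by (simp add: tyi_def)
 show "b = tyi x y B i" if b: "ty x b" "und b = B" "cmap (xt x b) i y"
 proof -
  have "xt x b = xt x (tyi x y B i)"
   unfolding xa by (rule lift_unique[OF L]) (use tyD(4)[OF b(1)] b in simp_all)
  then have "str b = str (tyi x y B i)" by simp
  then show ?thesis using tyD(6)[OF b(1)] tyD(6)[OF t] b(2) by (simp add: tyi_def)
 qed
qed

end

lemma XW [simp]: "cw XW"
 using XW_facts by blast

lemma XW_WComp: "x \<in> Ob X ==> XFun (WComp XW) x = G x"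
 by (simp add: XW_def family_ifun_def Let_def)

lemma XW_proj: "ty x a ==> proj XW x a = mk (xt x a) (pj x (und a)) x"
 using tyD(1)[of x a] by (simp add: proj_def XW_WComp)

lemma XW_cext: "ty x a ==> Dom X (proj XW x a) = xt x a"
 using tyD(4)[of x a] by (simp add: XW_proj)

lemma XW_over:
 assumes "over XW w g b a"
 obtains f where "g = mk a f (tre w b)" "tm (Dom X w) a f (tre w b)" "w \<in> Ar X" "ty (Cod X w) b" "over M (ar w) f (und b) (und a)"
proof -
 have "w \<in> Ar X" using assms by (simp add: over_def)
 moreover from this have "ty (Cod X w) b" using assms by (simp add: over_def)
 ultimately have w: "w \<in> Ar X" "ty (Cod X w) b" by blast+
 then have "g \<in> Ar (TF (Dom X w))" "Dom (TF (Dom X w)) g = a" "Cod (TF (Dom X w)) g = tre w b" using assms by (simp_all add: over_def)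
 then obtain f where f: "g = mk a f (tre w b)" "tm (Dom X w) a f (tre w b)" by (auto elim: TF_ArE)
 then have "over M (ar w) f (und b) (und a)" using w tmD[OF f(2)] tyD[OF w(2)] by (simp add: over_def)
 then show ?thesis using that f w by blast
qed

text \<open>Both factors of realization in the new CwA, \<open>Q\<close> and \<open>ext_map\<close>,
  have the corresponding factors of \<open>M\<close> as underlying arrows.\<close>

lemma XW_realize:
 assumes w: "w \<in> Ar X" "ty (Cod X w) b" and f: "tm (Dom X w) a f (tre w b)"
 shows "realize XW w b (mk a f (tre w b)) = mk (xt (Dom X w) a) (realize M (ar w) (und b) f) (xt (Cod X w) b)"
  "cmap (xt (Dom X w) a) (realize M (ar w) (und b) f) (xt (Cod X w) b)"
proof -
 have c: "cart XW w b = Q w b" using XW_facts w by blast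
 have e: "ext_map XW (Dom X w) (mk a f (tre w b)) = mk (xt (Dom X w) a) (ext_map M (und (Dom X w)) f) (xt (Dom X w) (tre w b))"
  using w f by (simp add: ext_map_def XW_WComp)
 note t = tre(2)[OF w(1) refl refl w(2)]
 show "realize XW w b (mk a f (tre w b)) = mk (xt (Dom X w) a) (realize M (ar w) (und b) f) (xt (Cod X w) b)"
  "cmap (xt (Dom X w) a) (realize M (ar w) (und b) f) (xt (Cod X w) b)"
  using cmap_comp[OF t tmD(6)[OF f]] X_Cmp_mk[OF t tmD(6)[OF f]] w by (simp_all add: realize_def c e Q_def)
qed

text \<open>The extension of a type over a coalgebra has the extension of its base type as
  underlying object, so \<open>HTau\<close> can consist of identities. This makes factorizations
  through \<open>UM\<close> strictly unique.\<close>

definition UM where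
 "UM = \<lparr>HSrc = XW, HTrg = M, HFun = U,
  HTp = \<lparr>XDom = TX, XCod = pull_icat U (WTp M),
   XFun = (\<lambda>x\<in>Ob X. \<lparr>FDom = TF x, FCod = P x, FOb = restrict und (Ob (TF x)), FAr = restrict ar (Ar (TF x))\<rparr>),
   XRho = (\<lambda>w\<in>Ar X. \<lambda>a\<in>Ob (TF (Cod X w)). Idn (P (Dom X w)) (und (tre w a)))\<rparr>,
  HTau = (\<lambda>x\<in>Ob X. \<lambda>a\<in>Ob (TF x). (pj x (und a), idn (cext M (und x) (und a)), pj x (und a)))\<rparr>"

lemma UM_simps [simp]:
 "HSrc UM = XW" "HTrg UM = M" "HFun UM = U" "ty x a ==> fo UM x a = und a" "tm x a f b ==> fa UM x (mk a f b) = f"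
 "ty x a ==> tau UM x a = idn (cext M (und x) (und a))"
 using tyD(1)[of x a] tyD(1)[OF tmD(1)] by (simp_all add: UM_def tau_def)

lemma UM_cw_mor: "cw_mor UM"
 unfolding cw_mor_iff
proof (intro conjI)
 have f: "functor (XFun (HTp UM) x)" "FDom (XFun (HTp UM) x) = TF x" "FCod (XFun (HTp UM) x) = P x" if x: "x \<in> Ob X" for x
 proof -
  show s: "FDom (XFun (HTp UM) x) = TF x" "FCod (XFun (HTp UM) x) = P x" using x by (simp_all add: UM_def)
  show "functor (XFun (HTp UM) x)"
  proof (rule functorI, unfold s)
   show "fo UM x \<in> extensional (Ob (TF x))" "fa UM x \<in> extensional (Ar (TF x))" using x by (simp_all add: UM_def)
   fix f assume f: "f \<in> Ar (TF x)"
   then show "fa UM x f \<in> Ar (P x) \<and> Dom (P x) (fa UM x f) = fo UM x (Dom (TF x) f) \<and> Cod (P x) (fa UM x f) = fo UM x (Cod (TF x) f)"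
    by (rule TF_ArE) (simp add: tmD)
   fix g assume "g \<in> Ar (TF x)" "Dom (TF x) g = Cod (TF x) f"
   with f show "fa UM x (Cmp (TF x) g f) = Cmp (P x) (fa UM x g) (fa UM x f)" by (elim TF_ArE) (simp add: tm_comp)
  qed (use x tm_id in \<open>simp_all add: tyD\<close>)
 qed
 show "cwa_mor_struct UM"
  unfolding cwa_mor_struct_def UM_simps XW_simps
 proof (intro conjI U_display XW M)
  show "strict_indexed_functor (HTp UM)"
  proof (rule strict_ifunI)
   show "XFun (HTp UM) \<in> extensional (Ob X)" by (simp add: UM_def)
   show "XRho (HTp UM) = (\<lambda>w\<in>Ar X. \<lambda>a\<in>Ob (IFib (XDom (HTp UM)) (Cod X w)).
     Idn (IFib (XCod (HTp UM)) (Dom X w)) (fo UM (Dom X w) (FOb (IRe (XDom (HTp UM)) w) a)))"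
    by (simp add: UM_def) (rule restrict_ext, simp, rule restrict_ext, simp add: tre(1))
   show "comp_func (IRe (XCod (HTp UM)) w) (XFun (HTp UM) (Cod X w)) = comp_func (XFun (HTp UM) (Dom X w)) (IRe (XDom (HTp UM)) w)"
    if w: "w \<in> Ar X" for w
   proof -
    have c: "XDom (HTp UM) = TX" "IRe (XCod (HTp UM)) w = IRe (WTp M) (ar w)" using w by (simp_all add: UM_def)
    note t = tre(1)[OF w refl refl] tm_re[OF w refl refl]
    have o: "Dom X w \<in> Ob X" "Cod X w \<in> Ob X" using w by simp_all
    show ?thesis unfolding c
    proof (rule functor_eqI)
     show "FAr (comp_func (IRe (WTp M) (ar w)) (XFun (HTp UM) (Cod X w))) g = FAr (comp_func (XFun (HTp UM) (Dom X w)) (IRe TX w)) g"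
      if "g \<in> Ar (FDom (comp_func (XFun (HTp UM) (Dom X w)) (IRe TX w)))" for g
      using that w o by (simp add: f) (erule TF_ArE, simp add: t f)
    qed (use w o in \<open>simp_all add: f t\<close>)
   qed
  qed (use f tre(1) in \<open>simp_all add: UM_def TX_strict pull_strict\<close>)
 qed (simp_all add: UM_def)
 show "tau_typed UM"
  unfolding tau_typed_def UM_simps XW_simps DX_simps
 proof (intro conjI ballI)
  show "HTau UM \<in> extensional (Ob X)" "x \<in> Ob X ==> HTau UM x \<in> extensional (Ob (IFib TX x))" for x by (simp_all add: UM_def)
  fix x a assume x: "x \<in> Ob X" and a: "a \<in> Ob (IFib TX x)"
  then have t: "ty x a" by simp
  show "HTau UM x a = (FAr U (proj XW x a), tau UM x a, proj M (FOb U x) (fo UM x a))"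
   using x t tyD(4)[OF t] by (simp add: XW_proj) (simp add: UM_def)
 qed (use tyD in \<open>simp_all add: XW_proj\<close>)
 show "tau_nat UM"
  unfolding tau_nat_def UM_simps XW_simps DX_simps
 proof (intro allI impI)
  fix w g b a assume "over XW w g b a"
  then obtain f where f: "g = mk a f (tre w b)" "tm (Dom X w) a f (tre w b)" "w \<in> Ar X" "ty (Cod X w) b" "over M (ar w) f (und b) (und a)"
   by (rule XW_over)
  note r = XW_realize[OF f(3,4,2)]
  show "tau UM (Cod X w) b \<cdot> FAr U (realize XW w b g) =
   realize M (FAr U w) (fo UM (Cod X w) b) (fa UM (Dom X w) g) \<cdot> tau UM (Dom X w) a"
   using r cmapD[OF r(2)] f tmD(1)[OF f(2)] realize_Ar[OF M f(5)] by (simp del: realize_Idn)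
 qed
qed

end

section \<open>Factoring a morphism of CwAs through the forgetful morphism\<close>

locale coalg_lift = coalg_cwa small pair T M + f: cwa_morphism f W M F0
 for small :: "'u set => bool" and pair T and M :: "'u cwa" and f :: "'u cwa_mor" and W F0 +
 fixes h
 assumes h [simp]: "functor h" "FDom h = WCat W" "FCod h = X" and Uh: "comp_func U h = F0"
begin

abbreviation ho where "ho \<equiv> FOb h"
abbreviation ce where "ce \<equiv> cext W"
abbreviation PW where "PW d \<equiv> Tp W d"

lemma W [simp]: "cw W"
 by (rule f.C)

lemma h_simps [simp]: "d \<in> Ctx W ==> und (ho d) = FOb F0 d" "g \<in> Sub W ==> ar (FAr h g) = FAr F0 g"
 using arg_cong[OF Uh, of "\<lambda>F. FOb F d"] arg_cong[OF Uh, of "\<lambda>F. FAr F g"] by simp_all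

lemma h_cmap: "g \<in> Sub W ==> cmap (ho (Dm W g)) (FAr F0 g) (ho (Cd W g))"
 and h_eq: "g \<in> Sub W ==> FAr h g = mk (ho (Dm W g)) (FAr F0 g) (ho (Cd W g))"
 using ar_cmap[of "FAr h g"] X_mk_eq[of "FAr h g"] by simp_all

text \<open>Displays and pullbacks of displays are created by \<open>U\<close>, so preservation by
  \<open>h\<close> follows from preservation by the composite \<open>F0\<close>.\<close>

lemma h_display: "display_functor (WDisp W) DX h"
proof (rule display_functor.intro)
 show "is_pullback (DCat DX) (FAr h g) (FAr h p) (FAr h p') (FAr h g')"
  if p: "p \<in> Disp (WDisp W)" and pb: "is_pullback (WCat W) g p p' g'" for g p p' g'
 proof -
  note a = pb_Ar[OF _ pb] pb_ends[OF _ pb]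
  show ?thesis
   using X_pullback[of "ho (Dm W g)" "FAr F0 g" "ho (Cd W g)" "ho (Dm W p)" "FAr F0 p" "FAr F0 p'" "FAr F0 g'" "ho (Dm W p')"]
    h_cmap[of g] h_cmap[of p] h_cmap[of p'] h_cmap[of g'] f.F_Disp[OF p] f.F_pullback[OF p pb] a by (simp add: h_eq)
 qed
qed (use f.F_Disp cw_disp[OF W] f.C.Disp_Ar in \<open>auto simp: functors_iff\<close>)

text \<open>The coalgebra structure on the extension of the image type is transported from the image
  under \<open>h\<close> of the extension, along \<open>tau\<close>. Nothing else is possible if
  \<open>tau\<close> is to underlie an arrow of coalgebras.\<close>

definition lo where "lo d A = tyi (ho d) (ho (ce d A)) (fo f d A) (inv_arrow (WCat M) (tau f d A))"

context
 fixes d A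
 assumes d [simp]: "d \<in> Ctx W" and A [simp]: "A \<in> Ob (PW d)"
begin

lemma lo_ctx:
 "cmap (ho (ce d A)) (FAr F0 (proj W d A)) (ho d)" "FAr F0 (proj W d A) \<in> Disp (WDisp M)" "fo f d A \<in> Ob (P (ho d))"
 "iso_arrow (WCat M) (inv_arrow (WCat M) (tau f d A))" "dm (inv_arrow (WCat M) (tau f d A)) = cext M (und (ho d)) (fo f d A)"
 "cd (inv_arrow (WCat M) (tau f d A)) = dm (FAr F0 (proj W d A))"
 "FAr F0 (proj W d A) \<cdot> inv_arrow (WCat M) (tau f d A) = pj (ho d) (fo f d A)"
 using h_cmap[of "proj W d A"] f.F_Disp[of "proj W d A"] by (simp_all) (simp add: f.proj_tau[symmetric])

lemma lo: "ty (ho d) (lo d A)" "und (lo d A) = fo f d A"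
  "cmap (ho (ce d A)) (tau f d A) (xt (ho d) (lo d A))" "cmap (xt (ho d) (lo d A)) (inv_arrow (WCat M) (tau f d A)) (ho (ce d A))"
proof -
 note t = tyi[OF lo_ctx, folded lo_def]
 show "ty (ho d) (lo d A)" "und (lo d A) = fo f d A" "cmap (xt (ho d) (lo d A)) (inv_arrow (WCat M) (tau f d A)) (ho (ce d A))" by (rule t)+
 have "inv_arrow (WCat M) (inv_arrow (WCat M) (tau f d A)) = tau f d A"
  by (rule inv_arrow_eq) (simp_all add: inverse_arrows_iff)
 then show "cmap (ho (ce d A)) (tau f d A) (xt (ho d) (lo d A))" using cmap_inv[OF t(2)] by simp
qed

lemma lo_unique:
 assumes "ty (ho d) b" "und b = fo f d A" "cmap (ho (ce d A)) (tau f d A) (xt (ho d) b)"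
 shows "b = lo d A"
 unfolding lo_def by (rule tyi_unique[OF lo_ctx assms(1,2) cmap_inv[OF assms(3)]]) simp

end

text \<open>Naturality of \<open>tau\<close> exhibits the realized image as the image of a
  realization conjugated by \<open>tau\<close>, a composite of three coalgebra maps.
  \<open>lo_re\<close> and \<open>lo_tm\<close> are its cases of an identity map of types and an
  identity in the base.\<close>

lemma realize_cmap:
 assumes o: "over W w g B A" and e: "d = Dm W w" "c = Cd W w"
 shows "cmap (xt (ho d) (lo d A)) (realize M (FAr F0 w) (fo f c B) (fa f d g)) (xt (ho c) (lo c B))"
proof -
 have w: "w \<in> Sub W" "B \<in> Ob (PW c)" using o e by (simp_all add: over_def)
 have A: "A \<in> Ob (PW d)" "d \<in> Ctx W" "c \<in> Ctx W" using over_Ob[OF W o] w e by simp_all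
 note oM = f.over_fa[OF o]
 define R where "R = realize M (FAr F0 w) (fo f c B) (fa f d g)"
 define S where "S = realize W w B g"
 have r: "R \<in> A1" "dm R = cext M (FOb F0 d) (fo f d A)" "S \<in> Sub W" "Dm W S = ce d A" "Cd W S = ce c B"
  unfolding R_def S_def using realize_Ar[OF M oM] Dom_realize[OF M oM] realize_Ar[OF W o] Dom_realize[OF W o] Cod_realize[OF W o] w A e
  by (simp_all del: realize_Idn)
 have n: "tau f c B \<cdot> FAr F0 S = R \<cdot> tau f d A" using f.tau_natural[OF o] unfolding R_def S_def e .
 \<comment> \<open>Composing the naturality square with the inverse of \<open>tau f d A\<close>
   isolates \<open>R\<close>.\<close>
 have "tau f c B \<cdot> (FAr F0 S \<cdot> inv_arrow (WCat M) (tau f d A)) = R \<cdot> (tau f d A \<cdot> inv_arrow (WCat M) (tau f d A))"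
  by (rule Cmp_reassoc[OF n]) (use A w r in simp_all)
 then have "R = tau f c B \<cdot> (FAr F0 S \<cdot> inv_arrow (WCat M) (tau f d A))" using A r by simp
 then show ?thesis unfolding R_def[symmetric]
  using cmap_comp[OF lo(3)[OF A(3) w(2)] cmap_comp[OF h_cmap[OF r(3), unfolded r] lo(4)[OF A(2,1)]]] by simp
qed

text \<open>By \<open>tre_unique\<close> it suffices that \<open>cart\<close> be a coalgebra map;
  \<open>cart\<close> is the realization of an identity map of types.\<close>

lemma lo_re:
 assumes w: "w \<in> Sub W" "A \<in> Ob (PW (Cd W w))"
 shows "lo (Dm W w) (Re W w A) = tre (FAr h w) (lo (Cd W w) A)"
proof -
 let ?d = "Dm W w" and ?c = "Cd W w"
 have o: "?d \<in> Ctx W" "?c \<in> Ctx W" "Re W w A \<in> Ob (PW ?d)" using w by simp_all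
 have ov: "over W w (Idn (PW ?d) (Re W w A)) A (Re W w A)" using w o by (simp add: over_def)
 show ?thesis
 proof (rule tre_unique[of _ "ho ?d" "ho ?c"])
  show "cmap (xt (ho ?d) (lo ?d (Re W w A))) (cart M (ar (FAr h w)) (und (lo ?c A))) (xt (ho ?c) (lo ?c A))"
   using realize_cmap[OF ov refl refl] w o realize_cart[OF M, of "FAr F0 w" "fo f ?c A"] by (simp add: lo(2))
 qed (use w o in \<open>simp_all add: lo(1,2)\<close>)
qed

lemma lo_tm:
 assumes d: "d \<in> Ctx W" and g: "g \<in> Ar (PW d)"
 shows "tm (ho d) (lo d (Dom (PW d) g)) (fa f d g) (lo d (Cod (PW d) g))"
proof -
 have o: "Dom (PW d) g \<in> Ob (PW d)" "Cod (PW d) g \<in> Ob (PW d)" using assms by simp_all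
 have "over W (Idn (WCat W) d) g (Cod (PW d) g) (Dom (PW d) g)" using assms o by (simp add: over_def)
 from realize_cmap[OF this] show ?thesis unfolding tm_def using assms o by (simp add: lo(1,2))
qed

text \<open>The arrows \<open>tau f d A\<close>, read as arrows of coalgebras, become
  \<open>HTau\<close> of the lift, since \<open>UM\<close> contributes identities.\<close>

definition lm where
 "lm = \<lparr>HSrc = W, HTrg = XW, HFun = h,
  HTp = \<lparr>XDom = WTp W, XCod = pull_icat h TX,
   XFun = (\<lambda>d\<in>Ctx W. \<lparr>FDom = PW d, FCod = TF (ho d), FOb = restrict (lo d) (Ob (PW d)),
    FAr = (\<lambda>g\<in>Ar (PW d). mk (lo d (Dom (PW d) g)) (fa f d g) (lo d (Cod (PW d) g)))\<rparr>),
   XRho = (\<lambda>w\<in>Sub W. \<lambda>A\<in>Ob (PW (Cd W w)). Idn (TF (ho (Dm W w))) (lo (Dm W w) (Re W w A)))\<rparr>,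
  HTau = (\<lambda>d\<in>Ctx W. \<lambda>A\<in>Ob (PW d). (FAr h (proj W d A), mk (ho (ce d A)) (tau f d A) (xt (ho d) (lo d A)),
   mk (xt (ho d) (lo d A)) (pj (ho d) (fo f d A)) (ho d)))\<rparr>"

lemma lm_simps [simp]:
 "HSrc lm = W" "HTrg lm = XW" "HFun lm = h" "d \<in> Ctx W ==> A \<in> Ob (PW d) ==> fo lm d A = lo d A"
 "d \<in> Ctx W ==> g \<in> Ar (PW d) ==> fa lm d g = mk (lo d (Dom (PW d) g)) (fa f d g) (lo d (Cod (PW d) g))"
 "d \<in> Ctx W ==> A \<in> Ob (PW d) ==> tau lm d A = mk (ho (ce d A)) (tau f d A) (xt (ho d) (lo d A))"
 by (simp_all add: lm_def tau_def)

lemma iso_mk: "cmap x i y ==> iso_arrow (WCat M) i ==> iso_arrow X (mk x i y)"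
 using cmap_inv[of x i y] cmapD[of x i y]
 by (intro iso_arrowI[of X _ "mk y (inv_arrow (WCat M) i) x"]) (simp_all add: X_Idn)

lemma lm_cw_mor: "cw_mor lm"
 unfolding cw_mor_iff
proof (intro conjI)
 have F: "functor (XFun (HTp lm) d)" "FDom (XFun (HTp lm) d) = PW d" "FCod (XFun (HTp lm) d) = TF (ho d)" if d: "d \<in> Ctx W" for d
 proof -
  show s: "FDom (XFun (HTp lm) d) = PW d" "FCod (XFun (HTp lm) d) = TF (ho d)" using d by (simp_all add: lm_def)
  show "functor (XFun (HTp lm) d)"
  proof (rule functorI, unfold s)
   show "fo lm d \<in> extensional (Ob (PW d))" "fa lm d \<in> extensional (Ar (PW d))" using d by (simp_all add: lm_def)
   fix g k assume "k \<in> Ar (PW d)" "g \<in> Ar (PW d)" "Dom (PW d) k = Cod (PW d) g"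
   then show "fa lm d (Cmp (PW d) k g) = Cmp (TF (ho d)) (fa lm d k) (fa lm d g)"
    using lo_tm[OF d, of g] lo_tm[OF d, of k] d by simp
  qed (use d in \<open>simp_all add: lo lo_tm\<close>)
 qed
 show "cwa_mor_struct lm"
  unfolding cwa_mor_struct_def lm_simps XW_simps
 proof (intro conjI h_display XW W)
  show "strict_indexed_functor (HTp lm)"
  proof (rule strict_ifunI)
   show "XFun (HTp lm) \<in> extensional (Ctx W)" by (simp add: lm_def)
   show "XRho (HTp lm) = (\<lambda>w\<in>Sub W. \<lambda>A\<in>Ob (IFib (XDom (HTp lm)) (Cd W w)).
     Idn (IFib (XCod (HTp lm)) (Dm W w)) (fo lm (Dm W w) (FOb (IRe (XDom (HTp lm)) w) A)))"
    by (simp add: lm_def) (intro restrict_ext, simp)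
   show "comp_func (IRe (XCod (HTp lm)) w) (XFun (HTp lm) (Cd W w)) = comp_func (XFun (HTp lm) (Dm W w)) (IRe (XDom (HTp lm)) w)"
    if w: "w \<in> Sub W" for w
   proof -
    have c: "XDom (HTp lm) = WTp W" "IRe (XCod (HTp lm)) w = IRe TX (FAr h w)" using w by (simp_all add: lm_def)
    have o: "Dm W w \<in> Ctx W" "Cd W w \<in> Ctx W" using w by simp_all
    show ?thesis unfolding c
    proof (rule functor_eqI)
     show "FAr (comp_func (IRe TX (FAr h w)) (XFun (HTp lm) (Cd W w))) g = FAr (comp_func (XFun (HTp lm) (Dm W w)) (IRe (WTp W) w)) g"
      if "g \<in> Ar (FDom (comp_func (XFun (HTp lm) (Dm W w)) (IRe (WTp W) w)))" for g
      using that w o lo_tm[OF o(2), of g] by (simp add: F lo_re)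
    qed (use w o in \<open>simp_all add: F lo lo_re\<close>)
   qed
  qed (use F in \<open>simp_all add: lm_def TX_strict pull_strict\<close>)
 qed (simp_all add: lm_def)
 show "tau_typed lm"
  unfolding tau_typed_def lm_simps XW_simps DX_simps
 proof (intro conjI ballI)
  show "HTau lm \<in> extensional (Ctx W)" "d \<in> Ctx W ==> HTau lm d \<in> extensional (Ob (PW d))" for d by (simp_all add: lm_def)
  fix d A assume d: "d \<in> Ctx W" and A: "A \<in> Ob (PW d)"
  note l = lo[OF d A] tyD(4)[OF lo(1)[OF d A]]
  show "HTau lm d A = (FAr h (proj W d A), tau lm d A, proj XW (ho d) (fo lm d A))"
   using d A l by (simp add: XW_proj) (simp add: lm_def)
  show "iso_arrow X (tau lm d A)" "Dom X (tau lm d A) = ho (ce d A)" "Cod X (tau lm d A) = Dom X (proj XW (ho d) (fo lm d A))"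
   using d A l by (simp_all add: XW_cext iso_mk)
  show "Cmp X (proj XW (ho d) (fo lm d A)) (tau lm d A) = FAr h (proj W d A)"
   using d A l f.proj_tau[OF d A] by (simp add: XW_proj h_eq)
 qed
 show "tau_nat lm"
  unfolding tau_nat_def lm_simps XW_simps DX_simps
 proof (intro allI impI)
  fix w g B A assume o: "over W w g B A"
  let ?d = "Dm W w" and ?c = "Cd W w"
  have w: "w \<in> Sub W" "B \<in> Ob (PW ?c)" "g \<in> Ar (PW ?d)" "Dom (PW ?d) g = A" "Cod (PW ?d) g = Re W w B"
   using o by (simp_all add: over_def)
  have A: "?d \<in> Ctx W" "?c \<in> Ctx W" "A \<in> Ob (PW ?d)" using w over_Ob[OF W o] by simp_all
  have t: "tm (ho ?d) (lo ?d A) (fa f ?d g) (tre (FAr h w) (lo ?c B))" using lo_tm[OF A(1) w(3)] w by (simp add: lo_re)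
  have hw: "FAr h w \<in> Ar X" "ty (Cod X (FAr h w)) (lo ?c B)" "Dom X (FAr h w) = ho ?d" "Cod X (FAr h w) = ho ?c" "und (lo ?c B) = fo f ?c B"
   using w A lo by simp_all
  note r = XW_realize[OF hw(1,2), unfolded hw(3,4), OF t, unfolded h_simps(2)[OF w(1)] hw(5)]
  define S where "S = realize W w B g"
  have S: "S \<in> Sub W" "Dm W S = ce ?d A" "Cd W S = ce ?c B"
   unfolding S_def using realize_Ar[OF W o] Dom_realize[OF W o] Cod_realize[OF W o] by (simp_all del: realize_Idn)
  have fl: "fa lm ?d g = mk (lo ?d A) (fa f ?d g) (tre (FAr h w) (lo ?c B))" "fo lm ?c B = lo ?c B"
   using w A by (simp_all add: lo_re)
  have "Cmp X (tau lm ?c B) (FAr h S) = mk (ho (ce ?d A)) (tau f ?c B \<cdot> FAr F0 S) (xt (ho ?c) (lo ?c B))"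
   using lo(3)[OF A(2) w(2)] h_cmap[OF S(1)] S A w by (simp add: h_eq)
  also have "\<dots> = Cmp X (mk (xt (ho ?d) (lo ?d A)) (realize M (FAr F0 w) (fo f ?c B) (fa f ?d g)) (xt (ho ?c) (lo ?c B))) (tau lm ?d A)"
   unfolding S_def f.tau_natural[OF o] using lm_simps(6)[OF A(1,3)] X_Cmp_mk[OF r(2) lo(3)[OF A(1,3)]] by (simp add: hw(5))
  finally show "Cmp X (tau lm ?c B) (FAr h (realize W w B g)) = Cmp X (realize XW (FAr h w) (fo lm ?c B) (fa lm ?d g)) (tau lm ?d A)"
   unfolding fl r(1) S_def hw(5) .
 qed
qed

text \<open>As \<open>UM\<close> has identity \<open>HTau\<close>, the arrow underlying
  \<open>tau k d A\<close> is \<open>tau f d A\<close>. It is then a coalgebra map into the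
  extension of \<open>fo k d A\<close>, which forces that type to be \<open>lo d A\<close>; the type
  maps are determined by their ends and underlying maps.\<close>

lemma lift_unique1:
 assumes k: "cw_mor k" "HSrc k = W" "HTrg k = XW" "HFun k = h" "comp_cwa UM k = f"
 shows "k = lm"
proof -
 interpret k: cwa_morphism k W XW "HFun k" using k by (simp_all add: cwa_morphism_iff)
 interpret c: composable_cwa k UM W XW M "HFun k" "HFun UM" using k UM_cw_mor composable_cwa_iff[of k UM W XW M] by simp_all
 note kh = k(4)
 have fo: "fo k d A = lo d A" and tau: "tau k d A = tau lm d A" if d: "d \<in> Ctx W" and A: "A \<in> Ob (PW d)" for d A
 proof -
  have b: "ty (ho d) (fo k d A)" using k.fo_Ob[OF d A] d kh by simp
  have u: "und (fo k d A) = fo f d A" using c.comp_simps(4)[OF d A] b k by simp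
  have K: "tau k d A \<in> Ar X" "Dom X (tau k d A) = ho (ce d A)" "Cod X (tau k d A) = xt (ho d) (fo k d A)"
   using k.tau_Ar[OF d A] k.Dom_tau[OF d A] k.Cod_tau[OF d A] b kh by (simp_all add: XW_cext)
  then have a: "ar (tau k d A) = tau f d A"
   using c.comp_tau[OF d A] b k by (simp add: u)
  have "cmap (ho (ce d A)) (tau f d A) (xt (ho d) (fo k d A))" using ar_cmap[OF K(1)] K a by simp
  then show fo: "fo k d A = lo d A" by (rule lo_unique[OF d A b u])
  show "tau k d A = tau lm d A" using X_mk_eq[OF K(1)] K a d A fo by simp
 qed
 show ?thesis
 proof (rule cwa_mor_eqI[OF k(1) lm_cw_mor])
  fix d g assume "d \<in> Ctx (HSrc lm)" "g \<in> Ar (Tp (HSrc lm) d)"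
  then have d: "d \<in> Ctx W" and g: "g \<in> Ar (PW d)" by simp_all
  have "fa k d g \<in> Ar (TF (ho d))" "Dom (TF (ho d)) (fa k d g) = lo d (Dom (PW d) g)" "Cod (TF (ho d)) (fa k d g) = lo d (Cod (PW d) g)"
   using d g kh k.tp_fun[OF d] by (simp_all add: fo[symmetric])
  then obtain b where b: "fa k d g = mk (lo d (Dom (PW d) g)) b (lo d (Cod (PW d) g))" "tm (ho d) (lo d (Dom (PW d) g)) b (lo d (Cod (PW d) g))"
   by (auto elim: TF_ArE)
  have "fa f d g = b" using c.comp_simps(5)[OF d g] b k by simp
  then show "fa k d g = fa lm d g" using b d g by simp
 qed (use k fo tau in simp_all)
qed

lemma lift_exists1: "comp_cwa UM lm = f"
proof -
 interpret c: composable_cwa lm UM W XW M "HFun lm" "HFun UM" using lm_cw_mor UM_cw_mor composable_cwa_iff[of lm UM W XW M] by simp_all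
 have f: "cw_mor f" "HSrc f = W" "HTrg f = M" "HFun f = F0" using f.cwa_morphism_axioms f.F_def by (simp_all add: cwa_morphism_iff)
 show ?thesis
 proof (rule cwa_mor_eqI[OF c.cw_mor_comp f(1)])
  fix d g assume "d \<in> Ctx (HSrc f)" "g \<in> Ar (Tp (HSrc f) d)"
  then show "fa (comp_cwa UM lm) d g = fa f d g" using lo_tm[of d g] f by (simp add: c.comp_simps)
 next
  fix d A assume "d \<in> Ctx (HSrc f)" "A \<in> Ob (Tp (HSrc f) d)"
  then have d: "d \<in> Ctx W" "A \<in> Ob (PW d)" using f by simp_all
  note l = lo[OF d] cmapD[OF lo(3)[OF d]]
  show "fo (comp_cwa UM lm) d A = fo f d A" using d l by (simp add: c.comp_simps)
  show "tau (comp_cwa UM lm) d A = tau f d A" using d l by (simp add: c.comp_tau)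
 qed (use f Uh in simp_all)
qed

end

section \<open>Coalgebras for comonads in the 2-category of CwAs\<close>

locale cwa_comonad =
 fixes small :: "'u set => bool" and pair T
 assumes univ: "universe small pair" and T: "comonad (CwA small) T"
begin

abbreviation T0 where "T0 \<equiv> map_comonad CwA_forget T"

sublocale Fg: strict_two_functor "CwA small" "Cat small" CwA_forget by (rule CwA_forget_functor)

lemma E_mor: "cw_mor (MEnd T)" "HSrc (MEnd T) = MOb T" "HTrg (MEnd T) = MOb T" "cwa small (MOb T)"
 using T by (simp_all add: comonad_def cell1_iff)

lemma T0_simps: "MOb T0 = WCat (MOb T)" "MEnd T0 = HFun (MEnd T)"
 by (simp_all add: map_comonad_def)

sublocale coalg_cwa small pair T0 "MOb T"
proof (rule coalg_cwa.intro)
 show "cat_comonad small pair T0" using univ Fg.map_comonad[OF T] by (simp add: cat_comonad_def cat_comonad_axioms_def)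
 show "display_functor (WDisp (MOb T)) (WDisp (MOb T)) (MEnd T0)"
  using E_mor(1)[unfolded cw_mor_iff] E_mor(2,3) unfolding cwa_mor_struct_def T0_simps by simp
qed (use E_mor(4) T0_simps in \<open>simp_all add: cwa_iff[of small]\<close>)

text \<open>Types over a coalgebra are coded by pairs of a base type and an arrow of the base, and
  their maps by nested pairs, so small sets suffice fibre by fibre.\<close>

lemma XW_small: "cwa small XW"
proof -
 have s: "small (Ob (P x))" "small (Ar (P x))" if "x \<in> Ob X" for x
  using E_mor(4) that unfolding cwa_iff[of small] small_cwa_def by simp_all
 have o: "small {a. ty x a}" if x: "x \<in> Ob X" for x
 proof (rule small_subset[OF small_pairs[OF s(1)[OF x] C_small(2)]])
  show "{a. ty x a} \<subseteq> {pair A s |A s. A \<in> Ob (P x) \<and> s \<in> A1}"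
  proof clarify
   fix a assume a: "ty x a"
   then have "str a \<in> A1" using X_Ob_simps(2)[OF tyD(5)[OF a]] by simp
   then show "\<exists>A s. a = pair A s \<and> A \<in> Ob (P x) \<and> s \<in> A1" using tyD(3,6)[OF a] by metis
  qed
 qed
 have "small (Ar (TF x))" if x: "x \<in> Ob X" for x
 proof (rule small_subset[OF small_pairs[OF o[OF x] small_pairs[OF s(2)[OF x] o[OF x]]]])
  show "Ar (TF x) \<subseteq> {pair a b |a b. a \<in> {a. ty x a} \<and> b \<in> {pair a b |a b. a \<in> Ar (P x) \<and> b \<in> {a. ty x a}}}"
   by (auto elim!: TF_ArE dest: tmD)
 qed
 moreover have "Ob (TF x) = {a. ty x a}" for x by auto
 ultimately show ?thesis unfolding cwa_iff[of small] small_cwa_def using o X_small by simp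
qed

lemma UM_cell: "UM \<in> cells1 (CwA small) XW (MOb T)"
 using UM_cw_mor XW_small E_mor by (simp add: cell1_iff)

text \<open>The structure 2-cell of the universal coalgebra in \<open>Cat\<close>, extended to
  types; existence is fullness on 2-cells.\<close>

definition uc where "uc = (SOME a. a \<in> cells2 (CwA small) UM (comp_cwa (MEnd T) UM) \<and> LNat a = u)"

lemma uc: "uc \<in> cells2 (CwA small) UM (comp_cwa (MEnd T) UM)" "LNat uc = u"
proof -
 have t: "MEnd T \<in> cells1 (CwA small) (MOb T) (MOb T)" using T by (simp add: comonad_def)
 have c: "comp_cwa (MEnd T) UM \<in> cells1 (CwA small) XW (MOb T)"
  using Fg.K.Cmp1_cell[OF UM_cell t] by simp
 have "u \<in> cells2 (Cat small) (P1 CwA_forget UM) (P1 CwA_forget (comp_cwa (MEnd T) UM))"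
  using universal unfolding universal_coalgebra_def coalgebra_on_def by (simp add: T0_simps)
 from someI_ex[OF CwA_full[OF UM_cell c this]]
 show "uc \<in> cells2 (CwA small) UM (comp_cwa (MEnd T) UM)" "LNat uc = u" unfolding uc_def by simp_all
qed

text \<open>The universal coalgebra of \<open>Cat\<close> is reflected along the forgetful
  2-functor; the remaining condition on 1-cells is the unique lift \<open>l.lm\<close> with
  prescribed underlying functor \<open>h\<close>.\<close>

lemma universal_CwA: "universal_coalgebra (CwA small) T XW UM uc"
proof (rule Fg.universal_coalgebra_reflect[OF T CwA_faithful CwA_full _ UM_cell])
 show "XW \<in> Zero (CwA small)" using XW_small by simp
 show "uc \<in> cells2 (CwA small) UM (Cmp1 (CwA small) (MEnd T) UM)" using uc by simp
 show "universal_coalgebra (Cat small) T0 (P0 CwA_forget XW) (P1 CwA_forget UM) (P2 CwA_forget uc)"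
  using universal uc by simp
 fix W f h assume f: "f \<in> cells1 (CwA small) W (MOb T)" and h: "h \<in> cells1 (Cat small) (P0 CwA_forget W) (P0 CwA_forget XW)"
  and e: "Cmp1 (Cat small) (P1 CwA_forget UM) h = P1 CwA_forget f" and W: "W \<in> Zero (CwA small)"
 have f': "cw_mor f" "HSrc f = W" "HTrg f = MOb T" using f by (simp_all add: cell1_iff)
 have m: "cwa_morphism f W (MOb T)" using f' by (simp add: cwa_morphism_iff)
 interpret l: coalg_lift small pair T0 "MOb T" f W "HFun f" h
  by (intro coalg_lift.intro coalg_lift_axioms.intro m coalg_cwa_axioms) (use h e in \<open>simp_all add: cells1_iff\<close>)
 show "\<exists>!k. k \<in> cells1 (CwA small) W XW \<and> P1 CwA_forget k = h \<and> Cmp1 (CwA small) UM k = f"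
 proof (rule ex1I[of _ l.lm])
  show "l.lm \<in> cells1 (CwA small) W XW \<and> P1 CwA_forget l.lm = h \<and> Cmp1 (CwA small) UM l.lm = f"
   using l.lm_cw_mor l.lift_exists1 XW_small W by (simp add: cell1_iff)
  show "k = l.lm" if "k \<in> cells1 (CwA small) W XW \<and> P1 CwA_forget k = h \<and> Cmp1 (CwA small) UM k = f" for k
   using l.lift_unique1[of k] that by (simp add: cell1_iff)
 qed
qed assumption+

definition ch where
 "ch = postcomp_coalg (CwA small) T XW \<lparr>CSrc = P0 (triv (CwA small)) XW, CTrg = T, CMor = UM, CTau = uc\<rparr>"

lemma ch: "coalgebra_object (CwA small) T ch"
proof -
 interpret uc: universal_coalg "CwA small" T XW UM uc
  using universal_CwA T CwA_2cat by (intro universal_coalg.intro universal_coalg_axioms.intro)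
 show ?thesis using uc.coalgebra_object by (simp add: ch_def uc.m_def)
qed

text \<open>\<open>XW\<close> has the prescribed coalgebra category as its underlying category,
  \<open>UM\<close> the forgetful functor and \<open>uc\<close> the universal structure, so the
  comparison in \<open>Cat\<close> is an identity.\<close>

lemma ch_nose: "comonadic_on_the_nose (Cat small) (Cat_coalg small pair) (map_adj CwA_forget (coalg_adjunction (CwA small) T ch))"
 unfolding ch_def
 by (rule Fg.comonadic_on_the_nose[OF T universal_CwA]) (use universal uc in \<open>simp_all add: Cat_coalg_eq\<close>)

end

theorem theorem4p3p1:
 fixes small :: "'u set => bool" and pair :: "'u => 'u => 'u"
 assumes "universe small pair"
 shows "admits_coalgebras_over (CwA small) (Cat small) (Cat_coalg small pair) CwA_forget"
proof -
 have c: "cwa_comonad small pair T" if "comonad (CwA small) T" for T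
  using assms that by (rule cwa_comonad.intro)
 have d: "cat_comonad small pair T" if "comonad (Cat small) T" for T
  using assms that by (simp add: cat_comonad_def cat_comonad_axioms_def)
 show ?thesis
  unfolding admits_coalgebras_over_def admits_coalgebras_def coalgebra_choice_def preserves_coalgebras_on_the_nose_def
  using CwA_forget_functor cwa_comonad.ch[OF c] cwa_comonad.ch_nose[OF c] cat_comonad.coalgebra_object_Cat[OF d]
  by (intro conjI exI[of _ "cwa_comonad.ch small pair"]) blast+
qed

end
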